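(* Let $M$ be a hermitean locally symmetric space and $p\in M$. The difference element $K:=\exp_p^{-1}\circ\mathrm{knc}_p$ measuring the deviation between the Riemannian and the Kähler normal coordinates centered in $p$, and its inverse $K^{-1}$, are given for $X\in T_pM$ near $0$ by $$KX=\frac{\mathrm{artanh}(\frac12\,\mathrm{ad}\,IX)}{\frac12\,\mathrm{ad}\,IX}\,X,\qquad K^{-1}X=\frac{\tanh(\frac12\,\mathrm{ad}\,IX)}{\frac12\,\mathrm{ad}\,IX}\,X,$$ where both right hand sides are the even power series $\frac{\mathrm{artanh}(x/2)}{x/2}$ and $\frac{\tanh(x/2)}{x/2}$ in $x$, evaluated by replacing $x^2$ with the endomorphism $\mathrm{ad}^2IX:A\mapsto R_{IX,A}IX$ of $T_pM$.
   Context: A Kähler manifold is a smooth manifold $M$ with a Riemannian metric $g$ and an orthogonal almost complex structure $I$ with $\nabla I=0$ for the Levi-Civita connection $\nabla$. A hermitean locally symmetric space is a Kähler manifold with $\nabla R=0$, where $R_{X,Y}Z=\nabla_X\nabla_YZ-\nabla_Y\nabla_XZ-\nabla_{[X,Y]}Z$. For $Y,A\in T_pM$ write $(\mathrm{ad}^2Y)A:=R_{Y,A}Y$. The Kähler form is $\omega(X,Y)=g(IX,Y)$. A local potential is a real function $\theta^{\mathrm{loc}}$ on an open set with $\omega=\frac i2\partial\overline\partial\theta^{\mathrm{loc}}$. $\mathrm{Sym}^{\kappa,\overline\kappa}T_p^*M$ is the space of complex valued polynomials $\eta$ on $T_pM$, homogeneous of degree $\kappa+\overline\kappa$, with $\frac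 d{dt}|_0\eta(X+tI_pX)=i(\kappa-\overline\kappa)\eta(X)$. $\overline{\mathrm{Sym}}^{\ge(2,2)}T_p^*M$ is the space of real formal power series on $T_pM$ all of whose bihomogeneous components have $\kappa,\overline\kappa\ge2$. Anchored coordinates centered in $p$ are a smooth map $\varphi$ from a neighborhood of $0\in T_pM$ to $M$, diffeomorphic onto a neighborhood of $p$, with $\varphi(0)=p$ and differential $\mathrm{id}_{T_pM}$ at $0$. Kähler normal coordinates (Bochner): there are unique (as germs) anchored coordinates $\mathrm{knc}_p$ centered in $p$, holomorphic with respect to $I_p$ on $T_pM$ and $I$ on $M$, and a unique local potential $\theta_p^{\mathrm{loc}}$ near $p$ such that the Taylor series $\theta_p$ of $\theta_p^{\mathrm{loc}}\circ\mathrm{knc}_p$ in $0$ satisfies $\theta_p(X)\equiv g_p(X,X)$ modulo $\overline{\mathrm{Sym}}^{\ge(2,2)}T_p^*M$. $\exp_p$ denotes the Riemannian exponential map. *)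

theory Defs
  imports "HOL-Analysis.Analysis"
begin

section \<open>Smooth maps between open subsets of normed spaces\<close>

abbreviation dir_deriv ::
    "('a::real_normed_vector \<Rightarrow> 'b::real_normed_vector) \<Rightarrow> 'a \<Rightarrow> 'a \<Rightarrow> 'b" where
  "dir_deriv f x u \<equiv> frechet_derivative f (at x) u"

text \<open>Only meant for open \<open>S\<close>; the domains below are finite dimensional, so that testing the
  derivative on each fixed vector is the same as testing it as a map into the linear maps.\<close>

fun Ck_on :: "nat \<Rightarrow> ('a::real_normed_vector \<Rightarrow> 'b::real_normed_vector) \<Rightarrow> 'a set \<Rightarrow> bool" where
  "Ck_on 0 f S \<longleftrightarrow> continuous_on S f"
| "Ck_on (Suc k) f S \<longleftrightarrow> f differentiable_on S \<and> (\<forall>v. Ck_on k (\<lambda>x. dir_deriv f x v) S)"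

definition smooth_on :: "('a::real_normed_vector \<Rightarrow> 'b::real_normed_vector) \<Rightarrow> 'a set \<Rightarrow> bool" where
  "smooth_on f S \<longleftrightarrow> (\<forall>k. Ck_on k f S)"


section \<open>Smooth manifolds\<close>

text \<open>A manifold is the union \<open>M\<close> of the domains of an atlas \<open>A\<close>; the values of a \<open>chart_map\<close>
  outside its \<open>chart_dom\<close> carry no information.\<close>

record ('m, 'e) chart =
  chart_dom :: "'m set"
  chart_map :: "'m \<Rightarrow> 'e"

definition chart_img :: "('m, 'e) chart \<Rightarrow> 'e set" where
  "chart_img d = chart_map d ` chart_dom d"

definition chart_inv :: "('m, 'e) chart \<Rightarrow> 'e \<Rightarrow> 'm" where
  "chart_inv d = inv_into (chart_dom d) (chart_map d)"

definition transition :: "('m, 'e) chart \<Rightarrow> ('m, 'e) chart \<Rightarrow> 'e \<Rightarrow> 'e" where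
  "transition d d' = chart_map d' \<circ> chart_inv d"

locale smooth_manifold =
  fixes M :: "'m::{t2_space, second_countable_topology} set"
    and A :: "('m, 'e::euclidean_space) chart set"
  assumes carrier: "M = (\<Union>d\<in>A. chart_dom d)"
    and open_dom: "d \<in> A \<Longrightarrow> open (chart_dom d)"
    and open_img: "d \<in> A \<Longrightarrow> open (chart_img d)"
    and homeo: "d \<in> A \<Longrightarrow>
      homeomorphism (chart_dom d) (chart_img d) (chart_map d) (chart_inv d)"
    and smooth_transition: "d \<in> A \<Longrightarrow> d' \<in> A \<Longrightarrow>
      smooth_on (transition d d') (chart_map d ` (chart_dom d \<inter> chart_dom d'))"

definition smooth_into ::
    "'m::topological_space set \<Rightarrow> ('m, 'e::real_normed_vector) chart set \<Rightarrow>
     ('a::real_normed_vector \<Rightarrow> 'm) \<Rightarrow> 'a set \<Rightarrow> bool" where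
  "smooth_into M A f S \<longleftrightarrow> continuous_on S f \<and> f ` S \<subseteq> M \<and>
     (\<forall>d\<in>A. smooth_on (chart_map d \<circ> f) {x\<in>S. f x \<in> chart_dom d})"

definition smooth_from ::
    "('m, 'e::real_normed_vector) chart set \<Rightarrow> ('m \<Rightarrow> 'b::real_normed_vector) \<Rightarrow> 'm set \<Rightarrow> bool" where
  "smooth_from A h W \<longleftrightarrow>
     (\<forall>d\<in>A. smooth_on (h \<circ> chart_inv d) (chart_map d ` (chart_dom d \<inter> W)))"


section \<open>Levi-Civita connection and curvature in a chart\<close>

text \<open>A metric in a chart is \<open>G x u v\<close>, with \<open>x\<close> a point of the chart image and \<open>u, v\<close> tangent
  vectors written in the coordinates of the chart. The Christoffel symbols come from Koszul's
  formula for the coordinate (constant) vector fields \<open>u, v, z\<close>.\<close>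

definition christoffel ::
    "('e::euclidean_space \<Rightarrow> 'e \<Rightarrow> 'e \<Rightarrow> real) \<Rightarrow> 'e \<Rightarrow> 'e \<Rightarrow> 'e \<Rightarrow> 'e" where
  "christoffel G x u v = (THE w. \<forall>z. 2 * G x w z =
     dir_deriv (\<lambda>y. G y v z) x u + dir_deriv (\<lambda>y. G y u z) x v - dir_deriv (\<lambda>y. G y u v) x z)"

definition nabla ::
    "('e::euclidean_space \<Rightarrow> 'e \<Rightarrow> 'e \<Rightarrow> real) \<Rightarrow> ('e \<Rightarrow> 'e) \<Rightarrow> ('e \<Rightarrow> 'e) \<Rightarrow> 'e \<Rightarrow> 'e" where
  "nabla G X Y x = dir_deriv Y x (X x) + christoffel G x (X x) (Y x)"

definition lie_bracket :: "('e::euclidean_space \<Rightarrow> 'e) \<Rightarrow> ('e \<Rightarrow> 'e) \<Rightarrow> 'e \<Rightarrow> 'e" where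
  "lie_bracket X Y x = dir_deriv Y x (X x) - dir_deriv X x (Y x)"

definition curvature_field ::
    "('e::euclidean_space \<Rightarrow> 'e \<Rightarrow> 'e \<Rightarrow> real) \<Rightarrow> ('e \<Rightarrow> 'e) \<Rightarrow> ('e \<Rightarrow> 'e) \<Rightarrow> ('e \<Rightarrow> 'e) \<Rightarrow> 'e \<Rightarrow> 'e" where
  "curvature_field G X Y Z x =
     nabla G X (nabla G Y Z) x - nabla G Y (nabla G X Z) x - nabla G (lie_bracket X Y) Z x"

text \<open>Curvature is tensorial, so its value on vectors is obtained from constant extensions.\<close>

definition curvature ::
    "('e::euclidean_space \<Rightarrow> 'e \<Rightarrow> 'e \<Rightarrow> real) \<Rightarrow> 'e \<Rightarrow> 'e \<Rightarrow> 'e \<Rightarrow> 'e \<Rightarrow> 'e" where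
  "curvature G x u v w = curvature_field G (\<lambda>_. u) (\<lambda>_. v) (\<lambda>_. w) x"

definition ad2 :: "('e::euclidean_space \<Rightarrow> 'e \<Rightarrow> 'e \<Rightarrow> real) \<Rightarrow> 'e \<Rightarrow> 'e \<Rightarrow> 'e \<Rightarrow> 'e" where
  "ad2 G x u a = curvature G x u a u"


section \<open>Kaehler manifolds and hermitean locally symmetric spaces\<close>

text \<open>Tensor fields are given by their components \<open>g d\<close>, \<open>J d\<close> in each chart \<open>d\<close>, subject to
  the usual transformation laws under change of charts.\<close>

locale riemannian_manifold = smooth_manifold M A
  for M :: "'m::{t2_space, second_countable_topology} set"
    and A :: "('m, 'e::euclidean_space) chart set" +
  fixes g :: "('m, 'e) chart \<Rightarrow> 'e \<Rightarrow> 'e \<Rightarrow> 'e \<Rightarrow> real"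
  assumes metric_bilinear: "d \<in> A \<Longrightarrow> x \<in> chart_img d \<Longrightarrow> bilinear (g d x)"
    and metric_sym: "d \<in> A \<Longrightarrow> x \<in> chart_img d \<Longrightarrow> g d x u v = g d x v u"
    and metric_pos: "d \<in> A \<Longrightarrow> x \<in> chart_img d \<Longrightarrow> u \<noteq> 0 \<Longrightarrow> 0 < g d x u u"
    and metric_smooth: "d \<in> A \<Longrightarrow> smooth_on (\<lambda>x. g d x u v) (chart_img d)"
    and metric_transform: "d \<in> A \<Longrightarrow> d' \<in> A \<Longrightarrow>
      x \<in> chart_map d ` (chart_dom d \<inter> chart_dom d') \<Longrightarrow>
      g d' (transition d d' x) (dir_deriv (transition d d') x u) (dir_deriv (transition d d') x v)
        = g d x u v"

locale kaehler_manifold = riemannian_manifold M A g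
  for M :: "'m::{t2_space, second_countable_topology} set"
    and A :: "('m, 'e::euclidean_space) chart set"
    and g :: "('m, 'e) chart \<Rightarrow> 'e \<Rightarrow> 'e \<Rightarrow> 'e \<Rightarrow> real" +
  fixes J :: "('m, 'e) chart \<Rightarrow> 'e \<Rightarrow> 'e \<Rightarrow> 'e"
  assumes J_linear: "d \<in> A \<Longrightarrow> x \<in> chart_img d \<Longrightarrow> linear (J d x)"
    and J_square: "d \<in> A \<Longrightarrow> x \<in> chart_img d \<Longrightarrow> J d x (J d x u) = - u"
    and J_orthogonal: "d \<in> A \<Longrightarrow> x \<in> chart_img d \<Longrightarrow> g d x (J d x u) (J d x v) = g d x u v"
    and J_smooth: "d \<in> A \<Longrightarrow> smooth_on (\<lambda>x. J d x u) (chart_img d)"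
    and J_transform: "d \<in> A \<Longrightarrow> d' \<in> A \<Longrightarrow>
      x \<in> chart_map d ` (chart_dom d \<inter> chart_dom d') \<Longrightarrow>
      J d' (transition d d' x) (dir_deriv (transition d d') x u)
        = dir_deriv (transition d d') x (J d x u)"
    and J_parallel: "d \<in> A \<Longrightarrow> x \<in> chart_img d \<Longrightarrow>
      smooth_on X (chart_img d) \<Longrightarrow> smooth_on Y (chart_img d) \<Longrightarrow>
      nabla (g d) X (\<lambda>y. J d y (Y y)) x = J d x (nabla (g d) X Y x)"

locale hermitean_locally_symmetric_space = kaehler_manifold M A g J
  for M :: "'m::{t2_space, second_countable_topology} set"
    and A :: "('m, 'e::euclidean_space) chart set"
    and g :: "('m, 'e) chart \<Rightarrow> 'e \<Rightarrow> 'e \<Rightarrow> 'e \<Rightarrow> real"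
    and J :: "('m, 'e) chart \<Rightarrow> 'e \<Rightarrow> 'e \<Rightarrow> 'e" +
  assumes curvature_parallel: "d \<in> A \<Longrightarrow> x \<in> chart_img d \<Longrightarrow>
      smooth_on W (chart_img d) \<Longrightarrow> smooth_on X (chart_img d) \<Longrightarrow>
      smooth_on Y (chart_img d) \<Longrightarrow> smooth_on Z (chart_img d) \<Longrightarrow>
      nabla (g d) W (\<lambda>y. curvature (g d) y (X y) (Y y) (Z y)) x =
        curvature (g d) x (nabla (g d) W X x) (Y x) (Z x)
        + curvature (g d) x (X x) (nabla (g d) W Y x) (Z x)
        + curvature (g d) x (X x) (Y x) (nabla (g d) W Z x)"


section \<open>The Riemannian exponential map\<close>

definition geodesic ::
    "'m::topological_space set \<Rightarrow> ('m, 'e::euclidean_space) chart set \<Rightarrow>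
     (('m, 'e) chart \<Rightarrow> 'e \<Rightarrow> 'e \<Rightarrow> 'e \<Rightarrow> real) \<Rightarrow> (real \<Rightarrow> 'm) \<Rightarrow> real set \<Rightarrow> bool" where
  "geodesic M A g \<gamma> T \<longleftrightarrow> smooth_into M A \<gamma> T \<and>
     (\<forall>t\<in>T. \<forall>d\<in>A. \<gamma> t \<in> chart_dom d \<longrightarrow>
        (let x = chart_map d \<circ> \<gamma>; x' = (\<lambda>s. vector_derivative x (at s))
         in vector_derivative x' (at t) + christoffel (g d) (x t) (x' t) (x' t) = 0))"

text \<open>Here and below the tangent space at \<open>p\<close> is identified with \<open>'e\<close> by the differential at \<open>p\<close> of
  a chart \<open>c\<close> around \<open>p\<close>. The value of \<open>exp_map\<close> is unspecified at vectors for which the geodesic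
  does not exist up to time 1.\<close>

definition exp_map ::
    "'m::topological_space set \<Rightarrow> ('m, 'e::euclidean_space) chart set \<Rightarrow>
     (('m, 'e) chart \<Rightarrow> 'e \<Rightarrow> 'e \<Rightarrow> 'e \<Rightarrow> real) \<Rightarrow> ('m, 'e) chart \<Rightarrow> 'm \<Rightarrow> 'e \<Rightarrow> 'm" where
  "exp_map M A g c p X = (THE q. \<exists>T \<gamma>. open T \<and> is_interval T \<and> {0..1} \<subseteq> T \<and>
     geodesic M A g \<gamma> T \<and> \<gamma> 0 = p \<and> vector_derivative (chart_map c \<circ> \<gamma>) (at 0) = X \<and> \<gamma> 1 = q)"


section \<open>Anchored coordinates and Kaehler normal coordinates\<close>

definition anchored_coordinates ::
    "'m::topological_space set \<Rightarrow> ('m, 'e::euclidean_space) chart set \<Rightarrow> ('m, 'e) chart \<Rightarrow> 'm \<Rightarrow>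
     'e set \<Rightarrow> ('e \<Rightarrow> 'm) \<Rightarrow> bool" where
  "anchored_coordinates M A c p V \<phi> \<longleftrightarrow>
     open V \<and> 0 \<in> V \<and> open (\<phi> ` V) \<and> inj_on \<phi> V \<and>
     smooth_into M A \<phi> V \<and> smooth_from A (inv_into V \<phi>) (\<phi> ` V) \<and>
     \<phi> 0 = p \<and> (chart_map c \<circ> \<phi> has_derivative (\<lambda>h. h)) (at 0)"

definition holomorphic_coordinates ::
    "('m, 'e::euclidean_space) chart set \<Rightarrow> (('m, 'e) chart \<Rightarrow> 'e \<Rightarrow> 'e \<Rightarrow> 'e) \<Rightarrow>
     ('m, 'e) chart \<Rightarrow> 'm \<Rightarrow> 'e set \<Rightarrow> ('e \<Rightarrow> 'm) \<Rightarrow> bool" where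
  "holomorphic_coordinates A J c p V \<phi> \<longleftrightarrow>
     (\<forall>X\<in>V. \<forall>d\<in>A. \<phi> X \<in> chart_dom d \<longrightarrow>
        (\<forall>u. dir_deriv (chart_map d \<circ> \<phi>) X (J c (chart_map c p) u)
             = J d (chart_map d (\<phi> X)) (dir_deriv (chart_map d \<circ> \<phi>) X u)))"

text \<open>In the following three definitions \<open>J x u\<close> is the complex structure in one chart;
  forms are evaluated on tangent vectors in that chart, with
  \<open>d \<beta>(u, v) = u \<beta>(v) - v \<beta>(u)\<close> for constant \<open>u, v\<close>. The form \<open>delbar f\<close> is the (0,1)-part of
  \<open>df\<close>, and \<open>del\<close> of a (0,1)-form is the (1,1)-part of its exterior derivative; the (1,1)-part of
  a 2-form \<open>\<eta>\<close> is \<open>(\<eta>(u, v) + \<eta>(Ju, Jv)) / 2\<close>.\<close>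

definition delbar ::
    "('e::euclidean_space \<Rightarrow> 'e \<Rightarrow> 'e) \<Rightarrow> ('e \<Rightarrow> real) \<Rightarrow> 'e \<Rightarrow> 'e \<Rightarrow> complex" where
  "delbar J f x u = (of_real (dir_deriv f x u) + \<i> * of_real (dir_deriv f x (J x u))) / 2"

definition ext_deriv :: "('e::euclidean_space \<Rightarrow> 'e \<Rightarrow> complex) \<Rightarrow> 'e \<Rightarrow> 'e \<Rightarrow> 'e \<Rightarrow> complex" where
  "ext_deriv \<beta> x u v = dir_deriv (\<lambda>y. \<beta> y v) x u - dir_deriv (\<lambda>y. \<beta> y u) x v"

definition del ::
    "('e::euclidean_space \<Rightarrow> 'e \<Rightarrow> 'e) \<Rightarrow> ('e \<Rightarrow> 'e \<Rightarrow> complex) \<Rightarrow> 'e \<Rightarrow> 'e \<Rightarrow> 'e \<Rightarrow> complex" where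
  "del J \<beta> x u v = (ext_deriv \<beta> x u v + ext_deriv \<beta> x (J x u) (J x v)) / 2"

definition local_potential ::
    "'m::topological_space set \<Rightarrow> ('m, 'e::euclidean_space) chart set \<Rightarrow>
     (('m, 'e) chart \<Rightarrow> 'e \<Rightarrow> 'e \<Rightarrow> 'e \<Rightarrow> real) \<Rightarrow> (('m, 'e) chart \<Rightarrow> 'e \<Rightarrow> 'e \<Rightarrow> 'e) \<Rightarrow>
     'm set \<Rightarrow> ('m \<Rightarrow> real) \<Rightarrow> bool" where
  "local_potential M A g J W \<theta> \<longleftrightarrow> open W \<and> W \<subseteq> M \<and> smooth_from A \<theta> W \<and>
     (\<forall>d\<in>A. \<forall>x \<in> chart_map d ` (chart_dom d \<inter> W). \<forall>u v.
        of_real (g d x (J d x u) v)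
          = (\<i> / 2) * del (J d) (delbar (J d) (\<theta> \<circ> chart_inv d)) x u v)"

definition Sym_bi :: "('e::euclidean_space \<Rightarrow> 'e) \<Rightarrow> nat \<Rightarrow> nat \<Rightarrow> ('e \<Rightarrow> complex) set" where
  "Sym_bi I \<kappa> \<kappa>' = {\<eta>. polynomial_function \<eta> \<and>
     (\<forall>t X. \<eta> (t *\<^sub>R X) = of_real (t ^ (\<kappa> + \<kappa>')) * \<eta> X) \<and>
     (\<forall>X. ((\<lambda>t. \<eta> (X + t *\<^sub>R I X)) has_vector_derivative
            \<i> * (of_nat \<kappa> - of_nat \<kappa>') * \<eta> X) (at 0))}"

text \<open>A formal power series is the sequence of its homogeneous components \<open>\<eta> n\<close>; each must be a sum
  of bihomogeneous components of bidegrees \<open>(a, b)\<close> with \<open>a, b \<ge> 2\<close>.\<close>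

definition Sym_ge22 :: "('e::euclidean_space \<Rightarrow> 'e) \<Rightarrow> (nat \<Rightarrow> 'e \<Rightarrow> real) set" where
  "Sym_ge22 I = {\<eta>. \<forall>n. \<exists>\<zeta>.
     (\<forall>(a, b) \<in> {(a, b). a + b = n \<and> 2 \<le> a \<and> 2 \<le> b}. \<zeta> a b \<in> Sym_bi I a b) \<and>
     (\<forall>X. of_real (\<eta> n X) = (\<Sum>(a, b) \<in> {(a, b). a + b = n \<and> 2 \<le> a \<and> 2 \<le> b}. \<zeta> a b X))}"

definition taylor_series :: "('e::euclidean_space \<Rightarrow> real) \<Rightarrow> nat \<Rightarrow> 'e \<Rightarrow> real" where
  "taylor_series f n X = (deriv ^^ n) (\<lambda>t. f (t *\<^sub>R X)) 0 / fact n"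

definition kaehler_normal_coordinates ::
    "'m::topological_space set \<Rightarrow> ('m, 'e::euclidean_space) chart set \<Rightarrow>
     (('m, 'e) chart \<Rightarrow> 'e \<Rightarrow> 'e \<Rightarrow> 'e \<Rightarrow> real) \<Rightarrow> (('m, 'e) chart \<Rightarrow> 'e \<Rightarrow> 'e \<Rightarrow> 'e) \<Rightarrow>
     ('m, 'e) chart \<Rightarrow> 'm \<Rightarrow> 'e set \<Rightarrow> ('e \<Rightarrow> 'm) \<Rightarrow> bool" where
  "kaehler_normal_coordinates M A g J c p V \<phi> \<longleftrightarrow>
     anchored_coordinates M A c p V \<phi> \<and> holomorphic_coordinates A J c p V \<phi> \<and>
     (\<exists>W \<theta>. p \<in> W \<and> local_potential M A g J W \<theta> \<and>
        (\<lambda>n X. taylor_series (\<theta> \<circ> \<phi>) n X - (if n = 2 then g c (chart_map c p) X X else 0))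
          \<in> Sym_ge22 (J c (chart_map c p)))"


section \<open>Difference element and power series in \<open>ad\<close>\<close>

definition diff_dom :: "'e set \<Rightarrow> ('e \<Rightarrow> 'm) \<Rightarrow> 'e set \<Rightarrow> ('e \<Rightarrow> 'm) \<Rightarrow> 'e set" where
  "diff_dom U e V \<phi> = {X\<in>V. \<phi> X \<in> e ` U}"

definition diff_element :: "'e set \<Rightarrow> ('e \<Rightarrow> 'm) \<Rightarrow> ('e \<Rightarrow> 'm) \<Rightarrow> 'e \<Rightarrow> 'e" where
  "diff_element U e \<phi> = inv_into U e \<circ> \<phi>"

definition taylor_fps :: "(real \<Rightarrow> real) \<Rightarrow> real fps" where
  "taylor_fps f = Abs_fps (\<lambda>n. (deriv ^^ n) f 0 / fact n)"

text \<open>The power series \<open>f(x/2) / (x/2)\<close>; the quotient is exact when \<open>f 0 = 0\<close>, and the series is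
  even when \<open>f\<close> is odd.\<close>

definition half_quotient_series :: "(real \<Rightarrow> real) \<Rightarrow> real fps" where
  "half_quotient_series f = taylor_fps (\<lambda>x. f (x / 2)) / (fps_const (1 / 2) * fps_X)"

text \<open>Terms of the even power series \<open>P\<close> with \<open>x\<^sup>2\<close> replaced by the endomorphism \<open>L\<close>, applied to \<open>v\<close>.\<close>

definition even_series_terms :: "real fps \<Rightarrow> ('e::real_vector \<Rightarrow> 'e) \<Rightarrow> 'e \<Rightarrow> nat \<Rightarrow> 'e" where
  "even_series_terms P L v k = fps_nth P (2 * k) *\<^sub>R (L ^^ k) v"

end

theory Submission
  imports Defs
begin

text \<open>
  In Kaehler normal coordinates the Levi-Civita connection \<open>\<Gamma>\<close> is complex bilinear, and the normal
  form of the potential says that all pure holomorphic derivatives of \<open>\<Gamma>\<close> vanish at the origin.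
  Together with \<open>\<nabla>R = 0\<close> this makes \<open>\<Gamma>\<close> and the curvature, restricted to a complex line
  \<open>l \<mapsto> l z\<close>, a solution of a Cauchy-Riemann type system with known jet at \<open>0\<close>; as nothing is
  assumed to be analytic, uniqueness is obtained from strong unique continuation for
  \<open>|dbar F| \<le> C |F|\<close>. The curvature at the origin is a Jordan triple system \<open>p\<close> with
  \<open>ad\<^sup>2 IX = p X X + p _ X X\<close>, and by power associativity the span of the odd powers of \<open>X\<close>
  behaves like a commutative algebra, on which the system is solved by
  \<open>\<Gamma>\<^sub>z(v, w) = p ((1 - D/2)\<^sup>-\<^sup>1 z) v w\<close>, \<open>D = p z z\<close>. Hence the curve \<open>c(t)\<close> given by the
  \<open>tanh\<close> series, which satisfies \<open>c' = X - p X c c / 2\<close>, is the geodesic with initial velocity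
  \<open>X\<close>. So \<open>exp\<close> is \<open>knc\<close> composed with the \<open>tanh\<close> series, and the \<open>artanh\<close> series is its
  inverse.
\<close>

section \<open>Calculus of smooth maps\<close>

text \<open>Only Taylor coefficients of the potential are prescribed and the metric is merely
  smooth, so agreement of formal series at one point says nothing about nearby points; this obstacle
  shapes the proof. On a complex line, \<Gamma> and the antilinear part of the curvature form a
  closed system: dbar of \<Gamma> is curvature and, the curvature being parallel, dbar of the
  curvature is curvature applied to \<Gamma>. Together with the holomorphic derivatives at 0 this
  fixes the whole jet, so the difference to the explicit solution is flat, and a frequency function
  makes it zero. The holomorphic derivatives of \<Gamma> vanish at 0 because, paired with the
  Hermitian metric, they are derivatives of the potential that see only bidegree (n+2, 1), which the
  normal form excludes. The Jordan identity is the Ricci identity for the parallel curvature, split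
  by type. On the span of the powers \<open>ad_sq X\<close> is twice \<open>p X X\<close>; this 2
  against the 1/4 in the recursion of the \<open>tanh\<close> coefficients gives the constant 1/2 in
  the equation of the curve.\<close>

lemma dir_deriv_eq:
  assumes "(f has_derivative f') (at x)"
  shows "dir_deriv f x v = f' v"
  using frechet_derivative_at[OF assms] by simp

lemma Ck_on_subset:
  assumes "Ck_on k f S" "T \<subseteq> S"
  shows "Ck_on k f T"
  using assms
proof (induction k arbitrary: f)
  case 0
  then show ?case by (auto intro: continuous_on_subset)
next
  case (Suc k)
  then show ?case by (auto intro: differentiable_on_subset)
qed

lemma dir_deriv_cong_open:
  assumes "open S" "x \<in> S" "\<And>y. y \<in> S \<Longrightarrow> f y = g y"
  shows "frechet_derivative f (at x) = frechet_derivative g (at x)"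
proof -
  have "(f has_derivative f') (at x) \<longleftrightarrow> (g has_derivative f') (at x)" for f'
    using assms has_derivative_transform_within_open[of f f' x UNIV S g]
      has_derivative_transform_within_open[of g f' x UNIV S f] by auto
  then show ?thesis
    unfolding frechet_derivative_def by simp
qed

lemma differentiable_on_cong_open:
  assumes "open S" "\<And>y. y \<in> S \<Longrightarrow> f y = g y" "f differentiable_on S"
  shows "g differentiable_on S"
  unfolding differentiable_on_def
proof
  fix x assume x: "x \<in> S"
  then have "f differentiable (at x within S)"
    using assms by (auto simp: differentiable_on_def)
  then show "g differentiable (at x within S)"
    unfolding differentiable_def
    using has_derivative_transform[OF x, of g f] assms(2) by metis
qed

lemma Ck_on_cong:
  assumes "open S" "\<And>y. y \<in> S \<Longrightarrow> f y = g y" "Ck_on k f S"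
  shows "Ck_on k g S"
  using assms(2,3)
proof (induction k arbitrary: f g)
  case 0
  then show ?case by (simp cong: continuous_on_cong)
next
  case (Suc k)
  have "Ck_on k (\<lambda>x. dir_deriv g x v) S" for v
  proof (rule Suc.IH[of "\<lambda>x. dir_deriv f x v"])
    show "dir_deriv f x v = dir_deriv g x v" if "x \<in> S" for x
      by (simp only: dir_deriv_cong_open[OF assms(1) that Suc.prems(1)])
    show "Ck_on k (\<lambda>x. dir_deriv f x v) S" using Suc.prems(2) by simp
  qed
  moreover have "g differentiable_on S"
    using differentiable_on_cong_open[OF assms(1) Suc.prems(1)] Suc.prems(2) by simp
  ultimately show ?case by simp
qed

lemma differentiable_on_at:
  assumes "open S" "f differentiable_on S" "x \<in> S"
  shows "f differentiable (at x)"
  using assms by (simp add: differentiable_on_eq_differentiable_at)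

lemma Ck_on_Suc_has_derivative:
  assumes "open S" "Ck_on (Suc k) f S" "x \<in> S"
  shows "(f has_derivative dir_deriv f x) (at x)"
  using assms differentiable_on_at[OF assms(1) _ assms(3), of f]
  by (simp add: frechet_derivative_works[symmetric])

lemma Ck_on_lower: "Ck_on (Suc k) f S \<Longrightarrow> Ck_on k f S"
  by (induction k arbitrary: f) (auto intro: differentiable_imp_continuous_on)

lemma Ck_on_mono: "Ck_on k f S \<Longrightarrow> j \<le> k \<Longrightarrow> Ck_on j f S"
proof (induction k)
  case (Suc k)
  show ?case
  proof (cases "j = Suc k")
    case False
    then show ?thesis using Suc Ck_on_lower[OF Suc.prems(1)] by simp
  qed (use Suc in simp)
qed simp

lemma Ck_on_continuous: "Ck_on k f S \<Longrightarrow> continuous_on S f"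
  using Ck_on_mono[of k f S 0] by simp

lemma Ck_on_SucI:
  assumes "open S" "\<And>x. x \<in> S \<Longrightarrow> (f has_derivative f' x) (at x)"
    "\<And>v. Ck_on k (\<lambda>x. f' x v) S"
  shows "Ck_on (Suc k) f S"
proof -
  have "f differentiable_on S"
    using assms by (auto simp: differentiable_on_eq_differentiable_at differentiable_def)
  moreover have "Ck_on k (\<lambda>x. dir_deriv f x v) S" for v
    using dir_deriv_eq[OF assms(2)] by (intro Ck_on_cong[OF assms(1) _ assms(3)[of v]]) auto
  ultimately show ?thesis by simp
qed

lemma Ck_on_const: "open S \<Longrightarrow> Ck_on k (\<lambda>x. c) S"
proof (induction k arbitrary: c)
  case (Suc k)
  show ?case by (rule Ck_on_SucI[of S _ "\<lambda>x v. 0"]) (simp_all only: Suc has_derivative_const)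
qed simp

lemma Ck_on_bounded_linear:
  assumes "open S" "bounded_linear L" "Ck_on k f S"
  shows "Ck_on k (\<lambda>x. L (f x)) S"
  using assms(3)
proof (induction k arbitrary: f)
  case 0
  then show ?case by (simp add: bounded_linear.continuous_on[OF assms(2)])
next
  case (Suc k)
  show ?case
  proof (rule Ck_on_SucI[OF assms(1)])
    show "((\<lambda>x. L (f x)) has_derivative (\<lambda>v. L (dir_deriv f x v))) (at x)" if "x \<in> S" for x
      by (rule bounded_linear.has_derivative[OF assms(2) Ck_on_Suc_has_derivative[OF assms(1) Suc.prems that]])
    show "Ck_on k (\<lambda>x. L (dir_deriv f x v)) S" for v
      using Suc.prems by (intro Suc.IH) simp
  qed
qed

lemma Ck_on_ident: "open S \<Longrightarrow> Ck_on k (\<lambda>x. x) S"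
proof (cases k)
  case (Suc j)
  assume "open S"
  then show ?thesis
    unfolding Suc by (intro Ck_on_SucI[of S _ "\<lambda>x v. v"] Ck_on_const has_derivative_ident)
qed simp

lemma Ck_on_add:
  assumes "open S" "Ck_on k f S" "Ck_on k g S"
  shows "Ck_on k (\<lambda>x. f x + g x) S"
  using assms(2,3)
proof (induction k arbitrary: f g)
  case 0
  then show ?case by (auto intro: continuous_intros)
next
  case (Suc k)
  show ?case
  proof (rule Ck_on_SucI[OF assms(1)])
    show "((\<lambda>x. f x + g x) has_derivative (\<lambda>v. dir_deriv f x v + dir_deriv g x v)) (at x)"
      if "x \<in> S" for x
      by (intro has_derivative_add Ck_on_Suc_has_derivative[OF assms(1) Suc.prems(1) that]
          Ck_on_Suc_has_derivative[OF assms(1) Suc.prems(2) that])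
    show "Ck_on k (\<lambda>x. dir_deriv f x v + dir_deriv g x v) S" for v
      using Suc.prems by (intro Suc.IH) simp_all
  qed
qed

lemma Ck_on_bilinear:
  assumes "open S" "bounded_bilinear B" "Ck_on k f S" "Ck_on k g S"
  shows "Ck_on k (\<lambda>x. B (f x) (g x)) S"
  using assms(3,4)
proof (induction k arbitrary: f g)
  case 0
  then show ?case by (simp add: bounded_bilinear.continuous_on[OF assms(2)])
next
  case (Suc k)
  show ?case
  proof (rule Ck_on_SucI[OF assms(1)])
    show "((\<lambda>x. B (f x) (g x)) has_derivative
        (\<lambda>v. B (f x) (dir_deriv g x v) + B (dir_deriv f x v) (g x))) (at x)" if "x \<in> S" for x
      by (intro bounded_bilinear.FDERIV[OF assms(2)] Ck_on_Suc_has_derivative[OF assms(1) Suc.prems(1) that]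
          Ck_on_Suc_has_derivative[OF assms(1) Suc.prems(2) that])
    show "Ck_on k (\<lambda>x. B (f x) (dir_deriv g x v) + B (dir_deriv f x v) (g x)) S" for v
      using Suc.prems
      by (intro Ck_on_add[OF assms(1)] Suc.IH Ck_on_lower[OF Suc.prems(1)] Ck_on_lower[OF Suc.prems(2)]) simp_all
  qed
qed

lemma Ck_on_sum:
  assumes "open S" "finite T" "\<And>i. i \<in> T \<Longrightarrow> Ck_on k (f i) S"
  shows "Ck_on k (\<lambda>x. \<Sum>i\<in>T. f i x) S"
  using assms(2,3)
proof (induction T rule: finite_induct)
  case empty
  then show ?case by (simp add: Ck_on_const[OF assms(1)])
next
  case (insert a T)
  then show ?case by (simp add: Ck_on_add[OF assms(1)])
qed

lemma linear_expand_Basis: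
  fixes L :: "'b::euclidean_space \<Rightarrow> 'c::real_vector"
  assumes "linear L"
  shows "L y = (\<Sum>b\<in>Basis. (y \<bullet> b) *\<^sub>R L b)"
proof -
  have "L y = L (\<Sum>b\<in>Basis. (y \<bullet> b) *\<^sub>R b)" by (simp add: euclidean_representation)
  then show ?thesis using assms by (simp add: linear_sum linear_scale)
qed

text \<open>\<open>Ck_on\<close> tests derivatives on fixed vectors, while the chain rule applies
  the derivative of \<open>f\<close> to \<open>dir_deriv g x v\<close>, which moves with
  \<open>x\<close>. Expanding that vector in \<open>Basis\<close> turns the chain rule into a finite
  sum of products to which the induction hypothesis applies.\<close>

lemma Ck_on_compose:
  fixes g :: "'a::real_normed_vector \<Rightarrow> 'b::euclidean_space"
  assumes "open S" "open T" "Ck_on k f T" "Ck_on k g S" "g ` S \<subseteq> T"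
  shows "Ck_on k (\<lambda>x. f (g x)) S"
  using assms(3-)
proof (induction k arbitrary: f)
  case 0
  then show ?case using continuous_on_compose2[of T f S g] by auto
next
  case (Suc k)
  have eq: "dir_deriv f (g x) (dir_deriv g x v)
      = (\<Sum>b\<in>Basis. (dir_deriv g x v \<bullet> b) *\<^sub>R dir_deriv f (g x) b)" if "x \<in> S" for x v
  proof (rule linear_expand_Basis)
    show "linear (dir_deriv f (g x))"
      using Ck_on_Suc_has_derivative[OF assms(2) Suc.prems(1), of "g x"] Suc.prems(3) that
      by (intro has_derivative_linear[of f]) auto
  qed
  show ?case
  proof (rule Ck_on_SucI[OF assms(1)])
    fix x assume x: "x \<in> S"
    show "((\<lambda>x. f (g x)) has_derivative (\<lambda>v. dir_deriv f (g x) (dir_deriv g x v))) (at x)"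
      using Ck_on_Suc_has_derivative[OF assms(2) Suc.prems(1), of "g x"]
        Ck_on_Suc_has_derivative[OF assms(1) Suc.prems(2) x] Suc.prems x
      by (intro has_derivative_compose[where f=g and g=f]) auto
  next
    fix v
    have "Ck_on k (\<lambda>x. dir_deriv f (g x) b) S" for b
      using Suc.prems by (intro Suc.IH[of "\<lambda>y. dir_deriv f y b"] Ck_on_lower[OF Suc.prems(2)]) simp_all
    moreover have "Ck_on k (\<lambda>x. dir_deriv g x v) S" using Suc.prems by simp
    ultimately have *: "Ck_on k (\<lambda>x. \<Sum>b\<in>Basis. (dir_deriv g x v \<bullet> b) *\<^sub>R dir_deriv f (g x) b) S"
      by (intro Ck_on_sum[OF assms(1)] Ck_on_bilinear[OF assms(1) bounded_bilinear_scaleR]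
          Ck_on_bounded_linear[OF assms(1) bounded_linear_inner_left]) auto
    show "Ck_on k (\<lambda>x. dir_deriv f (g x) (dir_deriv g x v)) S"
      by (rule Ck_on_cong[OF assms(1) _ *]) (simp only: eq)
  qed
qed

section \<open>Closure properties of smooth maps\<close>

lemma smooth_on_subset: "smooth_on f S \<Longrightarrow> T \<subseteq> S \<Longrightarrow> smooth_on f T"
  unfolding smooth_on_def by (simp add: Ck_on_subset[of _ f S T])

lemma smooth_on_cong: "open S \<Longrightarrow> (\<And>y. y \<in> S \<Longrightarrow> f y = g y) \<Longrightarrow> smooth_on f S \<Longrightarrow> smooth_on g S"
  unfolding smooth_on_def by (rule allI, rule Ck_on_cong[where f=f]) simp_all

lemma smooth_on_continuous: "smooth_on f S \<Longrightarrow> continuous_on S f"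
  unfolding smooth_on_def by (rule Ck_on_continuous) auto

lemma smooth_on_has_derivative:
  "open S \<Longrightarrow> smooth_on f S \<Longrightarrow> x \<in> S \<Longrightarrow> (f has_derivative dir_deriv f x) (at x)"
  unfolding smooth_on_def by (rule Ck_on_Suc_has_derivative[where k=0]) auto

lemma smooth_on_linear_dir_deriv:
  "open S \<Longrightarrow> smooth_on f S \<Longrightarrow> x \<in> S \<Longrightarrow> linear (dir_deriv f x)"
  by (rule has_derivative_linear[OF smooth_on_has_derivative])

lemma smooth_on_dir_deriv: "smooth_on f S \<Longrightarrow> smooth_on (\<lambda>x. dir_deriv f x v) S"
  unfolding smooth_on_def
proof
  fix k assume "\<forall>k. Ck_on k f S"
  then have "Ck_on (Suc k) f S" ..
  then show "Ck_on k (\<lambda>x. dir_deriv f x v) S" by simp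
qed

lemma smooth_onI:
  assumes "open S" "\<And>x. x \<in> S \<Longrightarrow> (f has_derivative f' x) (at x)"
    "\<And>v. smooth_on (\<lambda>x. f' x v) S"
  shows "smooth_on f S"
  unfolding smooth_on_def
proof
  fix k
  have "Ck_on (Suc k) f S"
    by (rule Ck_on_SucI[OF assms(1,2)]) (use assms(3) in \<open>simp_all add: smooth_on_def\<close>)
  then show "Ck_on k f S" by (rule Ck_on_lower)
qed

named_theorems smooth_intros

lemma smooth_on_const [smooth_intros]: "open S \<Longrightarrow> smooth_on (\<lambda>x. c) S"
  and smooth_on_ident [smooth_intros]: "open S \<Longrightarrow> smooth_on (\<lambda>x. x) S"
  by (simp_all add: smooth_on_def Ck_on_const Ck_on_ident)

lemma smooth_on_bounded_linear:
  "open S \<Longrightarrow> bounded_linear L \<Longrightarrow> smooth_on f S \<Longrightarrow> smooth_on (\<lambda>x. L (f x)) S"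
  unfolding smooth_on_def by (rule allI, rule Ck_on_bounded_linear) simp_all

lemma smooth_on_linear:
  fixes L :: "'b::euclidean_space \<Rightarrow> 'c::real_normed_vector"
  shows "open S \<Longrightarrow> linear L \<Longrightarrow> smooth_on f S \<Longrightarrow> smooth_on (\<lambda>x. L (f x)) S"
  by (rule smooth_on_bounded_linear) (simp_all only: linear_conv_bounded_linear)

lemma smooth_on_bilinear:
  "open S \<Longrightarrow> bounded_bilinear B \<Longrightarrow> smooth_on f S \<Longrightarrow> smooth_on g S \<Longrightarrow> smooth_on (\<lambda>x. B (f x) (g x)) S"
  unfolding smooth_on_def by (rule allI, rule Ck_on_bilinear) simp_all

lemma smooth_on_add [smooth_intros]:
  "open S \<Longrightarrow> smooth_on f S \<Longrightarrow> smooth_on g S \<Longrightarrow> smooth_on (\<lambda>x. f x + g x) S"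
  unfolding smooth_on_def by (rule allI, rule Ck_on_add) simp_all

lemma smooth_on_scaleR [smooth_intros]:
  "open S \<Longrightarrow> smooth_on f S \<Longrightarrow> smooth_on g S \<Longrightarrow> smooth_on (\<lambda>x. f x *\<^sub>R g x) S"
  by (rule smooth_on_bilinear[OF _ bounded_bilinear_scaleR])

lemma smooth_on_mult [smooth_intros]:
  fixes f g :: "'a::real_normed_vector \<Rightarrow> 'b::real_normed_algebra"
  shows "open S \<Longrightarrow> smooth_on f S \<Longrightarrow> smooth_on g S \<Longrightarrow> smooth_on (\<lambda>x. f x * g x) S"
  by (rule smooth_on_bilinear[OF _ bounded_bilinear_mult])

lemma smooth_on_inner [smooth_intros]:
  "open S \<Longrightarrow> smooth_on f S \<Longrightarrow> smooth_on g S \<Longrightarrow> smooth_on (\<lambda>x. f x \<bullet> g x) S"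
  by (rule smooth_on_bilinear[OF _ bounded_bilinear_inner])

lemma smooth_on_minus [smooth_intros]: "open S \<Longrightarrow> smooth_on f S \<Longrightarrow> smooth_on (\<lambda>x. - f x) S"
  by (rule smooth_on_bounded_linear[OF _ bounded_linear_minus[OF bounded_linear_ident]])

lemma smooth_on_diff [smooth_intros]:
  "open S \<Longrightarrow> smooth_on f S \<Longrightarrow> smooth_on g S \<Longrightarrow> smooth_on (\<lambda>x. f x - g x) S"
  using smooth_on_add[of S f "\<lambda>x. - g x"] smooth_on_minus[of S g] by simp

lemma smooth_on_of_real [smooth_intros]:
  fixes f :: "'a::real_normed_vector \<Rightarrow> real"
  shows "open S \<Longrightarrow> smooth_on f S
     \<Longrightarrow> smooth_on (\<lambda>x. of_real (f x) :: 'b::{real_normed_algebra_1,real_normed_vector}) S"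
  by (rule smooth_on_bounded_linear[OF _ bounded_linear_of_real])

lemma smooth_on_sum [smooth_intros]:
  "open S \<Longrightarrow> finite T \<Longrightarrow> (\<And>i. i \<in> T \<Longrightarrow> smooth_on (f i) S) \<Longrightarrow> smooth_on (\<lambda>x. \<Sum>i\<in>T. f i x) S"
  unfolding smooth_on_def by (rule allI, rule Ck_on_sum) simp_all

lemma smooth_on_compose:
  fixes g :: "'a::real_normed_vector \<Rightarrow> 'b::euclidean_space"
  shows "open S \<Longrightarrow> open T \<Longrightarrow> smooth_on f T \<Longrightarrow> smooth_on g S \<Longrightarrow> g ` S \<subseteq> T
    \<Longrightarrow> smooth_on (\<lambda>x. f (g x)) S"
  unfolding smooth_on_def by (rule allI, rule Ck_on_compose[where T=T]) simp_all

text \<open>This rule allows fields of linear maps to be handled as curried functions: smoothness is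
  known for each fixed argument, and a moving argument is expanded in \<open>Basis\<close>. Metrics,
  connections, curvature and complex structures are all treated this way.\<close>

lemma smooth_on_apply:
  fixes L :: "'a::real_normed_vector \<Rightarrow> 'b::euclidean_space \<Rightarrow> 'c::real_normed_vector"
  assumes "open S" "\<And>x. x \<in> S \<Longrightarrow> linear (L x)" "\<And>v. smooth_on (\<lambda>x. L x v) S" "smooth_on w S"
  shows "smooth_on (\<lambda>x. L x (w x)) S"
proof (rule smooth_on_cong[OF assms(1)])
  show "smooth_on (\<lambda>x. \<Sum>b\<in>Basis. (w x \<bullet> b) *\<^sub>R L x b) S"
    using assms by (intro smooth_intros) auto
  show "(\<Sum>b\<in>Basis. (w x \<bullet> b) *\<^sub>R L x b) = L x (w x)" if "x \<in> S" for x
    using linear_expand_Basis[OF assms(2)[OF that], of "w x"] by simp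
qed

lemma has_derivative_apply:
  fixes L :: "'a::real_normed_vector \<Rightarrow> 'b::euclidean_space \<Rightarrow> 'c::real_normed_vector"
  assumes S: "open S" "x \<in> S" and lin: "\<And>y. y \<in> S \<Longrightarrow> linear (L y)"
    and L: "\<And>v. ((\<lambda>y. L y v) has_derivative (\<lambda>u. L' u v)) (at x)"
    and w: "(w has_derivative w') (at x)"
  shows "((\<lambda>y. L y (w y)) has_derivative (\<lambda>u. L' u (w x) + L x (w' u))) (at x)"
proof -
  \<comment> \<open>Linearity is inherited from the maps \<open>L y\<close> by uniqueness of
    derivatives; it is needed to expand \<open>L' u (w x)\<close> in \<open>Basis\<close>.\<close>
  have lin': "linear (L' u)" for u
  proof (rule linearI)
    fix a b :: 'b and r :: real
    have "((\<lambda>y. L y (a + b)) has_derivative (\<lambda>u. L' u a + L' u b)) (at x)"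
      using has_derivative_add[OF L[of a] L[of b]]
      by (rule has_derivative_transform_within_open[OF _ S]) (simp add: lin linear_add)
    then show "L' u (a + b) = L' u a + L' u b"
      using has_derivative_unique[OF L[of "a + b"]] by metis
    have "((\<lambda>y. L y (r *\<^sub>R a)) has_derivative (\<lambda>u. r *\<^sub>R L' u a)) (at x)"
      using has_derivative_scaleR_right[OF L[of a], of r]
      by (rule has_derivative_transform_within_open[OF _ S]) (simp add: lin linear_scale)
    then show "L' u (r *\<^sub>R a) = r *\<^sub>R L' u a"
      using has_derivative_unique[OF L[of "r *\<^sub>R a"]] by metis
  qed
  have "((\<lambda>y. \<Sum>b\<in>Basis. (w y \<bullet> b) *\<^sub>R L y b) has_derivative
      (\<lambda>u. \<Sum>b\<in>Basis. (w x \<bullet> b) *\<^sub>R L' u b + (w' u \<bullet> b) *\<^sub>R L x b)) (at x)"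
    using L w by (auto intro!: derivative_eq_intros)
  moreover have "(\<Sum>b\<in>Basis. (w x \<bullet> b) *\<^sub>R L' u b + (w' u \<bullet> b) *\<^sub>R L x b) = L' u (w x) + L x (w' u)" for u
    using linear_expand_Basis[OF lin', of u "w x"] linear_expand_Basis[OF lin[OF S(2)], of "w' u"]
    by (simp add: sum.distrib)
  ultimately show ?thesis
    using has_derivative_transform_within_open[OF _ S, of "\<lambda>y. \<Sum>b\<in>Basis. (w y \<bullet> b) *\<^sub>R L y b"
        "\<lambda>u. L' u (w x) + L x (w' u)" UNIV "\<lambda>y. L y (w y)"] linear_expand_Basis[OF lin, of _ "w _"] by simp
qed

lemma dir_deriv_apply:
  fixes L :: "'a::real_normed_vector \<Rightarrow> 'b::euclidean_space \<Rightarrow> 'c::real_normed_vector"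
  assumes S: "open S" "x \<in> S" and lin: "\<And>y. y \<in> S \<Longrightarrow> linear (L y)"
    and L: "\<And>v. smooth_on (\<lambda>y. L y v) S" and w: "smooth_on w S"
  shows "dir_deriv (\<lambda>y. L y (w y)) x u = dir_deriv (\<lambda>y. L y (w x)) x u + L x (dir_deriv w x u)"
proof -
  have "((\<lambda>y. L y (w y)) has_derivative
     (\<lambda>u. dir_deriv (\<lambda>y. L y (w x)) x u + L x (dir_deriv w x u))) (at x)"
    by (rule has_derivative_apply[OF S lin, where L' = "\<lambda>u v. dir_deriv (\<lambda>y. L y v) x u"])
      (use smooth_on_has_derivative[OF S(1) L S(2)] smooth_on_has_derivative[OF S(1) w S(2)] in auto)
  then show ?thesis by (rule dir_deriv_eq)
qed

lemma dir_deriv_add: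
  assumes "open S" "x \<in> S" "smooth_on f S" "smooth_on g S"
  shows "dir_deriv (\<lambda>y. f y + g y) x u = dir_deriv f x u + dir_deriv g x u"
  using smooth_on_has_derivative[OF assms(1,3,2)] smooth_on_has_derivative[OF assms(1,4,2)]
  by (intro dir_deriv_eq has_derivative_add)

lemma dir_deriv_diff:
  assumes "open S" "x \<in> S" "smooth_on f S" "smooth_on g S"
  shows "dir_deriv (\<lambda>y. f y - g y) x u = dir_deriv f x u - dir_deriv g x u"
  using smooth_on_has_derivative[OF assms(1,3,2)] smooth_on_has_derivative[OF assms(1,4,2)]
  by (intro dir_deriv_eq has_derivative_diff)

lemma dir_deriv_bounded_linear:
  assumes "open S" "x \<in> S" "smooth_on f S" "bounded_linear L"
  shows "dir_deriv (\<lambda>y. L (f y)) x u = L (dir_deriv f x u)"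
  by (rule dir_deriv_eq[OF bounded_linear.has_derivative[OF assms(4) smooth_on_has_derivative[OF assms(1,3,2)]]])

lemma dir_deriv_compose:
  assumes "open S" "x \<in> S" "smooth_on g S" "open T" "g x \<in> T" "smooth_on f T"
  shows "dir_deriv (\<lambda>y. f (g y)) x u = dir_deriv f (g x) (dir_deriv g x u)"
  by (rule dir_deriv_eq[OF has_derivative_compose[OF smooth_on_has_derivative[OF assms(1,3,2)]
          smooth_on_has_derivative[OF assms(4,6,5)]]])

section \<open>Symmetry of second derivatives\<close>

lemma smooth_on_line_deriv:
  assumes "open S" "smooth_on f S" "y + t *\<^sub>R u \<in> S"
  shows "((\<lambda>t. f (y + t *\<^sub>R u)) has_vector_derivative dir_deriv f (y + t *\<^sub>R u) u) (at t)"
proof -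
  have "((\<lambda>t. y + t *\<^sub>R u) has_derivative (\<lambda>h. h *\<^sub>R u)) (at t)"
    by (auto intro!: derivative_eq_intros)
  from has_derivative_compose[OF this smooth_on_has_derivative[OF assms]]
  show ?thesis
    unfolding has_vector_derivative_def
    by (simp add: linear_scale[OF smooth_on_linear_dir_deriv[OF assms]])
qed

text \<open>The mean value theorem is used once in the direction \<open>u\<close> and once in the
  direction \<open>v\<close>. The difference on the left is symmetric in \<open>u\<close> and
  \<open>v\<close>, the right-hand side displays one order of differentiation.\<close>

lemma second_difference:
  fixes F :: "'a::real_normed_vector \<Rightarrow> real"
  assumes S: "open S" and F: "smooth_on F S" and s: "0 < s"
    and sub: "\<And>a b. 0 \<le> a \<Longrightarrow> a \<le> s \<Longrightarrow> 0 \<le> b \<Longrightarrow> b \<le> s \<Longrightarrow> x + a *\<^sub>R u + b *\<^sub>R v \<in> S"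
  obtains a b where "0 < a" "a < s" "0 < b" "b < s"
    "F (x + s *\<^sub>R u + s *\<^sub>R v) - F (x + s *\<^sub>R u) - F (x + s *\<^sub>R v) + F x
      = s * s * dir_deriv (\<lambda>y. dir_deriv F y u) (x + a *\<^sub>R u + b *\<^sub>R v) v"
proof -
  define p where "p a = F ((x + s *\<^sub>R v) + a *\<^sub>R u) - F (x + a *\<^sub>R u)" for a
  define p' where "p' a = dir_deriv F ((x + s *\<^sub>R v) + a *\<^sub>R u) u - dir_deriv F (x + a *\<^sub>R u) u" for a
  have "DERIV p a :> p' a" if "0 \<le> a" "a \<le> s" for a
    unfolding p_def p'_def has_real_derivative_iff_has_vector_derivative
    using sub[of a s] sub[of a 0] that s
    by (intro has_vector_derivative_diff smooth_on_line_deriv[OF S F]) (auto simp: algebra_simps)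
  from MVT2[OF s this] obtain a where a: "0 < a" "a < s" "p s - p 0 = s * p' a" by auto
  define q where "q b = dir_deriv F ((x + a *\<^sub>R u) + b *\<^sub>R v) u" for b
  have "DERIV q b :> dir_deriv (\<lambda>y. dir_deriv F y u) ((x + a *\<^sub>R u) + b *\<^sub>R v) v"
    if "0 \<le> b" "b \<le> s" for b
    unfolding q_def has_real_derivative_iff_has_vector_derivative
    using sub[of a b] that a
    by (intro smooth_on_line_deriv[OF S smooth_on_dir_deriv[OF F]]) auto
  from MVT2[OF s this] obtain b where b: "0 < b" "b < s"
    "q s - q 0 = s * dir_deriv (\<lambda>y. dir_deriv F y u) ((x + a *\<^sub>R u) + b *\<^sub>R v) v" by auto
  have "q s - q 0 = p' a" by (simp add: q_def p'_def algebra_simps)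
  with a b have "p s - p 0 = s * (s * dir_deriv (\<lambda>y. dir_deriv F y u) ((x + a *\<^sub>R u) + b *\<^sub>R v) v)"
    by simp
  then have "F (x + s *\<^sub>R u + s *\<^sub>R v) - F (x + s *\<^sub>R u) - F (x + s *\<^sub>R v) + F x
      = s * s * dir_deriv (\<lambda>y. dir_deriv F y u) (x + a *\<^sub>R u + b *\<^sub>R v) v"
    by (simp add: p_def algebra_simps)
  with a b that show thesis by blast
qed

text \<open>Both iterated derivatives, taken at suitable points near \<open>x\<close>, equal the
  same second difference quotient; continuity then forces them to agree at \<open>x\<close>.\<close>

lemma dir_deriv_commute_real:
  fixes F :: "'a::real_normed_vector \<Rightarrow> real"
  assumes S: "open S" "x \<in> S" and F: "smooth_on F S"
  shows "dir_deriv (\<lambda>y. dir_deriv F y u) x v = dir_deriv (\<lambda>y. dir_deriv F y v) x u"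
    (is "?A x = ?B x")
proof (rule ccontr)
  assume ne: "?A x \<noteq> ?B x"
  define e where "e = \<bar>?A x - ?B x\<bar> / 2"
  have e: "0 < e" using ne by (simp add: e_def)
  have "continuous_on S ?A" "continuous_on S ?B"
    by (intro smooth_on_continuous smooth_on_dir_deriv F)+
  then have "isCont ?A x" "isCont ?B x"
    using S by (auto simp: continuous_on_eq_continuous_at)
  then obtain d1 d2 where d: "0 < d1" "0 < d2"
    "\<And>y. dist y x < d1 \<Longrightarrow> dist (?A y) (?A x) < e" "\<And>y. dist y x < d2 \<Longrightarrow> dist (?B y) (?B x) < e"
    using e unfolding continuous_at_eps_delta by blast
  obtain r where r: "0 < r" "ball x r \<subseteq> S" using S openE by blast
  define m where "m = min r (min d1 d2)"
  have m: "0 < m" using d r by (simp add: m_def)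
  \<comment> \<open>The denominator keeps the parallelogram spanned by \<open>s u\<close> and
    \<open>s v\<close> within distance \<open>m / 2\<close> of \<open>x\<close>; the summand 1
    covers \<open>u = v = 0\<close>.\<close>
  define s where "s = m / (2 * (norm u + norm v + 1))"
  have s: "0 < s" using m by (simp add: s_def add_nonneg_pos)
  have small: "dist (x + a *\<^sub>R u + b *\<^sub>R v) x < m" if "0 \<le> a" "a \<le> s" "0 \<le> b" "b \<le> s" for a b
  proof -
    have "dist (x + a *\<^sub>R u + b *\<^sub>R v) x \<le> norm (a *\<^sub>R u) + norm (b *\<^sub>R v)"
      using norm_triangle_ineq[of "a *\<^sub>R u" "b *\<^sub>R v"] by (simp add: dist_norm)
    also have "\<dots> \<le> s * norm u + s * norm v"
      using that by (auto intro!: add_mono mult_right_mono)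
    also have "\<dots> \<le> s * (norm u + norm v + 1)" using s by (simp add: algebra_simps)
    also have "\<dots> = m / 2"
    proof -
      have "norm u + norm v + 1 \<noteq> 0"
        using norm_ge_zero[of u] norm_ge_zero[of v] by linarith
      then show ?thesis unfolding s_def by (metis mult.commute nonzero_mult_div_cancel_left times_divide_eq_left
            mult_divide_mult_cancel_right)
    qed
    finally show ?thesis using m by simp
  qed
  have sub: "x + a *\<^sub>R u + b *\<^sub>R v \<in> S" if "0 \<le> a" "a \<le> s" "0 \<le> b" "b \<le> s" for a b
    using small[OF that] r by (auto simp: m_def dist_commute mem_ball)
  obtain a b where ab: "0 < a" "a < s" "0 < b" "b < s"
    "F (x + s *\<^sub>R u + s *\<^sub>R v) - F (x + s *\<^sub>R u) - F (x + s *\<^sub>R v) + F x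
      = s * s * ?A (x + a *\<^sub>R u + b *\<^sub>R v)"
    using second_difference[OF S(1) F s sub] by blast
  have sub': "x + a *\<^sub>R v + b *\<^sub>R u \<in> S" if "0 \<le> a" "a \<le> s" "0 \<le> b" "b \<le> s" for a b
    using sub[of b a] that by (simp add: add.assoc add.commute[of "a *\<^sub>R v"])
  obtain a' b' where ab': "0 < a'" "a' < s" "0 < b'" "b' < s"
    "F (x + s *\<^sub>R v + s *\<^sub>R u) - F (x + s *\<^sub>R v) - F (x + s *\<^sub>R u) + F x
      = s * s * ?B (x + a' *\<^sub>R v + b' *\<^sub>R u)"
    using second_difference[OF S(1) F s sub'] by blast
  have perm: "x + i *\<^sub>R v + j *\<^sub>R u = x + j *\<^sub>R u + i *\<^sub>R v" for i j by (simp add: add_ac)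
  have "s * s * ?A (x + a *\<^sub>R u + b *\<^sub>R v) = s * s * ?B (x + b' *\<^sub>R u + a' *\<^sub>R v)"
    using ab(5) ab'(5) unfolding perm[of s s] perm[of a' b'] by linarith
  then have eq: "?A (x + a *\<^sub>R u + b *\<^sub>R v) = ?B (x + b' *\<^sub>R u + a' *\<^sub>R v)"
    using s by (metis mult_cancel_left mult_eq_0_iff less_irrefl)
  have "dist (?A (x + a *\<^sub>R u + b *\<^sub>R v)) (?A x) < e"
    using small[of a b] ab by (intro d) (auto simp: m_def)
  moreover have "dist (?B (x + b' *\<^sub>R u + a' *\<^sub>R v)) (?B x) < e"
    using small[of b' a'] ab' by (intro d) (auto simp: m_def)
  ultimately have "\<bar>?A x - ?B x\<bar> < 2 * e"
    using eq by (simp add: dist_real_def)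
  then show False by (simp add: e_def)
qed

lemma dir_deriv_commute:
  fixes F :: "'a::real_normed_vector \<Rightarrow> 'b::euclidean_space"
  assumes S: "open S" "x \<in> S" and F: "smooth_on F S"
  shows "dir_deriv (\<lambda>y. dir_deriv F y u) x v = dir_deriv (\<lambda>y. dir_deriv F y v) x u"
proof (rule euclidean_eqI)
  fix b :: 'b assume "b \<in> Basis"
  have bl: "bounded_linear (\<lambda>y. y \<bullet> b)" by (rule bounded_linear_inner_left)
  have eq: "dir_deriv (\<lambda>y. dir_deriv F y w \<bullet> b) x z = dir_deriv (\<lambda>y. dir_deriv (\<lambda>y. F y \<bullet> b) y w) x z" for w z
    using dir_deriv_cong_open[OF S, of "\<lambda>y. dir_deriv F y w \<bullet> b" "\<lambda>y. dir_deriv (\<lambda>y. F y \<bullet> b) y w"]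
      dir_deriv_bounded_linear[OF S(1) _ F bl] by simp
  have "dir_deriv (\<lambda>y. dir_deriv (\<lambda>y. F y \<bullet> b) y u) x v = dir_deriv (\<lambda>y. dir_deriv (\<lambda>y. F y \<bullet> b) y v) x u"
    by (rule dir_deriv_commute_real[OF S smooth_on_bounded_linear[OF S(1) bl F]])
  then show "dir_deriv (\<lambda>y. dir_deriv F y u) x v \<bullet> b = dir_deriv (\<lambda>y. dir_deriv F y v) x u \<bullet> b"
    using dir_deriv_bounded_linear[OF S smooth_on_dir_deriv[OF F] bl] eq by metis
qed

section \<open>Families of invertible linear maps\<close>

lemma Ck_on_apply:
  fixes L :: "'a::real_normed_vector \<Rightarrow> 'b::euclidean_space \<Rightarrow> 'c::real_normed_vector"
  assumes "open S" "\<And>x. x \<in> S \<Longrightarrow> linear (L x)" "\<And>v. Ck_on k (\<lambda>x. L x v) S" "Ck_on k w S"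
  shows "Ck_on k (\<lambda>x. L x (w x)) S"
proof (rule Ck_on_cong[OF assms(1)])
  show "Ck_on k (\<lambda>x. \<Sum>b\<in>Basis. (w x \<bullet> b) *\<^sub>R L x b) S"
    by (rule Ck_on_sum[OF assms(1) finite_Basis])
      (rule Ck_on_bilinear[OF assms(1) bounded_bilinear_scaleR
          Ck_on_bounded_linear[OF assms(1) bounded_linear_inner_left assms(4)] assms(3)])
  show "(\<Sum>b\<in>Basis. (w x \<bullet> b) *\<^sub>R L x b) = L x (w x)" if "x \<in> S" for x
    using linear_expand_Basis[OF assms(2)[OF that], of "w x"] by simp
qed

text \<open>Where \<open>f\<close> vanishes, the change of \<open>g\<close> is multiplied by a
  factor of first order, so continuity of \<open>g\<close> suffices. This serves the differentiation
  of inverse maps, for which at first only continuity is known.\<close>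

lemma has_derivative_scaleR_vanishing:
  fixes f :: "'a::real_normed_vector \<Rightarrow> real" and g :: "'a \<Rightarrow> 'b::real_normed_vector"
  assumes f: "(f has_derivative f') (at x)" and f0: "f x = 0" and g: "isCont g x"
  shows "((\<lambda>y. f y *\<^sub>R g y) has_derivative (\<lambda>h. f' h *\<^sub>R g x)) (at x)"
proof -
  have "((\<lambda>y. f y *\<^sub>R (g y - g x)) has_derivative (\<lambda>h. 0)) (at x)"
    unfolding has_derivative_at_alt
  proof (intro conjI allI impI)
    fix e :: real assume e: "0 < e"
    obtain K where K: "0 < K" "\<And>h. \<bar>f' h\<bar> \<le> norm h * K"
      using bounded_linear.pos_bounded[OF has_derivative_bounded_linear[OF f]] by auto
    obtain d1 where d1: "0 < d1" "\<And>y. norm (y - x) < d1 \<Longrightarrow> norm (f y - f x - f' (y - x)) \<le> 1 * norm (y - x)"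
      using f unfolding has_derivative_at_alt by (meson zero_less_one)
    define e' where "e' = e / (K + 1)"
    have e': "0 < e'" using e K by (simp add: e'_def)
    then obtain d2 where d2: "0 < d2" "\<And>y. dist y x < d2 \<Longrightarrow> dist (g y) (g x) < e'"
      using g unfolding continuous_at_eps_delta by meson
    show "\<exists>d>0. \<forall>y. norm (y - x) < d \<longrightarrow>
        norm (f y *\<^sub>R (g y - g x) - f x *\<^sub>R (g x - g x) - 0) \<le> e * norm (y - x)"
    proof (intro exI[of _ "min d1 d2"] conjI allI impI)
      fix y assume y: "norm (y - x) < min d1 d2"
      have "\<bar>f y\<bar> \<le> \<bar>f' (y - x)\<bar> + norm (y - x)"
        using d1(2)[of y] y f0 by auto
      also have "\<dots> \<le> (K + 1) * norm (y - x)" using K(2)[of "y - x"] by (simp add: algebra_simps)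
      finally have 1: "\<bar>f y\<bar> \<le> (K + 1) * norm (y - x)" .
      have 2: "norm (g y - g x) \<le> e'" using d2(2)[of y] y by (simp add: dist_norm)
      have "norm (f y *\<^sub>R (g y - g x)) \<le> ((K + 1) * norm (y - x)) * e'"
        using mult_mono[OF 1 2] K by simp
      also have "\<dots> = e * norm (y - x)" using K by (simp add: e'_def)
      finally show "norm (f y *\<^sub>R (g y - g x) - f x *\<^sub>R (g x - g x) - 0) \<le> e * norm (y - x)" by simp
    qed (use d1 d2 in auto)
  qed auto
  from has_derivative_add[OF this has_derivative_scaleR_left[OF f, of "g x"]]
  show ?thesis by (simp add: algebra_simps)
qed

text \<open>\<open>L x\<close> is bounded below by some \<open>B\<close> and nearby
  \<open>L y\<close> by \<open>B / 2\<close>, so the inverses stay bounded; then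
  \<open>N y v - N x v\<close>, which is \<open>N y\<close> applied to
  \<open>(L x - L y) (N x v)\<close>, tends to 0.\<close>

lemma inverse_family_continuous:
  fixes L N :: "'a::real_normed_vector \<Rightarrow> 'b::euclidean_space \<Rightarrow> 'b"
  assumes S: "open S" "x \<in> S" and lin: "\<And>x. x \<in> S \<Longrightarrow> linear (L x)"
    and cont: "\<And>v. continuous_on S (\<lambda>x. L x v)"
    and LN: "\<And>x v. x \<in> S \<Longrightarrow> L x (N x v) = v" and NL: "\<And>x v. x \<in> S \<Longrightarrow> N x (L x v) = v"
  shows "isCont (\<lambda>y. N y v) x"
proof -
  have "inj (L x)" using NL[OF S(2)] by (metis injI)
  then obtain B where B: "0 < B" "\<And>w. B * norm w \<le> norm (L x w)"
    using linear_inj_bounded_below_pos[OF lin[OF S(2)]] by blast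
  have cont: "isCont (\<lambda>y. L y w) x" for w
    using cont S continuous_on_eq_continuous_at by blast
  have "((\<lambda>y. \<Sum>b\<in>Basis. norm (L y b - L x b)) \<longlongrightarrow> (\<Sum>b\<in>(Basis::'b set). norm (L x b - L x b))) (at x)"
    using cont unfolding isCont_def by (intro tendsto_intros) auto
  then have "((\<lambda>y. \<Sum>b\<in>Basis. norm (L y b - L x b)) \<longlongrightarrow> 0) (at x)" by simp
  then have ev: "\<forall>\<^sub>F y in at x. (\<Sum>b\<in>Basis. norm (L y b - L x b)) < B / 2"
    using B by (intro order_tendstoD) auto
  moreover have evS: "\<forall>\<^sub>F y in at x. y \<in> S" using S by (rule eventually_at_in_open')
  ultimately have "\<forall>\<^sub>F y in at x. norm (N y v - N x v) \<le> 2 / B * norm (L y (N x v) - L x (N x v))"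
  proof eventually_elim
    case (elim y)
    have bound: "B / 2 * norm w \<le> norm (L y w)" for w
    proof -
      have "norm (L y w - L x w) \<le> (\<Sum>b\<in>Basis. norm (L y b - L x b)) * norm w"
      proof -
        have "L y w - L x w = (\<Sum>b\<in>Basis. (w \<bullet> b) *\<^sub>R (L y b - L x b))"
          using linear_expand_Basis[OF lin[OF S(2)], of w] linear_expand_Basis[OF lin[OF elim(2)], of w]
          by (simp add: scaleR_diff_right sum_subtractf)
        also have "norm \<dots> \<le> (\<Sum>b\<in>Basis. norm ((w \<bullet> b) *\<^sub>R (L y b - L x b)))" by (rule norm_sum)
        also have "\<dots> \<le> (\<Sum>b\<in>Basis. norm w * norm (L y b - L x b))"
          by (intro sum_mono) (auto intro!: mult_right_mono simp: Basis_le_norm)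
        finally show ?thesis by (simp add: sum_distrib_left mult.commute)
      qed
      also have "\<dots> \<le> B / 2 * norm w" using elim by (intro mult_right_mono) auto
      finally show ?thesis using B(2)[of w] norm_triangle_sub[of "L x w" "L y w"]
        by (simp add: norm_minus_commute)
    qed
    have "L y (N y v - N x v) = L x (N x v) - L y (N x v)"
      using LN[OF elim(2)] LN[OF S(2)] linear_diff[OF lin[OF elim(2)]] by simp
    then have "B / 2 * norm (N y v - N x v) \<le> norm (L y (N x v) - L x (N x v))"
      using bound[of "N y v - N x v"] by (simp add: norm_minus_commute)
    then show ?case using B by (simp add: field_simps)
  qed
  moreover have "((\<lambda>y. 2 / B * norm (L y (N x v) - L x (N x v))) \<longlongrightarrow> 2 / B * norm (L x (N x v) - L x (N x v))) (at x)"
    using cont unfolding isCont_def by (intro tendsto_intros) auto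
  then have "((\<lambda>y. 2 / B * norm (L y (N x v) - L x (N x v))) \<longlongrightarrow> 0) (at x)" by simp
  ultimately have "((\<lambda>y. N y v - N x v) \<longlongrightarrow> 0) (at x)"
    by (rule Lim_null_comparison)
  then show ?thesis unfolding isCont_def by (simp add: LIM_zero_iff)
qed

text \<open>In the identity \<open>N y v = N x v - N y ((L y - L x) (N x v))\<close> the inner
  vector vanishes at \<open>y = x\<close>. Its derivative together with continuity of
  \<open>N\<close> gives the familiar formula for the derivative of an inverse.\<close>

lemma inverse_family_has_derivative:
  fixes L N :: "'a::real_normed_vector \<Rightarrow> 'b::euclidean_space \<Rightarrow> 'b"
  assumes S: "open S" "x \<in> S" and lin: "\<And>x. x \<in> S \<Longrightarrow> linear (L x)"
    and L: "\<And>v. smooth_on (\<lambda>x. L x v) S"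
    and LN: "\<And>x v. x \<in> S \<Longrightarrow> L x (N x v) = v" and NL: "\<And>x v. x \<in> S \<Longrightarrow> N x (L x v) = v"
  shows "((\<lambda>y. N y v) has_derivative (\<lambda>u. - N x (dir_deriv (\<lambda>y. L y (N x v)) x u))) (at x)"
proof -
  have linN: "linear (N y)" if y: "y \<in> S" for y
  proof (rule linearI)
    show "N y (a + b) = N y a + N y b" for a b
      using NL[OF y, of "N y a + N y b"] by (simp add: linear_add[OF lin[OF y]] LN[OF y])
    show "N y (r *\<^sub>R a) = r *\<^sub>R N y a" for r a
      using NL[OF y, of "r *\<^sub>R N y a"] by (simp add: linear_scale[OF lin[OF y]] LN[OF y])
  qed
  have contN: "isCont (\<lambda>y. N y w) x" for w
    by (rule inverse_family_continuous[OF S lin smooth_on_continuous[OF L] LN NL])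
  define q where "q y = L y (N x v) - L x (N x v)" for y
  have q: "(q has_derivative dir_deriv (\<lambda>y. L y (N x v)) x) (at x)"
    unfolding q_def
    using has_derivative_diff[OF smooth_on_has_derivative[OF S(1) L S(2)] has_derivative_const] by simp
  have q0: "q x \<bullet> b = 0" for b by (simp add: q_def)
  have "((\<lambda>y. (q y \<bullet> b) *\<^sub>R N y b) has_derivative
      (\<lambda>u. (dir_deriv (\<lambda>y. L y (N x v)) x u \<bullet> b) *\<^sub>R N x b)) (at x)" for b
    by (rule has_derivative_scaleR_vanishing[OF has_derivative_inner_left[OF q] q0 contN])
  from has_derivative_diff[OF has_derivative_const has_derivative_sum[OF this]]
  have D: "((\<lambda>y. N x v - (\<Sum>b\<in>Basis. (q y \<bullet> b) *\<^sub>R N y b)) has_derivative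
      (\<lambda>u. 0 - (\<Sum>b\<in>Basis. (dir_deriv (\<lambda>y. L y (N x v)) x u \<bullet> b) *\<^sub>R N x b))) (at x)" .
  have *: "N x v - (\<Sum>b\<in>Basis. (q y \<bullet> b) *\<^sub>R N y b) = N y v" if "y \<in> S" for y
  proof -
    have "(\<Sum>b\<in>Basis. (q y \<bullet> b) *\<^sub>R N y b) = N y (q y)"
      by (rule linear_expand_Basis[OF linN[OF that], symmetric])
    also have "\<dots> = N x v - N y v"
      unfolding q_def using linear_diff[OF linN[OF that]] NL[OF that] LN[OF S(2)] by simp
    finally show ?thesis by simp
  qed
  have **: "0 - (\<Sum>b\<in>Basis. (dir_deriv (\<lambda>y. L y (N x v)) x u \<bullet> b) *\<^sub>R N x b)
      = - N x (dir_deriv (\<lambda>y. L y (N x v)) x u)" for u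
    by (simp only: linear_expand_Basis[OF linN[OF S(2)], of "dir_deriv _ _ _"] diff_0)
  show ?thesis
    using has_derivative_transform_within_open[OF D S *] unfolding ** .
qed

lemma linear_dir_deriv_family:
  fixes L :: "'a::real_normed_vector \<Rightarrow> 'b::real_vector \<Rightarrow> 'c::real_normed_vector"
  assumes S: "open S" "x \<in> S" and lin: "\<And>x. x \<in> S \<Longrightarrow> linear (L x)"
    and L: "\<And>v. smooth_on (\<lambda>x. L x v) S"
  shows "linear (\<lambda>w. dir_deriv (\<lambda>y. L y w) x u)"
proof (rule linearI)
  have D: "((\<lambda>y. L y w) has_derivative dir_deriv (\<lambda>y. L y w) x) (at x)" for w
    by (rule smooth_on_has_derivative[OF S(1) L S(2)])
  show "dir_deriv (\<lambda>y. L y (a + b)) x u = dir_deriv (\<lambda>y. L y a) x u + dir_deriv (\<lambda>y. L y b) x u" for a b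
    using dir_deriv_cong_open[OF S, of "\<lambda>y. L y (a + b)" "\<lambda>y. L y a + L y b"]
      dir_deriv_eq[OF has_derivative_add[OF D D]] linear_add[OF lin] by simp
  show "dir_deriv (\<lambda>y. L y (r *\<^sub>R a)) x u = r *\<^sub>R dir_deriv (\<lambda>y. L y a) x u" for r a
    using dir_deriv_cong_open[OF S, of "\<lambda>y. L y (r *\<^sub>R a)" "\<lambda>y. r *\<^sub>R L y a"]
      dir_deriv_eq[OF has_derivative_scaleR_right[OF D]] linear_scale[OF lin] by simp
qed

text \<open>The derivative formula expresses the derivative of \<open>N\<close> through
  \<open>N\<close> and smooth data, so each order of regularity yields the next.\<close>

lemma smooth_on_inverse_family:
  fixes L N :: "'a::real_normed_vector \<Rightarrow> 'b::euclidean_space \<Rightarrow> 'b"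
  assumes S: "open S" and lin: "\<And>x. x \<in> S \<Longrightarrow> linear (L x)"
    and L: "\<And>v. smooth_on (\<lambda>x. L x v) S"
    and LN: "\<And>x v. x \<in> S \<Longrightarrow> L x (N x v) = v" and NL: "\<And>x v. x \<in> S \<Longrightarrow> N x (L x v) = v"
  shows "smooth_on (\<lambda>x. N x v) S"
proof -
  note deriv = inverse_family_has_derivative[OF S _ lin L LN NL]
  have linN: "linear (N y)" if y: "y \<in> S" for y
  proof (rule linearI)
    show "N y (a + b) = N y a + N y b" for a b
      using NL[OF y, of "N y a + N y b"] by (simp add: linear_add[OF lin[OF y]] LN[OF y])
    show "N y (r *\<^sub>R a) = r *\<^sub>R N y a" for r a
      using NL[OF y, of "r *\<^sub>R N y a"] by (simp add: linear_scale[OF lin[OF y]] LN[OF y])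
  qed
  have linD: "linear (\<lambda>w. dir_deriv (\<lambda>y. L y w) x u)" if x: "x \<in> S" for x u
    by (rule linear_dir_deriv_family[OF S x lin L])
  have "Ck_on k (\<lambda>x. N x v) S" for k v
  proof (induction k arbitrary: v)
    case 0
    then show ?case
      using has_derivative_continuous[OF deriv] by (simp add: continuous_on_eq_continuous_at[OF S])
  next
    case (Suc k)
    show ?case
    proof (rule Ck_on_SucI[OF S deriv])
      fix u
      have *: "Ck_on k (\<lambda>x. dir_deriv (\<lambda>y. L y w) x u) S" for w
        using smooth_on_dir_deriv[OF L] by (simp add: smooth_on_def)
      have **: "Ck_on k (\<lambda>x. dir_deriv (\<lambda>y. L y (N x v)) x u) S"
        by (rule Ck_on_apply[OF S linD * Suc.IH])
      have "Ck_on k (\<lambda>x. N x (dir_deriv (\<lambda>y. L y (N x v)) x u)) S"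
        by (rule Ck_on_apply[OF S linN Suc.IH **])
      then show "Ck_on k (\<lambda>x. - N x (dir_deriv (\<lambda>y. L y (N x v)) x u)) S"
        by (rule Ck_on_bounded_linear[OF S bounded_linear_minus[OF bounded_linear_ident]])
    qed auto
  qed
  then show ?thesis by (simp add: smooth_on_def)
qed

text \<open>Leibniz' rule on a ball around \<open>x\<close>. The parameter \<open>s\<close> ranges
  over an open neighbourhood \<open>T\<close> of the interval because \<open>smooth_on\<close> is
  meant for open sets.\<close>

lemma integral_has_derivative_param:
  fixes G :: "'a::euclidean_space \<Rightarrow> real \<Rightarrow> 'b::euclidean_space"
  assumes S: "open S" "x \<in> S" and T: "open T" "{0..1} \<subseteq> T"
    and G: "smooth_on (\<lambda>p. G (fst p) (snd p)) (S \<times> T)"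
  shows "((\<lambda>y. integral {0..1} (G y)) has_derivative
    (\<lambda>v. integral {0..1} (\<lambda>s. dir_deriv (\<lambda>p. G (fst p) (snd p)) (x, s) (v, 0)))) (at x)"
proof -
  let ?G = "\<lambda>p. G (fst p) (snd p)"
  obtain r where r: "0 < r" "ball x r \<subseteq> S" using S openE by blast
  define U where "U = ball x r"
  have U: "open U" "convex U" "x \<in> U" "U \<subseteq> S" using r by (auto simp: U_def)
  have ST: "open (S \<times> T)" using S T by (simp add: open_Times)
  have DG: "(?G has_derivative dir_deriv ?G (y, t)) (at (y, t))" if "y \<in> U" "t \<in> {0..1}" for y t
    by (rule smooth_on_has_derivative[OF ST G]) (use that U T in auto)
  have D: "((\<lambda>y. G y t) has_derivative (\<lambda>v. dir_deriv ?G (y, t) (v, 0))) (at y)"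
    if "y \<in> U" "t \<in> {0..1}" for y t
  proof -
    have "((\<lambda>y. (y, t)) has_derivative (\<lambda>v. (v, 0))) (at y)"
      by (auto intro!: derivative_eq_intros)
    from has_derivative_compose[OF this DG[OF that]] show ?thesis by simp
  qed
  define fx where "fx y t = Blinfun (\<lambda>v. dir_deriv ?G (y, t) (v, 0))" for y t
  have fx: "blinfun_apply (fx y t) = (\<lambda>v. dir_deriv ?G (y, t) (v, 0))" if "y \<in> U" "t \<in> {0..1}" for y t
    unfolding fx_def by (rule bounded_linear_Blinfun_apply[OF has_derivative_bounded_linear[OF D[OF that]]])
  have cont: "continuous_on (U \<times> cbox 0 1) (\<lambda>p. dir_deriv ?G p (v, 0))" for v
    using continuous_on_subset[OF smooth_on_continuous[OF smooth_on_dir_deriv[OF G, of "(v, 0)"]], of "U \<times> {0..1}"] U T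
    by auto
  have contfx: "continuous_on (U \<times> cbox 0 1) (\<lambda>(y, t). fx y t)"
  proof (rule continuous_on_blinfun_componentwise)
    fix i :: 'a assume "i \<in> Basis"
    show "continuous_on (U \<times> cbox 0 1) (\<lambda>p. blinfun_apply (case p of (y, t) \<Rightarrow> fx y t) i)"
      using cont[of i] by (rule continuous_on_eq) (auto simp: fx)
  qed
  have intG: "G y integrable_on cbox 0 1" if "y \<in> U" for y
  proof (rule integrable_continuous)
    have "continuous_on (S \<times> T) ?G" by (rule smooth_on_continuous[OF G])
    then have "continuous_on {0..1} (\<lambda>t. ?G (y, t))"
      by (rule continuous_on_compose2) (use that U T in \<open>auto intro!: continuous_intros\<close>)
    then show "continuous_on (cbox 0 1) (G y)" by simp
  qed
  have "((\<lambda>y. integral (cbox 0 1) (G y)) has_derivative blinfun_apply (integral (cbox 0 1) (fx x))) (at x within U)"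
    by (rule leibniz_rule[OF _ intG contfx U(3,2)])
      (use D fx in \<open>auto intro: has_derivative_at_withinI\<close>)
  moreover have "fx x integrable_on cbox 0 1"
  proof (rule integrable_continuous)
    have "continuous_on (cbox 0 1) (\<lambda>t::real. (x, t))" by (intro continuous_intros)
    moreover have "(\<lambda>t. (x, t)) ` cbox 0 1 \<subseteq> U \<times> cbox (0::real) 1" using U by auto
    ultimately show "continuous_on (cbox 0 1) (fx x)"
      using continuous_on_compose2[OF contfx] by fastforce
  qed
  then have e1: "blinfun_apply (integral (cbox 0 1) (fx x)) v = integral (cbox 0 1) (\<lambda>t. fx x t v)" for v
    by (rule blinfun_apply_integral)
  moreover have e2: "integral (cbox 0 1) (\<lambda>t. fx x t v) = integral (cbox 0 1) (\<lambda>t. dir_deriv ?G (x, t) (v, 0))" for v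
    by (rule integral_cong) (use fx U in auto)
  ultimately have D: "((\<lambda>y. integral (cbox 0 1) (G y)) has_derivative blinfun_apply (integral (cbox 0 1) (fx x))) (at x within U)"
    by simp
  have "blinfun_apply (integral (cbox 0 1) (fx x))
      = (\<lambda>v. integral (cbox 0 1) (\<lambda>t. dir_deriv ?G (x, t) (v, 0)))"
    by (rule ext) (simp only: e1 e2)
  with D have "((\<lambda>y. integral (cbox 0 1) (G y)) has_derivative
      (\<lambda>v. integral (cbox 0 1) (\<lambda>t. dir_deriv ?G (x, t) (v, 0)))) (at x within U)"
    by (simp only:)
  then show ?thesis using at_within_open[OF U(3,1)] by simp
qed

lemma smooth_on_integral_param:
  fixes G :: "'a::euclidean_space \<Rightarrow> real \<Rightarrow> 'b::euclidean_space"
  assumes S: "open S" and T: "open T" "{0..1} \<subseteq> T"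
    and G: "smooth_on (\<lambda>p. G (fst p) (snd p)) (S \<times> T)"
  shows "smooth_on (\<lambda>x. integral {0..1} (G x)) S"
proof -
  have "Ck_on k (\<lambda>x. integral {0..1} (G x)) S" for k
    using G
  proof (induction k arbitrary: G)
    case 0
    show ?case
      using has_derivative_continuous[OF integral_has_derivative_param[OF S _ T 0]]
      by (simp add: continuous_on_eq_continuous_at[OF S])
  next
    case (Suc k)
    show ?case
    proof (rule Ck_on_SucI[OF S integral_has_derivative_param[OF S _ T Suc.prems]])
      fix v
      have "smooth_on (\<lambda>p. dir_deriv (\<lambda>p. G (fst p) (snd p)) (fst p, snd p) (v, 0)) (S \<times> T)"
        using smooth_on_dir_deriv[OF Suc.prems, of "(v, 0)"] by simp
      from Suc.IH[OF this]
      show "Ck_on k (\<lambda>x. integral {0..1} (\<lambda>s. dir_deriv (\<lambda>p. G (fst p) (snd p)) (x, s) (v, 0))) S" .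
    qed
  qed
  then show ?thesis by (simp add: smooth_on_def)
qed

text \<open>The inverse function theorem gives a differentiable \<open>g\<close> whose derivative is
  the inverse of \<open>dir_deriv f\<close> at \<open>g y\<close>. As inversion of that family is
  smooth, the formula lifts the regularity of \<open>g\<close> step by step.\<close>

lemma smooth_inverse_function:
  fixes f :: "'a::euclidean_space \<Rightarrow> 'a"
  assumes S: "open S" "x \<in> S" and f: "smooth_on f S" and inj: "inj (dir_deriv f x)"
  obtains U V g where "open U" "U \<subseteq> S" "x \<in> U" "open V" "homeomorphism U V f g" "smooth_on g V"
proof -
  define F where "F y = Blinfun (dir_deriv f y)" for y
  have F: "blinfun_apply (F y) = dir_deriv f y" if "y \<in> S" for y
    unfolding F_def
    by (rule bounded_linear_Blinfun_apply[OF has_derivative_bounded_linear[OF smooth_on_has_derivative[OF S(1) f that]]])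
  have contF: "continuous_on S F"
  proof (rule continuous_on_blinfun_componentwise)
    fix i :: 'a assume "i \<in> Basis"
    show "continuous_on S (\<lambda>y. blinfun_apply (F y) i)"
      using smooth_on_continuous[OF smooth_on_dir_deriv[OF f, of i]] by (rule continuous_on_eq) (simp add: F)
  qed
  obtain h where h: "linear h" "h \<circ> dir_deriv f x = id"
    using linear_injective_left_inverse[OF smooth_on_linear_dir_deriv[OF S(1) f S(2)] inj] by blast
  have "Blinfun h o\<^sub>L F x = id_blinfun"
    using h by (intro blinfun_eqI)
      (simp add: F[OF S(2)] bounded_linear_Blinfun_apply linear_conv_bounded_linear[symmetric] fun_eq_iff)
  note inv = this
  have der: "(f has_derivative blinfun_apply (F y)) (at y)" if "y \<in> S" for y
    using smooth_on_has_derivative[OF S(1) f that] F[OF that] by simp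
  obtain U V g g' where U: "open U" "U \<subseteq> S" "x \<in> U" "open V" "homeomorphism U V f g"
    and g: "\<And>y. y \<in> V \<Longrightarrow> (g has_derivative g' y) (at y)"
      "\<And>y. y \<in> V \<Longrightarrow> g' y = inv (blinfun_apply (F (g y)))"
      "\<And>y. y \<in> V \<Longrightarrow> bij (blinfun_apply (F (g y)))"
    using inverse_function_theorem[OF S(1) der contF S(2) inv] by metis
  have gU: "g y \<in> U" if "y \<in> V" for y using U(5) that by (auto simp: homeomorphism_def)
  have bij: "bij (dir_deriv f y)" if y: "y \<in> U" for y
  proof -
    have "f y \<in> V" "g (f y) = y" using U(5) y by (auto simp: homeomorphism_def)
    with g(3)[of "f y"] F[of y] y U(2) show ?thesis by auto
  qed
  have N: "smooth_on (\<lambda>y. inv (dir_deriv f y) v) U" for v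
  proof (rule smooth_on_inverse_family[OF U(1)])
    show "linear (dir_deriv f y)" if "y \<in> U" for y
      using smooth_on_linear_dir_deriv[OF S(1) f] that U by auto
    show "smooth_on (\<lambda>y. dir_deriv f y v) U" for v
      by (rule smooth_on_subset[OF smooth_on_dir_deriv[OF f] U(2)])
  qed (use bij in \<open>auto simp: bij_is_surj bij_is_inj surj_f_inv_f inv_f_f\<close>)
  have "Ck_on k g V" for k
  proof (induction k)
    case 0
    then show ?case using U(5) by (simp add: homeomorphism_def)
  next
    case (Suc k)
    have *: "Ck_on k (\<lambda>y. inv (dir_deriv f (g y)) v) V" for v
      by (rule Ck_on_compose[OF U(4,1) _ Suc]) (use N gU in \<open>auto simp: smooth_on_def\<close>)
    have "g' y = inv (dir_deriv f (g y))" if "y \<in> V" for y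
      using g(2)[OF that] F gU[OF that] U(2) by auto
    then show ?case
      using g(1) by (intro Ck_on_SucI[OF U(4) _ *]) simp
  qed
  then have "smooth_on g V" by (simp add: smooth_on_def)
  with U that show thesis by blast
qed

section \<open>Unique continuation for the Cauchy-Riemann operator\<close>

text \<open>\<open>N r\<close> will be the mean of the squared norm of the unknowns over the circle of radius \<open>r\<close>.
  The frequency \<open>M / N\<close> is almost increasing in \<open>r\<close>, hence bounded near \<open>0\<close>, so that a positive
  \<open>N\<close> decays at most polynomially, against the flatness.\<close>

lemma decaying_quotient_zero:
  fixes N M N' M' :: "real \<Rightarrow> real"
  assumes DN: "\<And>r. 0 < r \<Longrightarrow> r < R \<Longrightarrow> DERIV N r :> N' r"
    and DM: "\<And>r. 0 < r \<Longrightarrow> r < R \<Longrightarrow> DERIV M r :> M' r"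
    and N0: "\<And>r. 0 < r \<Longrightarrow> r < R \<Longrightarrow> 0 \<le> N r"
    and quot: "\<And>r. 0 < r \<Longrightarrow> r < R \<Longrightarrow> 0 < N r \<Longrightarrow> M' r * N r - M r * N' r \<ge> - (K * r / 2) * (N r)\<^sup>2"
    and growth: "\<And>r. 0 < r \<Longrightarrow> r < R \<Longrightarrow> r * N' r \<le> 2 * M r + (K * r\<^sup>2 + 1) * N r"
    and K: "0 \<le> K"
    and flat: "\<And>n. \<exists>C d. 0 < d \<and> (\<forall>r. 0 < r \<and> r < d \<longrightarrow> N r \<le> C * r ^ n)"
    and a: "0 < a" "a < R"
  shows "N a = 0"
proof (rule ccontr)
  assume "N a \<noteq> 0"
  with N0 a have Na: "0 < N a" by (simp add: order_less_le)
  define q where "q r = M r / N r" for r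
  \<comment> \<open>An upper bound for \<open>r N' / N\<close> once the quotient \<open>q\<close> is
    known to be almost nondecreasing; it becomes the exponent of the polynomial lower bound.\<close>
  obtain k :: nat where k: "2 * (q a + K * a\<^sup>2 / 4) + K * a\<^sup>2 + 1 \<le> real k"
    using real_arch_simple by blast
  define c where "c = N a / a ^ k"
  have c: "0 < c" using Na a by (simp add: c_def)
  have lower: "c * z ^ k \<le> N z" if z: "0 < z" "z \<le> a" and pos: "\<And>r. z \<le> r \<Longrightarrow> r \<le> a \<Longrightarrow> 0 < N r" for z
  proof -
    have q_le: "q r \<le> q a + K * a\<^sup>2 / 4" if r: "z \<le> r" "r \<le> a" for r
    proof -
      \<comment> \<open>The added term has derivative \<open>K r / 2\<close>, which compensates the
        decrease of \<open>q\<close> that \<open>quot\<close> permits.\<close>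
      have "q r + K * r\<^sup>2 / 4 \<le> q a + K * a\<^sup>2 / 4"
      proof (rule DERIV_nonneg_imp_nondecreasing[OF r(2)])
        fix x assume x: "r \<le> x" "x \<le> a"
        have x': "0 < x" "x < R" "0 < N x" using x r z a pos by auto
        have "DERIV (\<lambda>r. q r + K * r\<^sup>2 / 4) x :> (M' x * N x - M x * N' x) / (N x * N x) + K * x / 2"
          unfolding q_def by (rule derivative_eq_intros DN DM x' refl | use x' in simp)+
        moreover have "(M' x * N x - M x * N' x) / (N x * N x) \<ge> - (K * x / 2)"
        proof -
          have "- (K * x / 2) * (N x * N x) \<le> M' x * N x - M x * N' x"
            using quot[OF x'] by (simp add: power2_eq_square)
          then show ?thesis using x' by (subst pos_le_divide_eq) auto
        qed
        ultimately show "\<exists>y. DERIV (\<lambda>r. q r + K * r\<^sup>2 / 4) x :> y \<and> 0 \<le> y" by force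
      qed
      moreover have "0 \<le> K * r\<^sup>2 / 4" using K by simp
      ultimately show ?thesis by linarith
    qed
    have "N a / a ^ k \<le> N z / z ^ k"
    proof (rule DERIV_nonpos_imp_nonincreasing[OF z(2)])
      fix x assume x: "z \<le> x" "x \<le> a"
      have x': "0 < x" "x < R" "0 < N x" using x z a pos by auto
      have "DERIV (\<lambda>r. N r / r ^ k) x :> (N' x * x ^ k - N x * (real k * x ^ (k - 1))) / (x ^ k * x ^ k)"
        by (rule derivative_eq_intros DN x' refl | use x' in simp)+
      moreover have "(N' x * x ^ k - N x * (real k * x ^ (k - 1))) / (x ^ k * x ^ k) \<le> 0"
      proof -
        have "M x = q x * N x" using x' by (simp add: q_def)
        then have "x * N' x \<le> (2 * q x + K * x\<^sup>2 + 1) * N x"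
          using growth[OF x'(1,2)] by (simp add: algebra_simps)
        also have "\<dots> \<le> real k * N x"
        proof -
          have "x\<^sup>2 \<le> a\<^sup>2" using x x' by (simp add: power_mono)
          then have "K * x\<^sup>2 \<le> K * a\<^sup>2" using K by (rule mult_left_mono)
          moreover have "2 * q x \<le> 2 * (q a + K * a\<^sup>2 / 4)"
            using q_le[of x] x by simp
          ultimately have "2 * q x + K * x\<^sup>2 + 1 \<le> real k" using k by linarith
          then show ?thesis using x' by (intro mult_right_mono) auto
        qed
        finally have "x * N' x \<le> real k * N x" .
        then have le: "(x * N' x) * x ^ k \<le> (real k * N x) * x ^ k" using x' by (intro mult_right_mono) auto
        have "N' x * x ^ k - N x * (real k * x ^ (k - 1)) \<le> 0"
        proof (cases k)
          \<comment> \<open>Separate because \<open>k - 1\<close> is truncated for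
            \<open>k = 0\<close>.\<close>
          case 0
          then show ?thesis using le x' by (simp add: mult_le_0_iff)
        next
          case (Suc m)
          then have "x * (N' x * x ^ k - N x * (real k * x ^ (k - 1))) \<le> 0"
            using le by (simp add: algebra_simps)
          then show ?thesis using x' by (simp add: mult_le_0_iff)
        qed
        then show ?thesis by (intro divide_nonpos_nonneg) auto
      qed
      ultimately show "\<exists>y. DERIV (\<lambda>r. N r / r ^ k) x :> y \<and> y \<le> 0" by blast
    qed
    then show ?thesis using z by (simp add: c_def field_simps)
  qed
  \<comment> \<open>\<open>N\<close> has no zero in this range: to the right of its last zero the
    lower bound holds, and by continuity it would hold at the zero itself.\<close>
  have pos: "0 < N r" if r: "0 < r" "r \<le> a" for r
  proof (rule ccontr)
    assume "\<not> 0 < N r"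
    then have Nr: "N r = 0" using N0[of r] r a by simp
    define Z where "Z = {x\<in>{r..a}. N x = 0}"
    have cont: "continuous_on {r..a} N"
      using DERIV_isCont[OF DN] r a by (intro continuous_at_imp_continuous_on ballI) simp
    have "closed Z" unfolding Z_def
      by (rule continuous_closed_preimage_constant[OF cont closed_atLeastAtMost])
    moreover have "r \<in> Z" using Nr r by (simp add: Z_def)
    moreover have bdd: "bdd_above Z" by (auto simp: Z_def intro!: bdd_aboveI[of _ a])
    ultimately have SZ: "Sup Z \<in> Z" using closed_contains_Sup[of Z] by blast
    define z where "z = Sup Z"
    have z: "0 < z" "z < a" "N z = 0" "r \<le> z"
    proof -
      have "z \<in> Z" using SZ by (simp add: z_def)
      then show "N z = 0" "r \<le> z" by (simp_all add: Z_def)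
      then show "0 < z" using r by simp
      have "z \<noteq> a" using \<open>N z = 0\<close> Na by auto
      then show "z < a" using \<open>z \<in> Z\<close> by (simp add: Z_def)
    qed
    have above: "0 < N x" if "z < x" "x \<le> a" for x
    proof (rule ccontr)
      assume "\<not> 0 < N x"
      then have "N x = 0" using N0[of x] that z a by simp
      then have "x \<in> Z" using that z by (simp add: Z_def)
      then have "x \<le> z" using cSup_upper[OF _ bdd] by (simp add: z_def)
      then show False using that by simp
    qed
    have "((\<lambda>x. N x) \<longlongrightarrow> N z) (at_right z)"
    proof -
      have "isCont N z" using DERIV_isCont[OF DN[of z]] z a by simp
      then show ?thesis unfolding isCont_def by (rule filterlim_mono) (simp_all add: at_le)
    qed
    moreover have "((\<lambda>x. c * x ^ k) \<longlongrightarrow> c * z ^ k) (at_right z)"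
      by (intro tendsto_intros)
    moreover have "\<forall>\<^sub>F x in at_right z. c * x ^ k \<le> N x"
    proof -
      have "\<forall>\<^sub>F x in at_right z. x \<in> {z<..<a}" using z by (intro eventually_at_right_real)
      then show ?thesis
        by eventually_elim (rule lower, use z above in auto)
    qed
    ultimately have "c * z ^ k \<le> N z"
      using tendsto_le[OF trivial_limit_at_right_real] by blast
    then show False using z mult_pos_pos[OF c zero_less_power[OF z(1), of k]] by simp
  qed
  have low: "c * r ^ k \<le> N r" if "0 < r" "r \<le> a" for r
    using that pos by (intro lower) auto
  obtain C d where Cd: "0 < d" "\<And>r. 0 < r \<Longrightarrow> r < d \<Longrightarrow> N r \<le> C * r ^ Suc k" using flat[of "Suc k"] by blast
  \<comment> \<open>Small enough for \<open>C r^(k+1) <= c r^k / 2\<close>, against the lower bound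
    \<open>c r^k\<close>.\<close>
  define r where "r = min (min (a / 2) (d / 2)) (c / (2 * (\<bar>C\<bar> + 1)))"
  have r: "0 < r" "r \<le> a" "r < d" "r \<le> c / (2 * (\<bar>C\<bar> + 1))"
  proof -
    have "0 < c / (2 * (\<bar>C\<bar> + 1))" using c by (intro divide_pos_pos) auto
    then show "0 < r" using a Cd by (simp add: r_def)
    have "r \<le> a / 2" "r \<le> d / 2" unfolding r_def by (simp_all only: min_le_iff_disj order_refl simp_thms)
    then show "r \<le> a" "r < d" using a Cd(1) by simp_all
    show "r \<le> c / (2 * (\<bar>C\<bar> + 1))" unfolding r_def by (rule min.cobounded2)
  qed
  have "c * r ^ k \<le> (C * r) * r ^ k" using low[OF r(1,2)] Cd(2)[OF r(1,3)] by (simp add: mult_ac)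
  then have "c \<le> C * r" using r(1) by simp
  also have "\<dots> \<le> (\<bar>C\<bar> + 1) * r" using r(1) by (intro mult_right_mono) auto
  also have "\<dots> \<le> c / 2" using r(4) by (simp add: field_simps)
  finally show False using c by simp
qed

lemma smooth_on_cos: "smooth_on cos (UNIV :: real set)"
  and smooth_on_sin: "smooth_on sin (UNIV :: real set)"
proof -
  have "Ck_on k cos (UNIV :: real set) \<and> Ck_on k sin (UNIV :: real set)" for k
  proof (induction k)
    case 0
    show ?case by (simp add: continuous_on_cos continuous_on_sin)
  next
    case (Suc k)
    have "Ck_on (Suc k) cos (UNIV :: real set)"
    proof (rule Ck_on_SucI[of _ _ "\<lambda>x v. v * - sin x"])
      show "Ck_on k (\<lambda>x. v * - sin x) UNIV" for v :: real
        by (rule Ck_on_bounded_linear[of _ "\<lambda>y. v * - y"])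
          (use Suc bounded_linear_minus[OF bounded_linear_mult_right[of v]] in auto)
    qed (auto intro!: derivative_eq_intros)
    moreover have "Ck_on (Suc k) sin (UNIV :: real set)"
    proof (rule Ck_on_SucI[of _ _ "\<lambda>x v. v * cos x"])
      show "Ck_on k (\<lambda>x. v * cos x) UNIV" for v :: real
        by (rule Ck_on_bounded_linear[of _ "\<lambda>y. v * y"]) (use Suc bounded_linear_mult_right[of v] in auto)
    qed (auto intro!: derivative_eq_intros)
    ultimately show ?case ..
  qed
  then show "smooth_on cos (UNIV :: real set)" "smooth_on sin (UNIV :: real set)"
    by (simp_all add: smooth_on_def)
qed

lemma has_derivative_real_DERIV:
  fixes f :: "real \<Rightarrow> real"
  assumes "(f has_derivative f') (at x)"
  shows "DERIV f x :> f' 1"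
proof -
  have "f' = (*) (f' 1)"
  proof
    fix v :: real
    show "f' v = f' 1 * v"
      using linear_scale[OF has_derivative_linear[OF assms], of v 1] by simp
  qed
  with assms show ?thesis unfolding has_field_derivative_def by simp
qed

text \<open>The angle is measured in full turns, so that mean values over circles are integrals over
  \<open>{0..1}\<close>.\<close>

definition polar :: "real \<times> real \<Rightarrow> complex" where
  "polar p = (fst p * cos (2 * pi * snd p)) *\<^sub>R 1 + (fst p * sin (2 * pi * snd p)) *\<^sub>R \<i>"

lemma smooth_on_polar: "open S \<Longrightarrow> smooth_on polar S"
proof -
  have f: "smooth_on fst (UNIV :: (real \<times> real) set)"
    using smooth_on_bounded_linear[OF open_UNIV bounded_linear_fst smooth_on_ident[OF open_UNIV]] .
  have s: "smooth_on (\<lambda>p. 2 * pi * snd p) (UNIV :: (real \<times> real) set)"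
    using smooth_on_mult[OF open_UNIV smooth_on_const[OF open_UNIV]
        smooth_on_bounded_linear[OF open_UNIV bounded_linear_snd smooth_on_ident[OF open_UNIV]]] .
  have "smooth_on polar UNIV"
    unfolding polar_def[abs_def]
    by (intro smooth_on_add smooth_on_scaleR smooth_on_mult smooth_on_const f
        smooth_on_compose[OF open_UNIV open_UNIV smooth_on_cos s]
        smooth_on_compose[OF open_UNIV open_UNIV smooth_on_sin s]) auto
  then show "smooth_on polar S" by (rule smooth_on_subset) simp
qed

lemma dir_deriv_polar:
  "dir_deriv polar p (a, b) = a *\<^sub>R (cos (2 * pi * snd p) *\<^sub>R 1 + sin (2 * pi * snd p) *\<^sub>R \<i>)
     + (2 * pi * b * fst p) *\<^sub>R (- sin (2 * pi * snd p) *\<^sub>R 1 + cos (2 * pi * snd p) *\<^sub>R \<i>)"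
proof (rule dir_deriv_eq[THEN trans])
  show "(polar has_derivative (\<lambda>(a, b). a *\<^sub>R (cos (2 * pi * snd p) *\<^sub>R 1 + sin (2 * pi * snd p) *\<^sub>R \<i>)
     + (2 * pi * b * fst p) *\<^sub>R (- sin (2 * pi * snd p) *\<^sub>R 1 + cos (2 * pi * snd p) *\<^sub>R \<i>))) (at p)"
    unfolding polar_def[abs_def]
    by (auto intro!: derivative_eq_intros simp: algebra_simps)
qed auto

lemma norm_polar: "norm (polar p) = \<bar>fst p\<bar>"
proof -
  have "polar p = of_real (fst p) * cis (2 * pi * snd p)"
    by (simp add: polar_def complex_eq_iff)
  then show ?thesis by (simp add: norm_mult)
qed

lemma polar_surj:
  assumes "z \<noteq> 0"
  obtains s where "s \<in> {0..1}" "polar (norm z, s) = z"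
proof -
  obtain t where t: "0 \<le> t" "t < 2 * pi" "z = rcis (norm z) t"
    using Arg2pi[of z] by (auto simp: rcis_def cis_conv_exp is_Arg_def)
  have "polar (norm z, t / (2 * pi)) = z"
    using t(3) by (simp add: polar_def complex_eq_iff rcis_def)
  moreover have "t / (2 * pi) \<in> {0..1}" using t(1,2) by auto
  ultimately show thesis using that by blast
qed

text \<open>An inner product for which \<open>I\<close> is an isometry and hence skew; it makes the
  angular operator in the next proof symmetric.\<close>

locale hermitian_form =
  fixes I :: "'e::euclidean_space \<Rightarrow> 'e" and B :: "'e \<Rightarrow> 'e \<Rightarrow> real"
  assumes I: "linear I" "\<And>x. I (I x) = - x"
    and B: "bilinear B" "\<And>x y. B x y = B y x" "\<And>x y. B (I x) (I y) = B x y"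
      "\<And>x. x \<noteq> 0 \<Longrightarrow> 0 < B x x"
begin

lemma B_simps:
  "B (x + y) z = B x z + B y z" "B z (x + y) = B z x + B z y"
  "B (x - y) z = B x z - B y z" "B z (x - y) = B z x - B z y"
  "B (c *\<^sub>R x) z = c * B x z" "B z (c *\<^sub>R x) = c * B z x"
  "B (- x) z = - B x z" "B z (- x) = - B z x" "B 0 z = 0" "B z 0 = 0"
  using B(1) by (simp_all add: bilinear_ladd bilinear_radd bilinear_lsub bilinear_rsub bilinear_lmul
      bilinear_rmul bilinear_lneg bilinear_rneg bilinear_lzero bilinear_rzero)

lemma I_simps: "I (x + y) = I x + I y" "I (x - y) = I x - I y" "I (c *\<^sub>R x) = c *\<^sub>R I x"
  "I (- x) = - I x" "I 0 = 0"
  using I(1) by (simp_all add: linear_add linear_diff linear_scale linear_neg linear_0)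

lemma B_I_left: "B (I x) y = - B x (I y)"
  using B(3)[of x "I y"] by (simp add: I(2) B_simps)

lemma B_I_self: "B x (I x) = 0"
  using B_I_left[of x x] B(2)[of "I x" x] by simp

lemma B_nonneg: "0 \<le> B x x"
  using B(4)[of x] B_simps(9)[of x] by (cases "x = 0") auto

lemma bounded_bilinear_B: "bounded_bilinear B"
  using B(1) bilinear_conv_bounded_bilinear by blast

lemma bounded_linear_I: "bounded_linear I"
  using I(1) linear_conv_bounded_linear by blast

text \<open>In polar coordinates the radial derivative satisfies \<open>r X = Af + E\<close>. Here
  \<open>Af\<close>, the angular derivative multiplied by \<open>- I / (2 pi)\<close>, is symmetric
  for circle means, and \<open>E\<close> is \<open>r\<close> times a rotated \<open>W\<close>, hence
  small compared with the unknowns. Symmetry makes the frequency \<open>M / N\<close> almost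
  monotone, so that \<open>decaying_quotient_zero\<close> applies.\<close>

lemma cr_unique_continuation:
  fixes F :: "'j \<Rightarrow> complex \<Rightarrow> 'e"
  defines "W \<equiv> \<lambda>j z. dir_deriv (F j) z 1 + I (dir_deriv (F j) z \<i>)"
  assumes J: "finite J" and F: "\<And>j. j \<in> J \<Longrightarrow> smooth_on (F j) (ball 0 R)"
    and cr: "\<And>z. norm z < R \<Longrightarrow> (\<Sum>j\<in>J. B (W j z) (W j z)) \<le> K * (\<Sum>j\<in>J. B (F j z) (F j z))"
    and K: "0 \<le> K"
    and flat: "\<And>n. \<exists>C d. 0 < d \<and> (\<forall>z. norm z < d \<longrightarrow> (\<Sum>j\<in>J. B (F j z) (F j z)) \<le> C * norm z ^ n)"
    and z: "norm z < R" and j: "j \<in> J"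
  shows "F j z = 0"
proof -
  define \<phi> where "\<phi> j p = F j (polar p)" for j p
  define \<Omega> where "\<Omega> = {0<..<R} \<times> (UNIV :: real set)"
  have \<Omega>: "open \<Omega>" unfolding \<Omega>_def by (intro open_Times open_greaterThanLessThan open_UNIV)
  have pol: "polar p \<in> ball 0 R" if "p \<in> \<Omega>" for p
    using that norm_polar[of p] by (auto simp: \<Omega>_def)
  have \<phi>: "smooth_on (\<phi> j) \<Omega>" if "j \<in> J" for j
    unfolding \<phi>_def using pol
    by (intro smooth_on_compose[OF \<Omega> open_ball F[OF that] smooth_on_polar[OF \<Omega>]]) auto
  define X where "X j p = dir_deriv (\<phi> j) p (1, 0)" for j p
  define Y where "Y j p = dir_deriv (\<phi> j) p (0, 1)" for j p
  have X: "smooth_on (X j) \<Omega>" and Y: "smooth_on (Y j) \<Omega>" if "j \<in> J" for j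
    unfolding X_def Y_def by (intro smooth_on_dir_deriv \<phi> that)+
  define Af where "Af j p = (- 1 / (2 * pi)) *\<^sub>R I (Y j p)" for j p
  have Af: "smooth_on (Af j) \<Omega>" if "j \<in> J" for j
    unfolding Af_def
    by (intro smooth_on_scaleR smooth_on_const \<Omega> smooth_on_bounded_linear[OF \<Omega> bounded_linear_I Y[OF that]])
  define E where "E j p = fst p *\<^sub>R X j p - Af j p" for j p
  have E: "smooth_on (E j) \<Omega>" if "j \<in> J" for j
    unfolding E_def
    by (intro smooth_on_diff smooth_on_scaleR \<Omega> X Af that
        smooth_on_bounded_linear[OF \<Omega> bounded_linear_fst smooth_on_ident[OF \<Omega>]])
  \<comment> \<open>At angle \<theta> this is \<open>r exp(- I \<theta>) W\<close>; as
    \<open>I\<close> is an isometry, its length is \<open>r\<close> times that of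
    \<open>W\<close>.\<close>
  have E_eq: "E j p = fst p *\<^sub>R (cos (2 * pi * snd p) *\<^sub>R W j (polar p) - sin (2 * pi * snd p) *\<^sub>R I (W j (polar p)))"
    if "p \<in> \<Omega>" "j \<in> J" for j p
  proof -
    note lin = smooth_on_linear_dir_deriv[OF open_ball F[OF that(2)] pol[OF that(1)]]
    have "dir_deriv (\<phi> j) p v = dir_deriv (F j) (polar p) (dir_deriv polar p v)" for v
      unfolding \<phi>_def
      by (rule dir_deriv_compose[OF \<Omega> that(1) smooth_on_polar[OF \<Omega>] open_ball pol[OF that(1)] F[OF that(2)]])
    then show ?thesis
      unfolding E_def Af_def X_def Y_def W_def
      by (simp add: dir_deriv_polar linear_add[OF lin] linear_scale[OF lin] linear_neg[OF lin] linear_diff[OF lin]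
          I_simps I algebra_simps)
  qed
  have smB: "smooth_on (\<lambda>p. \<Sum>j\<in>J. B (f j p) (g j p)) \<Omega>"
    if "\<And>j. j \<in> J \<Longrightarrow> smooth_on (f j) \<Omega>" "\<And>j. j \<in> J \<Longrightarrow> smooth_on (g j) \<Omega>" for f g
    using that by (intro smooth_on_sum \<Omega> J smooth_on_bilinear[OF \<Omega> bounded_bilinear_B])
  define S :: "('j \<Rightarrow> real \<times> real \<Rightarrow> 'e) \<Rightarrow> ('j \<Rightarrow> real \<times> real \<Rightarrow> 'e) \<Rightarrow> real \<Rightarrow> real"
    where "S f g r = integral {0..1} (\<lambda>s. \<Sum>j\<in>J. B (f j (r, s)) (g j (r, s)))" for f g r
  have intB: "(\<lambda>s. \<Sum>j\<in>J. B (f j (r, s)) (g j (r, s))) integrable_on {0..1}"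
    if "\<And>j. j \<in> J \<Longrightarrow> smooth_on (f j) \<Omega>" "\<And>j. j \<in> J \<Longrightarrow> smooth_on (g j) \<Omega>" "0 < r" "r < R" for f g r
  proof (rule integrable_continuous_real)
    have "continuous_on {0..1} (\<lambda>s::real. (r, s))" by (intro continuous_intros)
    moreover have "(\<lambda>s. (r, s)) ` {0..1} \<subseteq> \<Omega>" using that by (auto simp: \<Omega>_def)
    ultimately show "continuous_on {0..1} (\<lambda>s. \<Sum>j\<in>J. B (f j (r, s)) (g j (r, s)))"
      using continuous_on_compose2[OF smooth_on_continuous[OF smB[OF that(1,2)]]] by fastforce
  qed
  have dirB: "dir_deriv (\<lambda>p. \<Sum>j\<in>J. B (f j p) (g j p)) p v
      = (\<Sum>j\<in>J. B (f j p) (dir_deriv (g j) p v) + B (dir_deriv (f j) p v) (g j p))"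
    if "\<And>j. j \<in> J \<Longrightarrow> smooth_on (f j) \<Omega>" "\<And>j. j \<in> J \<Longrightarrow> smooth_on (g j) \<Omega>" "p \<in> \<Omega>" for f g p v
  proof -
    have "((\<lambda>p. B (f j p) (g j p)) has_derivative
        (\<lambda>v. B (f j p) (dir_deriv (g j) p v) + B (dir_deriv (f j) p v) (g j p))) (at p)" if "j \<in> J" for j
      by (rule bounded_bilinear.FDERIV[OF bounded_bilinear_B
            smooth_on_has_derivative[OF \<Omega> \<open>\<And>j. j \<in> J \<Longrightarrow> smooth_on (f j) \<Omega>\<close>[OF that] \<open>p \<in> \<Omega>\<close>]
            smooth_on_has_derivative[OF \<Omega> \<open>\<And>j. j \<in> J \<Longrightarrow> smooth_on (g j) \<Omega>\<close>[OF that] \<open>p \<in> \<Omega>\<close>]])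
    from dir_deriv_eq[OF has_derivative_sum[OF this]] show ?thesis .
  qed
  have DS: "DERIV (S f g) r :> integral {0..1} (\<lambda>s. \<Sum>j\<in>J. B (f j (r, s)) (dir_deriv (g j) (r, s) (1, 0))
      + B (dir_deriv (f j) (r, s) (1, 0)) (g j (r, s)))"
    if f: "\<And>j. j \<in> J \<Longrightarrow> smooth_on (f j) \<Omega>" and g: "\<And>j. j \<in> J \<Longrightarrow> smooth_on (g j) \<Omega>"
      and r: "0 < r" "r < R" for f g r
  proof -
    have "smooth_on (\<lambda>p. \<Sum>j\<in>J. B (f j (fst p, snd p)) (g j (fst p, snd p))) ({0<..<R} \<times> UNIV)"
      using smB[OF f g] by (simp add: \<Omega>_def)
    from has_derivative_real_DERIV[OF integral_has_derivative_param[OF open_greaterThanLessThan _ open_UNIV _ this, of r]] r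
    have "DERIV (S f g) r :> integral {0..1} (\<lambda>s. dir_deriv (\<lambda>p. \<Sum>j\<in>J. B (f j p) (g j p)) (r, s) (1, 0))"
      unfolding S_def[abs_def] by simp
    moreover have "(r, s) \<in> \<Omega>" for s using r by (simp add: \<Omega>_def)
    ultimately show ?thesis by (simp add: dirB[OF f g])
  qed
  define N where "N = S \<phi> \<phi>"
  define M where "M = S Af \<phi>"
  have DN: "DERIV N r :> 2 * S X \<phi> r" if r: "0 < r" "r < R" for r
  proof -
    have "integral {0..1} (\<lambda>s. \<Sum>j\<in>J. B (\<phi> j (r, s)) (X j (r, s)) + B (X j (r, s)) (\<phi> j (r, s)))
        = 2 * S X \<phi> r"
      unfolding S_def by (simp add: B(2)[of "\<phi> _ _"] sum.distrib mult_2[symmetric] sum_distrib_left[symmetric])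
    with DS[of \<phi> \<phi> r, folded X_def] \<phi> r show ?thesis by (simp add: N_def)
  qed
  \<comment> \<open>Integration by parts over the circle, whose boundary terms cancel by
    periodicity: this is the symmetry of the angular operator.\<close>
  have parts: "integral {0..1} (\<lambda>s. \<Sum>j\<in>J. B (I (dir_deriv (X j) (r, s) (0, 1))) (\<phi> j (r, s)) + B (I (X j (r, s))) (Y j (r, s))) = 0"
    if r: "0 < r" "r < R" for r
  proof -
    have r\<Omega>: "(r, s) \<in> \<Omega>" for s using r by (simp add: \<Omega>_def)
    have smIX: "smooth_on (\<lambda>p. I (X j p)) \<Omega>" if "j \<in> J" for j
      by (rule smooth_on_bounded_linear[OF \<Omega> bounded_linear_I X[OF that]])
    define G where "G p = (\<Sum>j\<in>J. B (I (X j p)) (\<phi> j p))" for p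
    have G: "smooth_on G \<Omega>" unfolding G_def using smIX \<phi> by (rule smB)
    have GD: "dir_deriv G (r, s) (0, 1)
       = (\<Sum>j\<in>J. B (I (dir_deriv (X j) (r, s) (0, 1))) (\<phi> j (r, s)) + B (I (X j (r, s))) (Y j (r, s)))" for s
    proof -
      have "dir_deriv G (r, s) (0, 1) = (\<Sum>j\<in>J. B (I (X j (r, s))) (dir_deriv (\<phi> j) (r, s) (0, 1))
          + B (dir_deriv (\<lambda>p. I (X j p)) (r, s) (0, 1)) (\<phi> j (r, s)))"
        unfolding G_def by (rule dirB[where f = "\<lambda>j p. I (X j p)", OF smIX \<phi> r\<Omega>])
      then show ?thesis
        by (simp add: Y_def dir_deriv_bounded_linear[OF \<Omega> r\<Omega> X bounded_linear_I] add.commute)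
    qed
    have "((\<lambda>s. G (r, s)) has_vector_derivative dir_deriv G (r, s) (0, 1)) (at s within {0..1})" for s
      using smooth_on_line_deriv[OF \<Omega> G, of "(r, 0)" s "(0, 1)"] r\<Omega>
      by (simp add: has_vector_derivative_at_within)
    from fundamental_theorem_of_calculus[OF zero_le_one this]
    have "integral {0..1} (\<lambda>s. dir_deriv G (r, s) (0, 1)) = G (r, 1) - G (r, 0)"
      by (intro integral_unique) simp
    also have "G (r, 1) = G (r, 0)"
    proof -
      have "X j (r, 1) = X j (r, 0)" "\<phi> j (r, 1) = \<phi> j (r, 0)" if "j \<in> J" for j
      proof -
        have "dir_deriv (\<phi> j) (r, s) v = dir_deriv (F j) (polar (r, s)) (dir_deriv polar (r, s) v)" for v s
          unfolding \<phi>_def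
          by (rule dir_deriv_compose[OF \<Omega> r\<Omega> smooth_on_polar[OF \<Omega>] open_ball pol[OF r\<Omega>] F[OF that]])
        then show "X j (r, 1) = X j (r, 0)" by (simp add: X_def dir_deriv_polar, simp add: polar_def)
        show "\<phi> j (r, 1) = \<phi> j (r, 0)" by (simp add: \<phi>_def polar_def)
      qed
      then show ?thesis unfolding G_def by (intro sum.cong) auto
    qed
    finally show ?thesis by (simp add: GD)
  qed
  \<comment> \<open>Exchanging the mixed derivatives turns the radial derivative of
    \<open>Af\<close> into an angular derivative of \<open>X\<close>. The two terms of the product
    rule then agree up to a total angular derivative, whose mean is zero.\<close>
  have DM: "DERIV M r :> 2 * S Af X r" if r: "0 < r" "r < R" for r
  proof -
    have r\<Omega>: "(r, s) \<in> \<Omega>" for s using r by (simp add: \<Omega>_def)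
    have DAf: "dir_deriv (Af j) (r, s) (1, 0) = (- 1 / (2 * pi)) *\<^sub>R I (dir_deriv (X j) (r, s) (0, 1))" if "j \<in> J" for j s
    proof -
      have "dir_deriv (Y j) (r, s) (1, 0) = dir_deriv (X j) (r, s) (0, 1)"
        unfolding X_def Y_def by (rule dir_deriv_commute[OF \<Omega> r\<Omega> \<phi>[OF that]])
      moreover have bl: "bounded_linear (\<lambda>x. (- 1 / (2 * pi)) *\<^sub>R I x)"
        by (rule bounded_linear_compose[OF bounded_linear_scaleR_right bounded_linear_I])
      ultimately show ?thesis
        unfolding Af_def using dir_deriv_bounded_linear[OF \<Omega> r\<Omega> Y[OF that] bl] by simp
    qed
    have "integral {0..1} (\<lambda>s. \<Sum>j\<in>J. B (Af j (r, s)) (X j (r, s)) + B (dir_deriv (Af j) (r, s) (1, 0)) (\<phi> j (r, s)))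
      = integral {0..1} (\<lambda>s. 2 * (\<Sum>j\<in>J. B (Af j (r, s)) (X j (r, s)))
         - 1 / (2 * pi) * (\<Sum>j\<in>J. B (I (dir_deriv (X j) (r, s) (0, 1))) (\<phi> j (r, s)) + B (I (X j (r, s))) (Y j (r, s))))"
    proof (rule integral_cong)
      fix s :: real
      have "B (Af j (r, s)) (X j (r, s)) + B (dir_deriv (Af j) (r, s) (1, 0)) (\<phi> j (r, s))
        = 2 * B (Af j (r, s)) (X j (r, s))
         - 1 / (2 * pi) * (B (I (dir_deriv (X j) (r, s) (0, 1))) (\<phi> j (r, s)) + B (I (X j (r, s))) (Y j (r, s)))"
        if "j \<in> J" for j
      proof -
        have "B (Af j (r, s)) (X j (r, s)) = 1 / (2 * pi) * B (I (X j (r, s))) (Y j (r, s))"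
          using B_I_left[of "Y j (r, s)" "X j (r, s)"] B(2)[of "Y j (r, s)" "I (X j (r, s))"]
          by (simp add: Af_def B_simps)
        then show ?thesis by (simp add: DAf[OF that] B_simps distrib_left)
      qed
      then show "(\<Sum>j\<in>J. B (Af j (r, s)) (X j (r, s)) + B (dir_deriv (Af j) (r, s) (1, 0)) (\<phi> j (r, s)))
        = 2 * (\<Sum>j\<in>J. B (Af j (r, s)) (X j (r, s)))
         - 1 / (2 * pi) * (\<Sum>j\<in>J. B (I (dir_deriv (X j) (r, s) (0, 1))) (\<phi> j (r, s)) + B (I (X j (r, s))) (Y j (r, s)))"
        by (simp add: sum_distrib_left sum_subtractf)
    qed
    also have "\<dots> = 2 * S Af X r"
    proof -
      have smIX: "smooth_on (\<lambda>p. I (X j p)) \<Omega>" if "j \<in> J" for j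
        by (rule smooth_on_bounded_linear[OF \<Omega> bounded_linear_I X[OF that]])
      have smDX: "smooth_on (\<lambda>p. I (dir_deriv (X j) p (0, 1))) \<Omega>" if "j \<in> J" for j
        by (rule smooth_on_bounded_linear[OF \<Omega> bounded_linear_I smooth_on_dir_deriv[OF X[OF that]]])
      have "(\<lambda>s. \<Sum>j\<in>J. B (I (dir_deriv (X j) (r, s) (0, 1))) (\<phi> j (r, s)) + B (I (X j (r, s))) (Y j (r, s))) integrable_on {0..1}"
        unfolding sum.distrib
        by (intro integrable_add intB[OF smDX \<phi> r] intB[OF smIX Y r])
      with intB[OF Af X r] show ?thesis
        by (subst integral_diff)
          (simp_all add: parts[OF r] S_def integrable_on_cmult_left[where c = 2, simplified]
             integrable_on_cmult_left[where c = "1 / (2 * pi)", simplified])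
    qed
    finally show ?thesis
      using DS[of Af \<phi> r, folded X_def, OF Af \<phi> r] by (simp add: M_def)
  qed
  have r\<Omega>: "(r, s) \<in> \<Omega>" if "0 < r" "r < R" for r s using that by (simp add: \<Omega>_def)
  have S_sym: "S f g r = S g f r" for f g r unfolding S_def by (subst B(2)) (rule refl)
  have S_add: "S f (\<lambda>j p. g j p + h j p) r = S f g r + S f h r"
    if "\<And>j. j \<in> J \<Longrightarrow> smooth_on (f j) \<Omega>" "\<And>j. j \<in> J \<Longrightarrow> smooth_on (g j) \<Omega>"
      "\<And>j. j \<in> J \<Longrightarrow> smooth_on (h j) \<Omega>" "0 < r" "r < R" for f g h r
    unfolding S_def by (simp add: B_simps sum.distrib integral_add intB that)
  have S_scale: "S f (\<lambda>j p. c *\<^sub>R g j p) r = c * S f g r" for f g r c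
    unfolding S_def by (simp add: B_simps sum_distrib_left[symmetric])
  have S_nonneg: "0 \<le> S f f r" if "\<And>j. j \<in> J \<Longrightarrow> smooth_on (f j) \<Omega>" "0 < r" "r < R" for f r
    unfolding S_def by (rule integral_nonneg[OF intB[OF that(1,1,2,3)]]) (auto intro!: sum_nonneg B_nonneg)
  \<comment> \<open>Expansions of the nonnegative means of |Af + b \<phi> + c E|^2 and |E -
    \<phi>|^2.\<close>
  have S_quad: "0 \<le> S Af Af r + b\<^sup>2 * N r + c\<^sup>2 * S E E r + 2 * b * M r + 2 * c * S Af E r + 2 * b * c * S E \<phi> r"
    and S_quad2: "0 \<le> S E E r - 2 * S E \<phi> r + N r"
    if r: "0 < r" "r < R" for r b c
  proof -
    define g where "g j p = b *\<^sub>R \<phi> j p + c *\<^sub>R E j p" for j p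
    have g: "smooth_on (g j) \<Omega>" and bs: "smooth_on (\<lambda>p. b *\<^sub>R \<phi> j p) \<Omega>" "smooth_on (\<lambda>p. c *\<^sub>R E j p) \<Omega>"
      "smooth_on (\<lambda>p. - 1 *\<^sub>R \<phi> j p) \<Omega>" if "j \<in> J" for j
      unfolding g_def by (intro smooth_on_add smooth_on_scaleR smooth_on_const \<Omega> \<phi> E that)+
    have Sg: "S f g r = b * S f \<phi> r + c * S f E r" if "\<And>j. j \<in> J \<Longrightarrow> smooth_on (f j) \<Omega>" for f
      unfolding g_def[abs_def] by (simp add: S_add that bs r S_scale)
    have sm: "smooth_on (\<lambda>p. Af j p + g j p) \<Omega>" if "j \<in> J" for j
      by (intro smooth_on_add \<Omega> Af g that)
    have nn: "0 \<le> S (\<lambda>j p. Af j p + g j p) (\<lambda>j p. Af j p + g j p) r" by (rule S_nonneg[OF sm r])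
    have "S (\<lambda>j p. Af j p + g j p) (\<lambda>j p. Af j p + g j p) r
      = S (\<lambda>j p. Af j p + g j p) Af r + S (\<lambda>j p. Af j p + g j p) g r"
      by (rule S_add[OF sm Af g r])
    also have "S (\<lambda>j p. Af j p + g j p) Af r = S Af Af r + S Af g r"
      by (subst S_sym) (rule S_add[OF Af Af g r])
    also have "S (\<lambda>j p. Af j p + g j p) g r = S g Af r + S g g r"
      by (subst S_sym) (rule S_add[OF g Af g r])
    also have "S g Af r = S Af g r" by (rule S_sym)
    also have "S g g r = b * S g \<phi> r + c * S g E r" by (rule Sg[of g, OF g])
    also have "S g \<phi> r = S \<phi> g r" by (rule S_sym)
    also have "S g E r = S E g r" by (rule S_sym)
    also have "S \<phi> g r = b * N r + c * S E \<phi> r" using Sg[of \<phi>, OF \<phi>] S_sym[of \<phi> E r] by (simp add: N_def)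
    also have "S E g r = b * S E \<phi> r + c * S E E r" by (rule Sg[of E, OF E])
    also have "S Af g r = b * M r + c * S Af E r" using Sg[of Af, OF Af] by (simp add: M_def)
    finally show "0 \<le> S Af Af r + b\<^sup>2 * N r + c\<^sup>2 * S E E r + 2 * b * M r + 2 * c * S Af E r + 2 * b * c * S E \<phi> r"
      using nn by (simp add: algebra_simps power2_eq_square)
    have sm2: "smooth_on (\<lambda>p. E j p + (- 1) *\<^sub>R \<phi> j p) \<Omega>" if "j \<in> J" for j
      by (intro smooth_on_add \<Omega> E bs that)
    have nn2: "0 \<le> S (\<lambda>j p. E j p + (- 1) *\<^sub>R \<phi> j p) (\<lambda>j p. E j p + (- 1) *\<^sub>R \<phi> j p) r"
      by (rule S_nonneg[OF sm2 r])
    have "S (\<lambda>j p. E j p + (- 1) *\<^sub>R \<phi> j p) (\<lambda>j p. E j p + (- 1) *\<^sub>R \<phi> j p) r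
      = S (\<lambda>j p. E j p + (- 1) *\<^sub>R \<phi> j p) E r - S (\<lambda>j p. E j p + (- 1) *\<^sub>R \<phi> j p) \<phi> r"
      by (subst S_add[of "\<lambda>j p. E j p + (- 1) *\<^sub>R \<phi> j p" E "\<lambda>j p. (- 1) *\<^sub>R \<phi> j p", OF sm2 E bs(3) r]) (simp_all only: S_scale)
    also have "S (\<lambda>j p. E j p + (- 1) *\<^sub>R \<phi> j p) E r = S E E r - S E \<phi> r"
      using S_add[of E E "\<lambda>j p. (- 1) *\<^sub>R \<phi> j p", OF E E bs(3) r] unfolding S_scale
      by (subst S_sym) linarith
    also have "S (\<lambda>j p. E j p + (- 1) *\<^sub>R \<phi> j p) \<phi> r = S E \<phi> r - N r"
      using S_add[of \<phi> E "\<lambda>j p. (- 1) *\<^sub>R \<phi> j p", OF \<phi> E bs(3) r] S_sym[of \<phi> E r] unfolding S_scale N_def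
      by (subst S_sym) linarith
    finally show "0 \<le> S E E r - 2 * S E \<phi> r + N r" using nn2 by linarith
  qed
  have SX: "r * S f X r = S f Af r + S f E r"
    if "\<And>j. j \<in> J \<Longrightarrow> smooth_on (f j) \<Omega>" "0 < r" "r < R" for f r
  proof -
    have "r * S f X r = S f (\<lambda>j p. Af j p + E j p) r"
      unfolding S_def E_def
      by (simp add: B_simps sum_distrib_left[symmetric])
    then show ?thesis by (simp add: S_add that Af E)
  qed
  have SE: "S E E r \<le> K * r\<^sup>2 * N r" if r: "0 < r" "r < R" for r
  proof -
    have "S E E r \<le> integral {0..1} (\<lambda>s. K * r\<^sup>2 * (\<Sum>j\<in>J. B (\<phi> j (r, s)) (\<phi> j (r, s))))"
      unfolding S_def
    proof (rule integral_le[OF intB[OF E E r]])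
      show "(\<lambda>s. K * r\<^sup>2 * (\<Sum>j\<in>J. B (\<phi> j (r, s)) (\<phi> j (r, s)))) integrable_on {0..1}"
        by (rule integrable_on_mult_right[OF intB[of \<phi> \<phi> r, OF \<phi> \<phi> r]])
      fix s :: real
      have "B (E j (r, s)) (E j (r, s)) = r\<^sup>2 * B (W j (polar (r, s))) (W j (polar (r, s)))" if "j \<in> J" for j
      proof -
        have "B (r *\<^sub>R (c *\<^sub>R w - d *\<^sub>R I w)) (r *\<^sub>R (c *\<^sub>R w - d *\<^sub>R I w)) = r\<^sup>2 * (c\<^sup>2 + d\<^sup>2) * B w w" for c d w
          by (simp add: B_simps B_I_self B_I_left B(3) I power2_eq_square algebra_simps)
        from this[of "cos (2 * pi * s)" "W j (polar (r, s))" "sin (2 * pi * s)"]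
        show ?thesis unfolding E_eq[OF r\<Omega>[OF r] that] by simp
      qed
      then have "(\<Sum>j\<in>J. B (E j (r, s)) (E j (r, s))) = r\<^sup>2 * (\<Sum>j\<in>J. B (W j (polar (r, s))) (W j (polar (r, s))))"
        by (simp add: sum_distrib_left)
      also have "\<dots> \<le> r\<^sup>2 * (K * (\<Sum>j\<in>J. B (\<phi> j (r, s)) (\<phi> j (r, s))))"
        using cr[of "polar (r, s)"] r by (intro mult_left_mono) (auto simp: norm_polar \<phi>_def)
      finally show "(\<Sum>j\<in>J. B (E j (r, s)) (E j (r, s))) \<le> K * r\<^sup>2 * (\<Sum>j\<in>J. B (\<phi> j (r, s)) (\<phi> j (r, s)))"
        by (simp add: mult_ac)
    qed
    then show ?thesis by (simp add: N_def S_def)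
  qed
  have N0: "N r = 0" if r: "0 < r" "r < R" for r
  proof (rule decaying_quotient_zero[where N = N and M = M and R = R and K = K, OF DN DM])
    show "0 \<le> N r" if "0 < r" "r < R" for r unfolding N_def by (rule S_nonneg[OF \<phi> that])
    show "- (K * r / 2) * (N r)\<^sup>2 \<le> 2 * S Af X r * N r - M r * (2 * S X \<phi> r)"
      if r: "0 < r" "r < R" and pos: "0 < N r" for r
    proof -
      define q where "q = M r / N r"
      have q: "M r = q * N r" using pos by (simp add: q_def)
      have 1: "r * S Af X r = S Af Af r + S Af E r" by (rule SX[OF Af r])
      have 2: "r * S X \<phi> r = M r + S E \<phi> r"
        using SX[of \<phi> r, OF \<phi> r] S_sym[of \<phi> X r] S_sym[of \<phi> Af r] S_sym[of \<phi> E r] by (simp add: M_def)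
      \<comment> \<open>The square of \<open>Af - q \<phi> + E / 2\<close>. The weight 1/2 makes the
        mixed terms match those of \<open>r * S Af X r - q * (r * S X \<phi> r)\<close>.\<close>
      have quad: "0 \<le> S Af Af r + q\<^sup>2 * N r + S E E r / 4 - 2 * q * M r + S Af E r - q * S E \<phi> r"
        using S_quad[OF r, of "- q" "1 / 2"] by (simp add: power2_eq_square)
      then have "0 \<le> S Af Af r + S Af E r - q * (M r + S E \<phi> r) + K * r\<^sup>2 * N r / 4"
        using SE[OF r] by (simp add: q power2_eq_square algebra_simps)
      then have "0 \<le> r * S Af X r - q * (r * S X \<phi> r) + K * r\<^sup>2 * N r / 4"
        by (simp only: 1 2)
      then have "0 \<le> r * (S Af X r - q * S X \<phi> r + K * r * N r / 4)"
        by (simp add: algebra_simps power2_eq_square)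
      then have "0 \<le> S Af X r - q * S X \<phi> r + K * r * N r / 4"
        using r by (simp add: zero_le_mult_iff)
      then have "0 \<le> 2 * N r * (S Af X r - q * S X \<phi> r + K * r * N r / 4)"
        using pos by simp
      then show ?thesis by (simp add: q algebra_simps power2_eq_square)
    qed
    show "r * (2 * S X \<phi> r) \<le> 2 * M r + (K * r\<^sup>2 + 1) * N r" if r: "0 < r" "r < R" for r
    proof -
      have 2: "r * S X \<phi> r = M r + S E \<phi> r"
        using SX[of \<phi> r, OF \<phi> r] S_sym[of \<phi> X r] S_sym[of \<phi> Af r] S_sym[of \<phi> E r] by (simp add: M_def)
      have "r * (2 * S X \<phi> r) = 2 * (r * S X \<phi> r)" by simp
      also have "\<dots> = 2 * M r + 2 * S E \<phi> r" unfolding 2 by simp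
      also have "\<dots> \<le> 2 * M r + (K * r\<^sup>2 * N r + N r)" using S_quad2[OF r] SE[OF r] by linarith
      finally show ?thesis by (simp add: algebra_simps)
    qed
    show "\<exists>C d. 0 < d \<and> (\<forall>r. 0 < r \<and> r < d \<longrightarrow> N r \<le> C * r ^ n)" for n
    proof -
      obtain C d where Cd: "0 < d" "\<And>z. norm z < d \<Longrightarrow> (\<Sum>j\<in>J. B (F j z) (F j z)) \<le> C * norm z ^ n"
        using flat by metis
      have R: "0 < R" using r by simp
      have "N r \<le> C * r ^ n" if "0 < r" "r < min d R" for r
      proof -
        have "N r \<le> integral {0..1} (\<lambda>s::real. C * r ^ n)"
          unfolding N_def S_def
        proof (rule integral_le[OF intB[OF \<phi> \<phi>]])
          show "(\<Sum>j\<in>J. B (\<phi> j (r, s)) (\<phi> j (r, s))) \<le> C * r ^ n" for s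
            using Cd(2)[of "polar (r, s)"] that by (simp add: \<phi>_def norm_polar)
        qed (use that in auto)
        then show ?thesis by simp
      qed
      then show ?thesis using Cd(1) R by (intro exI[of _ C] exI[of _ "min d R"]) auto
    qed
  qed (use K r in auto)
  show ?thesis
  proof (cases "z = 0")
    case True
    obtain C d where Cd: "0 < d" "\<And>z. norm z < d \<Longrightarrow> (\<Sum>j\<in>J. B (F j z) (F j z)) \<le> C * norm z ^ 1"
      using flat by metis
    from Cd(2)[of 0] Cd(1) have "(\<Sum>j\<in>J. B (F j 0) (F j 0)) \<le> 0" by simp
    then have "(\<Sum>j\<in>J. B (F j 0) (F j 0)) = 0" by (intro antisym sum_nonneg B_nonneg)
    then have "B (F j 0) (F j 0) = 0" using J j B_nonneg by (simp add: sum_nonneg_eq_0_iff)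
    then show ?thesis using True B(4)[of "F j 0"] by force
  next
    case False
    then obtain s where s: "s \<in> {0..1}" "polar (norm z, s) = z" using polar_surj by blast
    have r: "0 < norm z" "norm z < R" using False z by auto
    have cont: "continuous_on {0..1} (\<lambda>s. \<Sum>j\<in>J. B (\<phi> j (norm z, s)) (\<phi> j (norm z, s)))"
    proof -
      have "continuous_on {0..1} (\<lambda>s::real. (norm z, s))" by (intro continuous_intros)
      moreover have "(\<lambda>s. (norm z, s)) ` {0..1} \<subseteq> \<Omega>" using r by (auto simp: \<Omega>_def)
      ultimately show ?thesis
        using continuous_on_compose2[OF smooth_on_continuous[OF smB[OF \<phi> \<phi>]]] by fastforce
    qed
    have "(\<Sum>j\<in>J. B (\<phi> j (norm z, s)) (\<phi> j (norm z, s))) = 0"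
    proof -
      have "integral {0..1} (\<lambda>s. \<Sum>j\<in>J. B (\<phi> j (norm z, s)) (\<phi> j (norm z, s))) = 0"
        using N0[OF r] by (simp add: N_def S_def)
      moreover have "0 \<le> (\<Sum>j\<in>J. B (\<phi> j (norm z, s)) (\<phi> j (norm z, s)))" for s
        by (intro sum_nonneg B_nonneg)
      ultimately show ?thesis
        using integral_eq_0_iff[OF cont zero_less_one] s(1) by blast
    qed
    then have "B (\<phi> j (norm z, s)) (\<phi> j (norm z, s)) = 0" using J j B_nonneg by (simp add: sum_nonneg_eq_0_iff)
    then have "\<phi> j (norm z, s) = 0" using B(4)[of "\<phi> j (norm z, s)"] by (metis less_irrefl)
    then show ?thesis using s(2) by (simp add: \<phi>_def)
  qed
qed

end

subsection \<open>Jets in one complex variable\<close>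

text \<open>Together with \<open>dlb\<close>, the Wirtinger operators d/dz and d/dzbar for maps into
  the complex vector space given by \<open>I\<close>.\<close>

definition dl :: "('e::real_normed_vector \<Rightarrow> 'e) \<Rightarrow> (complex \<Rightarrow> 'e) \<Rightarrow> complex \<Rightarrow> 'e" where
  "dl I F z = (1 / 2) *\<^sub>R (dir_deriv F z 1 - I (dir_deriv F z \<i>))"

definition dlb :: "('e::real_normed_vector \<Rightarrow> 'e) \<Rightarrow> (complex \<Rightarrow> 'e) \<Rightarrow> complex \<Rightarrow> 'e" where
  "dlb I F z = (1 / 2) *\<^sub>R (dir_deriv F z 1 + I (dir_deriv F z \<i>))"

text \<open>Concerns the pure derivatives (d/dz)^k with \<open>k < n\<close> at 0; derivatives
  involving zbar are unrestricted.\<close>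

primrec hjet :: "('e::real_normed_vector \<Rightarrow> 'e) \<Rightarrow> nat \<Rightarrow> (complex \<Rightarrow> 'e) \<Rightarrow> bool" where
  "hjet I 0 F \<longleftrightarrow> True"
| "hjet I (Suc n) F \<longleftrightarrow> F 0 = 0 \<and> hjet I n (dl I F)"

primrec vanishes :: "nat \<Rightarrow> (complex \<Rightarrow> 'e::real_normed_vector) \<Rightarrow> bool" where
  "vanishes 0 F \<longleftrightarrow> True"
| "vanishes (Suc n) F \<longleftrightarrow> F 0 = 0 \<and> (\<forall>v. vanishes n (\<lambda>z. dir_deriv F z v))"

lemma dl_cong_open:
  assumes "open U" "\<And>z. z \<in> U \<Longrightarrow> F z = G z" "z \<in> U"
  shows "dl I F z = dl I G z"
  by (simp add: dl_def dir_deriv_cong_open[OF assms(1,3,2)])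

lemma hjet_cong:
  assumes "open U" "0 \<in> U" "\<And>z. z \<in> U \<Longrightarrow> F z = G z" "hjet I n F"
  shows "hjet I n G"
  using assms(3,4)
proof (induction n arbitrary: F G)
  case (Suc n)
  have "hjet I n (dl I G)"
    by (rule Suc.IH[of "dl I F"]) (use Suc.prems dl_cong_open[OF assms(1) Suc.prems(1)] in auto)
  then show ?case using Suc.prems assms(2) by simp
qed simp

lemma vanishes_cong:
  assumes "open U" "0 \<in> U" "\<And>z. z \<in> U \<Longrightarrow> F z = G z" "vanishes n F"
  shows "vanishes n G"
  using assms(3,4)
proof (induction n arbitrary: F G)
  case (Suc n)
  have "vanishes n (\<lambda>z. dir_deriv G z v)" for v
    by (rule Suc.IH[of "\<lambda>z. dir_deriv F z v"])
      (use Suc.prems(2) dir_deriv_cong_open[OF assms(1) _ Suc.prems(1)] in auto)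
  then show ?case using Suc.prems assms(2) by simp
qed simp

lemma hjet_lower: "hjet I (Suc n) F \<Longrightarrow> hjet I n F"
  by (induction n arbitrary: F) auto

lemma vanishes_lower: "vanishes (Suc n) F \<Longrightarrow> vanishes n F"
  by (induction n arbitrary: F) auto

locale complex_structure =
  fixes I :: "'e::euclidean_space \<Rightarrow> 'e"
  assumes linear_I: "linear I" and I_I [simp]: "I (I x) = - x"
begin

lemma I_simps [simp]: "I (x + y) = I x + I y" "I (x - y) = I x - I y" "I (c *\<^sub>R x) = c *\<^sub>R I x"
  "I (- x) = - I x" "I 0 = 0"
  using linear_I by (simp_all add: linear_add linear_diff linear_scale linear_neg linear_0)

lemma bounded_linear_I: "bounded_linear I"
  using linear_I linear_conv_bounded_linear by blast

text \<open>Multiplication by complex scalars in the complex structure \<open>I\<close>.\<close>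

definition cs :: "complex \<Rightarrow> 'e \<Rightarrow> 'e" where
  "cs k x = Re k *\<^sub>R x + Im k *\<^sub>R I x"

lemma linear_cs: "linear (cs k)"
  unfolding cs_def by (rule linearI) (simp_all add: algebra_simps)

lemma bounded_bilinear_cs: "bounded_bilinear cs"
proof -
  have "bilinear cs"
    unfolding bilinear_def cs_def by (auto intro!: linearI simp: algebra_simps)
  then show ?thesis using bilinear_conv_bounded_bilinear by blast
qed

lemma cs_simps: "cs 1 x = x" "cs \<i> x = I x" "cs (of_real r) x = r *\<^sub>R x" "cs (k * l) x = cs k (cs l x)"
  "cs (k + l) x = cs k x + cs l x" "cs k (x + y) = cs k x + cs k y" "cs k (x - y) = cs k x - cs k y"
  "cs k (I x) = I (cs k x)" "cs k (r *\<^sub>R x) = r *\<^sub>R cs k x" "cs 0 x = 0" "cs k 0 = 0" "cs k (- x) = - cs k x"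
  by (simp_all add: cs_def algebra_simps)

context
  fixes U :: "complex set"
  assumes U: "open U"
begin

lemma smooth_on_I: "smooth_on F U \<Longrightarrow> smooth_on (\<lambda>z. I (F z)) U"
  by (rule smooth_on_bounded_linear[OF U bounded_linear_I])

lemma smooth_on_dl: "smooth_on F U \<Longrightarrow> smooth_on (dl I F) U"
  unfolding dl_def[abs_def]
  by (intro smooth_on_scaleR smooth_on_const smooth_on_diff smooth_on_I smooth_on_dir_deriv U)

lemma smooth_on_dlb: "smooth_on F U \<Longrightarrow> smooth_on (dlb I F) U"
  unfolding dlb_def[abs_def]
  by (intro smooth_on_scaleR smooth_on_const smooth_on_add smooth_on_I smooth_on_dir_deriv U)

lemma dir_deriv_dl_dlb:
  assumes "smooth_on F U" "z \<in> U"
  shows "dir_deriv F z v = cs v (dl I F z) + cs (cnj v) (dlb I F z)"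
proof -
  have lin: "linear (dir_deriv F z)" using smooth_on_linear_dir_deriv[OF U assms] .
  have "dir_deriv F z v = dir_deriv F z (Re v *\<^sub>R 1 + Im v *\<^sub>R \<i>)"
    by (rule arg_cong[of _ _ "dir_deriv F z"]) (simp add: complex_eq_iff)
  also have "\<dots> = Re v *\<^sub>R dir_deriv F z 1 + Im v *\<^sub>R dir_deriv F z \<i>"
    by (simp only: linear_add[OF lin] linear_scale[OF lin])
  finally show ?thesis
    by (simp add: dl_def dlb_def cs_def scaleR_add_right scaleR_diff_right, simp flip: scaleR_2 add: scaleR_add_right)
qed

lemma dl_add:
  assumes "smooth_on F U" "smooth_on G U" "z \<in> U"
  shows "dl I (\<lambda>z. F z + G z) z = dl I F z + dl I G z"
  by (simp add: dl_def dir_deriv_add[OF U assms(3,1,2)] scaleR_add_right[symmetric])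

lemma dl_diff:
  assumes "smooth_on F U" "smooth_on G U" "z \<in> U"
  shows "dl I (\<lambda>z. F z - G z) z = dl I F z - dl I G z"
  by (simp add: dl_def dir_deriv_diff[OF U assms(3,1,2)] algebra_simps)

lemma dlb_diff:
  assumes "smooth_on F U" "smooth_on G U" "z \<in> U"
  shows "dlb I (\<lambda>z. F z - G z) z = dlb I F z - dlb I G z"
  by (simp add: dlb_def dir_deriv_diff[OF U assms(3,1,2)] algebra_simps)

lemma dl_dlb_commute:
  assumes F: "smooth_on F U" and z: "z \<in> U"
  shows "dlb I (dl I F) z = dl I (dlb I F) z"
proof -
  have s: "smooth_on (\<lambda>z. dir_deriv F z v) U" "smooth_on (\<lambda>z. I (dir_deriv F z v)) U" for v
    by (intro smooth_on_I smooth_on_dir_deriv F)+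
  have "dir_deriv (dl I F) z v = (1 / 2) *\<^sub>R (dir_deriv (\<lambda>z. dir_deriv F z 1) z v - I (dir_deriv (\<lambda>z. dir_deriv F z \<i>) z v))"
    "dir_deriv (dlb I F) z v = (1 / 2) *\<^sub>R (dir_deriv (\<lambda>z. dir_deriv F z 1) z v + I (dir_deriv (\<lambda>z. dir_deriv F z \<i>) z v))" for v
    unfolding dl_def[abs_def] dlb_def[abs_def]
    by (simp_all add: dir_deriv_bounded_linear[OF U z _ bounded_linear_scaleR_right]
        dir_deriv_bounded_linear[OF U z _ bounded_linear_I] smooth_on_diff smooth_on_add U s
        dir_deriv_diff[OF U z] dir_deriv_add[OF U z])
  note D = this
  show ?thesis
    unfolding dl_def[of I "dlb I F"] dlb_def[of I "dl I F"]
    by (simp only: D) (simp add: dir_deriv_commute[OF U z F, of 1 \<i>] algebra_simps)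
qed

lemma dl_I:
  assumes "smooth_on F U" "z \<in> U"
  shows "dl I (\<lambda>z. I (F z)) z = I (dl I F z)"
  by (simp add: dl_def dir_deriv_bounded_linear[OF U assms(2,1) bounded_linear_I])

end

end

section \<open>Orders of vanishing and holomorphic jets under products\<close>

lemma vanishes_add:
  assumes U: "open U" "0 \<in> U" and "smooth_on F U" "smooth_on G U" "vanishes n F" "vanishes n G"
  shows "vanishes n (\<lambda>z. F z + G z)"
  using assms(3-)
proof (induction n arbitrary: F G)
  case (Suc n)
  have "vanishes n (\<lambda>z. dir_deriv (\<lambda>z. F z + G z) z v)" for v
  proof (rule vanishes_cong[OF U])
    show "vanishes n (\<lambda>z. dir_deriv F z v + dir_deriv G z v)"
      using Suc.prems by (intro Suc.IH smooth_on_dir_deriv) auto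
    show "dir_deriv F z v + dir_deriv G z v = dir_deriv (\<lambda>z. F z + G z) z v" if "z \<in> U" for z
      using dir_deriv_add[OF U(1) that Suc.prems(1,2)] by simp
  qed
  then show ?case using Suc.prems by simp
qed simp

lemma vanishes_const0: "vanishes n (\<lambda>z. 0)"
  by (induction n) auto

lemma vanishes_sum:
  assumes U: "open U" "0 \<in> U" and "finite T" "\<And>i. i \<in> T \<Longrightarrow> smooth_on (F i) U" "\<And>i. i \<in> T \<Longrightarrow> vanishes n (F i)"
  shows "vanishes n (\<lambda>z. \<Sum>i\<in>T. F i z)"
  using assms(3-)
proof (induction T rule: finite_induct)
  case (insert a T)
  have "vanishes n (\<lambda>z. F a z + (\<Sum>i\<in>T. F i z))"
    using insert by (intro vanishes_add[OF U] smooth_on_sum[OF U(1)]) auto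
  then show ?case using insert by simp
qed (simp add: vanishes_const0)

lemma vanishes_bilinear:
  assumes U: "open U" "0 \<in> U" and B: "bounded_bilinear B" and "smooth_on k U" "smooth_on F U" "vanishes n F"
  shows "vanishes n (\<lambda>z. B (k z) (F z))"
  using assms(4-)
proof (induction n arbitrary: F k)
  case (Suc n)
  have "vanishes n (\<lambda>z. dir_deriv (\<lambda>z. B (k z) (F z)) z v)" for v
  proof (rule vanishes_cong[OF U])
    have "vanishes n (\<lambda>z. B (k z) (dir_deriv F z v))"
      using Suc.prems by (intro Suc.IH smooth_on_dir_deriv) auto
    moreover have "vanishes n (\<lambda>z. B (dir_deriv k z v) (F z))"
      using Suc.prems(1,2) by (intro Suc.IH smooth_on_dir_deriv vanishes_lower[OF Suc.prems(3)])
    ultimately show "vanishes n (\<lambda>z. B (k z) (dir_deriv F z v) + B (dir_deriv k z v) (F z))"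
      by (intro vanishes_add[OF U] smooth_on_bilinear[OF U(1) B] smooth_on_dir_deriv Suc.prems(1,2))
    show "B (k z) (dir_deriv F z v) + B (dir_deriv k z v) (F z) = dir_deriv (\<lambda>z. B (k z) (F z)) z v" if "z \<in> U" for z
      using dir_deriv_eq[OF bounded_bilinear.FDERIV[OF B smooth_on_has_derivative[OF U(1) Suc.prems(1) that]
            smooth_on_has_derivative[OF U(1) Suc.prems(2) that]]] by simp
  qed
  then show ?case using Suc.prems by (simp add: bounded_bilinear.zero_right[OF B])
qed simp

lemma vanishes_bounded_linear:
  assumes U: "open U" "0 \<in> U" and L: "bounded_linear L" and "smooth_on F U" "vanishes n F"
  shows "vanishes n (\<lambda>z. L (F z))"
  using assms(4-)
proof (induction n arbitrary: F)
  case (Suc n)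
  have "vanishes n (\<lambda>z. dir_deriv (\<lambda>z. L (F z)) z v)" for v
  proof (rule vanishes_cong[OF U])
    show "vanishes n (\<lambda>z. L (dir_deriv F z v))"
      using Suc.prems by (intro Suc.IH smooth_on_dir_deriv) auto
    show "L (dir_deriv F z v) = dir_deriv (\<lambda>z. L (F z)) z v" if "z \<in> U" for z
      using dir_deriv_bounded_linear[OF U(1) that Suc.prems(1) L] by simp
  qed
  then show ?case using Suc.prems by (simp add: linear_0[OF bounded_linear.linear[OF L]])
qed simp

lemma vanishes_apply:
  fixes y :: "complex \<Rightarrow> 'b::euclidean_space"
  assumes U: "open U" "0 \<in> U" and M: "\<And>z. z \<in> U \<Longrightarrow> linear (M z)" "\<And>v. smooth_on (\<lambda>z. M z v) U"
    and y: "smooth_on y U" "vanishes n y"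
  shows "vanishes n (\<lambda>z. M z (y z))"
proof (rule vanishes_cong[OF U])
  have s: "smooth_on (\<lambda>z. y z \<bullet> b) U" for b
    by (rule smooth_on_bounded_linear[OF U(1) bounded_linear_inner_left y(1)])
  have "vanishes n (\<lambda>z. y z \<bullet> b)" for b
    by (rule vanishes_bounded_linear[OF U bounded_linear_inner_left y])
  from vanishes_bilinear[OF U bounded_bilinear.flip[OF bounded_bilinear_scaleR] M(2) s this]
  have "vanishes n (\<lambda>z. (y z \<bullet> b) *\<^sub>R M z b)" for b .
  then show "vanishes n (\<lambda>z. \<Sum>b\<in>Basis. (y z \<bullet> b) *\<^sub>R M z b)"
    by (intro vanishes_sum[OF U] smooth_on_scaleR U s M) auto
  show "(\<Sum>b\<in>Basis. (y z \<bullet> b) *\<^sub>R M z b) = M z (y z)" if "z \<in> U" for z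
    by (rule linear_expand_Basis[OF M(1)[OF that], symmetric])
qed

text \<open>Induction on the order: the first partial derivatives are O(|z|^n), and the mean value
  inequality on the closed ball of radius |z| gains one power.\<close>

lemma vanishes_norm_le:
  assumes U: "open U" "0 \<in> U" and "smooth_on F U" "vanishes n F"
  shows "\<exists>C d. 0 \<le> C \<and> 0 < d \<and> (\<forall>z. norm z < d \<longrightarrow> norm (F z) \<le> C * norm z ^ n)"
  using assms(3-)
proof (induction n arbitrary: F)
  case 0
  have "isCont F 0"
    using smooth_on_continuous[OF 0(1)] U continuous_on_eq_continuous_at by blast
  then obtain d where d: "0 < d" "\<And>z. dist z 0 < d \<Longrightarrow> dist (F z) (F 0) < 1"
    unfolding continuous_at_eps_delta by (meson zero_less_one)
  have "norm (F z) \<le> (norm (F 0) + 1) * norm z ^ 0" if "norm z < d" for z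
    using d(2)[of z] that norm_triangle_ineq2[of "F z" "F 0"] by (simp add: dist_norm)
  then show ?case using d(1) by (intro exI[of _ "norm (F 0) + 1"] exI[of _ d]) auto
next
  case (Suc n)
  have D: "\<exists>C d. 0 \<le> C \<and> 0 < d \<and> (\<forall>z. norm z < d \<longrightarrow> norm (dir_deriv F z v) \<le> C * norm z ^ n)" for v
    using Suc.prems by (intro Suc.IH smooth_on_dir_deriv) auto
  obtain C1 d1 where 1: "0 \<le> C1" "0 < d1" "\<And>z. norm z < d1 \<Longrightarrow> norm (dir_deriv F z 1) \<le> C1 * norm z ^ n" using D by blast
  obtain C2 d2 where 2: "0 \<le> C2" "0 < d2" "\<And>z. norm z < d2 \<Longrightarrow> norm (dir_deriv F z \<i>) \<le> C2 * norm z ^ n" using D by blast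
  obtain r where r: "0 < r" "ball 0 r \<subseteq> U" using U openE by blast
  define d where "d = min r (min d1 d2)"
  have d: "0 < d" using r 1 2 by (simp add: d_def)
  have "norm (F z) \<le> (C1 + C2) * norm z ^ Suc n" if z: "norm z < d" for z
  proof -
    have bound: "norm (dir_deriv F w v) \<le> ((C1 + C2) * norm z ^ n) * norm v" if w: "norm w \<le> norm z" for w v
    proof -
      have wU: "w \<in> U" using w z r by (auto simp: d_def)
      have lin: "linear (dir_deriv F w)" by (rule smooth_on_linear_dir_deriv[OF U(1) Suc.prems(1) wU])
      have "dir_deriv F w v = dir_deriv F w (Re v *\<^sub>R 1 + Im v *\<^sub>R \<i>)"
        by (rule arg_cong[of _ _ "dir_deriv F w"]) (simp add: complex_eq_iff)
      also have "\<dots> = Re v *\<^sub>R dir_deriv F w 1 + Im v *\<^sub>R dir_deriv F w \<i>"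
        by (simp only: linear_add[OF lin] linear_scale[OF lin])
      also have "norm \<dots> \<le> \<bar>Re v\<bar> * norm (dir_deriv F w 1) + \<bar>Im v\<bar> * norm (dir_deriv F w \<i>)"
        by (rule norm_triangle_le) simp
      also have "\<dots> \<le> norm v * (C1 * norm z ^ n) + norm v * (C2 * norm z ^ n)"
      proof (intro add_mono mult_mono abs_Re_le_cmod abs_Im_le_cmod)
        have "norm w ^ n \<le> norm z ^ n" using w by (simp add: power_mono)
        then show "norm (dir_deriv F w 1) \<le> C1 * norm z ^ n" "norm (dir_deriv F w \<i>) \<le> C2 * norm z ^ n"
          using 1(3)[of w] 2(3)[of w] w z mult_left_mono[OF _ 1(1), of "norm w ^ n" "norm z ^ n"]
            mult_left_mono[OF _ 2(1), of "norm w ^ n" "norm z ^ n"] by (auto simp: d_def)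
      qed auto
      finally show ?thesis by (simp add: algebra_simps)
    qed
    have "norm (F z - F 0) \<le> ((C1 + C2) * norm z ^ n) * norm (z - 0)"
    proof (rule differentiable_bound[of "cball 0 (norm z)"])
      fix w :: complex assume w: "w \<in> cball 0 (norm z)"
      then have wU: "w \<in> U" using z r by (auto simp: d_def)
      show "(F has_derivative dir_deriv F w) (at w within cball 0 (norm z))"
        by (rule has_derivative_at_withinI[OF smooth_on_has_derivative[OF U(1) Suc.prems(1) wU]])
      show "onorm (dir_deriv F w) \<le> (C1 + C2) * norm z ^ n"
        by (rule onorm_le) (use bound w in \<open>simp add: dist_norm\<close>)
    qed auto
    then show ?thesis using Suc.prems by (simp add: mult_ac)
  qed
  then show ?case using d 1 2 by (intro exI[of _ "C1 + C2"] exI[of _ d]) auto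
qed

lemma hjet_add:
  assumes "complex_structure I" and U: "open U" "0 \<in> U" and "smooth_on F U" "smooth_on G U" "hjet I n F" "hjet I n G"
  shows "hjet I n (\<lambda>z. F z + G z)"
  using assms(4-)
proof (induction n arbitrary: F G)
  case (Suc n)
  interpret complex_structure I by fact
  have "hjet I n (dl I (\<lambda>z. F z + G z))"
  proof (rule hjet_cong[OF U])
    show "hjet I n (\<lambda>z. dl I F z + dl I G z)"
      using Suc.prems U by (intro Suc.IH smooth_on_dl) auto
    show "dl I F z + dl I G z = dl I (\<lambda>z. F z + G z) z" if "z \<in> U" for z
      using dl_add[OF U(1) Suc.prems(1,2) that] by simp
  qed
  then show ?case using Suc.prems by simp
qed simp

lemma hjet_zero: "complex_structure I \<Longrightarrow> hjet I n (\<lambda>z. 0)"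
proof (induction n)
  case (Suc n)
  have "dl I (\<lambda>z. 0) = (\<lambda>z. 0)"
    using complex_structure.I_simps(5)[OF Suc.prems] by (simp add: dl_def fun_eq_iff)
  with Suc show ?case by simp
qed simp

lemma hjet_sum:
  assumes I: "complex_structure I" and U: "open U" "0 \<in> U" and "finite T" "\<And>i. i \<in> T \<Longrightarrow> smooth_on (F i) U" "\<And>i. i \<in> T \<Longrightarrow> hjet I n (F i)"
  shows "hjet I n (\<lambda>z. \<Sum>i\<in>T. F i z)"
  using assms(4-)
proof (induction T rule: finite_induct)
  case (insert a T)
  have "hjet I n (\<lambda>z. F a z + (\<Sum>i\<in>T. F i z))"
    using insert by (intro hjet_add[OF I U] smooth_on_sum[OF U(1)]) auto
  then show ?case using insert by simp
qed (simp add: hjet_zero[OF I])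

text \<open>Complex linearity lets the \<open>I\<close> inside \<open>dl\<close> pass through
  \<open>M z\<close>, so that the product rule holds for d/dz by itself.\<close>

lemma dl_apply:
  fixes y :: "complex \<Rightarrow> 'b::euclidean_space" and I' :: "'c::euclidean_space \<Rightarrow> 'c"
  assumes I': "complex_structure I'"
    and U: "open U" "z \<in> U" and M: "\<And>z. z \<in> U \<Longrightarrow> linear (M z)" "\<And>v. smooth_on (\<lambda>z. M z v) U"
    and MI: "\<And>z v. z \<in> U \<Longrightarrow> M z (I v) = I' (M z v)"
    and y: "smooth_on y U"
  shows "dl I' (\<lambda>z. M z (y z)) z = dl I' (\<lambda>z'. M z' (y z)) z + M z (dl I y z)"
proof -
  have D: "dir_deriv (\<lambda>z. M z (y z)) z v = dir_deriv (\<lambda>z'. M z' (y z)) z v + M z (dir_deriv y z v)" for v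
    by (rule dir_deriv_apply[OF U M y])
  interpret I': complex_structure I' by fact
  show ?thesis
    unfolding dl_def
    by (simp add: D linear_diff[OF M(1)[OF U(2)]] linear_scale[OF M(1)[OF U(2)]] MI[OF U(2)] algebra_simps)
qed

lemma linear_dl_family:
  assumes I': "complex_structure I'" and U: "open U" "z \<in> U"
    and M: "\<And>z. z \<in> U \<Longrightarrow> linear (M z)" "\<And>v. smooth_on (\<lambda>z. M z v) U"
  shows "linear (\<lambda>v. dl I' (\<lambda>z. M z v) z)"
proof -
  interpret I': complex_structure I' by fact
  note lin = linear_dir_deriv_family[OF U M]
  show ?thesis unfolding dl_def
    by (rule linearI) (simp_all add: linear_add[OF lin] linear_scale[OF lin] algebra_simps)
qed

lemma dl_family_I:
  assumes I': "complex_structure I'" and U: "open U" "z \<in> U"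
    and M: "\<And>v. smooth_on (\<lambda>z. M z v) U" and MI: "\<And>z v. z \<in> U \<Longrightarrow> M z (I v) = I' (M z v)"
  shows "dl I' (\<lambda>z. M z (I v)) z = I' (dl I' (\<lambda>z. M z v) z)"
proof -
  interpret I': complex_structure I' by fact
  show ?thesis
    using dl_cong_open[OF U(1), of "\<lambda>z. M z (I v)" "\<lambda>z. I' (M z v)"] MI I'.dl_I[OF U(1) M U(2)] U(2) by simp
qed

text \<open>The d/dz of \<open>M z (y z)\<close> is again a sum of complex linear families, applied
  to \<open>y\<close> and to its d/dz, so the induction runs over all such families at once.\<close>

lemma hjet_apply:
  fixes y :: "complex \<Rightarrow> 'b::euclidean_space" and I' :: "'c::euclidean_space \<Rightarrow> 'c"
  assumes I: "complex_structure I" and I': "complex_structure I'"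
    and U: "open U" "0 \<in> U" and "\<And>z. z \<in> U \<Longrightarrow> linear (M z)" "\<And>v. smooth_on (\<lambda>z. M z v) U"
    and "\<And>z v. z \<in> U \<Longrightarrow> M z (I v) = I' (M z v)"
    and "smooth_on y U" "hjet I n y"
  shows "hjet I' n (\<lambda>z. M z (y z))"
  using assms(5-)
proof (induction n arbitrary: M y)
  case (Suc n)
  interpret I: complex_structure I by fact
  interpret I': complex_structure I' by fact
  have sM: "smooth_on (dl I' (\<lambda>z. M z v)) U" for v by (rule I'.smooth_on_dl[OF U(1) Suc.prems(2)])
  have lM: "linear (\<lambda>v. dl I' (\<lambda>z. M z v) z)" if "z \<in> U" for z
    by (rule linear_dl_family[OF I' U(1) that Suc.prems(1,2)])
  have IM: "dl I' (\<lambda>z. M z (I v)) z = I' (dl I' (\<lambda>z. M z v) z)" if "z \<in> U" for z v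
    by (rule dl_family_I[where I = I and M = M, OF I' U(1) that]) (use Suc.prems in auto)
  have "hjet I' n (dl I' (\<lambda>z. M z (y z)))"
  proof (rule hjet_cong[OF U])
    have "hjet I' n (\<lambda>z. dl I' (\<lambda>z'. M z' (y z)) z)"
      by (rule Suc.IH[where M = "\<lambda>z v. dl I' (\<lambda>z. M z v) z", OF lM sM
            IM Suc.prems(4) hjet_lower[OF Suc.prems(5)]])
    moreover have "hjet I' n (\<lambda>z. M z (dl I y z))"
      using Suc.prems(5) by (intro Suc.IH[OF Suc.prems(1,2,3)] I.smooth_on_dl U(1) Suc.prems(4)) auto
    ultimately show "hjet I' n (\<lambda>z. dl I' (\<lambda>z'. M z' (y z)) z + M z (dl I y z))"
      by (intro hjet_add[OF I' U] smooth_on_apply[where L = "\<lambda>z v. dl I' (\<lambda>z. M z v) z", OF U(1) lM sM Suc.prems(4)]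
          smooth_on_apply[OF U(1) Suc.prems(1,2) I.smooth_on_dl[OF U(1) Suc.prems(4)]])
    show "dl I' (\<lambda>z'. M z' (y z)) z + M z (dl I y z) = dl I' (\<lambda>z. M z (y z)) z" if "z \<in> U" for z
      using dl_apply[OF I' U(1) that Suc.prems(1,2,3,4)] by simp
  qed
  then show ?case using Suc.prems linear_0[OF Suc.prems(1)[OF U(2)]] by simp
qed simp

lemma hjet_diff:
  assumes "complex_structure I" and U: "open U" "0 \<in> U" and "smooth_on F U" "smooth_on G U" "hjet I n F" "hjet I n G"
  shows "hjet I n (\<lambda>z. F z - G z)"
  using assms(4-)
proof (induction n arbitrary: F G)
  case (Suc n)
  interpret complex_structure I by fact
  have "hjet I n (dl I (\<lambda>z. F z - G z))"
  proof (rule hjet_cong[OF U])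
    show "hjet I n (\<lambda>z. dl I F z - dl I G z)"
      using Suc.prems U by (intro Suc.IH smooth_on_dl) auto
    show "dl I F z - dl I G z = dl I (\<lambda>z. F z - G z) z" if "z \<in> U" for z
      using dl_diff[OF U(1) Suc.prems(1,2) that] by simp
  qed
  then show ?case using Suc.prems by simp
qed simp

lemma complex_structure_complex: "complex_structure ((*) \<i>)"
  by unfold_locales (auto intro!: linearI simp: algebra_simps)

text \<open>A converse of \<open>hjet_apply\<close> for a separating set of functionals: in the d/dz
  of \<open>\<kappa> v z (y z)\<close> the part where \<kappa> is differentiated is already
  controlled by the lower jet of \<open>y\<close>. It serves to read off the jet of \<Gamma> from
  its pairings with the Hermitian metric.\<close>

lemma hjet_from_functionals:
  fixes y :: "complex \<Rightarrow> 'e::euclidean_space"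
  assumes I: "complex_structure I" and U: "open U" "0 \<in> U"
    and \<kappa>: "\<And>v z. z \<in> U \<Longrightarrow> linear (\<kappa> v z)" "\<And>v x. smooth_on (\<lambda>z. \<kappa> v z x) U"
      "\<And>v z x. z \<in> U \<Longrightarrow> \<kappa> v z (I x) = \<i> * \<kappa> v z x"
    and sep: "\<And>x. (\<And>v. \<kappa> v 0 x = 0) \<Longrightarrow> x = 0"
    and "smooth_on y U" "\<And>v. hjet ((*) \<i>) n (\<lambda>z. \<kappa> v z (y z))"
  shows "hjet I n y"
  using assms(8-)
proof (induction n arbitrary: y)
  case (Suc n)
  note C = complex_structure_complex
  interpret I: complex_structure I by fact
  interpret C: complex_structure "(*) \<i>" by (rule C)
  have y: "hjet I n y" by (rule Suc.IH[OF Suc.prems(1) hjet_lower[OF Suc.prems(2)]])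
  have y0: "y 0 = 0" by (rule sep) (use Suc.prems(2) in simp)
  have dly: "smooth_on (dl I y) U" by (rule I.smooth_on_dl[OF U(1) Suc.prems(1)])
  have "hjet I n (dl I y)"
  proof (rule Suc.IH[OF dly])
    fix v
    have s: "smooth_on (dl ((*) \<i>) (\<lambda>z. \<kappa> v z x)) U" for x
      by (rule C.smooth_on_dl[OF U(1) \<kappa>(2)])
    have l: "linear (\<lambda>x. dl ((*) \<i>) (\<lambda>z. \<kappa> v z x) z)" if "z \<in> U" for z
      by (rule linear_dl_family[OF C U(1) that \<kappa>(1,2)])
    have i: "dl ((*) \<i>) (\<lambda>z. \<kappa> v z (I x)) z = \<i> * dl ((*) \<i>) (\<lambda>z. \<kappa> v z x) z" if "z \<in> U" for z x
      by (rule dl_family_I[where I = I and M = "\<kappa> v", OF C U(1) that \<kappa>(2,3)])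
    have 1: "hjet ((*) \<i>) n (\<lambda>z. dl ((*) \<i>) (\<lambda>z'. \<kappa> v z' (y z)) z)"
      by (rule hjet_apply[where M = "\<lambda>z x. dl ((*) \<i>) (\<lambda>z. \<kappa> v z x) z", OF I C U l s i Suc.prems(1) y])
    have s1: "smooth_on (\<lambda>z. dl ((*) \<i>) (\<lambda>z'. \<kappa> v z' (y z)) z) U"
      by (rule smooth_on_apply[where L = "\<lambda>z x. dl ((*) \<i>) (\<lambda>z. \<kappa> v z x) z", OF U(1) l s Suc.prems(1)])
    have s2: "smooth_on (\<lambda>z. \<kappa> v z (y z)) U" by (rule smooth_on_apply[OF U(1) \<kappa>(1,2) Suc.prems(1)])
    have 2: "hjet ((*) \<i>) n (dl ((*) \<i>) (\<lambda>z. \<kappa> v z (y z)))" using Suc.prems(2)[of v] by simp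
    show "hjet ((*) \<i>) n (\<lambda>z. \<kappa> v z (dl I y z))"
    proof (rule hjet_cong[OF U])
      show "hjet ((*) \<i>) n (\<lambda>z. dl ((*) \<i>) (\<lambda>z. \<kappa> v z (y z)) z - dl ((*) \<i>) (\<lambda>z'. \<kappa> v z' (y z)) z)"
        using 1 2 by (intro hjet_diff[OF C U] C.smooth_on_dl[OF U(1) s2] s1) auto
      show "dl ((*) \<i>) (\<lambda>z. \<kappa> v z (y z)) z - dl ((*) \<i>) (\<lambda>z'. \<kappa> v z' (y z)) z = \<kappa> v z (dl I y z)"
        if "z \<in> U" for z
        using dl_apply[where I = I and M = "\<kappa> v", OF C U(1) that \<kappa>(1,2,3) Suc.prems(1)] by simp
    qed
  qed
  then show ?case using y0 by simp
qed simp

section \<open>From holomorphic jets to flatness and uniqueness\<close>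

context complex_structure
begin

lemma complex_structure_I: "complex_structure I" by unfold_locales

lemma hjet_cs:
  assumes U: "open U" "0 \<in> U" and k: "smooth_on k U" and F: "smooth_on F U" "hjet I n F"
  shows "hjet I n (\<lambda>z. cs (k z) (F z))"
  by (rule hjet_apply[where M = "\<lambda>z. cs (k z)", OF complex_structure_I complex_structure_I U linear_cs _ cs_simps(8) F])
    (rule smooth_on_bilinear[OF U(1) bounded_bilinear_cs k smooth_on_const[OF U(1)]])

text \<open>In contrast to \<open>hjet_apply\<close>, the coefficients carry the vanishing jet and
  the argument is arbitrary: its real components act as complex scalars on the values
  \<open>M z b\<close>.\<close>

lemma hjet_family:
  fixes y :: "complex \<Rightarrow> 'b::euclidean_space"
  assumes U: "open U" "0 \<in> U" and M: "\<And>z. z \<in> U \<Longrightarrow> linear (M z)" "\<And>v. smooth_on (\<lambda>z. M z v) U"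
    "\<And>v. hjet I n (\<lambda>z. M z v)" and y: "smooth_on y U"
  shows "hjet I n (\<lambda>z. M z (y z))"
proof (rule hjet_cong[OF U])
  have s: "smooth_on (\<lambda>z. complex_of_real (y z \<bullet> b)) U" for b
    by (intro smooth_on_of_real U smooth_on_bounded_linear[OF U(1) bounded_linear_inner_left y])
  have s': "smooth_on (\<lambda>z. cs (complex_of_real (y z \<bullet> b)) (M z b)) U" for b
    by (rule smooth_on_bilinear[OF U(1) bounded_bilinear_cs s M(2)])
  show "hjet I n (\<lambda>z. \<Sum>b\<in>Basis. cs (complex_of_real (y z \<bullet> b)) (M z b))"
    by (rule hjet_sum[OF complex_structure_I U finite_Basis s' hjet_cs[OF U s M(2,3)]])
  show "(\<Sum>b\<in>Basis. cs (complex_of_real (y z \<bullet> b)) (M z b)) = M z (y z)" if "z \<in> U" for z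
    unfolding cs_simps by (rule linear_expand_Basis[OF M(1)[OF that], symmetric])
qed

lemma smooth_on_cnj: "open U \<Longrightarrow> smooth_on cnj U"
  by (rule smooth_on_bounded_linear[OF _ bounded_linear_cnj smooth_on_ident])

lemma dl_cs:
  assumes U: "open U" "z \<in> U" and k: "smooth_on k U" and F: "smooth_on F U"
  shows "dl I (\<lambda>z. cs (k z) (F z)) z = dl I (\<lambda>z'. cs (k z') (F z)) z + cs (k z) (dl I F z)"
  by (rule dl_apply[where M = "\<lambda>z. cs (k z)", OF complex_structure_I U linear_cs _ cs_simps(8) F])
    (rule smooth_on_bilinear[OF U(1) bounded_bilinear_cs k smooth_on_const[OF U(1)]])

lemma dir_deriv_cs_const: "(k has_derivative k') (at z) \<Longrightarrow> dir_deriv (\<lambda>z. cs (k z) x) z v = cs (k' v) x"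
  by (rule dir_deriv_eq[OF bounded_linear.has_derivative[OF bounded_bilinear.bounded_linear_left[OF bounded_bilinear_cs]]])

lemma dl_cs_cnj: "dl I (\<lambda>z. cs (cnj z) x) z = 0"
proof -
  have "(cnj has_derivative cnj) (at z)" by (rule bounded_linear_imp_has_derivative[OF bounded_linear_cnj])
  from dir_deriv_cs_const[OF this] show ?thesis
    unfolding dl_def by (simp only:) (simp add: cs_def)
qed

text \<open>d/dz does not see the factor zbar, so every pure derivative of zbar G still contains
  this factor and is zero at 0.\<close>

lemma hjet_cnj:
  assumes U: "open U" "0 \<in> U" and "smooth_on G U"
  shows "hjet I n (\<lambda>z. cs (cnj z) (G z))"
  using assms(3)
proof (induction n arbitrary: G)
  case (Suc n)
  have "hjet I n (dl I (\<lambda>z. cs (cnj z) (G z)))"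
  proof (rule hjet_cong[OF U])
    show "hjet I n (\<lambda>z. cs (cnj z) (dl I G z))"
      by (intro Suc.IH smooth_on_dl[OF U(1) Suc.prems])
    show "cs (cnj z) (dl I G z) = dl I (\<lambda>z. cs (cnj z) (G z)) z" if "z \<in> U" for z
      using dl_cs[OF U(1) that smooth_on_cnj[OF U(1)] Suc.prems] dl_cs_cnj by simp
  qed
  then show ?case by (simp add: cs_simps)
qed simp

text \<open>Every directional derivative combines d/dz and d/dzbar. The latter vanishes by
  assumption; the former satisfies the same hypotheses with the order lowered by one, since the two
  operators commute.\<close>

lemma vanishes_from_dlb:
  assumes U: "open U" "0 \<in> U" and "smooth_on G U" "\<And>n. hjet I n G" "vanishes k (dlb I G)"
  shows "vanishes (Suc k) G"
  using assms(3-)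
proof (induction k arbitrary: G)
  case 0
  then show ?case using 0(2)[of 1] by simp
next
  case (Suc k)
  note bl = bounded_bilinear.bounded_linear_right[OF bounded_bilinear_cs]
  have s: "smooth_on (dl I G) U" "smooth_on (dlb I G) U"
    by (intro smooth_on_dl smooth_on_dlb U(1) Suc.prems(1))+
  have "vanishes (Suc k) (dl I G)"
  proof (rule Suc.IH[OF s(1)])
    show "hjet I n (dl I G)" for n using Suc.prems(2)[of "Suc n"] by simp
    have v: "vanishes k (\<lambda>z. dir_deriv (dlb I G) z v)" for v using Suc.prems(3) by simp
    show "vanishes k (dlb I (dl I G))"
    proof (rule vanishes_cong[OF U])
      have "vanishes k (\<lambda>z. (1 / 2) *\<^sub>R dir_deriv (dlb I G) z 1 + (- (1 / 2)) *\<^sub>R I (dir_deriv (dlb I G) z \<i>))"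
        using U s(2) v bounded_linear_I
        by (intro vanishes_add[OF U] vanishes_bounded_linear[OF U bounded_linear_scaleR_right]
            vanishes_bounded_linear[OF U bounded_linear_I] smooth_on_scaleR smooth_on_const smooth_on_I smooth_on_dir_deriv)
      then show "vanishes k (dl I (dlb I G))" by (simp add: dl_def[abs_def] scaleR_diff_right)
      show "dl I (dlb I G) z = dlb I (dl I G) z" if "z \<in> U" for z
        using dl_dlb_commute[OF U(1) Suc.prems(1) that] by simp
    qed
  qed
  then have *: "vanishes (Suc k) (\<lambda>z. cs v (dl I G z) + cs (cnj v) (dlb I G z))" for v
    by (intro vanishes_add[OF U] vanishes_bounded_linear[OF U bl] smooth_on_bounded_linear[OF U(1) bl] s Suc.prems(3))
  have "vanishes (Suc k) (\<lambda>z. dir_deriv G z v)" for v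
    by (rule vanishes_cong[OF U _ *]) (rule dir_deriv_dl_dlb[OF U(1) Suc.prems(1), symmetric])
  then show ?case using Suc.prems(2)[of 1] by simp
qed

lemma hermitian_form_I: "hermitian_form I (\<lambda>x y. x \<bullet> y + I x \<bullet> I y)"
proof
  show "bilinear (\<lambda>x y. x \<bullet> y + I x \<bullet> I y)"
    unfolding bilinear_def by (auto intro!: linearI simp: inner_simps algebra_simps)
  show "0 < x \<bullet> x + I x \<bullet> I x" if "x \<noteq> 0" for x
    using that by (simp add: add_pos_nonneg)
qed (auto simp: linear_I inner_commute)

text \<open>The system raises flatness by itself: if all unknowns vanish to order \<open>k\<close>,
  so do their d/dzbar, and with the holomorphic jets this gives order \<open>k + 1\<close>. Hence
  the unknowns are flat, and the linear bound on d/dzbar leads to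
  \<open>cr_unique_continuation\<close>.\<close>

theorem cr_system_unique:
  fixes F :: "'j \<Rightarrow> complex \<Rightarrow> 'e"
  assumes J: "finite J" and F: "\<And>j. j \<in> J \<Longrightarrow> smooth_on (F j) (ball 0 R)"
    and jets: "\<And>j n. j \<in> J \<Longrightarrow> hjet I n (F j)"
    and van: "\<And>k j. (\<And>j. j \<in> J \<Longrightarrow> vanishes k (F j)) \<Longrightarrow> j \<in> J \<Longrightarrow> vanishes k (dlb I (F j))"
    and bound: "\<And>z j. norm z < R \<Longrightarrow> j \<in> J \<Longrightarrow> norm (dlb I (F j) z) \<le> C * (\<Sum>k\<in>J. norm (F k z))"
    and z: "norm z < R" and j: "j \<in> J"
  shows "F j z = 0"
proof -
  define B where "B x y = x \<bullet> y + I x \<bullet> I y" for x y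
  interpret H: hermitian_form I B unfolding B_def[abs_def] by (rule hermitian_form_I)
  have R: "0 < R" using z norm_ge_zero[of z] by linarith
  have U: "open (ball (0::complex) R)" "0 \<in> ball (0::complex) R" using R by auto
  have "\<forall>j\<in>J. vanishes k (F j)" for k
  proof (induction k)
    case (Suc k)
    then have "vanishes k (dlb I (F j))" if "j \<in> J" for j using van that by blast
    then show ?case using vanishes_from_dlb[OF U F jets] by blast
  qed simp
  then have vanF: "vanishes k (F j)" if "j \<in> J" for j k using that by blast
  obtain b where b: "0 < b" "\<And>x. norm (I x) \<le> b * norm x"
    using bounded_linear.pos_bounded[OF bounded_linear_I] by (metis mult.commute)
  have Bn: "(norm x)\<^sup>2 \<le> B x x" "B x x \<le> (1 + b\<^sup>2) * (norm x)\<^sup>2" for x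
  proof -
    have "(norm (I x))\<^sup>2 \<le> (b * norm x)\<^sup>2" using b(2)[of x] by (rule power_mono) simp
    then show "(norm x)\<^sup>2 \<le> B x x" "B x x \<le> (1 + b\<^sup>2) * (norm x)\<^sup>2"
      by (simp_all add: B_def power2_norm_eq_inner[symmetric] algebra_simps power_mult_distrib)
  qed
  define m where "m = real (card J)"
  have sum_sq: "(\<Sum>k\<in>J. norm (F k z))\<^sup>2 \<le> m * (\<Sum>k\<in>J. B (F k z) (F k z))" for z
  proof -
    have "(\<Sum>k\<in>J. norm (F k z))\<^sup>2 \<le> (\<Sum>k\<in>J. 1\<^sup>2) * (\<Sum>k\<in>J. (norm (F k z))\<^sup>2)"
      using Cauchy_Schwarz_ineq_sum[of "\<lambda>_. 1" "\<lambda>k. norm (F k z)" J] by simp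
    also have "\<dots> \<le> m * (\<Sum>k\<in>J. B (F k z) (F k z))"
      by (auto simp: m_def intro!: mult_left_mono sum_mono Bn)
    finally show ?thesis .
  qed
  define W where "W j z = dir_deriv (F j) z 1 + I (dir_deriv (F j) z \<i>)" for j z
  have W: "W j z = 2 *\<^sub>R dlb I (F j) z" for j z by (simp add: W_def dlb_def)
  \<comment> \<open>One factor \<open>m\<close> comes from the Cauchy-Schwarz inequality for the sum
    of norms, the other from summing over \<open>J\<close>; \<open>1 + b^2\<close> compares
    \<open>B\<close> with the norm, and 4 is the square of the 2 in
    \<open>W = 2 dlb\<close>.\<close>
  define K where "K = m * ((1 + b\<^sup>2) * (4 * C\<^sup>2 * m))"
  show ?thesis
  proof (rule H.cr_unique_continuation[OF J F, where K = K])
    show "0 \<le> K" by (auto simp: K_def m_def)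
    show "(\<Sum>j\<in>J. B (dir_deriv (F j) z 1 + I (dir_deriv (F j) z \<i>)) (dir_deriv (F j) z 1 + I (dir_deriv (F j) z \<i>)))
       \<le> K * (\<Sum>j\<in>J. B (F j z) (F j z))" if z: "norm z < R" for z
    proof -
      have "B (W j z) (W j z) \<le> (1 + b\<^sup>2) * (4 * C\<^sup>2 * m) * (\<Sum>j\<in>J. B (F j z) (F j z))" if "j \<in> J" for j
      proof -
        have "(norm (W j z))\<^sup>2 \<le> (2 * (C * (\<Sum>k\<in>J. norm (F k z))))\<^sup>2"
          using bound[OF z that] by (intro power_mono) (simp_all add: W)
        also have "\<dots> = 4 * C\<^sup>2 * (\<Sum>k\<in>J. norm (F k z))\<^sup>2" by (simp add: power_mult_distrib)
        also have "\<dots> \<le> 4 * C\<^sup>2 * (m * (\<Sum>k\<in>J. B (F k z) (F k z)))"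
          using sum_sq by (intro mult_left_mono) auto
        finally have "(1 + b\<^sup>2) * (norm (W j z))\<^sup>2 \<le> (1 + b\<^sup>2) * (4 * C\<^sup>2 * (m * (\<Sum>k\<in>J. B (F k z) (F k z))))"
          by (rule mult_left_mono) simp
        with Bn(2)[of "W j z"] show ?thesis by (simp add: mult_ac)
      qed
      then have "(\<Sum>j\<in>J. B (W j z) (W j z)) \<le> (\<Sum>j\<in>J. (1 + b\<^sup>2) * (4 * C\<^sup>2 * m) * (\<Sum>j\<in>J. B (F j z) (F j z)))"
        by (rule sum_mono)
      then show ?thesis by (simp add: W_def[symmetric] K_def m_def mult_ac)
    qed
    show "\<exists>C d. 0 < d \<and> (\<forall>z. norm z < d \<longrightarrow> (\<Sum>j\<in>J. B (F j z) (F j z)) \<le> C * norm z ^ n)" for n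
    proof -
      have "\<forall>j\<in>J. \<exists>C d. 0 \<le> C \<and> 0 < d \<and> (\<forall>z. norm z < d \<longrightarrow> norm (F j z) \<le> C * norm z ^ n)"
        using vanishes_norm_le[OF U F vanF] by blast
      then obtain c d where cd: "\<And>j. j \<in> J \<Longrightarrow> 0 \<le> c j" "\<And>j. j \<in> J \<Longrightarrow> 0 < d j"
        "\<And>j z. j \<in> J \<Longrightarrow> norm z < d j \<Longrightarrow> norm (F j z) \<le> c j * norm z ^ n" by metis
      define e where "e = Min (insert 1 (d ` J))"
      have e: "0 < e" "e \<le> 1" "\<And>j. j \<in> J \<Longrightarrow> e \<le> d j"
        using J cd(2) by (auto simp: e_def)
      have "(\<Sum>j\<in>J. B (F j z) (F j z)) \<le> (\<Sum>j\<in>J. (1 + b\<^sup>2) * (c j)\<^sup>2) * norm z ^ n" if z: "norm z < e" for z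
      proof -
        have "B (F j z) (F j z) \<le> (1 + b\<^sup>2) * (c j)\<^sup>2 * norm z ^ n" if j: "j \<in> J" for j
        proof -
          have "(norm (F j z))\<^sup>2 \<le> (c j * norm z ^ n)\<^sup>2"
            using cd(3)[OF j, of z] e(3)[OF j] z by (intro power_mono) auto
          also have "\<dots> = (c j)\<^sup>2 * (norm z ^ n * norm z ^ n)"
            by (simp add: power2_eq_square)
          also have "\<dots> \<le> (c j)\<^sup>2 * (norm z ^ n * 1)"
            using z e by (intro mult_left_mono power_le_one) auto
          finally have "(1 + b\<^sup>2) * (norm (F j z))\<^sup>2 \<le> (1 + b\<^sup>2) * ((c j)\<^sup>2 * (norm z ^ n * 1))"
            by (rule mult_left_mono) simp
          with Bn(2)[of "F j z"] show ?thesis by (simp add: mult_ac)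
        qed
        then have "(\<Sum>j\<in>J. B (F j z) (F j z)) \<le> (\<Sum>j\<in>J. (1 + b\<^sup>2) * (c j)\<^sup>2 * norm z ^ n)" by (rule sum_mono)
        then show ?thesis by (simp add: sum_distrib_right)
      qed
      then show ?thesis using e(1) by blast
    qed
  qed (use z j in auto)
qed

end

section \<open>Power associativity in Jordan triple systems\<close>

text \<open>Entries with \<open>a + j < i\<close> vanish, those with \<open>a + j = i\<close> all
  equal \<open>f i 0\<close>, and on the next antidiagonal \<open>f i 0\<close> accumulates
  \<open>j\<close> times; the diagonal relation then reads \<open>(i + 2) f i 0 = 0\<close>. In the
  application \<open>f\<close> measures the failure of power associativity.\<close>

lemma triangle_recurrence_zero:
  fixes f :: "nat \<Rightarrow> nat \<Rightarrow> 'a::real_vector"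
  assumes rec: "\<And>a j. a + j \<le> n \<Longrightarrow> f a (Suc j) = f (Suc a) j + f a j"
    and f00: "f 0 0 = 0" and fn: "f (Suc n) 0 = 0"
    and diag: "\<And>i. i \<le> n \<Longrightarrow> f i 0 = f (Suc i) 0 - f 0 (Suc i)"
    and aj: "a + j \<le> Suc n"
  shows "f a j = 0"
proof -
  have base: "f i 0 = 0" if "i \<le> Suc n" for i
    using that
  proof (induction i rule: less_induct)
    case (less i)
    show ?case
    proof (cases "i = Suc n")
      case False
      then have i: "i \<le> n" using less.prems by simp
      have low: "f a j = 0" if "a + j < i" for a j
        using that
      proof (induction j arbitrary: a)
        case 0
        then show ?case using less.IH less.prems by simp
      next
        case (Suc j)
        then show ?case using rec[of a j] i by simp
      qed
      have mid: "f a j = f i 0" if "a + j = i" for a j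
        using that
      proof (induction j arbitrary: a)
        case (Suc j)
        then show ?case using rec[of a j] low[of a j] i by simp
      qed simp
      have up: "f a j = f (Suc i) 0 + real j *\<^sub>R f i 0" if "a + j = Suc i" for a j
        using that
      proof (induction j arbitrary: a)
        case (Suc j)
        then show ?case using rec[of a j] mid[of a j] i by (simp add: algebra_simps)
      qed simp
      have "f i 0 + real (Suc i) *\<^sub>R f i 0 = 0"
      proof -
        have "f i 0 = - (real (Suc i) *\<^sub>R f i 0)" using diag[OF i] up[of 0 "Suc i"] by simp
        then show ?thesis by (simp only: eq_neg_iff_add_eq_0)
      qed
      then have "(real (Suc i) + 1) *\<^sub>R f i 0 = 0"
        by (metis add.commute scaleR_left_distrib scaleR_one)
      moreover have "real (Suc i) + 1 \<noteq> 0" by linarith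
      ultimately show ?thesis by (metis scaleR_eq_0_iff)
    qed (simp add: fn)
  qed
  show ?thesis
    using aj
  proof (induction j arbitrary: a)
    case 0
    then show ?case by (simp add: base)
  next
    case (Suc j)
    then show ?case using rec[of a j] by simp
  qed
qed

text \<open>In the usual notation \<open>p u v w\<close> is the triple product \<open>{v u w}\<close>.\<close>

locale jordan_triple =
  fixes p :: "'e::real_vector \<Rightarrow> 'e \<Rightarrow> 'e \<Rightarrow> 'e"
  assumes p_add: "p (u + u') v w = p u v w + p u' v w" "p u (v + v') w = p u v w + p u v' w"
      "p u v (w + w') = p u v w + p u v w'"
    and p_scale: "p (c *\<^sub>R u) v w = c *\<^sub>R p u v w" "p u (c *\<^sub>R v) w = c *\<^sub>R p u v w"
      "p u v (c *\<^sub>R w) = c *\<^sub>R p u v w"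
    and p_sym: "p u v w = p u w v"
    and p_jordan: "p (p n m u) v w = p u (p m n v) w + p u v (p m n w) - p m n (p u v w)"
begin

text \<open>The odd power X^(2k+1); a triple product forms odd powers only.\<close>

definition pow :: "'e \<Rightarrow> nat \<Rightarrow> 'e" where "pow X k = (p X X ^^ k) X"

lemma pow_0 [simp]: "pow X 0 = X" and pow_Suc: "pow X (Suc k) = p X X (pow X k)"
  by (simp_all add: pow_def)

text \<open>Induction on the total degree. For fixed degree the defects form a triangle: the Jordan
  identity for the operator \<open>p X X\<close> gives its recurrence of Pascal type, and a second
  instance gives the diagonal relation required by \<open>triangle_recurrence_zero\<close>.\<close>

lemma p_pow: "p (pow X j) (pow X i) (pow X k) = pow X (i + j + k + 1)"
proof -
  have "\<forall>i j k. i + j + k = N \<longrightarrow> p (pow X j) (pow X i) (pow X k) = pow X (Suc N)" for N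
  proof (induction N rule: less_induct)
    case (less N)
    show ?case
    proof (cases N)
      case 0
      then show ?thesis by (simp add: pow_Suc)
    next
      case (Suc n)
      \<comment> \<open>The third exponent is fixed by the total degree; the subtractions are exact
        for \<open>a + j <= Suc n\<close>.\<close>
      define e where "e a j = p (pow X j) (pow X a) (pow X (Suc n - a - j)) - pow X (Suc (Suc n))" for a j
      have IH: "p (pow X j) (pow X i) (pow X k) = pow X (Suc (i + j + k))" if "i + j + k \<le> n" for i j k
        using less[of "i + j + k"] that Suc by simp
      have e0: "e a j = 0" if "a + j \<le> Suc n" for a j
      proof (rule triangle_recurrence_zero[OF _ _ _ _ that])
        fix a j assume aj: "a + j \<le> n"
        define k where "k = n - a - j"
        have k: "a + j + k = n" using aj by (simp add: k_def)
        have "p (p X X (pow X j)) (pow X a) (pow X k) = p (pow X j) (p X X (pow X a)) (pow X k)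
            + p (pow X j) (pow X a) (p X X (pow X k)) - p X X (p (pow X j) (pow X a) (pow X k))"
          by (rule p_jordan)
        moreover have "p (pow X j) (pow X a) (pow X k) = pow X (Suc n)" using IH[of a j k] k by simp
        ultimately have "p (pow X (Suc j)) (pow X a) (pow X k) = p (pow X j) (pow X (Suc a)) (pow X k)
            + p (pow X j) (pow X a) (pow X (Suc k)) - pow X (Suc (Suc n))"
          by (simp add: pow_Suc)
        moreover have "Suc n - a - Suc j = k" "Suc n - Suc a - j = k" "Suc n - a - j = Suc k"
          using aj by (auto simp: k_def)
        ultimately show "e a (Suc j) = e (Suc a) j + e a j" by (simp add: e_def)
      next
        show "e 0 0 = 0" by (simp add: e_def pow_Suc)
        show "e (Suc n) 0 = 0" using p_sym[of X "pow X (Suc n)" X] by (simp add: e_def pow_Suc)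
      next
        fix i assume i: "i \<le> n"
        define m where "m = n - i"
        have m: "i + m = n" using i by (simp add: m_def)
        have pi: "p (pow X i) X X = pow X (Suc i)" "p X (pow X i) X = pow X (Suc i)"
          "p X (pow X i) (pow X m) = pow X (Suc n)"
          using IH[of 0 i 0] IH[of i 0 0] IH[of i 0 m] i m by simp_all
        \<comment> \<open>The instance with the operators \<open>p (pow X i) X\<close> and
          \<open>p X (pow X i)\<close>: it compares a power in the first slot with the same power in
          the second.\<close>
        have "p (p (pow X i) X X) X (pow X m) = p X (p X (pow X i) X) (pow X m)
            + p X X (p X (pow X i) (pow X m)) - p X (pow X i) (p X X (pow X m))"
          by (rule p_jordan)
        then have "p (pow X (Suc i)) X (pow X m) = p X (pow X (Suc i)) (pow X m)
            + pow X (Suc (Suc n)) - p X (pow X i) (pow X (Suc m))"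
          by (simp add: pi pow_Suc)
        moreover have "Suc n - 0 - Suc i = m" "Suc n - Suc i - 0 = m" "Suc n - i - 0 = Suc m"
          using i by (auto simp: m_def)
        ultimately show "e i 0 = e (Suc i) 0 - e 0 (Suc i)" by (simp add: e_def)
      qed
      have "p (pow X j) (pow X i) (pow X k) = pow X (Suc N)" if "i + j + k = N" for i j k
      proof -
        have "Suc n - i - j = k" "i + j \<le> Suc n" using that Suc by auto
        then show ?thesis using e0[of i j] Suc by (simp add: e_def)
      qed
      then show ?thesis by blast
    qed
  qed
  then show ?thesis by simp
qed

text \<open>Plays the role of the subalgebra generated by \<open>X\<close>: by \<open>p_pow\<close>
  the triple product is commutative and associative on it, in the sense of \<open>p_comm\<close> and
  \<open>p_assoc\<close>.\<close>

definition cyc :: "'e \<Rightarrow> 'e set" where "cyc X = span (range (pow X))"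

lemma subspace_cyc: "subspace (cyc X)" by (simp add: cyc_def)

lemma pow_cyc: "pow X k \<in> cyc X" by (simp add: cyc_def span_base)

lemma self_cyc: "X \<in> cyc X" using pow_cyc[of X 0] by simp

lemma p_linear: "linear (\<lambda>u. p u v w)" "linear (\<lambda>v. p u v w)" "linear (\<lambda>w. p u v w)"
  by (auto intro!: linearI simp: p_add p_scale)

lemma cyc_eqI:
  assumes "u \<in> cyc X" "linear f" "linear g" "\<And>k. f (pow X k) = g (pow X k)"
  shows "f u = g u"
  using assms(1) unfolding cyc_def
  by (rule linear_eq_on_span[OF assms(2,3), rotated]) (use assms(4) in auto)

lemma cyc_memI:
  assumes "u \<in> cyc X" "linear f" "\<And>k. f (pow X k) \<in> cyc X"
  shows "f u \<in> cyc X"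
proof -
  have "f ` span (range (pow X)) \<subseteq> span (range (pow X))"
    unfolding linear_span_image[OF assms(2), symmetric]
    by (rule span_minimal) (use assms(3) in \<open>auto simp: cyc_def\<close>)
  then show ?thesis using assms(1) by (auto simp: cyc_def)
qed

lemma p_cyc:
  assumes "u \<in> cyc X" "v \<in> cyc X" "w \<in> cyc X"
  shows "p u v w \<in> cyc X"
proof (rule cyc_memI[OF assms(1) p_linear(1)])
  fix i show "p (pow X i) v w \<in> cyc X"
  proof (rule cyc_memI[OF assms(2) p_linear(2)])
    fix j show "p (pow X i) (pow X j) w \<in> cyc X"
      by (rule cyc_memI[OF assms(3) p_linear(3)]) (simp only: p_pow pow_cyc)
  qed
qed

lemma p_comm:
  assumes "u \<in> cyc X" "v \<in> cyc X" "w \<in> cyc X"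
  shows "p u v w = p v u w"
proof (rule cyc_eqI[OF assms(1) p_linear(1,2)])
  fix i show "p (pow X i) v w = p v (pow X i) w"
  proof (rule cyc_eqI[OF assms(2) p_linear(2,1)])
    fix j show "p (pow X i) (pow X j) w = p (pow X j) (pow X i) w"
      by (rule cyc_eqI[OF assms(3) p_linear(3,3)]) (simp add: p_pow add_ac)
  qed
qed

lemma p_assoc:
  assumes "a \<in> cyc X" "b \<in> cyc X" "c \<in> cyc X" "d \<in> cyc X" "e \<in> cyc X"
  shows "p (p a b c) d e = p a b (p c d e)"
proof -
  have lin: "linear (\<lambda>x. p (f x) d e)" "linear (\<lambda>x. p a' b' (f x))" if "linear f" for f d e a' b'
    using linear_compose[OF that p_linear(1), of d e] linear_compose[OF that p_linear(3), of a' b']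
    by (simp_all add: o_def)
  show ?thesis
  proof (rule cyc_eqI[OF assms(1) lin(1)[OF p_linear(1)] p_linear(1)])
    fix i show "p (p (pow X i) b c) d e = p (pow X i) b (p c d e)"
    proof (rule cyc_eqI[OF assms(2) lin(1)[OF p_linear(2)] p_linear(2)])
      fix j show "p (p (pow X i) (pow X j) c) d e = p (pow X i) (pow X j) (p c d e)"
      proof (rule cyc_eqI[OF assms(3) lin(1)[OF p_linear(3)] lin(2)[OF p_linear(1)]])
        fix k show "p (p (pow X i) (pow X j) (pow X k)) d e = p (pow X i) (pow X j) (p (pow X k) d e)"
        proof (rule cyc_eqI[OF assms(4) p_linear(2) lin(2)[OF p_linear(2)]])
          fix l show "p (p (pow X i) (pow X j) (pow X k)) (pow X l) e
              = p (pow X i) (pow X j) (p (pow X k) (pow X l) e)"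
            by (rule cyc_eqI[OF assms(5) p_linear(3) lin(2)[OF p_linear(3)]]) (simp add: p_pow add_ac)
        qed
      qed
    qed
  qed
qed

end

section \<open>The connection along complex lines\<close>

lemma compact_family_bound:
  fixes M :: "'a::topological_space \<Rightarrow> 'b::euclidean_space \<Rightarrow> 'c::real_normed_vector"
  assumes "compact S" "\<And>z. z \<in> S \<Longrightarrow> linear (M z)" "\<And>v. continuous_on S (\<lambda>z. M z v)"
  obtains C where "0 \<le> C" "\<And>z y. z \<in> S \<Longrightarrow> norm (M z y) \<le> C * norm y"
proof -
  have "continuous_on S (\<lambda>z. \<Sum>b\<in>Basis. norm (M z b))"
    using assms(3) by (intro continuous_on_sum continuous_on_norm)
  then have "bounded ((\<lambda>z. \<Sum>b\<in>Basis. norm (M z b)) ` S)"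
    using assms(1) compact_continuous_image compact_imp_bounded by blast
  then obtain C where C: "\<And>z. z \<in> S \<Longrightarrow> norm (\<Sum>b\<in>Basis. norm (M z b)) \<le> C"
    unfolding bounded_iff by auto
  have "norm (M z y) \<le> max 0 C * norm y" if z: "z \<in> S" for z y
  proof -
    have "norm (M z y) = norm (\<Sum>b\<in>Basis. (y \<bullet> b) *\<^sub>R M z b)"
      using linear_expand_Basis[OF assms(2)[OF z], of y] by (rule arg_cong)
    also have "\<dots> \<le> (\<Sum>b\<in>Basis. norm ((y \<bullet> b) *\<^sub>R M z b))" by (rule norm_sum)
    also have "\<dots> \<le> (\<Sum>b\<in>Basis. norm y * norm (M z b))"
      by (intro sum_mono) (auto intro!: mult_right_mono simp: Basis_le_norm)
    also have "\<dots> = (\<Sum>b\<in>Basis. norm (M z b)) * norm y" by (simp add: sum_distrib_left mult.commute)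
    also have "\<dots> \<le> max 0 C * norm y"
      using C[OF z] by (intro mult_right_mono) auto
    finally show ?thesis .
  qed
  then show thesis using that[of "max 0 C"] by simp
qed

text \<open>Loosely speaking, \<open>G\<close> lies in the ideal generated by the unknowns
  \<open>F\<close>: these are the conditions that \<open>cr_system_unique\<close> puts on d/dzbar,
  in a form stable under sums and smooth linear families. The bound refers to a closed disc of
  radius \<open>r\<close>, later smaller than \<open>R\<close>, so that compactness bounds the
  coefficients.\<close>

definition controlled :: "real \<Rightarrow> real \<Rightarrow> 'j set \<Rightarrow> ('j \<Rightarrow> complex \<Rightarrow> 'e::euclidean_space) \<Rightarrow> (complex \<Rightarrow> 'e) \<Rightarrow> bool" where
  "controlled R r J F G \<longleftrightarrow> smooth_on G (ball 0 R) \<and>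
     (\<forall>k. (\<forall>j\<in>J. vanishes k (F j)) \<longrightarrow> vanishes k G) \<and>
     (\<exists>C. \<forall>z\<in>cball 0 r. norm (G z) \<le> C * (\<Sum>j\<in>J. norm (F j z)))"

lemma controlled_self:
  assumes "finite J" "j \<in> J" "smooth_on (F j) (ball 0 R)"
  shows "controlled R r J F (F j)"
proof -
  have "norm (F j z) \<le> 1 * (\<Sum>j\<in>J. norm (F j z))" for z
    using assms(1,2) member_le_sum[of j J "\<lambda>j. norm (F j z)"] by simp
  then show ?thesis using assms unfolding controlled_def by blast
qed

lemma controlled_add:
  assumes "0 < R" "controlled R r J F G" "controlled R r J F H"
  shows "controlled R r J F (\<lambda>z. G z + H z)"
proof -
  have U: "open (ball (0::complex) R)" "0 \<in> ball (0::complex) R" using assms(1) by auto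
  obtain C D where CD: "\<And>z. z \<in> cball 0 r \<Longrightarrow> norm (G z) \<le> C * (\<Sum>j\<in>J. norm (F j z))"
    "\<And>z. z \<in> cball 0 r \<Longrightarrow> norm (H z) \<le> D * (\<Sum>j\<in>J. norm (F j z))"
    using assms(2,3) unfolding controlled_def by blast
  have "norm (G z + H z) \<le> (C + D) * (\<Sum>j\<in>J. norm (F j z))" if "z \<in> cball 0 r" for z
    using norm_triangle_ineq[of "G z" "H z"] CD[OF that] by (simp add: distrib_right)
  moreover have "smooth_on (\<lambda>z. G z + H z) (ball 0 R)"
    using assms(2,3) by (intro smooth_on_add U(1)) (auto simp: controlled_def)
  moreover have "vanishes k (\<lambda>z. G z + H z)" if "\<forall>j\<in>J. vanishes k (F j)" for k
    using assms(2,3) that by (intro vanishes_add[OF U]) (auto simp: controlled_def)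
  ultimately show ?thesis unfolding controlled_def by blast
qed

lemma controlled_zero: "0 < R \<Longrightarrow> controlled R r J F (\<lambda>z. 0)"
  unfolding controlled_def
  using smooth_on_const[of "ball (0::complex) R" 0] vanishes_const0 by (auto intro!: exI[of _ 0])

lemma controlled_sum:
  assumes "0 < R" "finite T" "\<And>i. i \<in> T \<Longrightarrow> controlled R r J F (G i)"
  shows "controlled R r J F (\<lambda>z. \<Sum>i\<in>T. G i z)"
  using assms(2,3)
  by (induction T rule: finite_induct) (simp_all add: controlled_zero controlled_add assms(1))

lemma controlled_apply:
  assumes R: "0 < R" "r < R" and M: "\<And>z. z \<in> ball 0 R \<Longrightarrow> linear (M z)" "\<And>v. smooth_on (\<lambda>z. M z v) (ball 0 R)"
    and G: "controlled R r J F G"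
  shows "controlled R r J F (\<lambda>z. M z (G z))"
proof -
  have U: "open (ball (0::complex) R)" "0 \<in> ball (0::complex) R" "cball 0 r \<subseteq> ball (0::complex) R" using R by auto
  have sG: "smooth_on G (ball 0 R)" using G by (simp add: controlled_def)
  obtain C where C: "\<And>z. z \<in> cball 0 r \<Longrightarrow> norm (G z) \<le> C * (\<Sum>j\<in>J. norm (F j z))"
    using G unfolding controlled_def by blast
  have lin: "linear (M z)" if "z \<in> cball 0 r" for z using that U(3) by (intro M(1)) auto
  have cont: "continuous_on (cball 0 r) (\<lambda>z. M z v)" for v
    by (rule continuous_on_subset[OF smooth_on_continuous[OF M(2)] U(3)])
  obtain D where D: "0 \<le> D" "\<And>z y. z \<in> cball 0 r \<Longrightarrow> norm (M z y) \<le> D * norm y"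
    using compact_family_bound[OF compact_cball lin cont] by blast
  have "norm (M z (G z)) \<le> (D * C) * (\<Sum>j\<in>J. norm (F j z))" if "z \<in> cball 0 r" for z
    using D(2)[OF that, of "G z"] mult_left_mono[OF C[OF that] D(1)] by (simp add: mult.assoc)
  moreover have "smooth_on (\<lambda>z. M z (G z)) (ball 0 R)" by (rule smooth_on_apply[OF U(1) M sG])
  moreover have "vanishes k (\<lambda>z. M z (G z))" if "\<forall>j\<in>J. vanishes k (F j)" for k
    using that G by (intro vanishes_apply[OF U(1,2) M sG]) (auto simp: controlled_def)
  ultimately show ?thesis unfolding controlled_def by blast
qed

lemma controlled_cong:
  assumes "0 < R" "r < R" "\<And>z. z \<in> ball 0 R \<Longrightarrow> G z = H z" "controlled R r J F G"
  shows "controlled R r J F H"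
proof -
  have U: "open (ball (0::complex) R)" "0 \<in> ball (0::complex) R" "cball 0 r \<subseteq> ball (0::complex) R" using assms by auto
  have "G z = H z" if "z \<in> cball 0 r" for z using that U(3) assms(3) by blast
  moreover obtain C where "\<forall>z\<in>cball 0 r. norm (G z) \<le> C * (\<Sum>j\<in>J. norm (F j z))"
    using assms(4) unfolding controlled_def by blast
  ultimately have "\<forall>z\<in>cball 0 r. norm (H z) \<le> C * (\<Sum>j\<in>J. norm (F j z))" by simp
  moreover have "smooth_on H (ball 0 R)"
    by (rule smooth_on_cong[OF U(1) assms(3)]) (use assms(4) in \<open>auto simp: controlled_def\<close>)
  moreover have "vanishes k H" if "\<forall>j\<in>J. vanishes k (F j)" for k
    by (rule vanishes_cong[OF U(1,2) assms(3)]) (use assms(4) that in \<open>auto simp: controlled_def\<close>)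
  ultimately show ?thesis unfolding controlled_def by blast
qed

lemma (in complex_structure) controlled_system_unique:
  fixes F :: "'j \<Rightarrow> complex \<Rightarrow> 'e"
  assumes R: "0 < r" "r < R" and J: "finite J" and F: "\<And>j. j \<in> J \<Longrightarrow> smooth_on (F j) (ball 0 R)"
    and jets: "\<And>j n. j \<in> J \<Longrightarrow> hjet I n (F j)"
    and ctrl: "\<And>j. j \<in> J \<Longrightarrow> controlled R r J F (dlb I (F j))"
    and z: "norm z < r" and j: "j \<in> J"
  shows "F j z = 0"
proof -
  obtain C where C: "\<And>j z. j \<in> J \<Longrightarrow> z \<in> cball 0 r \<Longrightarrow> norm (dlb I (F j) z) \<le> C j * (\<Sum>j\<in>J. norm (F j z))"
    using ctrl unfolding controlled_def by metis
  show ?thesis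
  proof (rule cr_system_unique[OF J _ jets _ _ z j, where C = "\<Sum>j\<in>J. \<bar>C j\<bar>"])
    show "smooth_on (F j) (ball 0 r)" if "j \<in> J" for j
      using F[OF that] R by (rule_tac smooth_on_subset) auto
    show "vanishes k (dlb I (F j))" if "\<And>j. j \<in> J \<Longrightarrow> vanishes k (F j)" "j \<in> J" for k j
      using ctrl[OF that(2)] that(1) by (auto simp: controlled_def)
    show "norm (dlb I (F j) z) \<le> (\<Sum>j\<in>J. \<bar>C j\<bar>) * (\<Sum>k\<in>J. norm (F k z))" if "norm z < r" "j \<in> J" for z j
    proof -
      have "norm (dlb I (F j) z) \<le> C j * (\<Sum>k\<in>J. norm (F k z))" using C[OF that(2), of z] that by simp
      also have "\<dots> \<le> (\<Sum>j\<in>J. \<bar>C j\<bar>) * (\<Sum>k\<in>J. norm (F k z))"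
        using member_le_sum[OF that(2), of "\<lambda>j. \<bar>C j\<bar>"] J
        by (intro mult_right_mono sum_nonneg) (auto intro: order_trans[OF abs_ge_self])
      finally show ?thesis .
    qed
  qed
qed

text \<open>\<open>\<Gamma>\<close> is the Levi-Civita connection in Kaehler normal coordinates. In \<open>parallel\<close>, \<open>Rm\<close> just
  abbreviates its curvature. \<open>\<Gamma>_jets\<close> is what the normal form of the potential amounts to:
  along complex lines through \<open>0\<close>, \<open>\<Gamma>\<close> has no holomorphic derivatives at \<open>0\<close>.\<close>

locale symmetric_germ = complex_structure I for I :: "'e::euclidean_space \<Rightarrow> 'e" +
  fixes \<Gamma> :: "'e \<Rightarrow> 'e \<Rightarrow> 'e \<Rightarrow> 'e" and r0 :: real
  assumes r0: "0 < r0"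
    and \<Gamma>_linear: "x \<in> ball 0 r0 \<Longrightarrow> linear (\<Gamma> x u)"
    and \<Gamma>_sym: "x \<in> ball 0 r0 \<Longrightarrow> \<Gamma> x u v = \<Gamma> x v u"
    and \<Gamma>_I: "x \<in> ball 0 r0 \<Longrightarrow> \<Gamma> x u (I v) = I (\<Gamma> x u v)"
    and \<Gamma>_smooth: "smooth_on (\<lambda>x. \<Gamma> x u v) (ball 0 r0)"
    and parallel: "\<And>Rm x m u v w. (\<And>x u v w. x \<in> ball 0 r0 \<Longrightarrow> Rm x u v w = dir_deriv (\<lambda>y. \<Gamma> y v w) x u - dir_deriv (\<lambda>y. \<Gamma> y u w) x v
        + \<Gamma> x u (\<Gamma> x v w) - \<Gamma> x v (\<Gamma> x u w)) \<Longrightarrow> x \<in> ball 0 r0 \<Longrightarrow>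
        dir_deriv (\<lambda>y. Rm y u v w) x m + \<Gamma> x m (Rm x u v w)
          = Rm x (\<Gamma> x m u) v w + Rm x u (\<Gamma> x m v) w + Rm x u v (\<Gamma> x m w)"
    and \<Gamma>_jets: "hjet I n (\<lambda>l. \<Gamma> (cs l z) u v)"
begin

abbreviation "V \<equiv> ball 0 r0 :: 'e set"

lemma V0: "open V" "0 \<in> V" using r0 by auto

lemma \<Gamma>_linear1: "x \<in> V \<Longrightarrow> linear (\<lambda>u. \<Gamma> x u v)"
proof -
  assume x: "x \<in> V"
  have "(\<lambda>u. \<Gamma> x u v) = \<Gamma> x v" using \<Gamma>_sym[OF x] by auto
  then show ?thesis using \<Gamma>_linear[OF x] by simp
qed

lemma \<Gamma>_I1: "x \<in> V \<Longrightarrow> \<Gamma> x (I u) v = I (\<Gamma> x u v)"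
  using \<Gamma>_sym \<Gamma>_I by metis

definition D\<Gamma> where "D\<Gamma> m x u v = dir_deriv (\<lambda>y. \<Gamma> y u v) x m"

definition Rm where "Rm x u v w = D\<Gamma> u x v w - D\<Gamma> v x u w + \<Gamma> x u (\<Gamma> x v w) - \<Gamma> x v (\<Gamma> x u w)"

text \<open>The component of the curvature that is antilinear in \<open>u\<close>; it determines \<open>Rm\<close>.\<close>

definition rho where "rho x u v w = (1 / 2) *\<^sub>R (D\<Gamma> u x v w + I (D\<Gamma> (I u) x v w))"

lemma D\<Gamma>_smooth: "smooth_on (\<lambda>x. D\<Gamma> m x u v) V"
  unfolding D\<Gamma>_def by (rule smooth_on_dir_deriv[OF \<Gamma>_smooth])

lemma D\<Gamma>_linear: "x \<in> V \<Longrightarrow> linear (\<lambda>m. D\<Gamma> m x u v)" "x \<in> V \<Longrightarrow> linear (\<lambda>u. D\<Gamma> m x u v)"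
    "x \<in> V \<Longrightarrow> linear (\<lambda>v. D\<Gamma> m x u v)"
  unfolding D\<Gamma>_def
  by (rule smooth_on_linear_dir_deriv[OF V0(1) \<Gamma>_smooth]
      linear_dir_deriv_family[OF V0(1) _ \<Gamma>_linear1 \<Gamma>_smooth]
      linear_dir_deriv_family[OF V0(1) _ \<Gamma>_linear \<Gamma>_smooth]; assumption)+

lemma D\<Gamma>_sym: "x \<in> V \<Longrightarrow> D\<Gamma> m x u v = D\<Gamma> m x v u"
  unfolding D\<Gamma>_def using dir_deriv_cong_open[OF V0(1), of x "\<lambda>y. \<Gamma> y u v" "\<lambda>y. \<Gamma> y v u"] \<Gamma>_sym by simp

lemma D\<Gamma>_I: "x \<in> V \<Longrightarrow> D\<Gamma> m x u (I v) = I (D\<Gamma> m x u v)"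
  unfolding D\<Gamma>_def using dir_deriv_cong_open[OF V0(1), of x "\<lambda>y. \<Gamma> y u (I v)" "\<lambda>y. I (\<Gamma> y u v)"] \<Gamma>_I
    dir_deriv_bounded_linear[OF V0(1) _ \<Gamma>_smooth bounded_linear_I] by simp

lemma D\<Gamma>_I1: "x \<in> V \<Longrightarrow> D\<Gamma> m x (I u) v = I (D\<Gamma> m x u v)"
  using D\<Gamma>_sym D\<Gamma>_I by metis

lemma rho_linear: "x \<in> V \<Longrightarrow> linear (\<lambda>u. rho x u v w)" "x \<in> V \<Longrightarrow> linear (\<lambda>v. rho x u v w)"
    "x \<in> V \<Longrightarrow> linear (\<lambda>w. rho x u v w)"
  unfolding rho_def
  by (rule linearI; simp add: linear_add[OF D\<Gamma>_linear(1)] linear_scale[OF D\<Gamma>_linear(1)]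
      linear_add[OF D\<Gamma>_linear(2)] linear_scale[OF D\<Gamma>_linear(2)]
      linear_add[OF D\<Gamma>_linear(3)] linear_scale[OF D\<Gamma>_linear(3)] algebra_simps)+

lemma rho_I: "x \<in> V \<Longrightarrow> rho x (I u) v w = - I (rho x u v w)" "x \<in> V \<Longrightarrow> rho x u (I v) w = I (rho x u v w)"
    "x \<in> V \<Longrightarrow> rho x u v (I w) = I (rho x u v w)"
  unfolding rho_def by (simp_all add: D\<Gamma>_I D\<Gamma>_I1 linear_neg[OF D\<Gamma>_linear(1)] algebra_simps)

lemma rho_sym: "x \<in> V \<Longrightarrow> rho x u v w = rho x u w v"
  unfolding rho_def by (simp add: D\<Gamma>_sym[of x _ v w])

lemma smooth_on_I_V: "smooth_on F V \<Longrightarrow> smooth_on (\<lambda>x. I (F x)) V"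
  by (rule smooth_on_bounded_linear[OF V0(1) bounded_linear_I])

lemma rho_smooth: "smooth_on (\<lambda>x. rho x u v w) V"
  unfolding rho_def
  by (intro smooth_on_scaleR smooth_on_const smooth_on_add smooth_on_I_V D\<Gamma>_smooth V0)

text \<open>The other three terms of \<open>Rm\<close> are complex linear in \<open>u\<close> and
  drop out of the antilinear part.\<close>

lemma rho_Rm: "x \<in> V \<Longrightarrow> rho x u v w = (1 / 2) *\<^sub>R (Rm x u v w + I (Rm x (I u) v w))"
  unfolding rho_def Rm_def by (simp add: D\<Gamma>_I1 \<Gamma>_I1 \<Gamma>_I algebra_simps)

lemma Rm_smooth: "smooth_on (\<lambda>x. Rm x u v w) V"
proof -
  have "smooth_on (\<lambda>x. \<Gamma> x u (\<Gamma> x v w)) V" for u v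
    by (rule smooth_on_apply[OF V0(1) \<Gamma>_linear \<Gamma>_smooth \<Gamma>_smooth])
  then show ?thesis
    unfolding Rm_def by (intro smooth_on_add smooth_on_diff D\<Gamma>_smooth V0(1))
qed

text \<open>As \<Gamma> is complex linear, taking the antilinear part commutes with covariant
  differentiation, and \<open>rho\<close> inherits parallelism from \<open>Rm\<close>.\<close>

lemma dir_deriv_rho:
  assumes x: "x \<in> V"
  shows "dir_deriv (\<lambda>y. rho y u v w) x m = rho x (\<Gamma> x m u) v w + rho x u (\<Gamma> x m v) w
    + rho x u v (\<Gamma> x m w) - \<Gamma> x m (rho x u v w)"
proof -
  have par: "dir_deriv (\<lambda>y. Rm y u v w) x m = Rm x (\<Gamma> x m u) v w + Rm x u (\<Gamma> x m v) w + Rm x u v (\<Gamma> x m w)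
      - \<Gamma> x m (Rm x u v w)" for u
    using parallel[of Rm x u v w m] x by (simp add: Rm_def D\<Gamma>_def algebra_simps)
  have "dir_deriv (\<lambda>y. rho y u v w) x m
      = dir_deriv (\<lambda>y. (1 / 2) *\<^sub>R (Rm y u v w + I (Rm y (I u) v w))) x m"
    using dir_deriv_cong_open[OF V0(1) x, of "\<lambda>y. rho y u v w"] rho_Rm by simp
  also have "\<dots> = (1 / 2) *\<^sub>R (dir_deriv (\<lambda>y. Rm y u v w) x m + I (dir_deriv (\<lambda>y. Rm y (I u) v w) x m))"
    using x by (simp only: dir_deriv_bounded_linear[OF V0(1) x _ bounded_linear_scaleR_right] smooth_on_add[OF V0(1)]
        dir_deriv_add[OF V0(1) x] Rm_smooth smooth_on_I_V dir_deriv_bounded_linear[OF V0(1) x Rm_smooth bounded_linear_I])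
  also have "\<dots> = rho x (\<Gamma> x m u) v w + rho x u (\<Gamma> x m v) w + rho x u v (\<Gamma> x m w) - \<Gamma> x m (rho x u v w)"
    unfolding par rho_Rm[OF x]
    by (simp add: \<Gamma>_I[OF x] linear_add[OF \<Gamma>_linear[OF x]] linear_scale[OF \<Gamma>_linear[OF x]] algebra_simps)
  finally show ?thesis .
qed

section \<open>The curvature at the origin as a triple product\<close>

abbreviation "p \<equiv> rho 0"

lemma \<Gamma>_0: "\<Gamma> 0 u v = 0"
  using \<Gamma>_jets[of 1 0 u v] by (simp add: cs_simps)

lemma cs_line: "((\<lambda>l. cs l z) has_derivative (\<lambda>l. cs l z)) (at l)"
  by (rule bounded_linear_imp_has_derivative[OF bounded_bilinear.bounded_linear_left[OF bounded_bilinear_cs]])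

lemma smooth_on_cs_line: "open U \<Longrightarrow> smooth_on (\<lambda>l. cs l z) U"
  by (rule smooth_on_bounded_linear[OF _ bounded_bilinear.bounded_linear_left[OF bounded_bilinear_cs] smooth_on_ident])

lemma dir_deriv_line:
  assumes "smooth_on f V" "cs l z \<in> V"
  shows "dir_deriv (\<lambda>l. f (cs l z)) l v = dir_deriv f (cs l z) (cs v z)"
  by (rule dir_deriv_eq[OF has_derivative_compose[OF cs_line smooth_on_has_derivative[OF V0(1) assms]]])

text \<open>The jet condition of order 2 kills the complex linear part of the derivative of \<Gamma>
  at 0; the antilinear part remains.\<close>

lemma D\<Gamma>_0: "D\<Gamma> m 0 u v = p m u v"
proof -
  have "dl I (\<lambda>l. \<Gamma> (cs l m) u v) 0 = 0" using \<Gamma>_jets[of 2 m u v] by (simp add: numeral_2_eq_2)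
  then have "D\<Gamma> m 0 u v = I (D\<Gamma> (I m) 0 u v)"
    using r0 by (simp add: dl_def dir_deriv_line[OF \<Gamma>_smooth] cs_simps D\<Gamma>_def)
  then show ?thesis by (simp add: rho_def flip: scaleR_2)
qed

lemma p_simps:
  "p (u + u') v w = p u v w + p u' v w" "p u (v + v') w = p u v w + p u v' w" "p u v (w + w') = p u v w + p u v w'"
  "p (u - u') v w = p u v w - p u' v w" "p u (v - v') w = p u v w - p u v' w" "p u v (w - w') = p u v w - p u v w'"
  "p (c *\<^sub>R u) v w = c *\<^sub>R p u v w" "p u (c *\<^sub>R v) w = c *\<^sub>R p u v w" "p u v (c *\<^sub>R w) = c *\<^sub>R p u v w"
  "p (- u) v w = - p u v w" "p u (- v) w = - p u v w" "p u v (- w) = - p u v w"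
  "p (I u) v w = - I (p u v w)" "p u (I v) w = I (p u v w)" "p u v (I w) = I (p u v w)"
  using rho_linear[OF V0(2)] rho_I[OF V0(2)]
  by (simp_all add: linear_iff linear_diff[of "\<lambda>u. p u v w"] linear_diff[of "\<lambda>v. p u v w"] linear_diff[of "\<lambda>w. p u v w"]
      linear_neg[of "\<lambda>u. p u v w"] linear_neg[of "\<lambda>v. p u v w"] linear_neg[of "\<lambda>w. p u v w"])

text \<open>The Ricci identity for the parallel tensor \<open>rho\<close>.\<close>

lemma curvature_derivation:
  defines "R \<equiv> \<lambda>n m x. p n m x - p m n x"
  shows "R n m (p u v w) = p (R n m u) v w + p u (R n m v) w + p u v (R n m w)"
proof -
  note V = V0
  \<comment> \<open>At 0 the connection vanishes and its derivative is \<open>p\<close>, so only the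
    terms in which \<Gamma> is differentiated survive.\<close>
  have D2: "dir_deriv (\<lambda>y. dir_deriv (\<lambda>y. rho y u v w) y m) 0 n
    = p (p n m u) v w + p u (p n m v) w + p u v (p n m w) - p n m (p u v w)" for n m
  proof -
    have dG: "dir_deriv (\<lambda>y. \<Gamma> y m u) 0 n = p n m u" for u using D\<Gamma>_0[of n m u] by (simp add: D\<Gamma>_def)
    have s1: "smooth_on (\<lambda>y. rho y (\<Gamma> y m u) v w) V"
      by (rule smooth_on_apply[where L = "\<lambda>y a. rho y a v w", OF V(1) rho_linear(1) rho_smooth \<Gamma>_smooth])
    have s2: "smooth_on (\<lambda>y. rho y u (\<Gamma> y m v) w) V"
      by (rule smooth_on_apply[where L = "\<lambda>y a. rho y u a w", OF V(1) rho_linear(2) rho_smooth \<Gamma>_smooth])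
    have s3: "smooth_on (\<lambda>y. rho y u v (\<Gamma> y m w)) V"
      by (rule smooth_on_apply[where L = "\<lambda>y a. rho y u v a", OF V(1) rho_linear(3) rho_smooth \<Gamma>_smooth])
    have s4: "smooth_on (\<lambda>y. \<Gamma> y m (rho y u v w)) V"
      by (rule smooth_on_apply[OF V(1) \<Gamma>_linear \<Gamma>_smooth rho_smooth])
    have zero: "dir_deriv (\<lambda>y. rho y 0 v w) 0 n = 0" "dir_deriv (\<lambda>y. rho y u 0 w) 0 n = 0" "dir_deriv (\<lambda>y. rho y u v 0) 0 n = 0"
      using dir_deriv_cong_open[OF V, of "\<lambda>y. rho y 0 v w" "\<lambda>y. 0"] dir_deriv_cong_open[OF V, of "\<lambda>y. rho y u 0 w" "\<lambda>y. 0"]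
        dir_deriv_cong_open[OF V, of "\<lambda>y. rho y u v 0" "\<lambda>y. 0"]
        linear_0[OF rho_linear(1)] linear_0[OF rho_linear(2)] linear_0[OF rho_linear(3)] by simp_all
    have "dir_deriv (\<lambda>y. dir_deriv (\<lambda>y. rho y u v w) y m) 0 n
      = dir_deriv (\<lambda>x. rho x (\<Gamma> x m u) v w + rho x u (\<Gamma> x m v) w + rho x u v (\<Gamma> x m w) - \<Gamma> x m (rho x u v w)) 0 n"
      using dir_deriv_cong_open[OF V, of "\<lambda>y. dir_deriv (\<lambda>y. rho y u v w) y m"] dir_deriv_rho by simp
    also have "\<dots> = dir_deriv (\<lambda>x. rho x (\<Gamma> x m u) v w) 0 n + dir_deriv (\<lambda>x. rho x u (\<Gamma> x m v) w) 0 n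
       + dir_deriv (\<lambda>x. rho x u v (\<Gamma> x m w)) 0 n - dir_deriv (\<lambda>x. \<Gamma> x m (rho x u v w)) 0 n"
      by (simp only: dir_deriv_diff[OF V] dir_deriv_add[OF V] smooth_on_add[OF V(1)] s1 s2 s3 s4)
    also have "dir_deriv (\<lambda>x. rho x (\<Gamma> x m u) v w) 0 n = p (p n m u) v w"
      using dir_deriv_apply[where L = "\<lambda>y a. rho y a v w", OF V rho_linear(1) rho_smooth \<Gamma>_smooth] by (simp add: \<Gamma>_0 zero dG)
    also have "dir_deriv (\<lambda>x. rho x u (\<Gamma> x m v) w) 0 n = p u (p n m v) w"
      using dir_deriv_apply[where L = "\<lambda>y a. rho y u a w", OF V rho_linear(2) rho_smooth \<Gamma>_smooth] by (simp add: \<Gamma>_0 zero dG)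
    also have "dir_deriv (\<lambda>x. rho x u v (\<Gamma> x m w)) 0 n = p u v (p n m w)"
      using dir_deriv_apply[where L = "\<lambda>y a. rho y u v a", OF V rho_linear(3) rho_smooth \<Gamma>_smooth] by (simp add: \<Gamma>_0 zero dG)
    also have "dir_deriv (\<lambda>x. \<Gamma> x m (rho x u v w)) 0 n = p n m (p u v w)"
      using dir_deriv_apply[OF V \<Gamma>_linear \<Gamma>_smooth rho_smooth] by (simp add: \<Gamma>_0 dG)
    finally show ?thesis .
  qed
  show ?thesis
    using D2[of m n] D2[of n m] dir_deriv_commute[OF V rho_smooth, of u v w m n]
    by (simp add: R_def p_simps algebra_simps)
qed

text \<open>This is the component of \<open>curvature_derivation\<close> that is antilinear in
  \<open>m\<close>. The first slot of \<open>p\<close> is itself antilinear, which is why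
  \<open>p n m\<close> appears there in place of \<open>p m n\<close>, with the opposite
  sign.\<close>

lemma jordan_identity: "p (p n m u) v w = p u (p m n v) w + p u v (p m n w) - p m n (p u v w)"
proof -
  define q where "q = p u v w"
  have 1: "p n m q - p m n q = p (p n m u) v w - p (p m n u) v w + (p u (p n m v) w - p u (p m n v) w)
      + (p u v (p n m w) - p u v (p m n w))"
    using curvature_derivation[of n m u v w] by (simp add: p_simps q_def)
  \<comment> \<open>The derivation property with \<open>I m\<close> in place of \<open>m\<close>,
    which flips the relative sign of \<open>p m n\<close>.\<close>
  have "I (p n m q + p m n q) = I (- p (p n m u) v w - p (p m n u) v w + (p u (p n m v) w + p u (p m n v) w)
      + (p u v (p n m w) + p u v (p m n w)))"
    using curvature_derivation[of n "I m" u v w] by (simp add: p_simps q_def algebra_simps)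
  then have 2: "p n m q + p m n q = - p (p n m u) v w - p (p m n u) v w + (p u (p n m v) w + p u (p m n v) w)
      + (p u v (p n m w) + p u v (p m n w))"
    by (metis I_I neg_equal_iff_equal)
  have "x = y' + z' - b"
    if a: "a - b = x - x' + (y - y') + (z - z')" "a + b = - x - x' + (y + y') + (z + z')"
    for a b x x' y y' z z' :: 'e
  proof -
    have "a = b + (x - x' + (y - y') + (z - z'))" using a(1) by (simp add: algebra_simps)
    with a(2) have "2 *\<^sub>R (b + x) = 2 *\<^sub>R (y' + z')" by (simp add: scaleR_2 algebra_simps)
    then have "b + x = y' + z'" by (metis scaleR_cancel_left zero_neq_numeral)
    then show ?thesis by (simp add: algebra_simps)
  qed
  from this[OF 1 2] show ?thesis by (simp add: q_def)
qed

sublocale jordan_triple p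
  by unfold_locales (simp_all add: p_simps rho_sym[OF V0(2)] jordan_identity)

end

section \<open>The Cauchy-Riemann system on a complex line\<close>

context complex_structure
begin

text \<open>The assumed derivative is that of a function of |l|^2; for such a function d/dlbar is
  \<open>l\<close> times the derivative by |l|^2, here \<open>w / 2\<close>.\<close>

lemma dlb_radial:
  assumes "(G has_derivative (\<lambda>h. (l \<bullet> h) *\<^sub>R w)) (at l)"
  shows "dlb I G l = (1 / 2) *\<^sub>R cs l w"
  unfolding dlb_def dir_deriv_eq[OF assms] by (simp add: cs_def inner_complex_def)

lemma dlb_cs_cnj:
  assumes U: "open U" "l \<in> U" and G: "smooth_on G U"
  shows "dlb I (\<lambda>l. cs (cnj l) (G l)) l = G l + cs (cnj l) (dlb I G l)"
proof -
  have "(cnj has_derivative cnj) (at l)" by (rule bounded_linear_imp_has_derivative[OF bounded_linear_cnj])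
  then have D: "dir_deriv (\<lambda>l. cs (cnj l) (G l)) l v = cs (cnj l) (dir_deriv G l v) + cs (cnj v) (G l)" for v
    using dir_deriv_eq[OF bounded_bilinear.FDERIV[OF bounded_bilinear_cs _ smooth_on_has_derivative[OF U(1) G U(2)]]]
    by blast
  show ?thesis
    unfolding dlb_def D by (simp add: cs_def algebra_simps, simp flip: scaleR_2 scaleR_add_left)
qed

end

context symmetric_germ
begin

lemma rho_cs: "x \<in> V \<Longrightarrow> rho x (cs k y) v w = cs (cnj k) (rho x y v w)"
  unfolding cs_def
  by (simp add: linear_add[OF rho_linear(1)] linear_scale[OF rho_linear(1)] rho_I)

text \<open>d/dlbar takes the antilinear part of the derivative in the direction \<open>z\<close>,
  which for \<Gamma> is \<open>rho\<close> by definition: the first equation of the system.\<close>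

lemma dlb_\<Gamma>_line:
  assumes "cs l z \<in> V"
  shows "dlb I (\<lambda>l. \<Gamma> (cs l z) v w) l = rho (cs l z) z v w"
  unfolding dlb_def dir_deriv_line[OF \<Gamma>_smooth assms] cs_simps by (simp add: rho_def D\<Gamma>_def)

text \<open>In \<open>dir_deriv_rho\<close> only the term entering the antilinear slot is antilinear
  in the direction; the other three make up \<open>dl_rho_line\<close>. The system is thereby
  closed.\<close>

lemma dlb_rho_line:
  assumes "cs l z \<in> V"
  shows "dlb I (\<lambda>l. rho (cs l z) u v w) l = rho (cs l z) (\<Gamma> (cs l z) z u) v w"
  unfolding dlb_def dir_deriv_line[OF rho_smooth assms] cs_simps dir_deriv_rho[OF assms]
  by (simp add: \<Gamma>_I1[OF assms] rho_I[OF assms] algebra_simps, simp flip: scaleR_2 scaleR_add_left)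

lemma dl_rho_line:
  assumes "cs l z \<in> V"
  shows "dl I (\<lambda>l. rho (cs l z) u v w) l = rho (cs l z) u (\<Gamma> (cs l z) z v) w
    + rho (cs l z) u v (\<Gamma> (cs l z) z w) - \<Gamma> (cs l z) z (rho (cs l z) u v w)"
  unfolding dl_def dir_deriv_line[OF rho_smooth assms] cs_simps dir_deriv_rho[OF assms]
  by (simp add: \<Gamma>_I1[OF assms] rho_I[OF assms] algebra_simps, simp flip: scaleR_2 scaleR_add_left)

text \<open>The d/dl of the curvature is a sum of terms containing \<Gamma>, all with vanishing
  holomorphic jet, so the holomorphic jet of the curvature is that of the constant
  \<open>p u v w\<close>.\<close>

lemma hjet_rho_line:
  assumes U: "open U" "0 \<in> U" and dom: "\<And>l. l \<in> U \<Longrightarrow> cs l z \<in> V"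
  shows "hjet I n (\<lambda>l. rho (cs l z) u v w - p u v w)"
proof (cases n)
  case (Suc m)
  have sline: "smooth_on (\<lambda>l. f (cs l z)) U" if "smooth_on f V" for f :: "'e \<Rightarrow> 'e"
    using dom by (intro smooth_on_compose[OF U(1) V0(1) that smooth_on_cs_line[OF U(1)]]) auto
  note s\<Gamma> = sline[OF \<Gamma>_smooth] and s\<rho> = sline[OF rho_smooth]
  have "hjet I m (dl I (\<lambda>l. rho (cs l z) u v w - p u v w))"
  proof (rule hjet_cong[OF U])
    have 1: "hjet I m (\<lambda>l. rho (cs l z) u (\<Gamma> (cs l z) z v) w)"
      by (rule hjet_apply[where M = "\<lambda>l a. rho (cs l z) u a w", OF complex_structure_I complex_structure_I U
            rho_linear(2)[OF dom] s\<rho> rho_I(2)[OF dom] s\<Gamma> \<Gamma>_jets])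
    have 2: "hjet I m (\<lambda>l. rho (cs l z) u v (\<Gamma> (cs l z) z w))"
      by (rule hjet_apply[where M = "\<lambda>l a. rho (cs l z) u v a", OF complex_structure_I complex_structure_I U
            rho_linear(3)[OF dom] s\<rho> rho_I(3)[OF dom] s\<Gamma> \<Gamma>_jets])
    have 3: "hjet I m (\<lambda>l. \<Gamma> (cs l z) z (rho (cs l z) u v w))"
      by (rule hjet_family[where M = "\<lambda>l a. \<Gamma> (cs l z) z a", OF U \<Gamma>_linear[OF dom] s\<Gamma> \<Gamma>_jets s\<rho>])
    have s1: "smooth_on (\<lambda>l. rho (cs l z) u (\<Gamma> (cs l z) z v) w) U"
      by (rule smooth_on_apply[where L = "\<lambda>l a. rho (cs l z) u a w", OF U(1) rho_linear(2)[OF dom] s\<rho> s\<Gamma>])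
    have s2: "smooth_on (\<lambda>l. rho (cs l z) u v (\<Gamma> (cs l z) z w)) U"
      by (rule smooth_on_apply[where L = "\<lambda>l a. rho (cs l z) u v a", OF U(1) rho_linear(3)[OF dom] s\<rho> s\<Gamma>])
    have s3: "smooth_on (\<lambda>l. \<Gamma> (cs l z) z (rho (cs l z) u v w)) U"
      by (rule smooth_on_apply[where L = "\<lambda>l a. \<Gamma> (cs l z) z a", OF U(1) \<Gamma>_linear[OF dom] s\<Gamma> s\<rho>])
    show "hjet I m (\<lambda>l. rho (cs l z) u (\<Gamma> (cs l z) z v) w
        + rho (cs l z) u v (\<Gamma> (cs l z) z w) - \<Gamma> (cs l z) z (rho (cs l z) u v w))"
      by (rule hjet_diff[OF complex_structure_I U smooth_on_add[OF U(1) s1 s2] s3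
            hjet_add[OF complex_structure_I U s1 s2 1 2] 3])
    show "rho (cs l z) u (\<Gamma> (cs l z) z v) w + rho (cs l z) u v (\<Gamma> (cs l z) z w) - \<Gamma> (cs l z) z (rho (cs l z) u v w)
       = dl I (\<lambda>l. rho (cs l z) u v w - p u v w) l" if "l \<in> U" for l
    proof -
      have "dl I (\<lambda>l. p u v w) l = 0" by (simp add: dl_def)
      then show ?thesis
        using dl_diff[OF U(1) s\<rho> smooth_on_const[OF U(1)] that] dl_rho_line[OF dom[OF that]] by simp
    qed
  qed
  then show ?thesis by (simp add: Suc cs_simps)
qed simp

text \<open>Along \<open>l \<mapsto> l z\<close> the pair \<open>(\<Gamma>, rho)\<close> solves a nonlinear antiholomorphic first order system
  whose holomorphic jet at \<open>0\<close> is prescribed. On \<open>cyc X\<close> the powers of the commuting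
  endomorphisms \<open>p z z\<close> give an explicit solution with the same jet, so that the two agree.\<close>

theorem \<Gamma>_on_cyc:
  assumes z: "z \<in> cyc X" and vw: "v \<in> cyc X" "w \<in> cyc X"
    and dom: "\<And>l. norm l < 2 \<Longrightarrow> cs l z \<in> V"
    and small: "\<And>y. norm (p z z y) \<le> norm y / 4"
    and a: "a - (1 / 2) *\<^sub>R p z z a = z"
  shows "\<Gamma> z v w = p a v w"
proof -
  define U where "U = ball (0::complex) 2"
  have U: "open U" "0 \<in> U" by (auto simp: U_def)
  have domU: "cs l z \<in> V" if "l \<in> U" for l using that dom by (simp add: U_def)
  define D where "D y = p z z y" for y
  have linD: "linear D" unfolding D_def by (rule p_linear(3))
  have DI: "D (I y) = I (D y)" for y by (simp add: D_def p_simps)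
  \<comment> \<open>Since \<open>p\<close> is antilinear in the first and linear in the second slot,
    \<open>p (l z) (l z)\<close> is |l|^2 \<open>D\<close>. So the inverse \<open>N l\<close> of
    \<open>M l\<close> is the operator of the explicit solution at \<open>l z\<close>.\<close>
  define M where "M (l::complex) y = y - ((l \<bullet> l) / 2) *\<^sub>R D y" for l y
  have linM: "linear (M l)" for l
    unfolding M_def by (rule linearI) (simp_all add: linear_add[OF linD] linear_scale[OF linD] algebra_simps)
  \<comment> \<open>With |l| < 2 the factor is at most 2, and \<open>D\<close> has norm at most 1/4.
    The radius 2 leaves room around \<open>l = 1\<close>, where the solution is evaluated.\<close>
  have M_small: "(l \<bullet> l) / 2 * norm (D y) \<le> norm y / 2" if "l \<in> U" for l y
  proof -
    have "l \<bullet> l = (norm l)\<^sup>2" by (simp add: power2_norm_eq_inner)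
    also have "\<dots> \<le> 2\<^sup>2" using that by (intro power_mono) (auto simp: U_def)
    finally have "(l \<bullet> l) / 2 \<le> 2" by simp
    then have "(l \<bullet> l) / 2 * norm (D y) \<le> 2 * (norm y / 4)"
      using small[of y] by (intro mult_mono) (auto simp: D_def)
    then show ?thesis by simp
  qed
  have injM: "inj (M l)" if "l \<in> U" for l
    unfolding linear_injective_0[OF linM]
  proof (intro allI impI)
    fix y assume "M l y = 0"
    then have "y = ((l \<bullet> l) / 2) *\<^sub>R D y" by (simp add: M_def)
    then have "norm y = (l \<bullet> l) / 2 * norm (D y)"
      by (metis norm_scaleR abs_of_nonneg divide_nonneg_nonneg inner_ge_zero zero_le_numeral)
    with M_small[OF that, of y] have "norm y \<le> norm y / 2" by linarith
    then show "y = 0" by simp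
  qed
  then have bijM: "bij (M l)" if "l \<in> U" for l
    using linear_injective_imp_surjective[OF linM] that by (simp add: bij_def)
  define N where "N l = inv (M l)" for l
  have LN: "M l (N l y) = y" and NL: "N l (M l y) = y" if "l \<in> U" for l y
    using bijM[OF that] by (simp_all add: N_def bij_is_surj surj_f_inv_f bij_is_inj)
  have sM: "smooth_on (\<lambda>l. M l y) U" for y
  proof -
    have "smooth_on (\<lambda>l. l \<bullet> l) U" by (intro smooth_on_inner smooth_on_ident U(1))
    then have "smooth_on (\<lambda>l. (1 / 2) * (l \<bullet> l)) U" by (intro smooth_on_mult smooth_on_const U(1))
    then have "smooth_on (\<lambda>l. (l \<bullet> l) / 2) U" by simp
    then show ?thesis unfolding M_def by (intro smooth_on_diff smooth_on_scaleR smooth_on_const U(1))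
  qed
  have sN: "smooth_on (\<lambda>l. N l y) U" for y
    by (rule smooth_on_inverse_family[OF U(1) linM sM LN NL])
  have N_eqI: "N l y = x" if "l \<in> U" "M l x = y" for l x y using NL[OF that(1), of x] that(2) by simp
  have linN: "linear (N l)" if "l \<in> U" for l
    by (rule linearI) (rule N_eqI[OF that], simp add: linear_add[OF linM] linear_scale[OF linM] LN[OF that])+
  have NI: "N l (I y) = I (N l y)" if "l \<in> U" for l y
  proof (rule N_eqI[OF that])
    have "M l (I (N l y)) = I (M l (N l y))" by (simp add: M_def DI)
    then show "M l (I (N l y)) = I y" by (simp add: LN[OF that])
  qed
  have ND: "N l (D y) = D (N l y)" if "l \<in> U" for l y
  proof (rule N_eqI[OF that])
    have "M l (D (N l y)) = D (M l (N l y))" by (simp add: M_def linear_diff[OF linD] linear_scale[OF linD])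
    then show "M l (D (N l y)) = D y" by (simp add: LN[OF that])
  qed
  have DC: "D y \<in> cyc X" if "y \<in> cyc X" for y
    unfolding D_def by (rule p_cyc[OF z z that])
  have MC: "M l y \<in> cyc X" if "y \<in> cyc X" for l y
    unfolding M_def by (intro subspace_diff subspace_scale subspace_cyc DC that)
  \<comment> \<open>\<open>M l\<close> maps the finite dimensional space \<open>cyc X\<close>
    injectively into itself, hence onto itself.\<close>
  have NC: "N l y \<in> cyc X" if l: "l \<in> U" and y: "y \<in> cyc X" for l y
  proof -
    have "subspace (M l ` cyc X)" by (rule linear_subspace_image[OF linM subspace_cyc])
    moreover have "dim (M l ` cyc X) = dim (cyc X)"
      by (rule dim_image_eq[OF linM]) (use injM[OF l] in \<open>auto intro: inj_on_subset\<close>)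
    ultimately have "M l ` cyc X = cyc X"
      using MC by (intro subspace_dim_equal subspace_cyc) auto
    then obtain x where "x \<in> cyc X" "M l x = y" using y by (metis imageE)
    then show ?thesis using N_eqI[OF l] by metis
  qed
  \<comment> \<open>Associativity on \<open>cyc X\<close> lets \<open>D\<close>, and with it
    \<open>N l\<close>, be pulled out of the first slot.\<close>
  have Np: "p (N l y) b c = N l (p y b c)" if l: "l \<in> U" and y: "y \<in> cyc X" "b \<in> cyc X" "c \<in> cyc X" for l y b c
  proof (rule N_eqI[OF l, symmetric])
    have "D (p (N l y) b c) = p (D (N l y)) b c"
    proof -
      have Ny: "N l y \<in> cyc X" by (rule NC[OF l y(1)])
      have "p (p z z (N l y)) b c = p z z (p (N l y) b c)" by (rule p_assoc[OF z z Ny y(2,3)])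
      then show ?thesis by (simp add: D_def)
    qed
    then have "M l (p (N l y) b c) = p (M l (N l y)) b c" by (simp add: M_def p_simps)
    then show "M l (p (N l y) b c) = p y b c" by (simp add: LN[OF l])
  qed
  have dN: "((\<lambda>l. N l y) has_derivative (\<lambda>h. (l \<bullet> h) *\<^sub>R N l (D (N l y)))) (at l)" if l: "l \<in> U" for l y
  proof -
    have "((\<lambda>l. l \<bullet> l) has_derivative (\<lambda>h. l \<bullet> h + h \<bullet> l)) (at l)"
      by (rule has_derivative_inner[OF has_derivative_ident has_derivative_ident])
    then have "((\<lambda>l. b - ((l \<bullet> l) / 2) *\<^sub>R D b) has_derivative (\<lambda>h. 0 - ((l \<bullet> h + h \<bullet> l) / 2) *\<^sub>R D b)) (at l)" for b
      by (rule has_derivative_diff[OF has_derivative_const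
            has_derivative_scaleR_left[OF bounded_linear.has_derivative[OF bounded_linear_divide]]])
    then have "((\<lambda>l. M l b) has_derivative (\<lambda>h. - ((l \<bullet> h) *\<^sub>R D b))) (at l)" for b
      unfolding M_def by (simp add: inner_commute)
    then have dM: "dir_deriv (\<lambda>l. M l b) l h = - ((l \<bullet> h) *\<^sub>R D b)" for b h by (rule dir_deriv_eq)
    have "(\<lambda>h. - N l (dir_deriv (\<lambda>l'. M l' (N l y)) l h)) = (\<lambda>h. (l \<bullet> h) *\<^sub>R N l (D (N l y)))"
      by (simp add: dM linear_neg[OF linN[OF l]] linear_scale[OF linN[OF l]])
    with inverse_family_has_derivative[OF U(1) l linM sM LN NL, of y] show ?thesis by simp
  qed
  have dNN: "((\<lambda>l. N l (N l y)) has_derivative (\<lambda>h. (l \<bullet> h) *\<^sub>R (2 *\<^sub>R N l (N l (N l (D y)))))) (at l)" if l: "l \<in> U" for l y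
  proof -
    have "((\<lambda>l. N l (N l y)) has_derivative
        (\<lambda>h. (l \<bullet> h) *\<^sub>R N l (D (N l (N l y))) + N l ((l \<bullet> h) *\<^sub>R N l (D (N l y))))) (at l)"
      by (rule has_derivative_apply[where L' = "\<lambda>h x. (l \<bullet> h) *\<^sub>R N l (D (N l x))", OF U(1) l linN dN[OF l] dN[OF l]])
    then show ?thesis
      by (simp add: ND[OF l] linear_scale[OF linN[OF l]], simp flip: scaleR_2 add: scaleR_left_commute mult.commute)
  qed
  define A where "A b c l = \<Gamma> (cs l z) b c" for b c l
  define P where "P y b c l = rho (cs l z) y b c" for y b c l
  \<comment> \<open>The explicit solution at \<open>l z\<close>: the antilinear first slot turns the
    factor \<open>l\<close> of \<open>l z\<close> into its conjugate. \<open>P0\<close> is the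
    curvature that the first equation then demands.\<close>
  define A0 where "A0 b c l = cs (cnj l) (p (N l z) b c)" for b c l
  define P0 where "P0 y b c l = p (N l (N l y)) b c" for y b c l
  have sline: "smooth_on (\<lambda>l. f (cs l z)) U" if "smooth_on f V" for f :: "'e \<Rightarrow> 'e"
    using domU by (intro smooth_on_compose[OF U(1) V0(1) that smooth_on_cs_line[OF U(1)]]) auto
  have sA: "smooth_on (A b c) U" and sP: "smooth_on (P y b c) U" for y b c
    unfolding A_def P_def by (rule sline[OF \<Gamma>_smooth] sline[OF rho_smooth])+
  have sp: "smooth_on (\<lambda>l. p (f l) b c) U" if "smooth_on f U" for f b c
    by (rule smooth_on_linear[OF U(1) p_linear(1) that])
  have sNN: "smooth_on (\<lambda>l. N l (f l)) U" if "smooth_on f U" for f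
    by (rule smooth_on_apply[OF U(1) linN sN that])
  have sD: "smooth_on (\<lambda>l. D (f l)) U" if "smooth_on f U" for f
    by (rule smooth_on_linear[OF U(1) linD that])
  have scs: "smooth_on (\<lambda>l. cs (k l) (f l)) U" if "smooth_on k U" "smooth_on f U" for k f
    by (rule smooth_on_bilinear[OF U(1) bounded_bilinear_cs that])
  have sA0: "smooth_on (A0 b c) U" for b c
    unfolding A0_def by (intro scs smooth_on_cnj U(1) sp sN)
  have sP0: "smooth_on (P0 y b c) U" for y b c
    unfolding P0_def by (intro sp sNN sN)
  have dlbA: "dlb I (A b c) l = P z b c l" if "l \<in> U" for b c l
    unfolding A_def P_def by (rule dlb_\<Gamma>_line[OF domU[OF that]])
  have dlbP: "dlb I (P y b c) l = rho (cs l z) (A z y l) b c" if "l \<in> U" for y b c l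
    unfolding A_def P_def by (rule dlb_rho_line[OF domU[OF that]])
  \<comment> \<open>The product rule gives N z + (|l|^2 / 2) N D N z in the first slot; this is N N
    z because N - 1 = (|l|^2 / 2) D N.\<close>
  have dlbA0: "dlb I (A0 b c) l = P0 z b c l" if l: "l \<in> U" for b c l
  proof -
    have "((\<lambda>l. p (N l z) b c) has_derivative (\<lambda>h. p ((l \<bullet> h) *\<^sub>R N l (D (N l z))) b c)) (at l)"
      by (rule linear_imp_has_derivative[OF p_linear(1), THEN has_derivative_compose[rotated], OF dN[OF l]])
    then have "dlb I (\<lambda>l. p (N l z) b c) l = (1 / 2) *\<^sub>R cs l (p (N l (D (N l z))) b c)"
      unfolding p_simps by (rule dlb_radial)
    then have "dlb I (A0 b c) l = p (N l z) b c + cs (cnj l) ((1 / 2) *\<^sub>R cs l (p (N l (D (N l z))) b c))"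
      unfolding A0_def using dlb_cs_cnj[OF U(1) l sp[OF sN]] by simp
    also have "cs (cnj l) ((1 / 2) *\<^sub>R cs l (p (N l (D (N l z))) b c)) = p (((l \<bullet> l) / 2) *\<^sub>R N l (D (N l z))) b c"
    proof -
      have "cnj l * l = of_real (l \<bullet> l)"
        by (simp add: complex_eq_iff inner_complex_def)
      then have "cs (cnj l) (cs l x) = (l \<bullet> l) *\<^sub>R x" for x by (simp flip: cs_simps(4) add: cs_simps(3))
      then show ?thesis by (simp add: cs_simps p_simps)
    qed
    also have "((l \<bullet> l) / 2) *\<^sub>R N l (D (N l z)) = N l (N l z) - N l z"
      using LN[OF l, of "N l z"] by (simp add: M_def ND[OF l] algebra_simps)
    finally show ?thesis by (simp add: P0_def p_simps)
  qed
  have dlbP0: "dlb I (P0 y b c) l = cs l (p (N l (N l (N l (D y)))) b c)" if l: "l \<in> U" for y b c l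
  proof -
    have "((\<lambda>l. p (N l (N l y)) b c) has_derivative (\<lambda>h. p ((l \<bullet> h) *\<^sub>R (2 *\<^sub>R N l (N l (N l (D y))))) b c)) (at l)"
      by (rule linear_imp_has_derivative[OF p_linear(1), THEN has_derivative_compose[rotated], OF dNN[OF l]])
    from this[unfolded p_simps, THEN dlb_radial] show ?thesis
      unfolding P0_def by (simp add: cs_simps p_simps)
  qed
  \<comment> \<open>The unknowns are the components on a basis of \<open>cyc X\<close>: finitely
    many, and with arguments for which the algebra of \<open>cyc X\<close> is available.\<close>
  obtain Bc where Bc: "Bc \<subseteq> cyc X" "independent Bc" "cyc X \<subseteq> span Bc"
    using maximal_independent_subset by blast
  have finBc: "finite Bc" by (rule finiteI_independent[OF Bc(2)])
  have "\<exists>f. linear f \<and> (\<forall>b'\<in>Bc. f b' = (if b' = b then 1 else 0 :: real))" for b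
    using linear_independent_extend[OF Bc(2), of "\<lambda>b'. if b' = b then 1 else 0"] by blast
  then obtain c where c: "\<And>b. linear (c b)" "\<And>b b'. b' \<in> Bc \<Longrightarrow> c b b' = (if b' = b then 1 else 0 :: real)" by metis
  have expand: "y = (\<Sum>b\<in>Bc. c b y *\<^sub>R b)" if "y \<in> cyc X" for y
  proof (rule linear_eq_on_span[of "\<lambda>y. y" "\<lambda>y. \<Sum>b\<in>Bc. c b y *\<^sub>R b" Bc y])
    show "linear (\<lambda>y. \<Sum>b\<in>Bc. c b y *\<^sub>R b)"
      by (rule linearI) (simp_all add: linear_add[OF c(1)] linear_scale[OF c(1)] scaleR_add_left sum.distrib scaleR_sum_right)
    show "x = (\<Sum>b\<in>Bc. c b x *\<^sub>R b)" if "x \<in> Bc" for x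
      using that finBc by (simp add: c(2) if_distrib[of "\<lambda>r. r *\<^sub>R _"] cong: if_cong)
  qed (use that Bc(3) in \<open>auto simp: linear_iff\<close>)
  have expand_lin: "f y = (\<Sum>b\<in>Bc. c b y *\<^sub>R f b)" if "y \<in> cyc X" "linear f" for f :: "'e \<Rightarrow> 'e" and y
    by (subst expand[OF that(1)]) (simp add: linear_sum[OF that(2)] linear_scale[OF that(2)])
  define J where "J = Inl ` (Bc \<times> Bc) \<union> Inr ` (Bc \<times> Bc \<times> Bc)"
  define F where "F j = (case j of Inl (b, b') \<Rightarrow> (\<lambda>l. A b b' l - A0 b b' l)
      | Inr (y, b, b') \<Rightarrow> (\<lambda>l. P y b b' l - P0 y b b' l))" for j
  have F_simps: "F (Inl (b, b')) = (\<lambda>l. A b b' l - A0 b b' l)" "F (Inr (y, b, b')) = (\<lambda>l. P y b b' l - P0 y b b' l)"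
    for y b b' by (simp_all add: F_def)
  have J: "finite J" unfolding J_def using finBc by simp
  have sF: "smooth_on (F j) U" for j
    unfolding F_def
    by (cases j) (auto intro!: smooth_on_diff U(1) sA sA0 sP sP0 split: prod.splits)
  have ctrlF: "controlled 2 (3 / 2) J F (F j)" if "j \<in> J" for j
    by (rule controlled_self[OF J that]) (use sF in \<open>simp add: U_def\<close>)
  have ctrl_scale: "controlled 2 (3 / 2) J F (\<lambda>l. k *\<^sub>R G l)" if "controlled 2 (3 / 2) J F G" for G and k :: real
    by (rule controlled_apply[where M = "\<lambda>_ y. k *\<^sub>R y", OF _ _ _ _ that])
      (auto intro!: linearI smooth_on_const simp: algebra_simps)
  have linPP: "linear (\<lambda>y. P y b b' l - P0 y b b' l)" if "l \<in> U" for b b' l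
    unfolding P_def P0_def
    by (rule linearI) (simp_all add: linear_add[OF rho_linear(1)[OF domU[OF that]]] linear_scale[OF rho_linear(1)[OF domU[OF that]]]
        linear_add[OF linN[OF that]] linear_scale[OF linN[OF that]] p_simps algebra_simps)
  have linAA: "linear (\<lambda>y. A y b l - A0 y b l)" if "l \<in> U" for b l
    unfolding A_def A0_def
    by (rule linearI) (simp_all add: linear_add[OF \<Gamma>_linear1[OF domU[OF that]]] linear_scale[OF \<Gamma>_linear1[OF domU[OF that]]]
        p_simps cs_simps algebra_simps)
  have ctrlA: "controlled 2 (3 / 2) J F (\<lambda>l. A y b l - A0 y b l)" if "y \<in> cyc X" "b \<in> Bc" for y b
  proof (rule controlled_cong)
    show "controlled 2 (3 / 2) J F (\<lambda>l. \<Sum>b'\<in>Bc. c b' y *\<^sub>R F (Inl (b', b)) l)"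
      by (rule controlled_sum[OF _ finBc ctrl_scale[OF ctrlF]]) (use that in \<open>auto simp: J_def\<close>)
    show "(\<Sum>b'\<in>Bc. c b' y *\<^sub>R F (Inl (b', b)) l) = A y b l - A0 y b l" if "l \<in> ball 0 2" for l
      unfolding F_simps
      by (rule expand_lin[OF \<open>y \<in> cyc X\<close> linAA, symmetric]) (use that in \<open>simp add: U_def\<close>)
  qed auto
  have ctrl: "controlled 2 (3 / 2) J F (dlb I (F j))" if j: "j \<in> J" for j
  proof (cases j)
    case (Inl q)
    then obtain b b' where bb: "j = Inl (b, b')" "b \<in> Bc" "b' \<in> Bc" using j by (auto simp: J_def)
    show ?thesis
    proof (rule controlled_cong)
      show "controlled 2 (3 / 2) J F (\<lambda>l. \<Sum>y\<in>Bc. c y z *\<^sub>R F (Inr (y, b, b')) l)"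
        by (rule controlled_sum[OF _ finBc ctrl_scale[OF ctrlF]]) (use bb in \<open>auto simp: J_def\<close>)
      show "(\<Sum>y\<in>Bc. c y z *\<^sub>R F (Inr (y, b, b')) l) = dlb I (F j) l" if "l \<in> ball 0 2" for l
      proof -
        have l: "l \<in> U" using that by (simp add: U_def)
        have "dlb I (F j) l = P z b b' l - P0 z b b' l"
          unfolding bb(1) F_simps dlb_diff[OF U(1) sA sA0 l] dlbA[OF l] dlbA0[OF l] ..
        also have "\<dots> = (\<Sum>y\<in>Bc. c y z *\<^sub>R (P y b b' l - P0 y b b' l))"
          by (rule expand_lin[OF z linPP[OF l]])
        finally show ?thesis by (simp add: F_simps)
      qed
    qed auto
  next
    case (Inr q)
    then obtain y b b' where bb: "j = Inr (y, b, b')" "y \<in> Bc" "b \<in> Bc" "b' \<in> Bc" using j by (auto simp: J_def)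
    have yC: "y \<in> cyc X" using bb Bc by blast
    \<comment> \<open>The difference of the two right-hand sides splits into a term with the error
      in \<Gamma> and a term with the error in \<open>rho\<close>, both linear in the unknowns with
      smooth coefficients.\<close>
    have 1: "controlled 2 (3 / 2) J F (\<lambda>l. rho (cs l z) (A z y l - A0 z y l) b b')"
      by (rule controlled_apply[where M = "\<lambda>l x. rho (cs l z) x b b'", OF _ _ _ _ ctrlA[OF z bb(2)]])
        (use rho_linear(1)[OF domU] sline[OF rho_smooth] in \<open>auto simp: U_def\<close>)
    have 2: "controlled 2 (3 / 2) J F (\<lambda>l. \<Sum>x\<in>Bc. cs l (c x (N l (D y)) *\<^sub>R F (Inr (x, b, b')) l))"
    proof (rule controlled_sum[OF _ finBc])
      fix x assume x: "x \<in> Bc"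
      have sc: "smooth_on (\<lambda>l. c x (N l (D y))) U" by (rule smooth_on_linear[OF U(1) c(1) sN])
      show "controlled 2 (3 / 2) J F (\<lambda>l. cs l (c x (N l (D y)) *\<^sub>R F (Inr (x, b, b')) l))"
      proof (rule controlled_apply[where M = "\<lambda>l v. cs l (c x (N l (D y)) *\<^sub>R v)"])
        show "linear (\<lambda>v. cs l (c x (N l (D y)) *\<^sub>R v))" for l
          by (rule linearI) (simp_all add: cs_simps algebra_simps)
        have "smooth_on (\<lambda>l. cs l (c x (N l (D y)) *\<^sub>R v)) U" for v
          by (rule scs[OF smooth_on_ident[OF U(1)] smooth_on_scaleR[OF U(1) sc smooth_on_const[OF U(1)]]])
        then show "smooth_on (\<lambda>l. cs l (c x (N l (D y)) *\<^sub>R v)) (ball 0 2)" for v by (simp add: U_def)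
        show "controlled 2 (3 / 2) J F (F (Inr (x, b, b')))" by (rule ctrlF) (use x bb in \<open>auto simp: J_def\<close>)
      qed auto
    qed auto
    show ?thesis
    proof (rule controlled_cong[OF _ _ _ controlled_add[OF _ 1 2]])
      fix l assume "l \<in> ball (0::complex) 2"
      then have l: "l \<in> U" by (simp add: U_def)
      define x where "x = N l (D y)"
      have xC: "x \<in> cyc X" unfolding x_def by (rule NC[OF l DC[OF yC]])
      have "dlb I (F j) l = rho (cs l z) (A z y l) b b' - cs l (p (N l (N l x)) b b')"
        unfolding bb(1) F_simps dlb_diff[OF U(1) sP sP0 l] dlbP[OF l] dlbP0[OF l] x_def ..
      moreover have "rho (cs l z) (A z y l) b b' = rho (cs l z) (A z y l - A0 z y l) b b' + rho (cs l z) (A0 z y l) b b'"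
        by (simp add: linear_diff[OF rho_linear(1)[OF domU[OF l]]])
      moreover have "A0 z y l = cs (cnj l) x"
        unfolding A0_def x_def Np[OF l z z yC] by (simp add: D_def)
      moreover have "rho (cs l z) (cs (cnj l) x) b b' = cs l (P x b b' l)"
        using rho_cs[OF domU[OF l], of "cnj l" x b b'] by (simp add: P_def)
      moreover have "cs l (P x b b' l) - cs l (p (N l (N l x)) b b') = cs l (P x b b' l - P0 x b b' l)"
        by (simp only: P0_def cs_simps(7))
      ultimately have e: "dlb I (F j) l = rho (cs l z) (A z y l - A0 z y l) b b' + cs l (P x b b' l - P0 x b b' l)"
        by (simp only: add_diff_eq[symmetric])
      have "P x b b' l - P0 x b b' l = (\<Sum>u\<in>Bc. c u x *\<^sub>R (P u b b' l - P0 u b b' l))"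
        by (rule expand_lin[OF xC linPP[OF l, of b b']])
      then have "cs l (P x b b' l - P0 x b b' l) = (\<Sum>u\<in>Bc. cs l (c u x *\<^sub>R (P u b b' l - P0 u b b' l)))"
        by (simp only: linear_sum[OF linear_cs])
      then show "rho (cs l z) (A z y l - A0 z y l) b b' + (\<Sum>x\<in>Bc. cs l (c x (N l (D y)) *\<^sub>R F (Inr (x, b, b')) l))
         = dlb I (F j) l"
        unfolding F_simps e x_def by (simp only:)
    qed auto
  qed
  have jets: "hjet I n (F j)" for j n
  proof (cases j)
    case (Inl q)
    obtain b b' where q: "q = (b, b')" by fastforce
    have "hjet I n (A b b')" unfolding A_def by (rule \<Gamma>_jets)
    moreover have "hjet I n (A0 b b')" unfolding A0_def by (rule hjet_cnj[OF U sp[OF sN]])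
    ultimately show ?thesis
      unfolding Inl q F_simps by (rule hjet_diff[OF complex_structure_I U sA sA0])
  next
    case (Inr q)
    obtain y b b' where q: "q = (y, b, b')" by (metis prod_cases3)
    \<comment> \<open>N N y - y is |l|^2 times a smooth function, so the difference between
      \<open>P0\<close> and its value at 0 contains the factor lbar, and \<open>hjet_cnj\<close>
      applies.\<close>
    define G where "G l = cs (l / 2) (p (D (N l (N l y)) + D (N l y)) b b')" for l
    have sG: "smooth_on G U"
    proof -
      have "smooth_on (\<lambda>l::complex. l * (1 / 2)) U" by (intro smooth_on_mult smooth_on_ident smooth_on_const U(1))
      then have "smooth_on (\<lambda>l::complex. l / 2) U" by simp
      then show ?thesis unfolding G_def by (intro scs sp smooth_on_add U(1) sD sNN sN)
    qed
    have G: "P0 y b b' l - p y b b' = cs (cnj l) (G l)" if l: "l \<in> U" for l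
    proof -
      have "cnj l * (l / 2) = of_real ((l \<bullet> l) / 2)"
        by (simp add: complex_eq_iff inner_complex_def)
      then have cl: "cs (cnj l) (cs (l / 2) x) = ((l \<bullet> l) / 2) *\<^sub>R x" for x
        by (simp only: cs_simps(3) flip: cs_simps(4))
      have K: "N l x - x = ((l \<bullet> l) / 2) *\<^sub>R D (N l x)" for x
        using LN[OF l, of x] by (simp add: M_def algebra_simps)
      have "N l (N l y) - y = (N l (N l y) - N l y) + (N l y - y)" by simp
      also have "\<dots> = ((l \<bullet> l) / 2) *\<^sub>R (D (N l (N l y)) + D (N l y))"
        by (simp only: K scaleR_add_right)
      finally have "N l (N l y) - y = ((l \<bullet> l) / 2) *\<^sub>R (D (N l (N l y)) + D (N l y))" .
      then have "p (N l (N l y) - y) b b' = ((l \<bullet> l) / 2) *\<^sub>R p (D (N l (N l y)) + D (N l y)) b b'"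
        by (simp only: p_simps)
      then show ?thesis by (simp add: P0_def G_def cl p_simps)
    qed
    have 1: "hjet I n (\<lambda>l. P y b b' l - p y b b')"
      unfolding P_def by (rule hjet_rho_line[OF U domU])
    have 2: "hjet I n (\<lambda>l. P0 y b b' l - p y b b')"
      by (rule hjet_cong[OF U _ hjet_cnj[OF U sG]]) (rule G[symmetric])
    have "hjet I n (\<lambda>l. (P y b b' l - p y b b') - (P0 y b b' l - p y b b'))"
      by (rule hjet_diff[OF complex_structure_I U _ _ 1 2]) (intro smooth_on_diff smooth_on_const U(1) sP sP0)+
    then show ?thesis unfolding Inr q F_simps by simp
  qed
  \<comment> \<open>The point \<open>l = 1\<close> lies in the disc of radius 3/2 on which
    uniqueness is available; there \<open>N 1 z\<close> is the given \<open>a\<close>.\<close>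
  have F0: "F j 1 = 0" if "j \<in> J" for j
    by (rule controlled_system_unique[where R = 2 and r = "3 / 2", OF _ _ J _ jets ctrl _ that])
      (use sF in \<open>auto simp: U_def\<close>)
  have U1: "1 \<in> U" by (simp add: U_def)
  have zV: "z \<in> V" using domU[OF U1] by (simp add: cs_simps)
  have N1: "N 1 z = a" by (rule N_eqI[OF U1]) (use a in \<open>simp add: M_def D_def\<close>)
  have bas: "\<Gamma> z b b' = p a b b'" if "b \<in> Bc" "b' \<in> Bc" for b b'
    using F0[of "Inl (b, b')"] that by (simp add: J_def F_simps A_def A0_def cs_simps N1)
  have "\<Gamma> z b w = p a b w" if "b \<in> Bc" for b
    using expand_lin[OF vw(2) \<Gamma>_linear[OF zV], of b] expand_lin[OF vw(2) p_linear(3), of a b] bas[OF that] by simp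
  then show ?thesis
    using expand_lin[OF vw(1) \<Gamma>_linear1[OF zV], of w] expand_lin[OF vw(1) p_linear(2), of a w] by simp
qed

end

section \<open>The coefficients of the power series\<close>

abbreviation fps_coeff :: "'a::zero fps \<Rightarrow> nat \<Rightarrow> 'a" (infixl \<open>$$\<close> 75) where
  "F $$ n \<equiv> fps_nth F n"

lemma deriv_eq_dir_deriv:
  fixes f :: "real \<Rightarrow> real"
  assumes "open S" "smooth_on f S" "x \<in> S"
  shows "deriv f x = dir_deriv f x 1"
proof -
  have "DERIV f x :> dir_deriv f x 1"
    by (rule has_derivative_real_DERIV[OF smooth_on_has_derivative[OF assms]])
  then show ?thesis by (rule DERIV_imp_deriv)
qed

lemma smooth_on_deriv:
  fixes f :: "real \<Rightarrow> real"
  assumes "open S" "smooth_on f S"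
  shows "smooth_on (deriv f) S"
  by (rule smooth_on_cong[OF assms(1) _ smooth_on_dir_deriv[OF assms(2), of 1]])
    (simp add: deriv_eq_dir_deriv[OF assms])

lemma deriv_funpow_cong:
  fixes f g :: "real \<Rightarrow> real"
  assumes "open S" "x \<in> S" "\<And>y. y \<in> S \<Longrightarrow> f y = g y"
  shows "(deriv ^^ n) f x = (deriv ^^ n) g x"
  using assms(3)
proof (induction n arbitrary: f g)
  case (Suc n)
  have "deriv f y = deriv g y" if "y \<in> S" for y
    using Suc.prems that assms(1) by (intro deriv_cong_ev eventually_nhds[THEN iffD2] exI[of _ S]) auto
  then have "(deriv ^^ n) (deriv f) x = (deriv ^^ n) (deriv g) x" by (rule Suc.IH)
  then show ?case by (simp add: funpow_swap1)
qed (use assms(2) in simp)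

lemma taylor_fps_cong:
  assumes "open S" "0 \<in> S" "\<And>y. y \<in> S \<Longrightarrow> f y = g y"
  shows "taylor_fps f = taylor_fps g"
  unfolding taylor_fps_def by (simp add: deriv_funpow_cong[OF assms])

lemma fps_deriv_taylor_fps: "fps_deriv (taylor_fps f) = taylor_fps (deriv f)"
proof (rule fps_ext)
  fix n
  have "(deriv ^^ Suc n) f 0 = (deriv ^^ n) (deriv f) 0" by (simp add: funpow_swap1)
  moreover have "(1 + real n) * (a / ((1 + real n) * fact n)) = a / fact n" for a :: real
  proof -
    have "1 + real n \<noteq> 0" by linarith
    then show ?thesis by simp
  qed
  ultimately show "fps_deriv (taylor_fps f) $$ n = taylor_fps (deriv f) $$ n"
    by (simp add: taylor_fps_def)
qed

lemma taylor_fps_0: "taylor_fps f $$ 0 = f 0" by (simp add: taylor_fps_def)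

lemma taylor_fps_const: "taylor_fps (\<lambda>x. c) = fps_const c"
proof -
  have "fps_deriv (taylor_fps (\<lambda>x. c)) = taylor_fps (\<lambda>x. 0)" for c
    by (simp add: fps_deriv_taylor_fps deriv_const[abs_def])
  moreover have "taylor_fps (\<lambda>x. 0) = 0"
  proof (rule fps_ext)
    fix n
    have "deriv (\<lambda>x. 0) = (\<lambda>x. 0 :: real)" by (rule ext) simp
    then have "(deriv ^^ n) (\<lambda>x. 0) = (\<lambda>x. 0 :: real)" by (induction n) simp_all
    then show "taylor_fps (\<lambda>x. 0) $$ n = 0 $$ n" by (simp add: taylor_fps_def)
  qed
  ultimately have "fps_deriv (taylor_fps (\<lambda>x. c)) = fps_deriv (fps_const c)" for c by simp
  then show ?thesis unfolding fps_deriv_eq_iff by (simp add: taylor_fps_0)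
qed

lemma fps_coeff_Suc_eqI:
  fixes F G :: "real fps"
  shows "fps_deriv F $$ n = fps_deriv G $$ n \<Longrightarrow> F $$ Suc n = G $$ Suc n"
  by (simp del: of_nat_Suc)

lemma taylor_fps_add:
  assumes S: "open S" "0 \<in> S" and "smooth_on f S" "smooth_on g S"
  shows "taylor_fps (\<lambda>x. f x + g x) = taylor_fps f + taylor_fps g"
proof (rule fps_ext)
  fix n show "taylor_fps (\<lambda>x. f x + g x) $$ n = (taylor_fps f + taylor_fps g) $$ n"
    using assms(3,4)
  proof (induction n arbitrary: f g)
    case 0
    then show ?case by (simp add: taylor_fps_0)
  next
    case (Suc n)
    have "fps_deriv (taylor_fps (\<lambda>x. f x + g x)) = taylor_fps (\<lambda>x. deriv f x + deriv g x)"
      unfolding fps_deriv_taylor_fps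
      by (rule taylor_fps_cong[OF S])
        (simp add: deriv_eq_dir_deriv[OF S(1)] Suc.prems smooth_on_add[OF S(1)] dir_deriv_add[OF S(1)])
    then have "fps_deriv (taylor_fps (\<lambda>x. f x + g x)) $$ n = fps_deriv (taylor_fps f + taylor_fps g) $$ n"
      by (simp add: Suc.IH smooth_on_deriv[OF S(1)] Suc.prems fps_deriv_taylor_fps)
    then show ?case by (rule fps_coeff_Suc_eqI)
  qed
qed

lemma taylor_fps_mult:
  assumes S: "open S" "0 \<in> S" and "smooth_on f S" "smooth_on g S"
  shows "taylor_fps (\<lambda>x. f x * g x) = taylor_fps f * taylor_fps g"
proof (rule fps_ext)
  fix n show "taylor_fps (\<lambda>x. f x * g x) $$ n = (taylor_fps f * taylor_fps g) $$ n"
    using assms(3,4)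
  proof (induction n arbitrary: f g)
    case 0
    then show ?case by (simp add: taylor_fps_0)
  next
    case (Suc n)
    have "deriv (\<lambda>x. f x * g x) x = f x * deriv g x + deriv f x * g x" if "x \<in> S" for x
      using dir_deriv_eq[OF has_derivative_mult[OF smooth_on_has_derivative[OF S(1) Suc.prems(1) that]
            smooth_on_has_derivative[OF S(1) Suc.prems(2) that]]] that
      by (simp add: deriv_eq_dir_deriv[OF S(1)] Suc.prems smooth_on_mult[OF S(1)])
    then have "fps_deriv (taylor_fps (\<lambda>x. f x * g x)) = taylor_fps (\<lambda>x. f x * deriv g x + deriv f x * g x)"
      unfolding fps_deriv_taylor_fps by (rule taylor_fps_cong[OF S])
    also have "\<dots> = taylor_fps (\<lambda>x. f x * deriv g x) + taylor_fps (\<lambda>x. deriv f x * g x)"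
      by (intro taylor_fps_add[OF S] smooth_on_mult S(1) smooth_on_deriv Suc.prems)
    finally have "fps_deriv (taylor_fps (\<lambda>x. f x * g x)) $$ n = fps_deriv (taylor_fps f * taylor_fps g) $$ n"
      by (simp add: Suc.IH smooth_on_deriv[OF S(1)] Suc.prems fps_deriv_taylor_fps)
    then show ?case by (rule fps_coeff_Suc_eqI)
  qed
qed

lemma taylor_fps_ident: "taylor_fps (\<lambda>x. x) = fps_X"
proof -
  have "fps_deriv (taylor_fps (\<lambda>x. x)) = fps_deriv fps_X"
    by (simp add: fps_deriv_taylor_fps taylor_fps_const)
  then show ?thesis unfolding fps_deriv_eq_iff by (simp add: taylor_fps_0)
qed

text \<open>As the constant term vanishes, division by \<open>x / 2\<close> is an index shift with
  factor 2.\<close>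

lemma half_quotient_nth:
  assumes "f 0 = 0"
  shows "half_quotient_series f $$ n = 2 * taylor_fps (\<lambda>x. f (x / 2)) $$ Suc n"
proof -
  define H where "H = taylor_fps (\<lambda>x. f (x / 2))"
  have "H $$ 0 = 0" using assms by (simp add: H_def taylor_fps_0)
  then have "H = (fps_const (1 / 2) * fps_X) * (fps_const 2 * fps_shift 1 H)"
    by (intro fps_ext) (auto simp: mult.assoc fps_X_mult_nth)
  then have "H / (fps_const (1 / 2) * fps_X) = fps_const 2 * fps_shift 1 H"
    by (metis fps_X_neq_zero fps_const_nonzero_eq_nonzero mult_eq_0_iff nonzero_mult_div_cancel_left
        zero_neq_numeral divide_eq_0_iff one_neq_zero)
  then show ?thesis by (simp add: half_quotient_series_def H_def)
qed

lemma smooth_on_tanh_half: "smooth_on (\<lambda>x::real. tanh (x / 2)) UNIV"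
proof -
  have D: "DERIV (\<lambda>x::real. tanh (x / 2)) x :> (1 - tanh (x / 2) * tanh (x / 2)) * (1 / 2)" for x
    by (auto intro!: derivative_eq_intros simp: power2_eq_square)
  have "Ck_on k (\<lambda>x::real. tanh (x / 2)) UNIV" for k
  proof (induction k)
    case 0
    show ?case using DERIV_isCont[OF D] by (simp add: continuous_on_eq_continuous_at)
  next
    case (Suc k)
    show ?case
    proof (rule Ck_on_SucI[OF open_UNIV])
      show "((\<lambda>x::real. tanh (x / 2)) has_derivative (\<lambda>v. ((1 - tanh (x / 2) * tanh (x / 2)) * (1 / 2)) * v)) (at x)" for x
        using D[of x] unfolding has_field_derivative_def by (simp only: )
      fix v :: real
      have "Ck_on k (\<lambda>x::real. - (tanh (x / 2) * tanh (x / 2))) UNIV"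
        by (rule Ck_on_bounded_linear[OF open_UNIV bounded_linear_minus[OF bounded_linear_ident]
              Ck_on_bilinear[OF open_UNIV bounded_bilinear_mult Suc Suc]])
      from Ck_on_add[OF open_UNIV Ck_on_const[OF open_UNIV, of _ 1] this]
      have "Ck_on k (\<lambda>x::real. 1 - tanh (x / 2) * tanh (x / 2)) UNIV" by simp
      from Ck_on_bounded_linear[OF open_UNIV bounded_linear_mult_left[of "(1 / 2) * v"] this]
      show "Ck_on k (\<lambda>x. ((1 - tanh (x / 2) * tanh (x / 2)) * (1 / 2)) * v) UNIV" by (simp add: mult.assoc)
    qed
  qed
  then show ?thesis by (simp add: smooth_on_def)
qed

lemma sum_odd_terms:
  fixes f :: "nat \<Rightarrow> real"
  assumes "\<And>j. j \<le> k \<Longrightarrow> f (2 * j) = 0"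
  shows "(\<Sum>i\<le>2 * k. f i) = (\<Sum>j<k. f (2 * j + 1))"
  using assms
proof (induction k)
  case (Suc k)
  then show ?case using Suc.prems[of "Suc k"] by simp
qed simp

text \<open>For the series \<open>H\<close> of \<open>tanh (x / 2)\<close> the equation H' = (1 -
  H^2) / 2 gives a recursion, in which oddness of \<open>H\<close> leaves only odd indices; each
  \<open>c k\<close> is twice such a coefficient, whence the 1/4. For the bound, \<open>k\<close>
  products of size at most 1 are divided by \<open>4 (2k + 1)\<close>.\<close>

lemma tanh_coeffs:
  defines "c \<equiv> \<lambda>k. half_quotient_series tanh $$ (2 * k)"
  shows tanh_coeffs_rec: "real (2 * k + 1) * c k = (if k = 0 then 1 else 0) - (\<Sum>j<k. c j * c (k - 1 - j)) / 4"
    and tanh_coeffs_bound: "\<bar>c k\<bar> \<le> 1"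
proof -
  define H where "H = taylor_fps (\<lambda>x. tanh (x / 2))"
  note U = open_UNIV UNIV_I[of "0::real"]
  note sm = smooth_on_tanh_half
  have "deriv (\<lambda>x::real. tanh (x / 2)) = (\<lambda>x. (1 / 2) * (1 + (- 1) * (tanh (x / 2) * tanh (x / 2))))"
  proof
    fix x :: real
    have "DERIV (\<lambda>x::real. tanh (x / 2)) x :> (1 / 2) * (1 + (- 1) * (tanh (x / 2) * tanh (x / 2)))"
      by (auto intro!: derivative_eq_intros simp: power2_eq_square)
    then show "deriv (\<lambda>x::real. tanh (x / 2)) x = (1 / 2) * (1 + (- 1) * (tanh (x / 2) * tanh (x / 2)))"
      by (rule DERIV_imp_deriv)
  qed
  then have "fps_deriv H = taylor_fps (\<lambda>x. (1 / 2) * (1 + (- 1) * (tanh (x / 2) * tanh (x / 2))))"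
    by (simp add: H_def fps_deriv_taylor_fps)
  also have "\<dots> = fps_const (1 / 2) * (fps_const 1 + fps_const (- 1) * (H * H))"
    unfolding H_def
    by (simp only: taylor_fps_mult[OF U] taylor_fps_add[OF U] taylor_fps_const smooth_on_mult[OF U(1)]
        smooth_on_add[OF U(1)] smooth_on_const[OF U(1)] sm)
  finally have H': "fps_deriv H = fps_const (1 / 2) * (fps_const 1 + fps_const (- 1) * (H * H))" .
  have rec: "real (Suc n) * H $$ Suc n = ((if n = 0 then 1 else 0) - (\<Sum>i\<le>n. H $$ i * H $$ (n - i))) / 2" for n
    using arg_cong[OF H', of "\<lambda>F. F $$ n"] by (simp add: fps_mult_nth[of H H] atLeast0AtMost)
  have even: "H $$ (2 * m) = 0" for m
  proof (induction m rule: less_induct)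
    case (less m)
    show ?case
    proof (cases m)
      case 0
      then show ?thesis by (simp add: H_def taylor_fps_0)
    next
      case (Suc l)
      define q where "q = 2 * l + 1"
      have "H $$ i * H $$ (q - i) = 0" if "i \<le> q" for i
      proof (cases "even i")
        case True
        then obtain j where "i = 2 * j" by blast
        then show ?thesis using less[of j] that Suc by (simp add: q_def)
      next
        case False
        then obtain j where j: "i = 2 * j + 1" using oddE by blast
        then have "q - i = 2 * (l - j)" using that by (simp add: q_def)
        then show ?thesis using less[of "l - j"] Suc by simp
      qed
      then have "(\<Sum>i\<le>q. H $$ i * H $$ (q - i)) = 0" by (intro sum.neutral) auto
      moreover have "q \<noteq> 0" by (simp add: q_def)
      ultimately have "real (Suc q) * H $$ Suc q = 0" using rec[of q] by simp
      moreover have "Suc q = 2 * m" using Suc by (simp add: q_def)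
      ultimately show ?thesis by (metis mult_eq_0_iff of_nat_eq_0_iff nat.distinct(2))
    qed
  qed
  have c: "c k = 2 * H $$ (2 * k + 1)" for k
    unfolding c_def H_def by (simp add: half_quotient_nth)
  show c_rec: "real (2 * k + 1) * c k = (if k = 0 then 1 else 0) - (\<Sum>j<k. c j * c (k - 1 - j)) / 4" for k
  proof -
    have "(\<Sum>i\<le>2 * k. H $$ i * H $$ (2 * k - i)) = (\<Sum>j<k. H $$ (2 * j + 1) * H $$ (2 * k - (2 * j + 1)))"
      by (rule sum_odd_terms) (simp add: even)
    also have "\<dots> = (\<Sum>j<k. c j * c (k - 1 - j) / 4)"
    proof (rule sum.cong)
      fix j assume "j \<in> {..<k}"
      then have "2 * k - (2 * j + 1) = 2 * (k - 1 - j) + 1" by auto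
      then show "H $$ (2 * j + 1) * H $$ (2 * k - (2 * j + 1)) = c j * c (k - 1 - j) / 4" by (simp add: c)
    qed simp
    finally show ?thesis using rec[of "2 * k"] by (simp add: c sum_divide_distrib)
  qed
  show "\<bar>c k\<bar> \<le> 1"
  proof (induction k rule: less_induct)
    case (less k)
    show ?case
    proof (cases "k = 0")
      case True
      then show ?thesis using c_rec[of 0] by simp
    next
      case False
      have "\<bar>real (2 * k + 1) * c k\<bar> = \<bar>\<Sum>j<k. c j * c (k - 1 - j)\<bar> / 4"
        using c_rec[of k] False by simp
      also have "\<dots> \<le> (\<Sum>j<k. 1) / 4"
      proof (intro divide_right_mono order_trans[OF sum_abs] sum_mono)
        fix j assume "j \<in> {..<k}"
        then show "\<bar>c j * c (k - 1 - j)\<bar> \<le> 1"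
          using less[of j] less[of "k - 1 - j"] by (simp add: abs_mult mult_le_one)
      qed simp
      finally have "real (2 * k + 1) * \<bar>c k\<bar> \<le> real k / 4" by (simp add: abs_mult)
      also have "\<dots> \<le> real (2 * k + 1) * 1" by simp
      finally have "real (2 * k + 1) * \<bar>c k\<bar> \<le> real (2 * k + 1) * 1" .
      then show ?thesis by (rule mult_left_le_imp_le) simp
    qed
  qed
qed

lemma smooth_on_geometric: "smooth_on (\<lambda>x::real. 1 / (1 - (x / 2) * (x / 2))) {-2<..<2}"
  and smooth_on_artanh_half: "smooth_on (\<lambda>x::real. artanh (x / 2)) {-2<..<2}"
  and DERIV_artanh_half: "x \<in> {-2<..<2} \<Longrightarrow> DERIV (\<lambda>x::real. artanh (x / 2)) x :> (1 / 2) * (1 / (1 - (x / 2) * (x / 2)))"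
proof -
  let ?S = "{-2<..<2::real}"
  have pos: "0 < 1 - (x / 2) * (x / 2)" if "x \<in> ?S" for x :: real
  proof -
    have "\<bar>x / 2\<bar> < 1" using that by auto
    then have "\<bar>x / 2\<bar> * \<bar>x / 2\<bar> < 1 * 1" by (intro mult_strict_mono') auto
    then show ?thesis by (simp add: abs_mult[symmetric])
  qed
  define u where "u x = 1 / (1 - (x / 2) * (x / 2))" for x :: real
  have D: "(u has_derivative (\<lambda>v. (x * (u x * u x)) * (v / 2))) (at x)" if "x \<in> ?S" for x
  proof -
    have "DERIV u x :> (x * (u x * u x)) * (1 / 2)"
      unfolding u_def using pos[OF that]
      by (auto intro!: derivative_eq_intros simp: field_simps power2_eq_square)
    then show ?thesis unfolding has_field_derivative_def by (rule has_derivative_eq_rhs) (simp add: fun_eq_iff)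
  qed
  have o: "open ?S" by simp
  have "Ck_on k u ?S" for k
  proof (induction k)
    case 0
    show ?case using has_derivative_continuous[OF D] by (simp add: continuous_on_eq_continuous_at)
  next
    case (Suc k)
    show ?case
    proof (rule Ck_on_SucI[OF o D])
      show "Ck_on k (\<lambda>x. (x * (u x * u x)) * (v / 2)) ?S" for v
        by (intro Ck_on_bounded_linear[OF o bounded_linear_mult_left] Ck_on_bilinear[OF o bounded_bilinear_mult]
            Ck_on_ident[OF o] Suc)
    qed
  qed
  then show s: "smooth_on (\<lambda>x::real. 1 / (1 - (x / 2) * (x / 2))) ?S"
    unfolding u_def[symmetric] by (simp add: smooth_on_def)
  show D2: "DERIV (\<lambda>x::real. artanh (x / 2)) x :> (1 / 2) * (1 / (1 - (x / 2) * (x / 2)))" if "x \<in> ?S" for x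
  proof -
    have "\<bar>x / 2\<bar> < 1" using that by auto
    moreover have "DERIV (\<lambda>x::real. x / 2) x :> 1 / 2" by (auto intro!: derivative_eq_intros)
    ultimately have "DERIV (\<lambda>x::real. artanh (x / 2)) x :> 1 / (1 - (x / 2)\<^sup>2) * (1 / 2)"
      by (rule DERIV_chain2[OF artanh_real_has_field_derivative])
    then show ?thesis by (simp only: power2_eq_square mult.commute)
  qed
  have sm: "smooth_on (\<lambda>x. (1 / (1 - (x / 2) * (x / 2))) * (v / 2)) ?S" for v :: real
    by (intro smooth_on_mult o s smooth_on_const)
  have "((\<lambda>x::real. artanh (x / 2)) has_derivative (\<lambda>v. (1 / (1 - (x / 2) * (x / 2))) * (v / 2))) (at x)" if "x \<in> ?S" for x
    using D2[OF that] unfolding has_field_derivative_def by (rule has_derivative_eq_rhs) (simp add: fun_eq_iff)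
  from smooth_onI[OF o this sm] show "smooth_on (\<lambda>x::real. artanh (x / 2)) ?S" .
qed

text \<open>The derivative of \<open>artanh (x / 2)\<close> is half the function \<open>u\<close>,
  whose coefficients come from the geometric relation u = 1 + x^2 u / 4.\<close>

lemma artanh_coeffs: "half_quotient_series artanh $$ (2 * k) = (1 / 4) ^ k / real (2 * k + 1)"
proof -
  let ?S = "{-2<..<2::real}"
  have S: "open ?S" "0 \<in> ?S" by auto
  define H where "H = taylor_fps (\<lambda>x. artanh (x / 2))"
  define u where "u x = 1 / (1 - (x / 2) * (x / 2))" for x :: real
  have su: "smooth_on u ?S" unfolding u_def by (rule smooth_on_geometric)
  define G where "G = taylor_fps u"
  have u: "u x = 1 + (1 / 4) * (x * (x * u x))" if "x \<in> ?S" for x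
  proof -
    have "\<bar>x / 2\<bar> < 1" using that by auto
    then have "\<bar>x / 2\<bar> * \<bar>x / 2\<bar> < 1 * 1" by (intro mult_strict_mono') auto
    then have "1 - (x / 2) * (x / 2) \<noteq> 0" by (simp add: abs_mult[symmetric])
    then show ?thesis unfolding u_def by (simp add: field_simps)
  qed
  have "G = taylor_fps (\<lambda>x. 1 + (1 / 4) * (x * (x * u x)))"
    unfolding G_def by (rule taylor_fps_cong[OF S u])
  also have "\<dots> = fps_const 1 + fps_const (1 / 4) * (fps_X * (fps_X * G))"
    unfolding G_def
    by (simp only: taylor_fps_mult[OF S] taylor_fps_add[OF S] taylor_fps_const taylor_fps_ident smooth_on_mult[OF S(1)]
        smooth_on_add[OF S(1)] smooth_on_const[OF S(1)] smooth_on_ident[OF S(1)] su)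
  finally have G: "G = fps_const 1 + fps_const (1 / 4) * (fps_X * (fps_X * G))" .
  have G_even: "G $$ (2 * k) = (1 / 4) ^ k"
  proof (induction k)
    case 0
    show ?case using arg_cong[OF G, of "\<lambda>F. F $$ 0"] by simp
  next
    case (Suc k)
    have "G $$ (2 * Suc k) = (1 / 4) * G $$ (2 * k)"
      using arg_cong[OF G, of "\<lambda>F. F $$ (2 * Suc k)"] by simp
    then show ?case using Suc by simp
  qed
  have "fps_deriv H = taylor_fps (\<lambda>x. (1 / 2) * u x)"
    unfolding H_def fps_deriv_taylor_fps u_def
    by (rule taylor_fps_cong[OF S]) (rule DERIV_imp_deriv[OF DERIV_artanh_half])
  also have "\<dots> = fps_const (1 / 2) * G"
    unfolding G_def by (simp only: taylor_fps_mult[OF S smooth_on_const[OF S(1)] su] taylor_fps_const)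
  finally have "fps_deriv H $$ (2 * k) = (1 / 2) * (1 / 4) ^ k" using G_even by simp
  then have "real (2 * k + 1) * H $$ (2 * k + 1) = (1 / 4) ^ k / 2" by simp
  note eq = this
  have "2 * h = a / m" if "m * h = a / 2" "m \<noteq> 0" for m h a :: real
    using that by (simp add: field_simps)
  from this[OF eq] have "2 * H $$ (2 * k + 1) = (1 / 4) ^ k / real (2 * k + 1)"
    by (simp del: of_nat_add of_nat_mult)
  then show ?thesis by (simp add: half_quotient_nth H_def)
qed

section \<open>Vector valued power series\<close>

lemma summable_norm_inner:
  fixes a :: "nat \<Rightarrow> 'a::real_inner"
  assumes "summable (\<lambda>n. norm (a n))"
  shows "summable (\<lambda>n. norm (a n \<bullet> b))"
proof (rule summable_comparison_test')
  show "summable (\<lambda>n. norm (a n) * norm b)" by (rule summable_mult2[OF assms])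
  show "norm (norm (a n \<bullet> b)) \<le> norm (a n) * norm b" for n by (simp add: Cauchy_Schwarz_ineq2)
qed

lemma sums_inner:
  fixes a :: "nat \<Rightarrow> 'a::euclidean_space"
  shows "a sums s \<Longrightarrow> (\<lambda>n. a n \<bullet> b) sums (s \<bullet> b)"
  by (rule bounded_linear.sums[OF bounded_linear_inner_left])

lemma sums_componentwise:
  fixes a :: "nat \<Rightarrow> 'a::euclidean_space"
  assumes "\<And>b. b \<in> Basis \<Longrightarrow> (\<lambda>n. a n \<bullet> b) sums (s \<bullet> b)"
  shows "a sums s"
proof -
  have "(\<lambda>n. \<Sum>b\<in>Basis. (a n \<bullet> b) *\<^sub>R b) sums (\<Sum>b\<in>Basis. (s \<bullet> b) *\<^sub>R b)"
    using assms by (intro sums_sum bounded_linear.sums[OF bounded_linear_scaleR_left])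
  then show ?thesis by (simp add: euclidean_representation)
qed

text \<open>Expanding \<open>B\<close> in \<open>Basis\<close> reduces the claim to Cauchy products
  of the real component series.\<close>

lemma Cauchy_product_bilinear:
  fixes B :: "'a::euclidean_space \<Rightarrow> 'b::euclidean_space \<Rightarrow> 'c::euclidean_space"
  assumes B: "bilinear B" and a: "summable (\<lambda>n. norm (a n))" and b: "summable (\<lambda>n. norm (b n))"
  shows "(\<lambda>n. \<Sum>i\<le>n. B (a i) (b (n - i))) sums B (\<Sum>n. a n) (\<Sum>n. b n)"
proof -
  have B': "B x y = (\<Sum>i\<in>Basis. \<Sum>j\<in>Basis. ((x \<bullet> i) * (y \<bullet> j)) *\<^sub>R B i j)" for x y
  proof -
    have lin: "linear (\<lambda>x. B x y)" "linear (B x)" for x y using B by (auto simp: bilinear_def)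
    have "B x y = (\<Sum>i\<in>Basis. (x \<bullet> i) *\<^sub>R B i y)" by (rule linear_expand_Basis[OF lin(1)])
    also have "\<dots> = (\<Sum>i\<in>Basis. (x \<bullet> i) *\<^sub>R (\<Sum>j\<in>Basis. (y \<bullet> j) *\<^sub>R B i j))"
      by (intro sum.cong refl arg_cong[of _ _ "scaleR _"] linear_expand_Basis[OF lin(2)])
    finally show ?thesis by (simp add: scaleR_sum_right)
  qed
  have sa: "(\<Sum>n. a n) \<bullet> i = (\<Sum>n. a n \<bullet> i)" for i
    by (rule sums_unique[OF sums_inner[OF summable_sums[OF summable_norm_cancel[OF a]]]])
  have sb: "(\<Sum>n. b n) \<bullet> i = (\<Sum>n. b n \<bullet> i)" for i
    by (rule sums_unique[OF sums_inner[OF summable_sums[OF summable_norm_cancel[OF b]]]])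
  have "(\<lambda>n. \<Sum>k\<le>n. (a k \<bullet> i) * (b (n - k) \<bullet> j)) sums (((\<Sum>n. a n) \<bullet> i) * ((\<Sum>n. b n) \<bullet> j))" for i j
    unfolding sa sb by (rule Cauchy_product_sums[OF summable_norm_inner[OF a] summable_norm_inner[OF b]])
  then have "(\<lambda>n. \<Sum>i\<in>Basis. \<Sum>j\<in>Basis. (\<Sum>k\<le>n. (a k \<bullet> i) * (b (n - k) \<bullet> j)) *\<^sub>R B i j) sums
      (\<Sum>i\<in>Basis. \<Sum>j\<in>Basis. (((\<Sum>n. a n) \<bullet> i) * ((\<Sum>n. b n) \<bullet> j)) *\<^sub>R B i j)"
    by (intro sums_sum bounded_linear.sums[OF bounded_linear_scaleR_left])
  moreover have "(\<Sum>i\<in>Basis. \<Sum>j\<in>Basis. (\<Sum>k\<le>n. (a k \<bullet> i) * (b (n - k) \<bullet> j)) *\<^sub>R B i j) = (\<Sum>k\<le>n. B (a k) (b (n - k)))" for n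
  proof -
    have "(\<Sum>k\<le>n. B (a k) (b (n - k))) = (\<Sum>k\<le>n. \<Sum>i\<in>Basis. \<Sum>j\<in>Basis. ((a k \<bullet> i) * (b (n - k) \<bullet> j)) *\<^sub>R B i j)"
      by (rule sum.cong[OF refl B'])
    also have "\<dots> = (\<Sum>i\<in>Basis. \<Sum>k\<le>n. \<Sum>j\<in>Basis. ((a k \<bullet> i) * (b (n - k) \<bullet> j)) *\<^sub>R B i j)" by (rule sum.swap)
    also have "\<dots> = (\<Sum>i\<in>Basis. \<Sum>j\<in>Basis. \<Sum>k\<le>n. ((a k \<bullet> i) * (b (n - k) \<bullet> j)) *\<^sub>R B i j)"
      by (intro sum.cong refl sum.swap)
    finally show ?thesis by (simp add: scaleR_sum_left)
  qed
  ultimately show ?thesis by (simp only: B'[symmetric])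
qed

text \<open>The series is \<open>t g(t^2)\<close> with an ordinary power series \<open>g\<close>, to
  which termwise differentiation applies.\<close>

lemma odd_power_series_derivative_real:
  fixes w :: "nat \<Rightarrow> real"
  assumes w: "\<And>k. \<bar>w k\<bar> \<le> C * q ^ k" and q: "0 < q" "t\<^sup>2 * q < 1"
  shows "summable (\<lambda>k. real (2 * k + 1) * t ^ (2 * k) * w k)"
    and "DERIV (\<lambda>t. \<Sum>k. t ^ (2 * k + 1) * w k) t :> (\<Sum>k. real (2 * k + 1) * t ^ (2 * k) * w k)"
proof -
  define s where "s = t\<^sup>2"
  \<comment> \<open>A radius strictly between \<open>t^2\<close> and \<open>1 / q\<close>, up to
    which the bound on \<open>w\<close> guarantees convergence of \<open>g\<close>.\<close>
  obtain K where K: "s < K" "K * q < 1"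
  proof -
    have "s < 1 / q" using q by (simp add: s_def field_simps)
    then obtain K where "s < K" "K < 1 / q" using dense by blast
    then show thesis using that q by (simp add: field_simps)
  qed
  have s0: "0 \<le> s" by (simp add: s_def)
  have sumK: "summable (\<lambda>n. w n * K ^ n)"
  proof (rule summable_comparison_test')
    show "summable (\<lambda>n. C * (K * q) ^ n)" using K s0 q by (intro summable_mult summable_geometric) auto
    show "norm (w n * K ^ n) \<le> C * (K * q) ^ n" for n
      using mult_right_mono[OF w[of n], of "K ^ n"] K s0 by (simp add: abs_mult power_mult_distrib mult_ac)
  qed
  define g where "g x = (\<Sum>n. w n * x ^ n)" for x
  have Dg: "DERIV g s :> (\<Sum>n. diffs w n * s ^ n)"
    unfolding g_def by (rule termdiffs_strong[OF sumK]) (use K s0 in simp)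
  have sumd: "summable (\<lambda>n. diffs w n * s ^ n)"
    by (rule termdiff_converges[of _ K]) (use K s0 in \<open>auto intro: powser_inside[OF sumK]\<close>)
  have 1: "(\<lambda>n. s * (2 * (real n * w n * s ^ (n - Suc 0)))) sums (s * (2 * (\<Sum>n. diffs w n * s ^ n)))"
    by (intro sums_mult diffs_equiv sumd)
  have 2: "(\<lambda>n. w n * s ^ n) sums g s"
    unfolding g_def by (rule summable_sums[OF powser_inside[OF sumK]]) (use K s0 in simp)
  have "w n * s ^ n + s * (2 * (real n * w n * s ^ (n - Suc 0))) = real (2 * n + 1) * t ^ (2 * n) * w n" for n
  proof -
    have "t ^ (2 * n) = s ^ n" by (simp add: s_def power_mult)
    then show ?thesis by (cases n) (simp_all add: algebra_simps)
  qed
  with sums_add[OF 2 1] have S: "(\<lambda>n. real (2 * n + 1) * t ^ (2 * n) * w n) sums (g s + s * (2 * (\<Sum>n. diffs w n * s ^ n)))"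
    by simp
  then show "summable (\<lambda>k. real (2 * k + 1) * t ^ (2 * k) * w k)" by (rule sums_summable)
  have sq: "DERIV (\<lambda>t::real. t\<^sup>2) t :> 2 * t" by (auto intro!: derivative_eq_intros)
  have "DERIV (\<lambda>t. g (t\<^sup>2)) t :> (\<Sum>n. diffs w n * s ^ n) * (2 * t)"
    by (rule DERIV_chain2[where g = "\<lambda>t. t\<^sup>2", OF _ sq]) (use Dg in \<open>simp add: s_def\<close>)
  from DERIV_mult[OF DERIV_ident this]
  have "DERIV (\<lambda>t. t * g (t\<^sup>2)) t :> g (t\<^sup>2) + t * ((\<Sum>n. diffs w n * s ^ n) * (2 * t))"
    by (simp add: add.commute mult.commute mult.left_commute)
  also have "g (t\<^sup>2) + t * ((\<Sum>n. diffs w n * s ^ n) * (2 * t)) = g s + s * (2 * (\<Sum>n. diffs w n * s ^ n))"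
    by (simp add: s_def power2_eq_square)
  also have "\<dots> = (\<Sum>k. real (2 * k + 1) * t ^ (2 * k) * w k)" by (rule sums_unique[OF S])
  finally have D: "DERIV (\<lambda>t. t * g (t\<^sup>2)) t :> (\<Sum>k. real (2 * k + 1) * t ^ (2 * k) * w k)" .
  have eq: "(\<Sum>k. x ^ (2 * k + 1) * w k) = x * g (x\<^sup>2)" if x: "x\<^sup>2 < K" for x
  proof -
    have "summable (\<lambda>n. w n * (x\<^sup>2) ^ n)"
      by (rule powser_inside[OF sumK]) (use x in auto)
    then have "(\<lambda>n. x * (w n * (x\<^sup>2) ^ n)) sums (x * g (x\<^sup>2))" unfolding g_def by (intro sums_mult summable_sums)
    moreover have "x * (w n * (x\<^sup>2) ^ n) = x ^ (2 * n + 1) * w n" for n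
      by (simp only: power_add power_mult power_one_right) (simp add: mult_ac)
    ultimately show ?thesis by (simp add: sums_iff)
  qed
  have "open {x::real. x\<^sup>2 < K}" by (intro open_Collect_less continuous_intros)
  moreover have "t \<in> {x. x\<^sup>2 < K}" using K by (simp add: s_def)
  ultimately have "\<forall>\<^sub>F x in nhds t. x\<^sup>2 < K" by (auto simp: eventually_nhds)
  then have "\<forall>\<^sub>F x in nhds t. x * g (x\<^sup>2) = (\<Sum>k. x ^ (2 * k + 1) * w k)"
    by (rule eventually_mono) (rule eq[symmetric])
  with D show "DERIV (\<lambda>t. \<Sum>k. t ^ (2 * k + 1) * w k) t :> (\<Sum>k. real (2 * k + 1) * t ^ (2 * k) * w k)"
    by (subst DERIV_cong_ev[symmetric]) auto
qed

lemma odd_power_series: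
  fixes v :: "nat \<Rightarrow> 'a::euclidean_space"
  assumes v: "\<And>k. norm (v k) \<le> C * q ^ k" and q: "0 < q" "t\<^sup>2 * q < 1"
  shows "summable (\<lambda>k. norm (t ^ (2 * k + 1) *\<^sub>R v k))"
    and "summable (\<lambda>k. (real (2 * k + 1) * t ^ (2 * k)) *\<^sub>R v k)"
    and "((\<lambda>t. \<Sum>k. t ^ (2 * k + 1) *\<^sub>R v k) has_vector_derivative (\<Sum>k. (real (2 * k + 1) * t ^ (2 * k)) *\<^sub>R v k)) (at t)"
proof -
  have sm: "summable (\<lambda>k. norm (t ^ (2 * k + 1) *\<^sub>R v k))" if "t\<^sup>2 * q < 1" for t
  proof (rule summable_comparison_test')
    show "summable (\<lambda>k. \<bar>t\<bar> * (C * (t\<^sup>2 * q) ^ k))"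
      using that q by (intro summable_mult summable_geometric) auto
    show "norm (norm (t ^ (2 * k + 1) *\<^sub>R v k)) \<le> \<bar>t\<bar> * (C * (t\<^sup>2 * q) ^ k)" for k
    proof -
      have "\<bar>t ^ (2 * k + 1)\<bar> = \<bar>t\<bar> * (t\<^sup>2) ^ k" by (simp add: abs_mult power_mult)
      then show ?thesis using mult_left_mono[OF v[of k], of "\<bar>t\<bar> * (t\<^sup>2) ^ k"] by (simp add: power_mult_distrib mult_ac)
    qed
  qed
  show "summable (\<lambda>k. norm (t ^ (2 * k + 1) *\<^sub>R v k))" by (rule sm[OF q(2)])
  have w: "\<bar>v k \<bullet> b\<bar> \<le> C * q ^ k" if "b \<in> Basis" for k b
    using Basis_le_norm[OF that, of "v k"] v[of k] by linarith
  define y where "y = (\<Sum>b\<in>Basis. (\<Sum>k. real (2 * k + 1) * t ^ (2 * k) * (v k \<bullet> b)) *\<^sub>R b)"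
  have S: "(\<lambda>k. (real (2 * k + 1) * t ^ (2 * k)) *\<^sub>R v k) sums y"
  proof (rule sums_componentwise)
    fix b :: 'a assume b: "b \<in> Basis"
    have "(\<lambda>k. real (2 * k + 1) * t ^ (2 * k) * (v k \<bullet> b)) sums (\<Sum>k. real (2 * k + 1) * t ^ (2 * k) * (v k \<bullet> b))"
      by (rule summable_sums[OF odd_power_series_derivative_real(1)[OF w[OF b] q]])
    then show "(\<lambda>k. (real (2 * k + 1) * t ^ (2 * k)) *\<^sub>R v k \<bullet> b) sums (y \<bullet> b)" using b by (simp add: y_def)
  qed
  then show "summable (\<lambda>k. (real (2 * k + 1) * t ^ (2 * k)) *\<^sub>R v k)" by (rule sums_summable)
  have comp: "(\<Sum>k. x ^ (2 * k + 1) *\<^sub>R v k) = (\<Sum>b\<in>Basis. (\<Sum>k. x ^ (2 * k + 1) * (v k \<bullet> b)) *\<^sub>R b)"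
    if "x\<^sup>2 * q < 1" for x
  proof -
    have "(\<lambda>k. x ^ (2 * k + 1) *\<^sub>R v k \<bullet> b) sums ((\<Sum>k. x ^ (2 * k + 1) *\<^sub>R v k) \<bullet> b)" for b
      by (rule sums_inner[OF summable_sums[OF summable_norm_cancel[OF sm[OF that]]]])
    then have "(\<Sum>k. x ^ (2 * k + 1) *\<^sub>R v k) \<bullet> b = (\<Sum>k. x ^ (2 * k + 1) * (v k \<bullet> b))" for b
      by (simp add: sums_iff)
    note * = this
    show ?thesis
      using euclidean_representation[of "\<Sum>k. x ^ (2 * k + 1) *\<^sub>R v k", symmetric] unfolding * .
  qed
  have "((\<lambda>t. (\<Sum>k. t ^ (2 * k + 1) * (v k \<bullet> b)) *\<^sub>R b) has_vector_derivative
      (\<Sum>k. real (2 * k + 1) * t ^ (2 * k) * (v k \<bullet> b)) *\<^sub>R b) (at t)" if "b \<in> Basis" for b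
    using has_vector_derivative_scaleR[OF odd_power_series_derivative_real(2)[OF w[OF that] q] has_vector_derivative_const]
    by simp
  then have "((\<lambda>t. \<Sum>b\<in>Basis. (\<Sum>k. t ^ (2 * k + 1) * (v k \<bullet> b)) *\<^sub>R b) has_vector_derivative y) (at t)"
    unfolding y_def by (rule has_vector_derivative_sum)
  moreover have o: "open {x. x\<^sup>2 * q < 1}" by (intro open_Collect_less continuous_intros)
  ultimately have "((\<lambda>t. \<Sum>k. t ^ (2 * k + 1) *\<^sub>R v k) has_vector_derivative y) (at t)"
    by (rule has_vector_derivative_transform_within_open) (use q comp in auto)
  then show "((\<lambda>t. \<Sum>k. t ^ (2 * k + 1) *\<^sub>R v k) has_vector_derivative (\<Sum>k. (real (2 * k + 1) * t ^ (2 * k)) *\<^sub>R v k)) (at t)"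
    using sums_unique[OF S] by simp
qed

section \<open>The difference element in the model\<close>

lemma trilinear_bound:
  fixes p :: "'e::euclidean_space \<Rightarrow> 'e \<Rightarrow> 'e \<Rightarrow> 'e"
  assumes "\<And>v w. linear (\<lambda>u. p u v w)" "\<And>u w. linear (\<lambda>v. p u v w)" "\<And>u v. linear (\<lambda>w. p u v w)"
  obtains K where "0 < K" "\<And>u v w. norm (p u v w) \<le> K * (norm u * norm v * norm w)"
proof -
  have "bilinear (\<lambda>u v. p u v c)" for c using assms unfolding bilinear_def by blast
  then have "\<exists>k>0. \<forall>u v. norm (p u v c) \<le> k * norm u * norm v" for c using bilinear_bounded_pos by blast
  then obtain k where k: "\<And>c. 0 < k c" "\<And>c u v. norm (p u v c) \<le> k c * norm u * norm v" by metis
  define K where "K = (\<Sum>c\<in>(Basis :: 'e set). k c)"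
  have "0 < K" unfolding K_def by (intro sum_pos k) auto
  moreover have "norm (p u v w) \<le> K * (norm u * norm v * norm w)" for u v w
  proof -
    have "norm (p u v w) = norm (\<Sum>c\<in>Basis. (w \<bullet> c) *\<^sub>R p u v c)"
      using linear_expand_Basis[OF assms(3), of u v w] by (rule arg_cong)
    also have "\<dots> \<le> (\<Sum>c\<in>Basis. norm ((w \<bullet> c) *\<^sub>R p u v c))" by (rule norm_sum)
    also have "\<dots> \<le> (\<Sum>c\<in>Basis. norm w * (k c * norm u * norm v))"
      using k(2) by (intro sum_mono) (auto intro!: mult_mono simp: Basis_le_norm)
    also have "\<dots> = K * (norm u * norm v * norm w)" by (simp add: K_def sum_distrib_left sum_distrib_right mult_ac)
    finally show ?thesis .
  qed
  ultimately show thesis using that by blast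
qed

context jordan_triple
begin

definition ad_sq :: "'e \<Rightarrow> 'e \<Rightarrow> 'e" where "ad_sq X A = p X X A + p A X X"

lemma linear_ad_sq: "linear (ad_sq X)"
  unfolding ad_sq_def by (rule linearI) (simp_all add: p_add p_scale algebra_simps)

text \<open>On \<open>cyc X\<close> both summands agree by commutativity; this is the source of the
  powers of 2 that accompany \<open>pow\<close>.\<close>

lemma ad_sq_cyc:
  assumes "z \<in> cyc X" "u \<in> cyc X"
  shows "ad_sq z u = 2 *\<^sub>R p z z u"
  using p_comm[OF assms(2,1,1)] p_sym[of z u z] by (simp add: ad_sq_def scaleR_2)

lemma ad_sq_pow: "(ad_sq X ^^ k) X = 2 ^ k *\<^sub>R pow X k"
proof (induction k)
  case (Suc k)
  have "ad_sq X (pow X k) = 2 *\<^sub>R pow X (Suc k)"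
    using ad_sq_cyc[OF self_cyc pow_cyc, of X k] by (simp add: pow_Suc)
  then show ?case using Suc by (simp add: linear_scale[OF linear_ad_sq])
qed simp

text \<open>Associativity and commutativity move the factors past each other. In
  \<open>nop_p\<close> this makes the inverse operators commute with \<open>p a b\<close>.\<close>

lemma p_exchange:
  assumes "a \<in> cyc X" "b \<in> cyc X" "c \<in> cyc X" "d \<in> cyc X" "e \<in> cyc X"
  shows "p a b (p c d e) = p c d (p a b e)"
proof -
  note mem = assms p_cyc
  have "p a b (p c d e) = p (p a b c) d e" by (rule p_assoc[OF assms, symmetric])
  also have "p a b c = p c a b" using p_comm[of a X c b] p_sym[of a b c] assms by simp
  also have "p (p c a b) d e = p c a (p b d e)" by (rule p_assoc) (use assms in auto)
  also have "p b d e = p d b e" by (rule p_comm) (use assms in auto)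
  also have "p c a (p d b e) = p (p c a d) b e" by (rule p_assoc[symmetric]) (use assms in auto)
  also have "p c a d = p c d a" by (rule p_sym)
  also have "p (p c d a) b e = p c d (p a b e)" by (rule p_assoc) (use assms in auto)
  finally show ?thesis .
qed

lemma pow_scaleR: "pow (t *\<^sub>R X) k = t ^ (2 * k + 1) *\<^sub>R pow X k"
  by (induction k) (simp_all add: pow_Suc p_scale power2_eq_square)

end

text \<open>The choice of \<open>r1\<close> gives \<open>p X X\<close> norm at most 1/4 and
  \<open>ad_sq X\<close> norm at most 1/2 on the ball, so that the series and the inverses below
  exist there.\<close>

locale normed_jordan_triple = jordan_triple p for p :: "'e::euclidean_space \<Rightarrow> 'e \<Rightarrow> 'e \<Rightarrow> 'e" +
  fixes \<kappa> :: real and r1 :: real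
  assumes \<kappa>: "0 < \<kappa>" "norm (p u v w) \<le> \<kappa> * (norm u * norm v * norm w)"
    and r1: "0 < r1" "4 * \<kappa> * r1\<^sup>2 \<le> 1"
begin

lemma bounded_bilinear_p: "bounded_bilinear (\<lambda>u v. p u v w)" "bounded_bilinear (\<lambda>u w. p u v w)"
    "bounded_bilinear (\<lambda>v w. p u v w)"
  by (auto simp: bilinear_conv_bounded_bilinear[symmetric] bilinear_def p_linear)

lemma norm_pow: "norm (pow X k) \<le> norm X * (\<kappa> * (norm X)\<^sup>2) ^ k"
proof (induction k)
  case (Suc k)
  have "norm (pow X (Suc k)) \<le> \<kappa> * (norm X * norm X * norm (pow X k))"
    unfolding pow_Suc by (rule \<kappa>(2))
  also have "\<dots> \<le> \<kappa> * (norm X * norm X * (norm X * (\<kappa> * (norm X)\<^sup>2) ^ k))"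
    using Suc \<kappa>(1) by (intro mult_left_mono) auto
  finally show ?case by (simp add: power2_eq_square mult_ac)
qed simp

lemma small:
  assumes "norm X < r1"
  shows "\<kappa> * (norm X)\<^sup>2 \<le> 1 / 4"
proof -
  have "(norm X)\<^sup>2 \<le> r1\<^sup>2" using assms by (intro power_mono) auto
  then have "\<kappa> * (norm X)\<^sup>2 \<le> \<kappa> * r1\<^sup>2" using \<kappa>(1) by (intro mult_left_mono) auto
  then show ?thesis using r1(2) by linarith
qed

lemma norm_ad_sq:
  assumes "norm X < r1"
  shows "norm (ad_sq X y) \<le> norm y / 2"
proof -
  have "norm (ad_sq X y) \<le> \<kappa> * (norm X * norm X * norm y) + \<kappa> * (norm y * norm X * norm X)"
    unfolding ad_sq_def by (rule order_trans[OF norm_triangle_ineq]) (intro add_mono \<kappa>(2))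
  also have "\<dots> = 2 * (\<kappa> * (norm X)\<^sup>2) * norm y" by (simp add: power2_eq_square mult_ac)
  also have "\<dots> \<le> 2 * (1 / 4) * norm y" using small[OF assms] by (intro mult_right_mono) auto
  finally show ?thesis by simp
qed

subsection \<open>The tanh series\<close>

definition tc :: "nat \<Rightarrow> real" where "tc k = half_quotient_series tanh $$ (2 * k)"

text \<open>By \<open>ad_sq_pow\<close> the factor \<open>2 ^ k\<close> makes this the
  \<open>tanh\<close> series in \<open>ad_sq X\<close> applied to \<open>X\<close>, written in
  powers of \<open>X\<close>.\<close>

definition tanh_map :: "'e \<Rightarrow> 'e" where "tanh_map X = (\<Sum>k. (tc k * 2 ^ k) *\<^sub>R pow X k)"

lemma tc_rec: "real (2 * k + 1) * tc k = (if k = 0 then 1 else 0) - (\<Sum>j<k. tc j * tc (k - 1 - j)) / 4"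
  unfolding tc_def by (rule tanh_coeffs_rec)

lemma tc_bound: "\<bar>tc k\<bar> \<le> 1"
  unfolding tc_def by (rule tanh_coeffs_bound)

lemma norm_tanh_term: "norm ((tc k * 2 ^ k) *\<^sub>R pow X k) \<le> norm X * (2 * \<kappa> * (norm X)\<^sup>2) ^ k"
proof -
  have "norm ((tc k * 2 ^ k) *\<^sub>R pow X k) \<le> (1 * 2 ^ k) * (norm X * (\<kappa> * (norm X)\<^sup>2) ^ k)"
    unfolding norm_scaleR abs_mult using tc_bound[of k] by (intro mult_mono norm_pow) auto
  then show ?thesis by (simp add: power_mult_distrib mult_ac)
qed

lemma tanh_map_sums:
  assumes "norm X < r1"
  shows "summable (\<lambda>k. norm ((tc k * 2 ^ k) *\<^sub>R pow X k))"
    and "even_series_terms (half_quotient_series tanh) (ad_sq X) X sums tanh_map X"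
    and "norm (tanh_map X) \<le> 2 * norm X"
proof -
  have q: "2 * \<kappa> * (norm X)\<^sup>2 \<le> 1 / 2" "0 \<le> 2 * \<kappa> * (norm X)\<^sup>2" using small[OF assms] \<kappa>(1) by simp_all
  have sg: "summable (\<lambda>k. norm X * (1 / 2) ^ k)" by (intro summable_mult summable_geometric) auto
  have le: "norm ((tc k * 2 ^ k) *\<^sub>R pow X k) \<le> norm X * (1 / 2) ^ k" for k
    using norm_tanh_term[of k X] mult_left_mono[OF power_mono[OF q, of k] norm_ge_zero[of X]] by linarith
  show s: "summable (\<lambda>k. norm ((tc k * 2 ^ k) *\<^sub>R pow X k))"
    by (rule summable_comparison_test'[OF sg]) (use le in simp)
  have "(\<lambda>k. (tc k * 2 ^ k) *\<^sub>R pow X k) sums tanh_map X"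
    unfolding tanh_map_def by (rule summable_sums[OF summable_norm_cancel[OF s]])
  then show "even_series_terms (half_quotient_series tanh) (ad_sq X) X sums tanh_map X"
    by (simp add: even_series_terms_def[abs_def] ad_sq_pow tc_def)
  have "norm (tanh_map X) \<le> (\<Sum>k. norm X * (1 / 2) ^ k)"
    unfolding tanh_map_def by (rule order_trans[OF summable_norm[OF s] suminf_le[OF le s sg]])
  also have "\<dots> = 2 * norm X" by (simp add: suminf_mult suminf_geometric)
  finally show "norm (tanh_map X) \<le> 2 * norm X" .
qed

text \<open>The partial sums lie in \<open>cyc X\<close>, which is closed as a finite dimensional
  subspace.\<close>

lemma tanh_map_cyc:
  assumes "norm X < r1"
  shows "tanh_map X \<in> cyc X"
proof -
  have "(\<lambda>n. \<Sum>k<n. (tc k * 2 ^ k) *\<^sub>R pow X k) \<longlonglongrightarrow> tanh_map X"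
    unfolding tanh_map_def
    by (rule summable_LIMSEQ[OF summable_norm_cancel[OF tanh_map_sums(1)[OF assms]]])
  then show ?thesis
    by (rule closed_sequentially[OF closed_subspace[OF subspace_cyc], rotated])
      (intro subspace_sum subspace_scale subspace_cyc pow_cyc)
qed

lemma cyc_scaleR:
  assumes "t \<noteq> 0"
  shows "cyc (t *\<^sub>R X) = cyc X"
proof -
  have sub: "cyc (t *\<^sub>R X) \<subseteq> cyc X" for t X
    unfolding cyc_def[of "t *\<^sub>R X"]
    by (rule span_minimal[OF _ subspace_cyc]) (auto simp: pow_scaleR intro: subspace_scale subspace_cyc pow_cyc)
  from sub[of t X] sub[of "inverse t" "t *\<^sub>R X"] assms show ?thesis by auto
qed

text \<open>The defining recursion of the \<open>tanh\<close> coefficients is the power series form of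
  \<open>c' = X - p X c c / 2\<close>.\<close>

lemma tanh_curve_deriv:
  assumes t: "norm (t *\<^sub>R X) < r1"
  defines "c \<equiv> \<lambda>t. tanh_map (t *\<^sub>R X)"
  shows "(c has_vector_derivative X - (1 / 2) *\<^sub>R p X (c t) (c t)) (at t)"
proof -
  define v where "v k = (tc k * 2 ^ k) *\<^sub>R pow X k" for k
  \<comment> \<open>The first summand is the growth ratio of the terms; the second keeps
    \<open>q\<close> positive for \<open>X = 0\<close> and adds at most 1/4 to
    \<open>t^2 q\<close>.\<close>
  define q where "q = 2 * \<kappa> * (norm X)\<^sup>2 + 1 / (4 * (t\<^sup>2 + 1))"
  have t1: "0 < t\<^sup>2 + 1" by (simp add: add_nonneg_pos)
  have q0: "0 < q" unfolding q_def using \<kappa>(1) t1 by (intro add_nonneg_pos) auto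
  have "t\<^sup>2 * q = 2 * (\<kappa> * (norm (t *\<^sub>R X))\<^sup>2) + t\<^sup>2 / (4 * (t\<^sup>2 + 1))"
    by (simp add: q_def power_mult_distrib algebra_simps)
  also have "\<dots> < 1"
  proof -
    have "t\<^sup>2 / (4 * (t\<^sup>2 + 1)) \<le> 1 / 4" using t1 by (simp add: field_simps)
    then show ?thesis using small[OF t] by linarith
  qed
  finally have q1: "t\<^sup>2 * q < 1" .
  have v: "norm (v k) \<le> norm X * q ^ k" for k
  proof -
    have "(2 * \<kappa> * (norm X)\<^sup>2) ^ k \<le> q ^ k"
      using \<kappa>(1) t1 by (intro power_mono) (auto simp: q_def)
    then show ?thesis unfolding v_def using norm_tanh_term[of k X] mult_left_mono[OF _ norm_ge_zero[of X]] by force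
  qed
  have c: "c t = (\<Sum>k. t ^ (2 * k + 1) *\<^sub>R v k)" for t
    unfolding c_def tanh_map_def v_def pow_scaleR by (simp add: mult_ac)
  note ps = odd_power_series[OF v q0 q1]
  have D: "(c has_vector_derivative (\<Sum>k. (real (2 * k + 1) * t ^ (2 * k)) *\<^sub>R v k)) (at t)"
    unfolding c[abs_def] by (rule ps(3))
  define a where "a k = t ^ (2 * k + 1) *\<^sub>R v k" for k
  have "bilinear (\<lambda>u w. p X u w)" by (auto simp: bilinear_def p_linear)
  from Cauchy_product_bilinear[OF this ps(1) ps(1)]
  have cp: "(\<lambda>n. \<Sum>i\<le>n. p X (a i) (a (n - i))) sums p X (c t) (c t)"
    by (simp add: a_def c)
  \<comment> \<open>By power associativity all products in the Cauchy sum are multiples of one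
    power; having \<open>2 ^ n\<close> where \<open>2 ^ Suc n\<close> is wanted turns the 1/4 of
    \<open>tc_rec\<close> into 1/2.\<close>
  have coeff: "- (1 / 2) *\<^sub>R (\<Sum>i\<le>n. p X (a i) (a (n - i)))
      = (real (2 * Suc n + 1) * t ^ (2 * Suc n)) *\<^sub>R v (Suc n)" for n
  proof -
    have "p X (a i) (a (n - i)) = (t ^ (2 * Suc n) * 2 ^ n * (tc i * tc (n - i))) *\<^sub>R pow X (Suc n)" if "i \<le> n" for i
    proof -
      have "p X (pow X i) (pow X (n - i)) = pow X (Suc n)"
        using p_pow[of X 0 i "n - i"] p_comm[OF self_cyc pow_cyc pow_cyc, of X i "n - i"]
          p_pow[of X i 0 "n - i"] that by simp
      moreover have "t ^ (2 * i + 1) * t ^ (2 * (n - i) + 1) = t ^ (2 * Suc n)" "2 ^ i * 2 ^ (n - i) = (2 :: real) ^ n"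
        unfolding power_add[symmetric] using that by (auto intro!: arg_cong[where f = "power _"])
      moreover have "p X (a i) (a (n - i)) = ((t ^ (2 * i + 1) * t ^ (2 * (n - i) + 1)) * (2 ^ i * 2 ^ (n - i)) * (tc i * tc (n - i)))
          *\<^sub>R p X (pow X i) (pow X (n - i))"
        by (simp add: a_def v_def p_scale mult_ac)
      ultimately show ?thesis by (simp only:)
    qed
    then have "(\<Sum>i\<le>n. p X (a i) (a (n - i))) = (\<Sum>i\<le>n. (t ^ (2 * Suc n) * 2 ^ n * (tc i * tc (n - i))) *\<^sub>R pow X (Suc n))"
      by (intro sum.cong) auto
    also have "\<dots> = (t ^ (2 * Suc n) * 2 ^ n * (\<Sum>i\<le>n. tc i * tc (n - i))) *\<^sub>R pow X (Suc n)"
      by (simp only: scaleR_sum_left sum_distrib_left)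
    also have "(\<Sum>i\<le>n. tc i * tc (n - i)) = - 4 * (real (2 * Suc n + 1) * tc (Suc n))"
      using tc_rec[of "Suc n"] by (simp add: lessThan_Suc_atMost)
    finally have sm: "(\<Sum>i\<le>n. p X (a i) (a (n - i))) = (t ^ (2 * Suc n) * 2 ^ n * (- 4 * (real (2 * Suc n + 1) * tc (Suc n)))) *\<^sub>R pow X (Suc n)" .
    show ?thesis unfolding sm v_def scaleR_scaleR
      unfolding power_Suc[of 2 n] by (rule arg_cong[where f = "\<lambda>r. r *\<^sub>R pow X (Suc n)"]) algebra
  qed
  have "(\<lambda>n. (real (2 * Suc n + 1) * t ^ (2 * Suc n)) *\<^sub>R v (Suc n)) sums (- (1 / 2) *\<^sub>R p X (c t) (c t))"
    using bounded_linear.sums[OF bounded_linear_scaleR_right cp, of "- (1 / 2)"] by (simp only: coeff)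
  then have "(\<lambda>n. (real (2 * n + 1) * t ^ (2 * n)) *\<^sub>R v n) sums (- (1 / 2) *\<^sub>R p X (c t) (c t) + (real (2 * 0 + 1) * t ^ (2 * 0)) *\<^sub>R v 0)"
    by (rule sums_Suc)
  moreover have "v 0 = X" using tc_rec[of 0] by (simp add: v_def)
  ultimately have "(\<lambda>n. (real (2 * n + 1) * t ^ (2 * n)) *\<^sub>R v n) sums (X - (1 / 2) *\<^sub>R p X (c t) (c t))" by simp
  with D show ?thesis by (simp add: sums_iff)
qed

subsection \<open>The artanh series\<close>

text \<open>The operator 1 - s^2 w^2 for w^2 = \<open>ad_sq X / 4\<close>, the denominator in the
  integral for \<open>artanh\<close>.\<close>

definition mop :: "'e \<Rightarrow> real \<Rightarrow> 'e \<Rightarrow> 'e" where "mop X s y = y - (s\<^sup>2 / 4) *\<^sub>R ad_sq X y"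

definition nop :: "'e \<Rightarrow> real \<Rightarrow> 'e \<Rightarrow> 'e" where "nop X s = inv (mop X s)"

text \<open>\<open>artanh w / w\<close> is the integral of \<open>1 / (1 - s^2 w^2)\<close> over \<open>0 \<le> s \<le> 1\<close>, which makes smoothness evident.\<close>

definition artanh_map :: "'e \<Rightarrow> 'e" where "artanh_map X = integral {0..1} (\<lambda>s. nop X s X)"

text \<open>An open interval around \<open>{0..1}\<close>, small enough that s^2 / 2 < 1, as the
  series in \<open>artanh_map_sums\<close> requires.\<close>

abbreviation "sdom \<equiv> {- (6 / 5) <..< (6 / 5 :: real)}"

lemma linear_mop: "linear (mop X s)"
  unfolding mop_def
  by (rule linearI) (simp_all add: linear_add[OF linear_ad_sq] linear_scale[OF linear_ad_sq] algebra_simps)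

lemma bij_mop:
  assumes X: "norm X < r1" and s: "s \<in> sdom"
  shows "bij (mop X s)"
proof -
  have "s\<^sup>2 \<le> (6 / 5)\<^sup>2" using s by (intro abs_le_square_iff[THEN iffD1]) auto
  then have s4: "s\<^sup>2 / 4 \<le> 1" by (simp add: power2_eq_square)
  have "inj (mop X s)"
    unfolding linear_injective_0[OF linear_mop]
  proof (intro allI impI)
    fix y assume "mop X s y = 0"
    then have "y = (s\<^sup>2 / 4) *\<^sub>R ad_sq X y" by (simp add: mop_def)
    then have "norm y = s\<^sup>2 / 4 * norm (ad_sq X y)"
      by (metis norm_scaleR abs_of_nonneg divide_nonneg_nonneg zero_le_power2 zero_le_numeral)
    also have "\<dots> \<le> 1 * (norm y / 2)" using s4 norm_ad_sq[OF X, of y] by (intro mult_mono) auto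
    finally show "y = 0" by simp
  qed
  then show ?thesis using linear_injective_imp_surjective[OF linear_mop] by (simp add: bij_def)
qed

lemma mop_nop: "norm X < r1 \<Longrightarrow> s \<in> sdom \<Longrightarrow> mop X s (nop X s y) = y"
  and nop_mop: "norm X < r1 \<Longrightarrow> s \<in> sdom \<Longrightarrow> nop X s (mop X s y) = y"
  using bij_mop by (simp_all add: nop_def bij_is_surj surj_f_inv_f bij_is_inj)

lemma nop_eqI: "norm X < r1 \<Longrightarrow> s \<in> sdom \<Longrightarrow> mop X s x = y \<Longrightarrow> nop X s y = x"
  using nop_mop by blast

lemma linear_nop:
  assumes "norm X < r1" "s \<in> sdom"
  shows "linear (nop X s)"
  by (rule linearI) (rule nop_eqI[OF assms], simp add: linear_add[OF linear_mop] linear_scale[OF linear_mop] mop_nop[OF assms])+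

abbreviation "XS \<equiv> ball 0 r1 \<times> sdom"

lemma open_XS: "open XS" by (intro open_Times open_ball open_greaterThanLessThan)

lemma smooth_on_mop: "smooth_on (\<lambda>q. mop (fst q) (snd q) y) XS"
proof -
  have f: "smooth_on fst XS" and s: "smooth_on snd XS"
    using smooth_on_bounded_linear[OF open_XS bounded_linear_fst smooth_on_ident[OF open_XS]]
      smooth_on_bounded_linear[OF open_XS bounded_linear_snd smooth_on_ident[OF open_XS]] by simp_all
  have 1: "smooth_on (\<lambda>q. p (fst q) (fst q) y) XS" "smooth_on (\<lambda>q. p y (fst q) (fst q)) XS"
    by (rule smooth_on_bilinear[OF open_XS bounded_bilinear_p(1) f f] smooth_on_bilinear[OF open_XS bounded_bilinear_p(3) f f])+
  have 2: "smooth_on (\<lambda>q. (1 / 4) * (snd q * snd q)) XS"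
    by (intro smooth_on_mult smooth_on_const open_XS s)
  have "smooth_on (\<lambda>q. y - ((1 / 4) * (snd q * snd q)) *\<^sub>R (p (fst q) (fst q) y + p y (fst q) (fst q))) XS"
    by (rule smooth_on_diff[OF open_XS smooth_on_const[OF open_XS] smooth_on_scaleR[OF open_XS 2 smooth_on_add[OF open_XS 1]]])
  then show ?thesis unfolding mop_def ad_sq_def by (simp add: power2_eq_square)
qed

lemma smooth_on_nop: "smooth_on (\<lambda>q. nop (fst q) (snd q) y) XS"
  by (rule smooth_on_inverse_family[OF open_XS linear_mop smooth_on_mop])
    (auto simp: mop_nop nop_mop)

lemma smooth_on_nop_self: "smooth_on (\<lambda>q. nop (fst q) (snd q) (fst q)) XS"
  by (rule smooth_on_apply[OF open_XS _ smooth_on_nop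
        smooth_on_bounded_linear[OF open_XS bounded_linear_fst smooth_on_ident[OF open_XS]]])
    (auto intro: linear_nop)

lemma smooth_on_artanh_map: "smooth_on artanh_map (ball 0 r1)"
  unfolding artanh_map_def[abs_def]
  by (rule smooth_on_integral_param[OF open_ball open_greaterThanLessThan _ smooth_on_nop_self]) auto

text \<open>The auxiliary series \<open>h\<close> has as derivative the geometric series that
  \<open>mop X s\<close> sends to \<open>X\<close>, that is, \<open>nop X s X\<close>; integration
  over \<open>{0..1}\<close> therefore gives \<open>h 1\<close>, the \<open>artanh\<close>
  series.\<close>

lemma artanh_map_sums:
  assumes X: "norm X < r1"
  shows "even_series_terms (half_quotient_series artanh) (ad_sq X) X sums artanh_map X"
proof -
  define w where "w k = (1 / 4) ^ k *\<^sub>R (ad_sq X ^^ k) X" for k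
  define v where "v k = (1 / real (2 * k + 1)) *\<^sub>R w k" for k
  have w: "norm (w k) \<le> norm X * (1 / 2) ^ k" for k
  proof -
    have "norm (w k) = (1 / 2) ^ k * norm (pow X k)"
      by (simp add: w_def ad_sq_pow power_one_over flip: power_mult_distrib)
        (simp add: divide_simps flip: power_mult_distrib)
    also have "\<dots> \<le> (1 / 2) ^ k * (norm X * (\<kappa> * (norm X)\<^sup>2) ^ k)" by (intro mult_left_mono norm_pow) auto
    also have "\<dots> \<le> (1 / 2) ^ k * (norm X * 1)"
      using small[OF X] \<kappa>(1) by (intro mult_left_mono power_le_one) auto
    finally show ?thesis by (simp add: mult.commute)
  qed
  have v: "norm (v k) \<le> norm X * (1 / 2) ^ k" for k
  proof -
    have "norm (v k) \<le> 1 * norm (w k)" unfolding v_def norm_scaleR by (intro mult_right_mono) auto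
    then show ?thesis using w[of k] by linarith
  qed
  define h where "h s = (\<Sum>k. s ^ (2 * k + 1) *\<^sub>R v k)" for s
  have Dh: "(h has_vector_derivative nop X s X) (at s)" and sumh: "summable (\<lambda>k. s ^ (2 * k + 1) *\<^sub>R v k)"
    if s: "s \<in> sdom" for s
  proof -
    have "s\<^sup>2 \<le> (6 / 5)\<^sup>2" using s by (intro abs_le_square_iff[THEN iffD1]) auto
    then have s2: "s\<^sup>2 * (1 / 2) < 1" by (simp add: power2_eq_square)
    note ps = odd_power_series[OF v _ s2]
    show "summable (\<lambda>k. s ^ (2 * k + 1) *\<^sub>R v k)" by (rule summable_norm_cancel[OF ps(1)]) simp
    define u where "u k = (s\<^sup>2 / 4) ^ k *\<^sub>R (ad_sq X ^^ k) X" for k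
    have u: "(real (2 * k + 1) * s ^ (2 * k)) *\<^sub>R v k = u k" for k
    proof -
      have "real (2 * k + 1) * (1 / real (2 * k + 1)) = 1" by (simp del: of_nat_add of_nat_mult)
      moreover have "s ^ (2 * k) * (1 / 4) ^ k = (s\<^sup>2 / 4) ^ k" by (simp add: power_mult power_divide)
      moreover have "(real (2 * k + 1) * s ^ (2 * k)) *\<^sub>R v k
          = ((real (2 * k + 1) * (1 / real (2 * k + 1))) * (s ^ (2 * k) * (1 / 4) ^ k)) *\<^sub>R (ad_sq X ^^ k) X"
        by (simp add: v_def w_def mult_ac)
      ultimately show ?thesis by (simp only: u_def mult_1)
    qed
    have su: "summable u" using ps(2) unfolding u by simp
    have "(s\<^sup>2 / 4) *\<^sub>R ad_sq X (\<Sum>k. u k) = (\<Sum>k. (s\<^sup>2 / 4) *\<^sub>R ad_sq X (u k))"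
    proof -
      have "bounded_linear (\<lambda>y. (s\<^sup>2 / 4) *\<^sub>R ad_sq X y)"
        using bounded_linear_compose[OF bounded_linear_scaleR_right] linear_ad_sq[of X]
        by (simp add: linear_conv_bounded_linear)
      from bounded_linear.suminf[OF this su] show ?thesis .
    qed
    also have "\<dots> = (\<Sum>k. u (Suc k))"
      by (simp add: u_def linear_scale[OF linear_ad_sq] mult_ac)
    also have "\<dots> = (\<Sum>k. u k) - X"
    proof -
      have "u 0 = X" by (simp add: u_def)
      then show ?thesis using suminf_split_head[OF su] by simp
    qed
    finally have "mop X s (\<Sum>k. u k) = X" by (simp add: mop_def)
    then have "nop X s X = (\<Sum>k. u k)" by (rule nop_eqI[OF X s])
    moreover have "(h has_vector_derivative (\<Sum>k. u k)) (at s)"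
      using ps(3) unfolding h_def[abs_def] u by simp
    ultimately show "(h has_vector_derivative nop X s X) (at s)" by (simp only:)
  qed
  have "((\<lambda>s. nop X s X) has_integral h 1 - h 0) {0..1}"
    by (rule fundamental_theorem_of_calculus) (auto intro!: has_vector_derivative_at_within Dh)
  then have "artanh_map X = h 1" unfolding artanh_map_def by (simp add: integral_unique h_def)
  moreover have "(\<lambda>k. v k) sums h 1" using summable_sums[OF sumh[of 1]] by (simp add: h_def)
  moreover have "v = even_series_terms (half_quotient_series artanh) (ad_sq X) X"
    by (simp add: fun_eq_iff v_def w_def even_series_terms_def artanh_coeffs)
  ultimately show ?thesis by simp
qed

lemma artanh_map_0: "artanh_map 0 = 0"
proof -
  have "nop 0 s 0 = 0" if "s \<in> {0..1}" for s
    by (rule nop_eqI) (use r1 that in \<open>auto simp: mop_def linear_0[OF linear_ad_sq]\<close>)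
  then have "integral {0..1} (\<lambda>s. nop 0 s 0) = integral {0..1} (\<lambda>s::real. 0)" by (intro integral_cong) auto
  then show ?thesis by (simp add: artanh_map_def)
qed

lemma nop_cyc:
  assumes z: "z \<in> cyc X" and n: "norm z < r1" and s: "s \<in> sdom" and y: "y \<in> cyc X"
  shows "nop z s y \<in> cyc X"
proof -
  have MC: "mop z s ` cyc X \<subseteq> cyc X"
    unfolding mop_def by (auto intro!: subspace_diff subspace_scale subspace_cyc simp: ad_sq_cyc[OF z] p_cyc[OF z z])
  have "dim (mop z s ` cyc X) = dim (cyc X)"
    by (rule dim_image_eq[OF linear_mop]) (use bij_mop[OF n s] in \<open>auto simp: bij_def intro: inj_on_subset\<close>)
  then have "mop z s ` cyc X = cyc X"
    using MC by (intro subspace_dim_equal subspace_cyc linear_subspace_image[OF linear_mop]) auto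
  then obtain x where "x \<in> cyc X" "mop z s x = y" using y by (metis imageE)
  then show ?thesis using nop_eqI[OF n s] by metis
qed

lemma nop_p:
  assumes z: "z \<in> cyc X" and n: "norm z < r1" and s: "s \<in> sdom"
    and m: "a \<in> cyc X" "b \<in> cyc X" "y \<in> cyc X"
  shows "nop z s (p a b y) = p a b (nop z s y)"
proof (rule nop_eqI[OF n s])
  note my = nop_cyc[OF z n s m(3)]
  have "ad_sq z (p a b (nop z s y)) = p a b (ad_sq z (nop z s y))"
    by (simp add: ad_sq_cyc[OF z] p_cyc m my p_scale p_exchange[OF z z m(1,2) my])
  then have "mop z s (p a b (nop z s y)) = p a b (mop z s (nop z s y))"
    by (simp add: mop_def p_scale linear_diff[OF p_linear(3)])
  then show "mop z s (p a b (nop z s y)) = p a b y" by (simp add: mop_nop[OF n s])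
qed

text \<open>The derivative of the integrand in the direction \<open>v\<close> is d/ds of
  \<open>s nop z s v\<close>, so the integral is given by its boundary values. The identity rests on
  commuting operators, hence \<open>z\<close> and \<open>v\<close> lie in one
  \<open>cyc X\<close>.\<close>

lemma artanh_map_deriv:
  assumes z: "z \<in> cyc X" and n: "norm z < r1" and v: "v \<in> cyc X"
  shows "dir_deriv artanh_map z v = nop z 1 v"
proof -
  let ?G = "\<lambda>q. nop (fst q) (snd q) (fst q)"
  have q: "(z, s) \<in> XS" if "s \<in> sdom" for s using n that by simp
  have dM: "((\<lambda>q. mop (fst q) (snd q) y) has_derivative
      (\<lambda>h. - ((s\<^sup>2 / 4) *\<^sub>R (p z (fst h) y + p (fst h) z y + (p y z (fst h) + p y (fst h) z)) + (s * snd h / 2) *\<^sub>R ad_sq z y))) (at (z, s))" for s y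
  proof -
    have 1: "((\<lambda>q. p (fst q) (fst q) y + p y (fst q) (fst q)) has_derivative
        (\<lambda>h. p z (fst h) y + p (fst h) z y + (p y z (fst h) + p y (fst h) z))) (at (z, s))"
    proof -
      have f: "(fst has_derivative fst) (at (z, s))" by (rule bounded_linear_imp_has_derivative[OF bounded_linear_fst])
      show ?thesis
        by (rule has_derivative_eq_rhs[OF has_derivative_add[OF bounded_bilinear.FDERIV[OF bounded_bilinear_p(1) f f]
              bounded_bilinear.FDERIV[OF bounded_bilinear_p(3) f f]]]) (simp add: fun_eq_iff)
    qed
    have 2: "((\<lambda>q::'e \<times> real. (snd q * snd q) / 4) has_derivative (\<lambda>h. (s * snd h + snd h * s) / 4)) (at (z, s))"
    proof -
      have sn: "(snd has_derivative snd) (at (z, s))" by (rule bounded_linear_imp_has_derivative[OF bounded_linear_snd])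
      show ?thesis
        by (rule has_derivative_eq_rhs[OF bounded_linear.has_derivative[OF bounded_linear_divide has_derivative_mult[OF sn sn]]])
          (simp add: fun_eq_iff)
    qed
    show ?thesis
      unfolding mop_def ad_sq_def power2_eq_square
      by (rule has_derivative_eq_rhs[OF has_derivative_diff[OF has_derivative_const has_derivative_scaleR[OF 2 1]]])
        (simp add: fun_eq_iff)
  qed
  have dN: "((\<lambda>q. nop (fst q) (snd q) y) has_derivative
      (\<lambda>h. - nop z s (dir_deriv (\<lambda>q. mop (fst q) (snd q) (nop z s y)) (z, s) h))) (at (z, s))" if "s \<in> sdom" for s y
    by (rule inverse_family_has_derivative[OF open_XS q[OF that] linear_mop smooth_on_mop,
        of "\<lambda>q. nop (fst q) (snd q)" y, simplified fst_conv snd_conv]) (auto intro: mop_nop nop_mop)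
  note dN = dN[unfolded dir_deriv_eq[OF dM]]
  have G: "dir_deriv ?G (z, s) (v, 0) = nop z s v + s\<^sup>2 *\<^sub>R p z v (nop z s (nop z s z))" if s: "s \<in> sdom" for s
  proof -
    define g where "g = nop z s z"
    have g: "g \<in> cyc X" unfolding g_def by (rule nop_cyc[OF z n s z])
    have "(?G has_derivative (\<lambda>h. - nop z s (- ((s\<^sup>2 / 4) *\<^sub>R (p z (fst h) g + p (fst h) z g + (p g z (fst h) + p g (fst h) z)) + (s * snd h / 2) *\<^sub>R ad_sq z g))
        + nop z s (fst h))) (at (z, s))"
      unfolding g_def
      by (rule has_derivative_eq_rhs[OF has_derivative_apply[OF open_XS q[OF s], of "\<lambda>q. nop (fst q) (snd q)",
          OF _ dN[OF s] bounded_linear_imp_has_derivative[OF bounded_linear_fst]]]) (auto intro: linear_nop)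
    then have "dir_deriv ?G (z, s) (v, 0) = - nop z s (- ((s\<^sup>2 / 4) *\<^sub>R (p z v g + p v z g + (p g z v + p g v z)))) + nop z s v"
      by (rule dir_deriv_eq[THEN trans]) simp
    \<comment> \<open>By commutativity all four terms become \<open>p z v g\<close>, which cancels
      the 1/4.\<close>
    also have "p v z g = p z v g" by (rule p_comm[OF v z g])
    also have "p g z v = p z v g" using p_comm[OF g z v] p_sym[of z g v] by simp
    also have "p g v z = p z v g" using p_sym[of g v z] \<open>p g z v = p z v g\<close> by simp
    also have "- nop z s (- ((s\<^sup>2 / 4) *\<^sub>R (p z v g + p z v g + (p z v g + p z v g)))) = s\<^sup>2 *\<^sub>R nop z s (p z v g)"
    proof -
      have "(s\<^sup>2 / 4) *\<^sub>R (p z v g + p z v g + (p z v g + p z v g)) = s\<^sup>2 *\<^sub>R p z v g"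
        by (simp flip: scaleR_2)
      then show ?thesis by (simp add: linear_neg[OF linear_nop[OF n s]] linear_scale[OF linear_nop[OF n s]])
    qed
    finally show ?thesis by (simp add: nop_p[OF z n s z v g[unfolded g_def]] g_def)
  qed
  have "((\<lambda>s. s *\<^sub>R nop z s v) has_vector_derivative dir_deriv ?G (z, s) (v, 0)) (at s)" if s: "s \<in> {0..1}" for s
  proof -
    have s': "s \<in> sdom" using s by auto
    define g where "g = nop z s v"
    have g: "g \<in> cyc X" unfolding g_def by (rule nop_cyc[OF z n s' v])
    have "((\<lambda>s. (z, s)) has_derivative (\<lambda>h. (0, h))) (at s)" by (auto intro!: derivative_eq_intros)
    from has_derivative_compose[OF this dN[OF s', of v]]
    have "((\<lambda>s. nop z s v) has_derivative (\<lambda>h. - nop z s (- ((s * h / 2) *\<^sub>R ad_sq z g)))) (at s)"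
      by (simp add: g_def linear_0[OF p_linear(1)] linear_0[OF p_linear(2)] linear_0[OF p_linear(3)])
    then have "((\<lambda>s. nop z s v) has_vector_derivative s *\<^sub>R nop z s (p z z g)) (at s)"
      unfolding has_vector_derivative_def
      by (rule has_derivative_eq_rhs)
        (simp add: fun_eq_iff ad_sq_cyc[OF z g] linear_neg[OF linear_nop[OF n s']] linear_scale[OF linear_nop[OF n s']] mult.commute)
    from has_vector_derivative_scaleR[OF DERIV_ident this]
    have "((\<lambda>s. s *\<^sub>R nop z s v) has_vector_derivative s *\<^sub>R (s *\<^sub>R nop z s (p z z g)) + 1 *\<^sub>R nop z s v) (at s)" .
    moreover have "nop z s (p z z g) = p z v (nop z s (nop z s z))"
    proof -
      have "p z z g = nop z s (p z z v)" unfolding g_def by (rule nop_p[OF z n s' z z v, symmetric])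
      also have "p z z v = p z v z" by (rule p_sym)
      also have "nop z s (p z v z) = p z v (nop z s z)" by (rule nop_p[OF z n s' z v z])
      finally show ?thesis by (simp add: nop_p[OF z n s' z v nop_cyc[OF z n s' z]])
    qed
    ultimately show ?thesis by (simp add: G[OF s'] power2_eq_square add.commute)
  qed
  then have "((\<lambda>s. dir_deriv ?G (z, s) (v, 0)) has_integral 1 *\<^sub>R nop z 1 v - 0 *\<^sub>R nop z 0 v) {0..1}"
    by (intro fundamental_theorem_of_calculus) (auto intro: has_vector_derivative_at_within)
  then have I: "integral {0..1} (\<lambda>s. dir_deriv ?G (z, s) (v, 0)) = nop z 1 v" by (simp add: integral_unique)
  have "(artanh_map has_derivative (\<lambda>v. integral {0..1} (\<lambda>s. dir_deriv ?G (z, s) (v, 0)))) (at z)"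
    unfolding artanh_map_def[abs_def]
    by (rule integral_has_derivative_param[OF open_ball _ open_greaterThanLessThan _ smooth_on_nop_self]) (use n in auto)
  then show ?thesis by (rule dir_deriv_eq[THEN trans]) (rule I)
qed

text \<open>Along \<open>c t = tanh_map (t X)\<close> the velocity is \<open>mop (c t) 1 X\<close>,
  and on it the derivative of \<open>artanh_map\<close> acts as the inverse of
  \<open>mop (c t) 1\<close>; so \<open>artanh_map (c t)\<close> has constant derivative
  \<open>X\<close>.\<close>

lemma artanh_tanh_map:
  assumes X: "norm X < r1 / 2"
  shows "artanh_map (tanh_map X) = X"
proof -
  define c where "c t = tanh_map (t *\<^sub>R X)" for t
  have D: "((\<lambda>t. artanh_map (c t) - t *\<^sub>R X) has_vector_derivative 0) (at t)" if t: "t \<in> {0..1}" for t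
  proof -
    have tX: "norm (t *\<^sub>R X) < r1 / 2"
    proof -
      have "norm (t *\<^sub>R X) \<le> 1 * norm X" unfolding norm_scaleR using t by (intro mult_right_mono) auto
      then show ?thesis using X by simp
    qed
    then have tX': "norm (t *\<^sub>R X) < r1" using r1 by simp
    have cn: "norm (c t) < r1" using tanh_map_sums(3)[OF tX'] tX by (simp add: c_def)
    have cc: "c t \<in> cyc X"
    proof (cases "t = 0")
      case True
      have "tanh_map 0 = 0" using tanh_map_sums(3)[of 0] r1 by simp
      then show ?thesis using True subspace_0[OF subspace_cyc] by (simp add: c_def)
    next
      case False
      then show ?thesis using tanh_map_cyc[OF tX'] by (simp add: c_def cyc_scaleR)
    qed
    define w where "w = X - (1 / 2) *\<^sub>R p X (c t) (c t)"
    have "(c has_vector_derivative w) (at t)"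
      using tanh_curve_deriv[OF tX'] by (simp add: c_def[abs_def] w_def)
    then have dc: "(c has_derivative (\<lambda>h. h *\<^sub>R w)) (at t)" unfolding has_vector_derivative_def .
    have ct: "c t \<in> ball 0 r1" using cn by simp
    have "((\<lambda>t. artanh_map (c t)) has_vector_derivative dir_deriv artanh_map (c t) w) (at t)"
      unfolding has_vector_derivative_def
      by (rule has_derivative_eq_rhs[OF has_derivative_compose[OF dc smooth_on_has_derivative[OF open_ball smooth_on_artanh_map ct]]])
        (simp add: linear_scale[OF smooth_on_linear_dir_deriv[OF open_ball smooth_on_artanh_map ct]])
    moreover have "dir_deriv artanh_map (c t) w = X"
    proof -
      have w: "w \<in> cyc X"
        unfolding w_def by (intro subspace_diff subspace_scale subspace_cyc self_cyc p_cyc cc)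
      have "p X (c t) (c t) = p (c t) (c t) X"
        using p_comm[OF self_cyc cc cc] p_sym[of "c t" X "c t"] by simp
      then have "mop (c t) 1 X = w" by (simp add: mop_def ad_sq_cyc[OF cc self_cyc] w_def)
      then have "nop (c t) 1 w = X" by (intro nop_eqI cn) auto
      then show ?thesis using artanh_map_deriv[OF cc cn w] by simp
    qed
    ultimately have "((\<lambda>t. artanh_map (c t)) has_vector_derivative X) (at t)" by simp
    from has_vector_derivative_diff[OF this has_vector_derivative_scaleR[OF DERIV_ident has_vector_derivative_const[of X]]]
    show ?thesis by simp
  qed
  obtain k where k: "\<And>t. t \<in> {0..1} \<Longrightarrow> artanh_map (c t) - t *\<^sub>R X = k"
    using has_vector_derivative_zero_constant[of "{0..1}" "\<lambda>t. artanh_map (c t) - t *\<^sub>R X"] D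
    by (metis convex_real_interval(5) has_vector_derivative_at_within)
  have "tanh_map 0 = 0" using tanh_map_sums(3)[of 0] r1 by simp
  then have "k = 0" using k[of 0] artanh_map_0 by (simp add: c_def)
  then show ?thesis using k[of 1] by (simp add: c_def)
qed

end

section \<open>Inverting the artanh map and the geodesic equation\<close>

context normed_jordan_triple
begin

lemma tanh_map_0: "tanh_map 0 = 0"
  using tanh_map_sums(3)[of 0] r1 by simp

lemma tanh_curve_cyc:
  assumes "norm (t *\<^sub>R X) < r1"
  shows "tanh_map (t *\<^sub>R X) \<in> cyc X"
proof (cases "t = 0")
  case True
  then show ?thesis using subspace_0[OF subspace_cyc] by (simp add: tanh_map_0)
next
  case False
  then show ?thesis using tanh_map_cyc[OF assms] by (simp add: cyc_scaleR)
qed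

text \<open>Near 0 \<open>tanh_map\<close> coincides with the smooth local inverse of
  \<open>artanh_map\<close>, since \<open>artanh_map\<close> undoes it. This yields its smoothness
  as a function of \<open>X\<close> and also the inverse relation in the other order.\<close>

lemma tanh_map_inverse:
  obtains r where "0 < r" "r \<le> r1" "smooth_on tanh_map (ball 0 r)" "(tanh_map has_derivative (\<lambda>v. v)) (at 0)"
    "\<And>d. 0 < d \<Longrightarrow> \<forall>\<^sub>F X in nhds 0. artanh_map X \<in> ball 0 d \<and> tanh_map (artanh_map X) = X"
proof -
  have D0: "dir_deriv artanh_map 0 v = v" for v
  proof -
    have "dir_deriv artanh_map 0 v = nop 0 1 v"
      using r1 by (intro artanh_map_deriv[of 0 v]) (auto intro: self_cyc subspace_0 subspace_cyc)
    also have "\<dots> = v"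
      by (rule nop_eqI) (use r1 in \<open>auto simp: mop_def ad_sq_def linear_0[OF p_linear(1)] linear_0[OF p_linear(3)]\<close>)
    finally show ?thesis .
  qed
  have "inj (dir_deriv artanh_map 0)" by (rule injI) (simp add: D0)
  from smooth_inverse_function[OF open_ball _ smooth_on_artanh_map this] r1
  obtain U W h where U: "open U" "U \<subseteq> ball 0 r1" "0 \<in> U" "open W" "homeomorphism U W artanh_map h" "smooth_on h W"
    by (metis centre_in_ball)
  have "0 \<in> W" using homeomorphism_image1[OF U(5)] U(3) artanh_map_0 by (metis imageI)
  obtain a where a: "0 < a" "ball 0 a \<subseteq> U" using U(1,3) openE by blast
  obtain b where b: "0 < b" "ball 0 b \<subseteq> W" using U(4) \<open>0 \<in> W\<close> openE by blast
  define r where "r = min (min (a / 2) b) (r1 / 2)"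
  have r: "0 < r" "r \<le> r1" using a b r1 by (auto simp: r_def)
  have eq: "h X = tanh_map X" if X: "X \<in> ball 0 r" for X
  proof -
    have n: "norm X < r1 / 2" "norm X < a / 2" using X by (auto simp: r_def)
    have "norm (tanh_map X) < a" using tanh_map_sums(3)[of X] n r1 by simp
    then have "tanh_map X \<in> U" using a(2) by auto
    then have "h (artanh_map (tanh_map X)) = tanh_map X" by (rule homeomorphism_apply1[OF U(5)])
    then show ?thesis by (simp add: artanh_tanh_map[OF n(1)])
  qed
  have sm: "smooth_on h (ball 0 r)"
    by (rule smooth_on_subset[OF U(6)]) (use b in \<open>auto simp: r_def\<close>)
  have smt: "smooth_on tanh_map (ball 0 r)"
    by (rule smooth_on_cong[OF open_ball _ sm]) (simp add: eq)
  have cont: "artanh_map \<midarrow>0\<rightarrow> 0"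
    using continuous_on_interior[OF smooth_on_continuous[OF smooth_on_artanh_map], of 0] r1 artanh_map_0
    by (simp add: isCont_def interior_open)
  then have "(artanh_map \<longlongrightarrow> 0) (nhds 0)" using artanh_map_0 by (metis tendsto_at_iff_tendsto_nhds)
  then have small: "\<forall>\<^sub>F X in nhds 0. artanh_map X \<in> ball 0 d" if "0 < d" for d
    by (rule topological_tendstoD) (use that in auto)
  have "\<forall>\<^sub>F X in nhds 0. X \<in> U" using U(1,3) by (rule eventually_nhds_in_open)
  then have ev: "\<forall>\<^sub>F X in nhds 0. artanh_map X \<in> ball 0 d \<and> tanh_map (artanh_map X) = X" if "0 < d" for d
    using small[OF r(1)] small[OF that]
  proof eventually_elim
    case (elim X)
    then show ?case using eq[of "artanh_map X"] homeomorphism_apply1[OF U(5), of X] by simp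
  qed
  have dt: "(tanh_map has_derivative (\<lambda>v. v)) (at 0)"
  proof -
    have t0: "(tanh_map has_derivative dir_deriv tanh_map 0) (at 0)"
      by (rule smooth_on_has_derivative[OF open_ball smt]) (use r in auto)
    have "(artanh_map has_derivative (\<lambda>v. v)) (at (tanh_map 0))"
      using smooth_on_has_derivative[OF open_ball smooth_on_artanh_map, of 0] r1 by (simp add: D0 tanh_map_0)
    from has_derivative_compose[OF t0 this]
    have "((\<lambda>X. artanh_map (tanh_map X)) has_derivative dir_deriv tanh_map 0) (at 0)" .
    then have "((\<lambda>X. X) has_derivative dir_deriv tanh_map 0) (at 0)"
      by (rule has_derivative_transform_within_open[of _ _ _ _ "ball 0 r"])
        (use r in \<open>auto simp: r_def intro!: artanh_tanh_map\<close>)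
    from has_derivative_unique[OF this has_derivative_ident] t0 show ?thesis by simp
  qed
  show thesis by (rule that[OF r smt dt ev])
qed

lemma tanh_curve_second_deriv:
  assumes t: "norm (t *\<^sub>R X) < r1"
  defines "c \<equiv> \<lambda>t. tanh_map (t *\<^sub>R X)"
  defines "c' \<equiv> \<lambda>t. X - (1 / 2) *\<^sub>R p X (c t) (c t)"
  shows "(c' has_vector_derivative - p X (c t) (c' t)) (at t)"
proof -
  have "(c has_vector_derivative c' t) (at t)" unfolding c_def c'_def by (rule tanh_curve_deriv[OF t])
  then have d: "(c has_derivative (\<lambda>h. h *\<^sub>R c' t)) (at t)" by (simp add: has_vector_derivative_def)
  have "((\<lambda>t. X - (1 / 2) *\<^sub>R p X (c t) (c t)) has_derivative
      (\<lambda>h. 0 - (1 / 2) *\<^sub>R (p X (c t) (h *\<^sub>R c' t) + p X (h *\<^sub>R c' t) (c t)))) (at t)"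
    by (rule has_derivative_diff[OF has_derivative_const
        has_derivative_scaleR_right[OF bounded_bilinear.FDERIV[OF bounded_bilinear_p(3) d d]]])
  moreover have "0 - (1 / 2) *\<^sub>R (p X (c t) (h *\<^sub>R c' t) + p X (h *\<^sub>R c' t) (c t)) = h *\<^sub>R - p X (c t) (c' t)" for h
    using p_sym[of X "c' t" "c t"] by (simp add: p_scale flip: scaleR_2)
  ultimately show ?thesis unfolding has_vector_derivative_def c'_def by simp
qed

text \<open>With D = \<open>p c c\<close> one has w = (1 - D / 2) X and (1 - D / 2) a = c, and on
  \<open>cyc X\<close> the factor 1 - D / 2 can be moved from \<open>w\<close> to \<open>a\<close>.
  This matches \<Gamma> on \<open>cyc X\<close> with the second derivative of the curve.\<close>

lemma tanh_curve_velocity: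
  assumes c: "c \<in> cyc X" "norm c < r1"
  defines "w \<equiv> X - (1 / 2) *\<^sub>R p X c c"
  obtains a where "w \<in> cyc X" "a \<in> cyc X" "a - (1 / 2) *\<^sub>R p c c a = c" "p a w w = p X c w"
proof -
  define a where "a = nop c 1 c"
  have a: "a \<in> cyc X" unfolding a_def by (rule nop_cyc[OF c _ c(1)]) auto
  have "mop c 1 a = c" unfolding a_def by (rule mop_nop[OF c(2)]) auto
  then have ac: "a - (1 / 2) *\<^sub>R p c c a = c" by (simp add: mop_def ad_sq_cyc[OF c(1) a])
  have X: "X \<in> cyc X" by (rule self_cyc)
  have w: "w \<in> cyc X"
    unfolding w_def by (intro subspace_diff subspace_scale subspace_cyc X p_cyc c)
  have "p a (p X c c) w = p (p c c a) X w"
  proof -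
    have "p a (p X c c) w = p (p X c c) a w" by (rule p_comm[OF a p_cyc[OF X c(1) c(1)] w])
    also have "\<dots> = p (p c c X) a w" using p_comm[OF X c(1) c(1)] p_sym[of c c X] by simp
    also have "\<dots> = p c c (p X a w)" by (rule p_assoc[OF c(1) c(1) X a w])
    also have "p X a w = p a X w" by (rule p_comm[OF X a w])
    also have "p c c (p a X w) = p (p c c a) X w" by (rule p_assoc[OF c(1) c(1) a X w, symmetric])
    finally show ?thesis .
  qed
  then have "p a w w = p (a - (1 / 2) *\<^sub>R p c c a) X w"
    unfolding w_def[THEN meta_eq_to_obj_eq, THEN arg_cong[where f = "\<lambda>x. p a x w"]]
    by (simp add: linear_diff[OF p_linear(1)] linear_diff[OF p_linear(2)] p_scale)
  also have "\<dots> = p X c w" unfolding ac by (rule p_comm[OF c(1) X w])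
  finally show thesis by (rule that[OF w a ac])
qed

end

context symmetric_germ
begin

text \<open>\<open>Ki\<close> is the \<open>tanh\<close> map and \<open>K\<close> the
  \<open>artanh\<close> map. The last clause holds because \<open>\<Gamma>_on_cyc\<close>, with
  \<open>a\<close> from \<open>tanh_curve_velocity\<close>, evaluates \<Gamma> on the velocity to
  \<open>p X c w\<close>, which is minus the second derivative of the curve.\<close>

theorem geodesic_model:
  obtains r K Ki where "0 < r" "smooth_on K (ball 0 r)" "smooth_on Ki (ball 0 r)" "K 0 = 0" "Ki 0 = 0"
    "(Ki has_derivative (\<lambda>v. v)) (at 0)" "\<And>X. norm X < r \<Longrightarrow> Ki X \<in> V"
    "\<forall>\<^sub>F X in nhds 0. K X \<in> ball 0 r \<and> Ki (K X) = X" "\<And>X. norm X < r \<Longrightarrow> K (Ki X) = X"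
    "\<And>X. norm X < r \<Longrightarrow> even_series_terms (half_quotient_series artanh) (ad_sq X) X sums K X"
    "\<And>X. norm X < r \<Longrightarrow> even_series_terms (half_quotient_series tanh) (ad_sq X) X sums Ki X"
    "\<And>X. \<exists>c'. c' 0 = X \<and> (\<forall>t. norm (t *\<^sub>R X) < r \<longrightarrow>
        ((\<lambda>t. Ki (t *\<^sub>R X)) has_vector_derivative c' t) (at t) \<and>
        (c' has_vector_derivative - \<Gamma> (Ki (t *\<^sub>R X)) (c' t) (c' t)) (at t))"
proof -
  obtain \<kappa> where \<kappa>: "0 < \<kappa>" "\<And>u v w. norm (p u v w) \<le> \<kappa> * (norm u * norm v * norm w)"
    using trilinear_bound[of p] p_linear by blast
  obtain \<beta> where \<beta>: "0 < \<beta>" "\<And>l z. norm (cs l z) \<le> norm l * norm z * \<beta>"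
    using bounded_bilinear.pos_bounded[OF bounded_bilinear_cs] by blast
  \<comment> \<open>The first bound is the smallness required by
    \<open>normed_jordan_triple\<close>, the second keeps \<open>cs l z\<close> in \<open>V\<close>
    for |l| < 2.\<close>
  define r1 where "r1 = min (1 / (2 * sqrt \<kappa>)) (r0 / (2 * \<beta>))"
  have r1: "0 < r1" using \<kappa>(1) \<beta>(1) r0 by (simp add: r1_def)
  have "4 * \<kappa> * r1\<^sup>2 \<le> 1"
  proof -
    have "r1\<^sup>2 \<le> (1 / (2 * sqrt \<kappa>))\<^sup>2" using r1 by (intro power_mono) (auto simp: r1_def)
    also have "\<dots> = 1 / (4 * \<kappa>)" using \<kappa>(1) by (simp add: power_divide power_mult_distrib)
    finally show ?thesis using \<kappa>(1) by (simp add: field_simps)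
  qed
  then interpret N: normed_jordan_triple p \<kappa> r1
    using \<kappa> r1 by unfold_locales
  have dom: "cs l z \<in> V" if "norm z < r1" "norm l < 2" for l z
  proof -
    have "norm l * norm z * \<beta> \<le> 2 * norm z * \<beta>" using that \<beta>(1) by (intro mult_right_mono) auto
    also have "\<dots> < 2 * (r0 / (2 * \<beta>)) * \<beta>"
      using that \<beta>(1) by (intro mult_strict_right_mono mult_strict_left_mono) (auto simp: r1_def)
    also have "\<dots> = r0" using \<beta>(1) by simp
    finally show ?thesis using \<beta>(2)[of l z] by simp
  qed
  obtain s where s: "0 < s" "s \<le> r1" "smooth_on N.tanh_map (ball 0 s)"
    and dK: "(N.tanh_map has_derivative (\<lambda>v. v)) (at 0)"
    and ev: "\<And>d. 0 < d \<Longrightarrow> \<forall>\<^sub>F X in nhds 0. N.artanh_map X \<in> ball 0 d \<and> N.tanh_map (N.artanh_map X) = X"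
    by (rule N.tanh_map_inverse) blast
  \<comment> \<open>The values of \<open>tanh_map\<close> have norm at most 2 |X|; halving
    \<open>r1\<close> keeps them in the ball of radius \<open>r1\<close>.\<close>
  define r where "r = min s (r1 / 2)"
  have r: "0 < r" "r \<le> s" "r \<le> r1 / 2" using s r1 by (auto simp: r_def)
  have cs1: "cs 1 z = z" for z by (simp add: cs_def)
  have tV: "N.tanh_map X \<in> V" "norm (N.tanh_map X) < r1" if "norm X < r" for X
  proof -
    show n: "norm (N.tanh_map X) < r1" using N.tanh_map_sums(3)[of X] that r by simp
    show "N.tanh_map X \<in> V" using dom[OF n, of 1] by (simp add: cs1)
  qed
  have geo: "\<Gamma> c w w = p X c w" if c: "c \<in> cyc X" "norm c < r1" and w: "w = X - (1 / 2) *\<^sub>R p X c c" for c w X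
  proof -
    obtain a where a: "w \<in> cyc X" "a - (1 / 2) *\<^sub>R p c c a = c" "p a w w = p X c w"
      using N.tanh_curve_velocity[OF c] unfolding w by metis
    have "\<Gamma> c w w = p a w w"
    proof (rule \<Gamma>_on_cyc[OF c(1) a(1) a(1) dom[OF c(2)] _ a(2)])
      show "norm (p c c y) \<le> norm y / 4" for y
        using \<kappa>(2)[of c c y] mult_right_mono[OF N.small[OF c(2)] norm_ge_zero[of y]]
        by (simp add: power2_eq_square mult_ac)
    qed
    then show ?thesis using a(3) by simp
  qed
  have sm: "smooth_on N.artanh_map (ball 0 r)" "smooth_on N.tanh_map (ball 0 r)"
    using r r1 by (auto intro!: smooth_on_subset[OF N.smooth_on_artanh_map]
      smooth_on_subset[OF s(3)])
  show thesis
  proof (rule that[OF r(1) sm N.artanh_map_0 N.tanh_map_0 dK tV(1)])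
    show "\<forall>\<^sub>F X in nhds 0. N.artanh_map X \<in> ball 0 r \<and> N.tanh_map (N.artanh_map X) = X"
      by (rule ev[OF r(1)])
    fix X :: 'e
    have 0: "norm X < r1" if "norm X < r" using that r r1 by linarith
    show "N.artanh_map (N.tanh_map X) = X" if "norm X < r"
      using that r by (intro N.artanh_tanh_map) simp
    show "even_series_terms (half_quotient_series artanh) (ad_sq X) X sums N.artanh_map X" if "norm X < r"
      by (rule N.artanh_map_sums[OF 0[OF that]])
    show "even_series_terms (half_quotient_series tanh) (ad_sq X) X sums N.tanh_map X" if "norm X < r"
      by (rule N.tanh_map_sums(2)[OF 0[OF that]])
    define c where "c t = N.tanh_map (t *\<^sub>R X)" for t
    define c' where "c' t = X - (1 / 2) *\<^sub>R p X (c t) (c t)" for t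
    have "c' 0 = X" by (simp add: c'_def c_def N.tanh_map_0 linear_0[OF p_linear(3)])
    moreover have "(c has_vector_derivative c' t) (at t) \<and>
        (c' has_vector_derivative - \<Gamma> (c t) (c' t) (c' t)) (at t)" if t: "norm (t *\<^sub>R X) < r" for t
    proof -
      have t1: "norm (t *\<^sub>R X) < r1" using t r r1 by linarith
      have "c t \<in> cyc X" "norm (c t) < r1" using N.tanh_curve_cyc[OF t1] tV[OF t] by (simp_all add: c_def)
      then have "\<Gamma> (c t) (c' t) (c' t) = p X (c t) (c' t)" by (rule geo) (simp add: c'_def)
      then show ?thesis
        using N.tanh_curve_deriv[OF t1] N.tanh_curve_second_deriv[OF t1]
        by (simp add: c'_def[abs_def] c_def[abs_def])
    qed
    ultimately show "\<exists>c'. c' 0 = X \<and> (\<forall>t. norm (t *\<^sub>R X) < r \<longrightarrow>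
        ((\<lambda>t. N.tanh_map (t *\<^sub>R X)) has_vector_derivative c' t) (at t) \<and>
        (c' has_vector_derivative - \<Gamma> (N.tanh_map (t *\<^sub>R X)) (c' t) (c' t)) (at t))"
      unfolding c_def by blast
  qed
qed

end

section \<open>Levi-Civita connection of a metric on an open set\<close>

lemma smooth_on_apply2:
  fixes B :: "'a::real_normed_vector \<Rightarrow> 'b::euclidean_space \<Rightarrow> 'c::euclidean_space \<Rightarrow> 'd::real_normed_vector"
  assumes S: "open S" and lin: "\<And>y. y \<in> S \<Longrightarrow> bilinear (B y)"
    and B: "\<And>v w. smooth_on (\<lambda>y. B y v w) S" and ab: "smooth_on a S" "smooth_on b S"
  shows "smooth_on (\<lambda>y. B y (a y) (b y)) S"
proof (rule smooth_on_apply[OF S _ _ ab(2)])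
  show "linear (B y (a y))" if "y \<in> S" for y using lin[OF that] by (simp add: bilinear_def)
  show "smooth_on (\<lambda>y. B y (a y) v) S" for v
    by (rule smooth_on_apply[where L = "\<lambda>y u. B y u v", OF S _ B ab(1)]) (use lin in \<open>simp add: bilinear_def\<close>)
qed

lemma dir_deriv_apply2:
  fixes B :: "'a::real_normed_vector \<Rightarrow> 'b::euclidean_space \<Rightarrow> 'c::euclidean_space \<Rightarrow> 'd::real_normed_vector"
  assumes S: "open S" "x \<in> S" and lin: "\<And>y. y \<in> S \<Longrightarrow> bilinear (B y)"
    and B: "\<And>v w. smooth_on (\<lambda>y. B y v w) S" and ab: "smooth_on a S" "smooth_on b S"
  shows "dir_deriv (\<lambda>y. B y (a y) (b y)) x u
    = dir_deriv (\<lambda>y. B y (a x) (b x)) x u + B x (dir_deriv a x u) (b x) + B x (a x) (dir_deriv b x u)"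
proof -
  have l: "linear (\<lambda>u. B y u w)" "linear (B y v)" if "y \<in> S" for y v w using lin[OF that] by (simp_all add: bilinear_def)
  have s: "smooth_on (\<lambda>y. B y (a y) v) S" for v
    by (rule smooth_on_apply[where L = "\<lambda>y u. B y u v", OF S(1) l(1) B ab(1)])
  have "dir_deriv (\<lambda>y. B y (a y) (b y)) x u = dir_deriv (\<lambda>y. B y (a y) (b x)) x u + B x (a x) (dir_deriv b x u)"
    by (rule dir_deriv_apply[where L = "\<lambda>y. B y (a y)", OF S l(2) s ab(2)])
  also have "dir_deriv (\<lambda>y. B y (a y) (b x)) x u = dir_deriv (\<lambda>y. B y (a x) (b x)) x u + B x (dir_deriv a x u) (b x)"
    by (rule dir_deriv_apply[where L = "\<lambda>y u. B y u (b x)", OF S l(1) B ab(1)])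
  finally show ?thesis .
qed

locale riemannian_metric =
  fixes S :: "'e::euclidean_space set" and G :: "'e \<Rightarrow> 'e \<Rightarrow> 'e \<Rightarrow> real"
  assumes open_S: "open S" and bilinear_G: "x \<in> S \<Longrightarrow> bilinear (G x)"
    and G_sym: "x \<in> S \<Longrightarrow> G x u v = G x v u" and G_pos: "x \<in> S \<Longrightarrow> u \<noteq> 0 \<Longrightarrow> 0 < G x u u"
    and smooth_G: "smooth_on (\<lambda>x. G x u v) S"
begin

abbreviation "\<Gamma> \<equiv> christoffel G"

lemma linear_G: "x \<in> S \<Longrightarrow> linear (G x u)" "x \<in> S \<Longrightarrow> linear (\<lambda>u. G x u v)"
  using bilinear_G by (simp_all add: bilinear_def)

lemma G_eqI:
  assumes "x \<in> S" "\<And>z. G x v z = G x w z"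
  shows "v = w"
proof (rule ccontr)
  assume "v \<noteq> w"
  then have "0 < G x (v - w) (v - w)" using G_pos[OF assms(1)] by simp
  then show False using assms(2)[of "v - w"] by (simp add: linear_diff[OF linear_G(2)[OF assms(1)]])
qed

definition koszul :: "'e \<Rightarrow> 'e \<Rightarrow> 'e \<Rightarrow> 'e \<Rightarrow> real" where
  "koszul x u v z = dir_deriv (\<lambda>y. G y v z) x u + dir_deriv (\<lambda>y. G y u z) x v - dir_deriv (\<lambda>y. G y u v) x z"

lemma linear_koszul:
  assumes x: "x \<in> S"
  shows "linear (koszul x u v)" "linear (\<lambda>v. koszul x u v z)"
proof -
  have d: "linear (\<lambda>z. dir_deriv (\<lambda>y. G y v z) x u)" "linear (\<lambda>v. dir_deriv (\<lambda>y. G y v z) x u)"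
      "linear (\<lambda>u. dir_deriv (\<lambda>y. G y v z) x u)" for u v z
    using linear_dir_deriv_family[OF open_S x, where L = "\<lambda>y z. G y v z"] linear_G(1) smooth_G
      linear_dir_deriv_family[OF open_S x, where L = "\<lambda>y v. G y v z"] linear_G(2)
      smooth_on_linear_dir_deriv[OF open_S smooth_G x] by blast+
  show "linear (koszul x u v)" "linear (\<lambda>v. koszul x u v z)"
    unfolding koszul_def
    by (rule linear_compose_sub[OF linear_compose_add[OF d(1) d(1)] d(3)] linear_compose_sub[OF linear_compose_add[OF d(2) d(3)] d(1)])+
qed

text \<open>The metric as an endomorphism relative to the Euclidean inner product; in this form
  \<open>smooth_on_inverse_family\<close> gives smoothness of its inverse and hence of the
  Christoffel symbols.\<close>

definition gram :: "'e \<Rightarrow> 'e \<Rightarrow> 'e" where "gram x w = (\<Sum>b\<in>Basis. G x w b *\<^sub>R b)"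

lemma inner_gram: "x \<in> S \<Longrightarrow> gram x w \<bullet> z = G x w z"
  using linear_expand_Basis[OF linear_G(1), of x w z]
  by (simp add: gram_def inner_sum_left inner_commute[of z] mult.commute)

lemma linear_gram: "x \<in> S \<Longrightarrow> linear (gram x)"
  unfolding gram_def
  by (rule linearI) (simp_all add: linear_add[OF linear_G(2)] linear_scale[OF linear_G(2)] scaleR_add_left sum.distrib scaleR_sum_right)

lemma smooth_on_gram: "smooth_on (\<lambda>x. gram x w) S"
  unfolding gram_def by (intro smooth_intros smooth_G open_S) auto

definition gram_inv :: "'e \<Rightarrow> 'e \<Rightarrow> 'e" where "gram_inv x = inv (gram x)"

lemma gram_inv: assumes x: "x \<in> S" shows "gram x (gram_inv x w) = w" "gram_inv x (gram x w) = w"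
proof -
  have inj: "inj (gram x)" by (rule injI) (metis G_eqI[OF x] inner_gram[OF x])
  then show "gram x (gram_inv x w) = w" "gram_inv x (gram x w) = w"
    using linear_injective_imp_surjective[OF linear_gram[OF x] inj] by (simp_all add: gram_inv_def surj_f_inv_f)
qed

lemma christoffel_unique:
  assumes x: "x \<in> S" and w: "\<And>z. 2 * G x w z = koszul x u v z"
  shows "\<Gamma> x u v = w"
  unfolding christoffel_def
proof (rule the_equality)
  show "\<forall>z. 2 * G x w z = dir_deriv (\<lambda>y. G y v z) x u + dir_deriv (\<lambda>y. G y u z) x v - dir_deriv (\<lambda>y. G y u v) x z"
    using w by (simp add: koszul_def)
  fix w' assume "\<forall>z. 2 * G x w' z = dir_deriv (\<lambda>y. G y v z) x u + dir_deriv (\<lambda>y. G y u z) x v - dir_deriv (\<lambda>y. G y u v) x z"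
  then have "2 * G x w' z = 2 * G x w z" for z using w by (simp only: koszul_def)
  then show "w' = w" by (intro G_eqI[OF x]) simp
qed

lemma christoffel_gram:
  assumes x: "x \<in> S"
  shows "\<Gamma> x u v = gram_inv x ((1 / 2) *\<^sub>R (\<Sum>b\<in>Basis. koszul x u v b *\<^sub>R b))"
proof (rule christoffel_unique[OF x])
  fix z
  have "2 * G x (gram_inv x ((1 / 2) *\<^sub>R (\<Sum>b\<in>Basis. koszul x u v b *\<^sub>R b))) z = (\<Sum>b\<in>Basis. koszul x u v b *\<^sub>R b) \<bullet> z"
    by (simp add: inner_gram[OF x, symmetric] gram_inv[OF x])
  also have "\<dots> = koszul x u v z"
    using linear_expand_Basis[OF linear_koszul(1)[OF x], of u v z]
    by (simp add: inner_sum_left inner_commute[of z] mult.commute)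
  finally show "2 * G x (gram_inv x ((1 / 2) *\<^sub>R (\<Sum>b\<in>Basis. koszul x u v b *\<^sub>R b))) z = koszul x u v z" .
qed

lemma koszul: "x \<in> S \<Longrightarrow> 2 * G x (\<Gamma> x u v) z = koszul x u v z"
proof -
  assume x: "x \<in> S"
  have "2 * G x (\<Gamma> x u v) z = (\<Sum>b\<in>Basis. koszul x u v b *\<^sub>R b) \<bullet> z"
    by (simp add: christoffel_gram[OF x] inner_gram[OF x, symmetric] gram_inv[OF x])
  also have "\<dots> = koszul x u v z"
    using linear_expand_Basis[OF linear_koszul(1)[OF x], of u v z]
    by (simp add: inner_sum_left inner_commute[of z] mult.commute)
  finally show ?thesis .
qed

lemma christoffel_sym: "x \<in> S \<Longrightarrow> \<Gamma> x u v = \<Gamma> x v u"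
proof (rule christoffel_unique)
  assume x: "x \<in> S"
  have "dir_deriv (\<lambda>y. G y u v) x = dir_deriv (\<lambda>y. G y v u) x"
    by (rule dir_deriv_cong_open[OF open_S x]) (rule G_sym)
  then show "2 * G x (\<Gamma> x v u) z = koszul x u v z" for z
    by (simp add: koszul[OF x]) (simp add: koszul_def)
qed

lemma linear_christoffel:
  assumes x: "x \<in> S"
  shows "linear (\<Gamma> x u)" "linear (\<lambda>u. \<Gamma> x u v)"
proof -
  show 1: "linear (\<Gamma> x u)" for u
  proof (rule linearI)
    fix a b :: 'e and r :: real
    show "\<Gamma> x u (a + b) = \<Gamma> x u a + \<Gamma> x u b"
      by (rule christoffel_unique[OF x])
        (simp add: linear_add[OF linear_G(2)[OF x]] distrib_left koszul[OF x] linear_add[OF linear_koszul(2)[OF x]])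
    show "\<Gamma> x u (r *\<^sub>R a) = r *\<^sub>R \<Gamma> x u a"
      by (rule christoffel_unique[OF x])
        (simp add: linear_scale[OF linear_G(2)[OF x]] mult.left_commute koszul[OF x] linear_scale[OF linear_koszul(2)[OF x]])
  qed
  have "(\<lambda>u. \<Gamma> x u v) = \<Gamma> x v" using christoffel_sym[OF x] by auto
  then show "linear (\<lambda>u. \<Gamma> x u v)" using 1 by simp
qed

lemma bilinear_christoffel: "x \<in> S \<Longrightarrow> bilinear (\<Gamma> x)"
  using linear_christoffel by (simp add: bilinear_def)

lemma smooth_on_christoffel: "smooth_on (\<lambda>x. \<Gamma> x u v) S"
proof (rule smooth_on_cong[OF open_S])
  have N: "linear (gram_inv x)" if x: "x \<in> S" for x
    by (rule linearI) (metis gram_inv[OF x] linear_add[OF linear_gram[OF x]], metis gram_inv[OF x] linear_scale[OF linear_gram[OF x]])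
  show "smooth_on (\<lambda>x. gram_inv x ((1 / 2) *\<^sub>R (\<Sum>b\<in>Basis. koszul x u v b *\<^sub>R b))) S"
  proof (rule smooth_on_apply[OF open_S N])
    show "smooth_on (\<lambda>x. gram_inv x w) S" for w
      by (rule smooth_on_inverse_family[OF open_S linear_gram smooth_on_gram]) (simp_all add: gram_inv)
    show "smooth_on (\<lambda>x. (1 / 2) *\<^sub>R (\<Sum>b\<in>Basis. koszul x u v b *\<^sub>R b)) S"
      unfolding koszul_def by (intro smooth_intros open_S smooth_on_dir_deriv smooth_G finite_Basis)
  qed
qed (simp add: christoffel_gram)

text \<open>Add two instances of the Koszul formula with \<open>v\<close> and \<open>w\<close>
  exchanged; the derivatives in the directions \<open>v\<close> and \<open>w\<close> cancel by
  symmetry of the metric.\<close>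

lemma metric_compatible:
  assumes x: "x \<in> S"
  shows "dir_deriv (\<lambda>y. G y v w) x u = G x (\<Gamma> x u v) w + G x v (\<Gamma> x u w)"
proof -
  have sw: "dir_deriv (\<lambda>y. G y a b) x c = dir_deriv (\<lambda>y. G y b a) x c" for a b c
    by (rule fun_cong[OF dir_deriv_cong_open[OF open_S x]]) (rule G_sym)
  have "2 * G x (\<Gamma> x u v) w + 2 * G x (\<Gamma> x u w) v = 2 * dir_deriv (\<lambda>y. G y v w) x u"
    unfolding koszul[OF x] koszul_def using sw[of v w u] sw[of u w v] sw[of u v w] by simp
  then show ?thesis using G_sym[OF x, of v] by simp
qed

lemma curvature_eq:
  assumes x: "x \<in> S"
  shows "curvature G x u v w = dir_deriv (\<lambda>y. \<Gamma> y v w) x u - dir_deriv (\<lambda>y. \<Gamma> y u w) x v + \<Gamma> x u (\<Gamma> x v w) - \<Gamma> x v (\<Gamma> x u w)"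
proof -
  have "linear (\<lambda>u. \<Gamma> x u w)" by (rule linear_christoffel[OF x])
  from linear_0[OF this] show ?thesis
    by (simp add: curvature_def curvature_field_def nabla_def[abs_def] lie_bracket_def)
qed

lemma smooth_on_curvature: "smooth_on (\<lambda>x. curvature G x u v w) S"
proof (rule smooth_on_cong[OF open_S curvature_eq[symmetric]])
  have s: "smooth_on (\<lambda>x. \<Gamma> x u (\<Gamma> x v w)) S" for u v w
    by (rule smooth_on_apply[OF open_S linear_christoffel(1) smooth_on_christoffel smooth_on_christoffel])
  show "smooth_on (\<lambda>x. dir_deriv (\<lambda>y. \<Gamma> y v w) x u - dir_deriv (\<lambda>y. \<Gamma> y u w) x v + \<Gamma> x u (\<Gamma> x v w) - \<Gamma> x v (\<Gamma> x u w)) S"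
    by (intro smooth_intros open_S smooth_on_dir_deriv smooth_on_christoffel s)
qed

lemma linear_curvature:
  assumes x: "x \<in> S"
  shows "linear (\<lambda>u. curvature G x u v w)" "linear (\<lambda>v. curvature G x u v w)" "linear (\<lambda>w. curvature G x u v w)"
proof -
  note L = linear_christoffel[OF x]
  have d: "linear (\<lambda>w. dir_deriv (\<lambda>y. \<Gamma> y v w) x u)" "linear (\<lambda>v. dir_deriv (\<lambda>y. \<Gamma> y v w) x u)"
      "linear (\<lambda>u. dir_deriv (\<lambda>y. \<Gamma> y v w) x u)" for u v w
    using linear_dir_deriv_family[OF open_S x, where L = "\<lambda>y w. \<Gamma> y v w"] linear_christoffel smooth_on_christoffel
      linear_dir_deriv_family[OF open_S x, where L = "\<lambda>y v. \<Gamma> y v w"]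
      smooth_on_linear_dir_deriv[OF open_S smooth_on_christoffel x] by blast+
  have c: "linear (\<lambda>v. \<Gamma> x u (\<Gamma> x v w))" "linear (\<lambda>w. \<Gamma> x u (\<Gamma> x v w))" for u v w
    using linear_compose[OF L(2) L(1)] linear_compose[OF L(1) L(1)] by (simp_all add: o_def)
  show "linear (\<lambda>u. curvature G x u v w)" "linear (\<lambda>v. curvature G x u v w)" "linear (\<lambda>w. curvature G x u v w)"
    unfolding curvature_eq[OF x]
    by (rule linear_compose_sub[OF linear_compose_add[OF linear_compose_sub[OF d(3) d(2)] L(2)] c(1)]
        linear_compose_sub[OF linear_compose_add[OF linear_compose_sub[OF d(2) d(3)] c(1)] L(2)]
        linear_compose_sub[OF linear_compose_add[OF linear_compose_sub[OF d(1) d(1)] c(2)] c(2)])+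
qed

end

section \<open>Pulling back connection, curvature and complex structure\<close>

locale metric_pullback = riemannian_metric S G
  for S :: "'e::euclidean_space set" and G :: "'e \<Rightarrow> 'e \<Rightarrow> 'e \<Rightarrow> real" +
  fixes V :: "'e set" and \<phi> :: "'e \<Rightarrow> 'e"
  assumes open_V: "open V" and smooth_\<phi>: "smooth_on \<phi> V" and \<phi>_into: "\<phi> ` V \<subseteq> S"
    and inj_d\<phi>: "x \<in> V \<Longrightarrow> inj (dir_deriv \<phi> x)"
begin

abbreviation "L \<equiv> \<lambda>x v. dir_deriv \<phi> x v"
abbreviation "D2 \<equiv> \<lambda>x u v. dir_deriv (\<lambda>y. dir_deriv \<phi> y v) x u"

definition pull :: "'e \<Rightarrow> 'e \<Rightarrow> 'e \<Rightarrow> real" where "pull x u v = G (\<phi> x) (L x u) (L x v)"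

text \<open>The covariant derivative of a vector field along \<phi>, with values in the target
  coordinates. Working along \<phi> avoids transporting fields to its image.\<close>

definition cov :: "'e \<Rightarrow> 'e \<Rightarrow> ('e \<Rightarrow> 'e) \<Rightarrow> 'e" where
  "cov x u F = dir_deriv F x u + \<Gamma> (\<phi> x) (L x u) (F x)"

lemma \<phi>_S: "x \<in> V \<Longrightarrow> \<phi> x \<in> S" using \<phi>_into by auto

lemma linear_L: "x \<in> V \<Longrightarrow> linear (L x)"
  by (rule smooth_on_linear_dir_deriv[OF open_V smooth_\<phi>])

lemma smooth_on_L: "smooth_on (\<lambda>x. L x v) V" by (rule smooth_on_dir_deriv[OF smooth_\<phi>])

lemma D2_sym: "x \<in> V \<Longrightarrow> D2 x u v = D2 x v u"
  by (rule dir_deriv_commute[OF open_V _ smooth_\<phi>])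

lemma L_eqI: "x \<in> V \<Longrightarrow> L x u = L x v \<Longrightarrow> u = v"
  using inj_d\<phi> by (metis injD)

lemma L_surj: "x \<in> V \<Longrightarrow> \<exists>v. L x v = w"
  using linear_injective_imp_surjective[OF linear_L inj_d\<phi>, of x] by (metis surjD)

lemma smooth_on_pulled:
  assumes "smooth_on f S"
  shows "smooth_on (\<lambda>x. f (\<phi> x)) V"
  by (rule smooth_on_compose[OF open_V open_S assms smooth_\<phi> \<phi>_into])

lemma dir_deriv_pulled:
  assumes "smooth_on f S" "x \<in> V"
  shows "dir_deriv (\<lambda>x. f (\<phi> x)) x u = dir_deriv f (\<phi> x) (L x u)"
  by (rule dir_deriv_compose[OF open_V assms(2) smooth_\<phi> open_S \<phi>_S[OF assms(2)] assms(1)])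

lemma pull_metric: "riemannian_metric V pull"
proof
  show "open V" by (rule open_V)
  show "pull x u v = pull x v u" if "x \<in> V" for x u v
    unfolding pull_def by (rule G_sym[OF \<phi>_S[OF that]])
  show "bilinear (pull x)" if x: "x \<in> V" for x
    unfolding pull_def bilinear_def
    using linear_compose[OF linear_L[OF x] linear_G(1)[OF \<phi>_S[OF x]]] linear_compose[OF linear_L[OF x] linear_G(2)[OF \<phi>_S[OF x]]]
    by (simp add: o_def)
  show "0 < pull x u u" if x: "x \<in> V" and "u \<noteq> 0" for x u
  proof -
    have "L x u \<noteq> 0" using L_eqI[OF x, of u 0] linear_0[OF linear_L[OF x]] \<open>u \<noteq> 0\<close> by auto
    then show ?thesis unfolding pull_def by (rule G_pos[OF \<phi>_S[OF x]])
  qed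
  show "smooth_on (\<lambda>x. pull x u v) V" for u v
    unfolding pull_def
    by (rule smooth_on_apply2[where B = "\<lambda>x. G (\<phi> x)", OF open_V bilinear_G[OF \<phi>_S] smooth_on_pulled[OF smooth_G] smooth_on_L smooth_on_L])
qed

sublocale pull: riemannian_metric V pull by (rule pull_metric)

text \<open>The right-hand side is symmetric and compatible with the pulled back metric, hence
  satisfies the Koszul formula that characterizes the Christoffel symbols.\<close>

theorem christoffel_pullback:
  assumes x: "x \<in> V"
  shows "L x (pull.\<Gamma> x u v) = \<Gamma> (\<phi> x) (L x u) (L x v) + D2 x u v"
proof -
  define B where "B u v = \<Gamma> (\<phi> x) (L x u) (L x v) + D2 x u v" for u v
  note y = \<phi>_S[OF x]
  have D: "dir_deriv (\<lambda>y. pull y v z) x u = G (\<phi> x) (B u v) (L x z) + G (\<phi> x) (L x v) (B u z)" for u v z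
  proof -
    have "dir_deriv (\<lambda>y. pull y v z) x u = dir_deriv (\<lambda>y. G (\<phi> y) (L x v) (L x z)) x u
        + G (\<phi> x) (D2 x u v) (L x z) + G (\<phi> x) (L x v) (D2 x u z)"
      unfolding pull_def
      by (rule dir_deriv_apply2[where B = "\<lambda>y. G (\<phi> y)", OF open_V x bilinear_G[OF \<phi>_S] smooth_on_pulled[OF smooth_G] smooth_on_L smooth_on_L])
    also have "dir_deriv (\<lambda>y. G (\<phi> y) (L x v) (L x z)) x u
        = G (\<phi> x) (\<Gamma> (\<phi> x) (L x u) (L x v)) (L x z) + G (\<phi> x) (L x v) (\<Gamma> (\<phi> x) (L x u) (L x z))"
      by (simp only: dir_deriv_pulled[OF smooth_G x] metric_compatible[OF y])
    finally show ?thesis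
      by (simp add: B_def linear_add[OF linear_G(1)[OF y]] linear_add[OF linear_G(2)[OF y]])
  qed
  have B_sym: "B u v = B v u" for u v
    by (simp add: B_def christoffel_sym[OF y, of "L x u"] D2_sym[OF x, of u])
  obtain w where w: "L x w = B u v" using L_surj[OF x] by blast
  have "pull.\<Gamma> x u v = w"
  proof (rule pull.christoffel_unique[OF x])
    show "2 * pull x w z = pull.koszul x u v z" for z
      unfolding pull.koszul_def D
      using B_sym[of v u] B_sym[of z u] B_sym[of z v] G_sym[OF y, of "B v z"] G_sym[OF y, of "B u z"]
      by (simp add: pull_def w)
  qed
  then show ?thesis using w by (simp add: B_def)
qed

lemma cov_L:
  assumes x: "x \<in> V" and Y: "smooth_on Y V"
  shows "cov x u (\<lambda>y. L y (Y y)) = L x (dir_deriv Y x u + pull.\<Gamma> x u (Y x))"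
  by (simp add: cov_def dir_deriv_apply[where L = L, OF open_V x linear_L smooth_on_L Y]
      linear_add[OF linear_L[OF x]] christoffel_pullback[OF x])

lemma cov_L_const:
  assumes x: "x \<in> V"
  shows "cov x u (\<lambda>y. L y v) = L x (pull.\<Gamma> x u v)"
  by (simp add: cov_def christoffel_pullback[OF x])

lemma cov_cong:
  assumes x: "x \<in> V" and "\<And>y. y \<in> V \<Longrightarrow> F y = F' y"
  shows "cov x u F = cov x u F'"
  using dir_deriv_cong_open[OF open_V x assms(2)] assms by (simp add: cov_def)

text \<open>Second derivatives of \<open>F\<close> and of \<phi> cancel by symmetry; what remains is
  the coordinate formula for the curvature of \<open>G\<close>.\<close>

lemma cov_commutator:
  assumes x: "x \<in> V" and F: "smooth_on F V"
  shows "cov x u (\<lambda>y. cov y v F) - cov x v (\<lambda>y. cov y u F) = curvature G (\<phi> x) (L x u) (L x v) (F x)"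
proof -
  note y = \<phi>_S[OF x]
  note s = smooth_on_pulled[OF smooth_on_christoffel]
  have cc: "cov x u (\<lambda>y. cov y v F) = dir_deriv (\<lambda>y. dir_deriv F y v) x u
      + (dir_deriv (\<lambda>z. \<Gamma> z (L x v) (F x)) (\<phi> x) (L x u) + \<Gamma> (\<phi> x) (D2 x u v) (F x) + \<Gamma> (\<phi> x) (L x v) (dir_deriv F x u))
      + (\<Gamma> (\<phi> x) (L x u) (dir_deriv F x v) + \<Gamma> (\<phi> x) (L x u) (\<Gamma> (\<phi> x) (L x v) (F x)))" for u v
  proof -
    have s2: "smooth_on (\<lambda>y. \<Gamma> (\<phi> y) (L y v) (F y)) V"
      by (rule smooth_on_apply2[where B = "\<lambda>y. \<Gamma> (\<phi> y)", OF open_V bilinear_christoffel[OF \<phi>_S] s smooth_on_L F])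
    have "dir_deriv (\<lambda>y. cov y v F) x u
        = dir_deriv (\<lambda>y. dir_deriv F y v) x u + dir_deriv (\<lambda>y. \<Gamma> (\<phi> y) (L y v) (F y)) x u"
      unfolding cov_def by (rule dir_deriv_add[OF open_V x smooth_on_dir_deriv[OF F] s2])
    also have "dir_deriv (\<lambda>y. \<Gamma> (\<phi> y) (L y v) (F y)) x u
        = dir_deriv (\<lambda>y. \<Gamma> (\<phi> y) (L x v) (F x)) x u + \<Gamma> (\<phi> x) (D2 x u v) (F x) + \<Gamma> (\<phi> x) (L x v) (dir_deriv F x u)"
      by (rule dir_deriv_apply2[where B = "\<lambda>y. \<Gamma> (\<phi> y)", OF open_V x bilinear_christoffel[OF \<phi>_S] s smooth_on_L F])
    also have "dir_deriv (\<lambda>y. \<Gamma> (\<phi> y) (L x v) (F x)) x u = dir_deriv (\<lambda>z. \<Gamma> z (L x v) (F x)) (\<phi> x) (L x u)"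
      by (rule dir_deriv_pulled[OF smooth_on_christoffel x])
    finally show ?thesis by (simp add: cov_def linear_add[OF linear_christoffel(1)[OF y]])
  qed
  show ?thesis
    unfolding cc curvature_eq[OF y]
    using dir_deriv_commute[OF open_V x F, of u v] D2_sym[OF x, of u v] by simp
qed

theorem curvature_pullback:
  assumes x: "x \<in> V"
  shows "L x (curvature pull x u v w) = curvature G (\<phi> x) (L x u) (L x v) (L x w)"
proof -
  have c: "cov x u (\<lambda>y. cov y v (\<lambda>z. L z w)) = L x (dir_deriv (\<lambda>y. pull.\<Gamma> y v w) x u + pull.\<Gamma> x u (pull.\<Gamma> x v w))" for u v
  proof -
    have "cov x u (\<lambda>y. cov y v (\<lambda>z. L z w)) = cov x u (\<lambda>y. L y (pull.\<Gamma> y v w))"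
      by (rule cov_cong[OF x]) (rule cov_L_const)
    then show ?thesis by (simp add: cov_L[OF x pull.smooth_on_christoffel])
  qed
  have "curvature G (\<phi> x) (L x u) (L x v) (L x w)
      = cov x u (\<lambda>y. cov y v (\<lambda>z. L z w)) - cov x v (\<lambda>y. cov y u (\<lambda>z. L z w))"
    by (rule cov_commutator[OF x smooth_on_L, symmetric])
  also have "\<dots> = L x (curvature pull x u v w)"
    unfolding c pull.curvature_eq[OF x]
    by (simp add: linear_diff[OF linear_L[OF x], symmetric] algebra_simps)
  finally show ?thesis by simp
qed

text \<open>Differentiating the curvature along \<phi> produces second derivatives of \<phi> in each
  slot; these are exactly the inhomogeneous terms in \<open>christoffel_pullback\<close>.\<close>

theorem parallel_curvature_pullback:
  assumes x: "x \<in> V"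
    and par: "\<And>a u v w. dir_deriv (\<lambda>y. curvature G y u v w) (\<phi> x) a + \<Gamma> (\<phi> x) a (curvature G (\<phi> x) u v w)
      = curvature G (\<phi> x) (\<Gamma> (\<phi> x) a u) v w + curvature G (\<phi> x) u (\<Gamma> (\<phi> x) a v) w + curvature G (\<phi> x) u v (\<Gamma> (\<phi> x) a w)"
  shows "dir_deriv (\<lambda>y. curvature pull y u v w) x a + pull.\<Gamma> x a (curvature pull x u v w)
      = curvature pull x (pull.\<Gamma> x a u) v w + curvature pull x u (pull.\<Gamma> x a v) w + curvature pull x u v (pull.\<Gamma> x a w)"
proof -
  note y = \<phi>_S[OF x]
  let ?R = "\<lambda>y. curvature G (\<phi> y)"
  have sR: "smooth_on (\<lambda>y. ?R y u v w) V" for u v w by (rule smooth_on_pulled[OF smooth_on_curvature])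
  have l1: "linear (\<lambda>u. ?R z u v w)" and l2: "linear (\<lambda>v. ?R z u v w)" and l3: "linear (?R z u v)"
    if "z \<in> V" for z u v w
    using linear_curvature[OF \<phi>_S[OF that]] by simp_all
  have s2: "smooth_on (\<lambda>y. ?R y (L y u) (L y v) w) V" for w
    by (rule smooth_on_apply2[where B = "\<lambda>y u v. ?R y u v w", OF open_V _ sR smooth_on_L smooth_on_L])
      (use l1 l2 in \<open>simp add: bilinear_def\<close>)
  have "dir_deriv (\<lambda>y. ?R y (L y u) (L y v) (L y w)) x a
      = dir_deriv (\<lambda>y. ?R y (L y u) (L y v) (L x w)) x a + ?R x (L x u) (L x v) (D2 x a w)"
    by (rule dir_deriv_apply[where L = "\<lambda>y. ?R y (L y u) (L y v)", OF open_V x l3 s2 smooth_on_L])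
  also have "dir_deriv (\<lambda>y. ?R y (L y u) (L y v) (L x w)) x a
      = dir_deriv (\<lambda>y. ?R y (L x u) (L x v) (L x w)) x a + ?R x (D2 x a u) (L x v) (L x w) + ?R x (L x u) (D2 x a v) (L x w)"
    by (rule dir_deriv_apply2[where B = "\<lambda>y u v. ?R y u v (L x w)", OF open_V x _ sR smooth_on_L smooth_on_L])
      (use l1 l2 in \<open>simp add: bilinear_def\<close>)
  also have "dir_deriv (\<lambda>y. ?R y (L x u) (L x v) (L x w)) x a
      = dir_deriv (\<lambda>z. curvature G z (L x u) (L x v) (L x w)) (\<phi> x) (L x a)"
    by (rule dir_deriv_pulled[OF smooth_on_curvature x])
  finally have "cov x a (\<lambda>y. ?R y (L y u) (L y v) (L y w))
    = (dir_deriv (\<lambda>z. curvature G z (L x u) (L x v) (L x w)) (\<phi> x) (L x a) + \<Gamma> (\<phi> x) (L x a) (?R x (L x u) (L x v) (L x w)))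
      + ?R x (D2 x a u) (L x v) (L x w) + ?R x (L x u) (D2 x a v) (L x w) + ?R x (L x u) (L x v) (D2 x a w)"
    by (simp add: cov_def)
  also have "\<dots> = ?R x (L x (pull.\<Gamma> x a u)) (L x v) (L x w) + ?R x (L x u) (L x (pull.\<Gamma> x a v)) (L x w)
      + ?R x (L x u) (L x v) (L x (pull.\<Gamma> x a w))"
    unfolding par christoffel_pullback[OF x]
    by (simp add: linear_add[OF l1[OF x]] linear_add[OF l2[OF x]] linear_add[OF l3[OF x]])
  also have "\<dots> = L x (curvature pull x (pull.\<Gamma> x a u) v w + curvature pull x u (pull.\<Gamma> x a v) w + curvature pull x u v (pull.\<Gamma> x a w))"
    by (simp add: linear_add[OF linear_L[OF x]] curvature_pullback[OF x])
  also have "cov x a (\<lambda>y. ?R y (L y u) (L y v) (L y w)) = cov x a (\<lambda>y. L y (curvature pull y u v w))"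
    by (rule cov_cong[OF x]) (simp add: curvature_pullback)
  also have "\<dots> = L x (dir_deriv (\<lambda>y. curvature pull y u v w) x a + pull.\<Gamma> x a (curvature pull x u v w))"
    by (rule cov_L[OF x pull.smooth_on_curvature])
  finally show ?thesis by (rule L_eqI[OF x])
qed

text \<open>In the coordinates given by \<phi> the complex structure is the constant
  \<open>I\<close>, so its parallelism says that the Christoffel symbols commute with
  \<open>I\<close>.\<close>

theorem parallel_structure_pullback:
  fixes I :: "'e \<Rightarrow> 'e" and J :: "'e \<Rightarrow> 'e \<Rightarrow> 'e"
  assumes x: "x \<in> V" and J: "\<And>y. y \<in> S \<Longrightarrow> linear (J y)" "\<And>v. smooth_on (\<lambda>y. J y v) S"
    and I: "\<And>y v. y \<in> V \<Longrightarrow> L y (I v) = J (\<phi> y) (L y v)"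
    and par: "\<And>a v. dir_deriv (\<lambda>y. J y v) (\<phi> x) a + \<Gamma> (\<phi> x) a (J (\<phi> x) v) = J (\<phi> x) (\<Gamma> (\<phi> x) a v)"
  shows "pull.\<Gamma> x u (I v) = I (pull.\<Gamma> x u v)"
proof -
  note y = \<phi>_S[OF x]
  have "L x (pull.\<Gamma> x u (I v)) = cov x u (\<lambda>y. L y (I v))" by (rule cov_L_const[OF x, symmetric])
  also have "\<dots> = cov x u (\<lambda>y. J (\<phi> y) (L y v))" by (rule cov_cong[OF x I])
  also have "\<dots> = (dir_deriv (\<lambda>y. J y (L x v)) (\<phi> x) (L x u) + \<Gamma> (\<phi> x) (L x u) (J (\<phi> x) (L x v))) + J (\<phi> x) (D2 x u v)"
    using dir_deriv_apply[where L = "\<lambda>y. J (\<phi> y)", OF open_V x J(1)[OF \<phi>_S] smooth_on_pulled[OF J(2)] smooth_on_L, of v u]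
    by (simp add: cov_def dir_deriv_pulled[OF J(2) x])
  also have "\<dots> = J (\<phi> x) (L x (pull.\<Gamma> x u v))"
    unfolding par by (simp add: christoffel_pullback[OF x] linear_add[OF J(1)[OF y]])
  also have "\<dots> = L x (I (pull.\<Gamma> x u v))" by (rule I[OF x, symmetric])
  finally show ?thesis by (rule L_eqI[OF x])
qed

end

section \<open>Taylor coefficients of a Kaehler potential\<close>

abbreviation ddir :: "'a::real_normed_vector \<Rightarrow> ('a \<Rightarrow> 'b::real_normed_vector) \<Rightarrow> 'a \<Rightarrow> 'b" where
  "ddir u F \<equiv> \<lambda>x. dir_deriv F x u"

lemma smooth_on_ddir_power: "smooth_on F V \<Longrightarrow> smooth_on ((ddir X ^^ n) F) V"
  by (induction n) (simp_all add: smooth_on_dir_deriv)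

lemma ddir_power_commute:
  fixes F :: "'a::euclidean_space \<Rightarrow> 'b::euclidean_space"
  assumes V: "open V" and F: "smooth_on F V" and x: "x \<in> V"
  shows "ddir Y ((ddir X ^^ n) F) x = (ddir X ^^ n) (ddir Y F) x"
  using x
proof (induction n arbitrary: x)
  case (Suc n)
  have "ddir Y (ddir X ((ddir X ^^ n) F)) x = ddir X (ddir Y ((ddir X ^^ n) F)) x"
    by (rule dir_deriv_commute[OF V Suc.prems smooth_on_ddir_power[OF F]])
  also have "\<dots> = ddir X ((ddir X ^^ n) (ddir Y F)) x"
    using dir_deriv_cong_open[OF V Suc.prems Suc.IH] by simp
  finally show ?case by simp
qed simp

lemma ddir_power_add:
  assumes V: "open V" and F: "smooth_on F V" "smooth_on G V" and x: "x \<in> V"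
  shows "(ddir X ^^ n) (\<lambda>x. F x + G x) x = (ddir X ^^ n) F x + (ddir X ^^ n) G x"
  using x
proof (induction n arbitrary: x)
  case (Suc n)
  show ?case
    using dir_deriv_cong_open[OF V Suc.prems Suc.IH]
      dir_deriv_add[OF V Suc.prems smooth_on_ddir_power[OF F(1)] smooth_on_ddir_power[OF F(2)]] by simp
qed simp

lemma ddir_power_bounded_linear:
  assumes V: "open V" and F: "smooth_on F V" and B: "bounded_linear B" and x: "x \<in> V"
  shows "(ddir X ^^ n) (\<lambda>x. B (F x)) x = B ((ddir X ^^ n) F x)"
  using x
proof (induction n arbitrary: x)
  case (Suc n)
  show ?case
    using dir_deriv_cong_open[OF V Suc.prems Suc.IH]
      dir_deriv_bounded_linear[OF V Suc.prems smooth_on_ddir_power[OF F] B] by simp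
qed simp

text \<open>A binomial expansion in \<open>s\<close>. The linear coefficient serves polarization;
  the constant one is needed to compute it in the induction.\<close>

lemma ddir_power_line_expansion:
  fixes F :: "'a::euclidean_space \<Rightarrow> 'b::euclidean_space"
  assumes V: "open V" and F: "smooth_on F V"
  obtains Q where "\<And>k. smooth_on (Q k) V" "\<And>x s. x \<in> V \<Longrightarrow> (ddir (X + s *\<^sub>R Y) ^^ m) F x = (\<Sum>k\<le>m. s ^ k *\<^sub>R Q k x)"
    "\<And>x. x \<in> V \<Longrightarrow> Q 0 x = (ddir X ^^ m) F x" "\<And>x. x \<in> V \<Longrightarrow> Q 1 x = real m *\<^sub>R (ddir X ^^ (m - 1)) (ddir Y F) x"
    "\<And>k x. m < k \<Longrightarrow> x \<in> V \<Longrightarrow> Q k x = 0"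
proof (induction m arbitrary: thesis)
  case 0
  show ?case
  proof (rule 0[of "\<lambda>k x. if k = 0 then F x else 0"])
    show "smooth_on (\<lambda>x. if k = 0 then F x else 0) V" for k :: nat
      by (cases "k = 0") (simp_all add: F smooth_on_const[OF V])
  qed simp_all
next
  case (Suc m)
  from Suc.IH obtain Q where Q: "\<And>k. smooth_on (Q k) V"
      "\<And>x s. x \<in> V \<Longrightarrow> (ddir (X + s *\<^sub>R Y) ^^ m) F x = (\<Sum>k\<le>m. s ^ k *\<^sub>R Q k x)"
      "\<And>x. x \<in> V \<Longrightarrow> Q 0 x = (ddir X ^^ m) F x" "\<And>x. x \<in> V \<Longrightarrow> Q 1 x = real m *\<^sub>R (ddir X ^^ (m - 1)) (ddir Y F) x"
      "\<And>k x. m < k \<Longrightarrow> x \<in> V \<Longrightarrow> Q k x = 0"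
    by blast
  define Q' where "Q' k x = ddir X (Q k) x + (if k = 0 then 0 else ddir Y (Q (k - 1)) x)" for k x
  show ?case
  proof (rule Suc.prems[of Q'])
    show "smooth_on (Q' k) V" for k
      unfolding Q'_def
      by (cases k) (auto intro!: smooth_on_add smooth_on_dir_deriv Q V smooth_on_const)
    have z: "ddir Z (Q k) x = 0" if "m < k" "x \<in> V" for k x Z
      using dir_deriv_cong_open[OF V that(2) Q(5)[OF that(1)]] by simp
    show "(ddir (X + s *\<^sub>R Y) ^^ Suc m) F x = (\<Sum>k\<le>Suc m. s ^ k *\<^sub>R Q' k x)" if x: "x \<in> V" for x s
    proof -
      have sm: "smooth_on (\<lambda>x. \<Sum>k\<le>m. s ^ k *\<^sub>R Q k x) V"
        by (intro smooth_on_sum smooth_on_scaleR smooth_on_const V Q) auto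
      have D: "ddir Z (\<lambda>x. \<Sum>k\<le>m. s ^ k *\<^sub>R Q k x) x = (\<Sum>k\<le>m. s ^ k *\<^sub>R ddir Z (Q k) x)" for Z
        by (rule dir_deriv_eq[OF has_derivative_sum[OF has_derivative_scaleR_right[OF smooth_on_has_derivative[OF V Q(1) x]]]])
      have "(ddir (X + s *\<^sub>R Y) ^^ Suc m) F x = ddir (X + s *\<^sub>R Y) (\<lambda>x. \<Sum>k\<le>m. s ^ k *\<^sub>R Q k x) x"
        using dir_deriv_cong_open[OF V x Q(2)] by simp
      also have "\<dots> = (\<Sum>k\<le>m. s ^ k *\<^sub>R ddir X (Q k) x) + s *\<^sub>R (\<Sum>k\<le>m. s ^ k *\<^sub>R ddir Y (Q k) x)"
        unfolding linear_add[OF smooth_on_linear_dir_deriv[OF V sm x]] linear_scale[OF smooth_on_linear_dir_deriv[OF V sm x]]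
        by (simp only: D)
      also have "(\<Sum>k\<le>m. s ^ k *\<^sub>R ddir X (Q k) x) = (\<Sum>k\<le>Suc m. s ^ k *\<^sub>R ddir X (Q k) x)"
        using z[of "Suc m", OF _ x] by simp
      also have "s *\<^sub>R (\<Sum>k\<le>m. s ^ k *\<^sub>R ddir Y (Q k) x) = (\<Sum>k\<le>Suc m. s ^ k *\<^sub>R (if k = 0 then 0 else ddir Y (Q (k - 1)) x))"
        by (simp add: sum.atMost_Suc_shift scaleR_sum_right del: sum.atMost_Suc)
      finally show ?thesis by (simp add: Q'_def scaleR_add_right sum.distrib del: sum.atMost_Suc)
    qed
    show "Q' 0 x = (ddir X ^^ Suc m) F x" if x: "x \<in> V" for x
      using dir_deriv_cong_open[OF V x Q(3)] by (simp add: Q'_def)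
    show "Q' 1 x = real (Suc m) *\<^sub>R (ddir X ^^ (Suc m - 1)) (ddir Y F) x" if x: "x \<in> V" for x
    proof -
      have "ddir X (Q 1) x = ddir X (\<lambda>x. real m *\<^sub>R (ddir X ^^ (m - 1)) (ddir Y F) x) x"
        using dir_deriv_cong_open[OF V x Q(4)] by simp
      also have "\<dots> = real m *\<^sub>R ddir X ((ddir X ^^ (m - 1)) (ddir Y F)) x"
        by (rule dir_deriv_bounded_linear[OF V x smooth_on_ddir_power[OF smooth_on_dir_deriv[OF F]] bounded_linear_scaleR_right])
      also have "\<dots> = real m *\<^sub>R (ddir X ^^ m) (ddir Y F) x" by (cases m) simp_all
      finally have "ddir X (Q 1) x = real m *\<^sub>R (ddir X ^^ m) (ddir Y F) x" .
      moreover have "ddir Y (Q 0) x = (ddir X ^^ m) (ddir Y F) x"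
        using dir_deriv_cong_open[OF V x Q(3)] ddir_power_commute[OF V F x, where X = X and Y = Y and n = m] by simp
      ultimately show ?thesis by (simp add: Q'_def algebra_simps)
    qed
    show "Q' k x = 0" if "Suc m < k" "x \<in> V" for k x
      using z[of k x X] z[of "k - 1" x Y] that by (simp add: Q'_def)
  qed
qed

text \<open>Says that the homogeneous Taylor component of degree \<open>n\<close> vanishes;
  components of other degrees are unrestricted.\<close>

definition flat :: "nat \<Rightarrow> ('a::real_normed_vector \<Rightarrow> 'b::real_normed_vector) \<Rightarrow> bool" where
  "flat n F \<longleftrightarrow> (\<forall>X. (ddir X ^^ n) F 0 = 0)"

text \<open>Polarization: the coefficient of \<open>s\<close> in the \<open>n\<close>-th derivative along \<open>X + s Y\<close>.\<close>

lemma flat_ddir: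
  fixes F :: "'a::euclidean_space \<Rightarrow> complex"
  assumes V: "open V" "0 \<in> V" and F: "smooth_on F V" and fl: "flat (Suc n) F"
  shows "flat n (ddir Y F)"
  unfolding flat_def
proof
  fix X
  obtain Q where Q: "\<And>x s. x \<in> V \<Longrightarrow> (ddir (X + s *\<^sub>R Y) ^^ Suc n) F x = (\<Sum>k\<le>Suc n. s ^ k *\<^sub>R Q k x)"
    "\<And>x. x \<in> V \<Longrightarrow> Q 1 x = real (Suc n) *\<^sub>R (ddir X ^^ (Suc n - 1)) (ddir Y F) x"
    by (rule ddir_power_line_expansion[OF V(1) F, where X = X and Y = Y and m = "Suc n"]) blast
  have "(\<Sum>k\<le>Suc n. Q k 0 * of_real s ^ k) = 0" for s :: real
    using Q(1)[OF V(2), of s] fl by (simp add: flat_def scaleR_conv_of_real mult.commute)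
  \<comment> \<open>A polynomial that vanishes for all real \<open>s\<close> has infinitely many
    complex roots, so each coefficient is zero.\<close>
  then have "range complex_of_real \<subseteq> {z. (\<Sum>k\<le>Suc n. Q k 0 * z ^ k) = 0}" by auto
  moreover have "infinite (range complex_of_real)"
    by (simp add: finite_image_iff inj_on_def infinite_UNIV_char_0)
  ultimately have "infinite {z. (\<Sum>k\<le>Suc n. Q k 0 * z ^ k) = 0}" using finite_subset by blast
  then have "Q 1 0 = 0" using polyfun_finite_roots[of "\<lambda>k. Q k 0" "Suc n"] by auto
  then show "(ddir X ^^ n) (ddir Y F) 0 = 0" using Q(2)[OF V(2)] by simp
qed

lemma flat_combination:
  fixes F G :: "'a::euclidean_space \<Rightarrow> complex"
  assumes V: "open V" "0 \<in> V" and F: "smooth_on F V" "flat n F" and G: "smooth_on G V" "flat n G"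
  shows "flat n (\<lambda>x. a * F x + b * G x)"
  unfolding flat_def
proof
  fix X
  have bl: "bounded_linear (\<lambda>x. c * x)" for c :: complex by (rule bounded_linear_mult_right)
  show "(ddir X ^^ n) (\<lambda>x. a * F x + b * G x) 0 = 0"
    using ddir_power_add[OF V(1) smooth_on_bounded_linear[OF V(1) bl[of a] F(1)] smooth_on_bounded_linear[OF V(1) bl[of b] G(1)] V(2), where X = X and n = n]
      ddir_power_bounded_linear[OF V(1) F(1) bl[of a] V(2), where X = X and n = n] ddir_power_bounded_linear[OF V(1) G(1) bl[of b] V(2), where X = X and n = n]
      F(2) G(2) by (simp add: flat_def)
qed

lemma ddir_power_homogeneous:
  fixes F :: "'a::euclidean_space \<Rightarrow> complex"
  assumes "smooth_on F UNIV" "\<And>t. F (t *\<^sub>R X) = of_real (t ^ k) * c"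
  shows "(ddir X ^^ k) F 0 = fact k * c"
  using assms
proof (induction k arbitrary: F c)
  case 0
  show ?case using "0.prems"(2)[of 0] by simp
next
  case (Suc k)
  have "ddir X F (t *\<^sub>R X) = of_real (t ^ k) * (of_nat (Suc k) * c)" for t
  proof -
    have "((\<lambda>t. F (0 + t *\<^sub>R X)) has_vector_derivative ddir X F (0 + t *\<^sub>R X)) (at t)"
      by (rule smooth_on_line_deriv[OF open_UNIV Suc.prems(1) UNIV_I])
    then have "((\<lambda>t. of_real (t ^ Suc k) * c) has_vector_derivative ddir X F (t *\<^sub>R X)) (at t)"
      using Suc.prems(2) by simp
    moreover have "((\<lambda>t. of_real (t ^ Suc k) * c) has_vector_derivative of_real (real (Suc k) * t ^ k) * c) (at t)"
    proof -
      have "((\<lambda>t. t ^ Suc k) has_real_derivative real (Suc k) * t ^ k) (at t)"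
        using DERIV_pow[of "Suc k" t] by simp
      from has_vector_derivative_mult_left[OF has_vector_derivative_of_real[OF this], of c] show ?thesis .
    qed
    ultimately have "ddir X F (t *\<^sub>R X) = of_real (real (Suc k) * t ^ k) * c"
      by (rule vector_derivative_unique_at)
    then show ?thesis by simp
  qed
  then have "(ddir X ^^ k) (ddir X F) 0 = fact k * (of_nat (Suc k) * c)"
    by (rule Suc.IH[OF smooth_on_dir_deriv[OF Suc.prems(1)]])
  then show ?case by (simp add: funpow_swap1[where f = "ddir X"] algebra_simps)
qed

lemma taylor_series_ddir:
  fixes f :: "'a::euclidean_space \<Rightarrow> real"
  assumes V: "open V" "0 \<in> V" and f: "smooth_on f V"
  shows "fact n * taylor_series f n X = (ddir X ^^ n) f 0"
proof -
  define U where "U = {t. t *\<^sub>R X \<in> V}"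
  have U: "open U" unfolding U_def
    using continuous_open_preimage[OF _ open_UNIV V(1), of "\<lambda>t. t *\<^sub>R X"]
    by (simp add: vimage_def continuous_on_scaleR continuous_on_id)
  have "(deriv ^^ n) (\<lambda>t. f (t *\<^sub>R X)) t = (ddir X ^^ n) f (t *\<^sub>R X)" if "t \<in> U" for t
    using that
  proof (induction n arbitrary: t)
    case (Suc n)
    have tV: "0 + t *\<^sub>R X \<in> V" using Suc.prems by (simp add: U_def)
    have "((\<lambda>t. (ddir X ^^ n) f (t *\<^sub>R X)) has_vector_derivative (ddir X ^^ Suc n) f (t *\<^sub>R X)) (at t)"
      using smooth_on_line_deriv[OF V(1) smooth_on_ddir_power[OF f] tV] by simp
    then have "((\<lambda>t. (ddir X ^^ n) f (t *\<^sub>R X)) has_real_derivative (ddir X ^^ Suc n) f (t *\<^sub>R X)) (at t)"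
      by (simp add: has_real_derivative_iff_has_vector_derivative)
    then have "((deriv ^^ n) (\<lambda>t. f (t *\<^sub>R X)) has_real_derivative (ddir X ^^ Suc n) f (t *\<^sub>R X)) (at t)"
      by (rule DERIV_cong_ev[OF refl _ refl, THEN iffD2, rotated])
        (use eventually_nhds_in_open[OF U Suc.prems] Suc.IH in \<open>auto elim: eventually_mono\<close>)
    then show ?case by (simp add: DERIV_imp_deriv)
  qed simp
  from this[of 0] show ?thesis using V(2) by (simp add: taylor_series_def U_def)
qed

lemma smooth_on_real_polynomial_function:
  fixes f :: "'a::euclidean_space \<Rightarrow> real"
  assumes "real_polynomial_function f"
  shows "smooth_on f UNIV"
  using assms
proof induction
  case (linear f)
  then show ?case using smooth_on_bounded_linear[OF open_UNIV linear smooth_on_ident[OF open_UNIV]] by simp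
qed (auto intro: smooth_intros)

lemma smooth_on_polynomial_function:
  fixes f :: "'a::euclidean_space \<Rightarrow> complex"
  assumes "polynomial_function f"
  shows "smooth_on f UNIV"
proof -
  have "smooth_on (\<lambda>x. Re (f x)) UNIV" "smooth_on (\<lambda>x. Im (f x)) UNIV"
    using assms bounded_linear_Re bounded_linear_Im
    by (auto intro!: smooth_on_real_polynomial_function simp: polynomial_function_def o_def)
  then have "smooth_on (\<lambda>x. of_real (Re (f x)) + \<i> * of_real (Im (f x))) UNIV"
    by (intro smooth_intros) auto
  then show ?thesis by (simp flip: complex_eq)
qed

section \<open>Derivatives by type and weights of the circle action\<close>

context complex_structure
begin

text \<open>Together with \<open>pdb\<close>, the derivatives along the (1,0) and (0,1) parts of the
  constant field \<open>u\<close>.\<close>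

definition pd :: "'e \<Rightarrow> ('e \<Rightarrow> complex) \<Rightarrow> 'e \<Rightarrow> complex" where
  "pd u F x = (1 / 2) * dir_deriv F x u + (- \<i> / 2) * dir_deriv F x (I u)"

definition pdb :: "'e \<Rightarrow> ('e \<Rightarrow> complex) \<Rightarrow> 'e \<Rightarrow> complex" where
  "pdb u F x = (1 / 2) * dir_deriv F x u + (\<i> / 2) * dir_deriv F x (I u)"

lemma smooth_on_pd: "open V \<Longrightarrow> smooth_on F V \<Longrightarrow> smooth_on (pd u F) V"
  and smooth_on_pdb: "open V \<Longrightarrow> smooth_on F V \<Longrightarrow> smooth_on (pdb u F) V"
  unfolding pd_def[abs_def] pdb_def[abs_def] by (intro smooth_intros smooth_on_dir_deriv; assumption)+

lemma smooth_on_pd_power: "open V \<Longrightarrow> smooth_on F V \<Longrightarrow> smooth_on ((pd z ^^ n) F) V"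
  by (induction n) (simp_all add: smooth_on_pd)

lemma pd_cong_open:
  assumes "open V" "\<And>x. x \<in> V \<Longrightarrow> F x = G x" "x \<in> V"
  shows "pd u F x = pd u G x" "pdb u F x = pdb u G x"
  using dir_deriv_cong_open[OF assms(1,3,2)] by (simp_all add: pd_def pdb_def)

lemma pd_add:
  assumes "open V" "smooth_on F V" "smooth_on G V" "x \<in> V"
  shows "pd u (\<lambda>x. F x + G x) x = pd u F x + pd u G x" "pdb u (\<lambda>x. F x + G x) x = pdb u F x + pdb u G x"
  by (simp_all add: pd_def pdb_def dir_deriv_add[OF assms(1,4,2,3)] algebra_simps)

lemma flat_pd:
  assumes V: "open V" "0 \<in> V" and F: "smooth_on F V" "flat (Suc n) F"
  shows "flat n (pd u F)" "flat n (pdb u F)"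
  unfolding pd_def[abs_def] pdb_def[abs_def]
  by (rule flat_combination[OF V smooth_on_dir_deriv[OF F(1)] flat_ddir[OF V F] smooth_on_dir_deriv[OF F(1)] flat_ddir[OF V F]])+

lemma flat_pd_power:
  assumes V: "open V" "0 \<in> V" and F: "smooth_on F V" "flat n F"
  shows "(pd z ^^ n) F 0 = 0"
  using F
proof (induction n arbitrary: F)
  case 0
  then show ?case by (simp add: flat_def)
next
  case (Suc n)
  then show ?case using Suc.IH[OF smooth_on_pd[OF V(1)] flat_pd(1)[OF V]] by (simp add: funpow_swap1[where f = "pd z"])
qed

text \<open>Eigenfunctions of the circle action generated by \<open>I\<close>. Bidegree (a, b) has
  weight \<open>a - b\<close>, \<open>pd\<close> lowers the weight by one, \<open>pdb\<close> raises
  it by one, and a nonzero weight forces the value 0 at the origin.\<close>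

definition weight :: "int \<Rightarrow> ('e \<Rightarrow> complex) \<Rightarrow> bool" where
  "weight m F \<longleftrightarrow> smooth_on F UNIV \<and> (\<forall>x. dir_deriv F x (I x) = \<i> * of_int m * F x)"

lemma weight_0: "weight m F \<Longrightarrow> m \<noteq> 0 \<Longrightarrow> F 0 = 0"
  using linear_0[OF smooth_on_linear_dir_deriv[OF open_UNIV, of F 0]] by (auto simp: weight_def dest!: spec[of _ 0])

text \<open>Differentiate the eigenvalue equation; the field that sends \<open>x\<close> to
  \<open>I x\<close> moves with \<open>x\<close> and contributes the extra term.\<close>

lemma weight_ddir:
  assumes F: "weight m F"
  shows "dir_deriv (ddir u F) x (I x) = \<i> * of_int m * ddir u F x - ddir (I u) F x"
proof -
  have sm: "smooth_on F UNIV" using F by (simp add: weight_def)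
  have "dir_deriv (\<lambda>y. dir_deriv F y (I y)) x u = dir_deriv (\<lambda>y. dir_deriv F y (I x)) x u + dir_deriv F x (dir_deriv I x u)"
    by (rule dir_deriv_apply[where L = "\<lambda>y. dir_deriv F y", OF open_UNIV UNIV_I smooth_on_linear_dir_deriv[OF open_UNIV sm UNIV_I]
        smooth_on_dir_deriv[OF sm] smooth_on_bounded_linear[OF open_UNIV bounded_linear_I smooth_on_ident[OF open_UNIV]]])
  also have "dir_deriv I x u = I u" by (rule dir_deriv_eq[OF bounded_linear_imp_has_derivative[OF bounded_linear_I]])
  also have "dir_deriv (\<lambda>y. dir_deriv F y (I x)) x u = dir_deriv (ddir u F) x (I x)"
    by (rule dir_deriv_commute[OF open_UNIV UNIV_I sm])
  also have "dir_deriv (\<lambda>y. dir_deriv F y (I y)) x u = \<i> * of_int m * dir_deriv F x u"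
    using F dir_deriv_bounded_linear[OF open_UNIV UNIV_I sm bounded_linear_mult_right[of "\<i> * of_int m"]]
    by (simp add: weight_def)
  finally show ?thesis by (simp add: algebra_simps)
qed

lemma weight_pd:
  assumes F: "weight m F"
  shows "weight (m - 1) (pd u F)" "weight (m + 1) (pdb u F)"
proof -
  have sm: "smooth_on F UNIV" using F by (simp add: weight_def)
  note l = smooth_on_linear_dir_deriv[OF open_UNIV sm UNIV_I]
  have c: "dir_deriv (\<lambda>x. a * dir_deriv F x u + b * dir_deriv F x v) x w
      = a * dir_deriv (ddir u F) x w + b * dir_deriv (ddir v F) x w" for a b u v x w
    using dir_deriv_add[OF open_UNIV UNIV_I smooth_on_bounded_linear[OF open_UNIV bounded_linear_mult_right[of a] smooth_on_dir_deriv[OF sm]]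
        smooth_on_bounded_linear[OF open_UNIV bounded_linear_mult_right[of b] smooth_on_dir_deriv[OF sm]]]
      dir_deriv_bounded_linear[OF open_UNIV UNIV_I smooth_on_dir_deriv[OF sm] bounded_linear_mult_right]
    by simp
  have "dir_deriv (pd u F) x (I x) = \<i> * of_int (m - 1) * pd u F x" for x
    unfolding pd_def c weight_ddir[OF F] by (simp add: linear_neg[OF l] field_simps)
  moreover have "dir_deriv (pdb u F) x (I x) = \<i> * of_int (m + 1) * pdb u F x" for x
    unfolding pdb_def c weight_ddir[OF F] by (simp add: linear_neg[OF l] field_simps)
  ultimately show "weight (m - 1) (pd u F)" "weight (m + 1) (pdb u F)"
    using smooth_on_pd[OF open_UNIV sm] smooth_on_pdb[OF open_UNIV sm] by (simp_all add: weight_def)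
qed

lemma weight_pd_power: "weight m F \<Longrightarrow> weight (m - int n) ((pd z ^^ n) F)"
proof (induction n)
  case (Suc n)
  have "m - int n - 1 = m - int (Suc n)" by simp
  then show ?case using weight_pd(1)[OF Suc.IH[OF Suc.prems], of z] by (simp only: funpow.simps o_apply)
qed simp

lemma Sym_bi_weight:
  assumes "\<eta> \<in> Sym_bi I a b"
  shows "weight (int a - int b) \<eta>"
proof -
  have sm: "smooth_on \<eta> UNIV" using assms by (intro smooth_on_polynomial_function) (simp add: Sym_bi_def)
  have "dir_deriv \<eta> x (I x) = \<i> * of_int (int a - int b) * \<eta> x" for x
  proof -
    have "((\<lambda>t. \<eta> (x + t *\<^sub>R I x)) has_vector_derivative dir_deriv \<eta> x (I x)) (at 0)"
      using smooth_on_line_deriv[OF open_UNIV sm UNIV_I, where y = x and t = 0 and u = "I x"] by simp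
    moreover have "((\<lambda>t. \<eta> (x + t *\<^sub>R I x)) has_vector_derivative \<i> * (of_nat a - of_nat b) * \<eta> x) (at 0)"
      using assms by (simp add: Sym_bi_def)
    ultimately show ?thesis using vector_derivative_unique_at by fastforce
  qed
  then show ?thesis using sm by (simp add: weight_def)
qed

abbreviation "mixed n z w u v F \<equiv> (pd z ^^ n) (pd w (pd u (pdb v F)))"

lemma mixed_add:
  assumes V: "open V" and F: "smooth_on F V" "smooth_on G V" and x: "x \<in> V"
  shows "mixed n z w u v (\<lambda>x. F x + G x) x = mixed n z w u v F x + mixed n z w u v G x"
  using x
proof (induction n arbitrary: x)
  case 0
  note s = smooth_on_pdb[OF V F(1), of v] smooth_on_pdb[OF V F(2), of v]
  have 1: "pd u (pdb v (\<lambda>x. F x + G x)) x = pd u (pdb v F) x + pd u (pdb v G) x" if x: "x \<in> V" for x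
    using pd_cong_open(1)[OF V pd_add(2)[OF V F] x] pd_add(1)[OF V s x] by simp
  show ?case
    using pd_cong_open(1)[OF V 1 "0.prems"] pd_add(1)[OF V smooth_on_pd[OF V s(1)] smooth_on_pd[OF V s(2)] "0.prems"] by simp
next
  case (Suc n)
  have "smooth_on (mixed n z w u v H) V" if "smooth_on H V" for H
    by (intro smooth_on_pd_power smooth_on_pd smooth_on_pdb V that)
  then show ?case
    using pd_cong_open(1)[OF V Suc.IH Suc.prems] pd_add(1)[OF V _ _ Suc.prems] F by simp
qed

lemma mixed_sum:
  assumes "finite T" "\<And>i. i \<in> T \<Longrightarrow> smooth_on (F i) UNIV"
  shows "mixed n z w u v (\<lambda>x. \<Sum>i\<in>T. F i x) 0 = (\<Sum>i\<in>T. mixed n z w u v (F i) 0)"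
  using assms
proof (induction T rule: finite_induct)
  case empty
  have z: "pd u (\<lambda>x. 0) = (\<lambda>x. 0)" "pdb u (\<lambda>x. 0) = (\<lambda>x. 0)" for u by (simp_all add: pd_def[abs_def] pdb_def[abs_def])
  have "(pd z ^^ n) (\<lambda>x. 0) = (\<lambda>x. 0)" by (induction n) (simp_all add: z)
  then show ?case by (simp add: z)
next
  case (insert i T)
  have "smooth_on (\<lambda>x. \<Sum>i\<in>T. F i x) UNIV" using insert by (intro smooth_on_sum) auto
  then show ?case using mixed_add[OF open_UNIV, of "F i" "\<lambda>x. \<Sum>i\<in>T. F i x" 0 n z w u v] insert by simp
qed

text \<open>Counting weights, only bidegree (n + 2, 1) can contribute to this derivative at 0, and
  the normal form excludes that bidegree.\<close>

theorem potential_jets: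
  assumes V: "open V" "0 \<in> V" and f: "smooth_on f V"
    and T: "(\<lambda>n X. taylor_series f n X - (if n = 2 then B X else 0)) \<in> Sym_ge22 I"
  shows "mixed n z w u v (\<lambda>x. of_real (f x)) 0 = 0"
proof -
  \<comment> \<open>The order of the operator: \<open>n\<close> derivatives along \<open>z\<close>,
    two further holomorphic ones and one antiholomorphic. It exceeds 2, so the quadratic correction
    in \<open>T\<close> does not enter.\<close>
  define N where "N = n + 3"
  define P where "P = {(a :: nat, b). a + b = N \<and> 2 \<le> a \<and> 2 \<le> b}"
  have finP: "finite P" by (rule finite_subset[of _ "{..N} \<times> {..N}"]) (auto simp: P_def)
  obtain \<zeta> where \<zeta>: "\<forall>(a, b)\<in>P. \<zeta> a b \<in> Sym_bi I a b"
    "\<forall>X. of_real (taylor_series f N X - (if N = 2 then B X else 0)) = (\<Sum>(a, b)\<in>P. \<zeta> a b X)"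
    using T unfolding Sym_ge22_def P_def by blast
  have N2: "N \<noteq> 2" by (simp add: N_def)
  define Z where "Z x = (\<Sum>i\<in>P. case i of (a, b) \<Rightarrow> \<zeta> a b x)" for x
  have wt: "weight (int (fst i) - int (snd i)) (case i of (a, b) \<Rightarrow> \<zeta> a b)" if "i \<in> P" for i
    using \<zeta>(1) that by (auto intro!: Sym_bi_weight)
  then have s\<zeta>: "smooth_on (case i of (a, b) \<Rightarrow> \<zeta> a b) UNIV" if "i \<in> P" for i
    using that by (auto simp: weight_def)
  have Zc: "Z = (\<lambda>x. \<Sum>i\<in>P. (case i of (a, b) \<Rightarrow> \<zeta> a b) x)" by (auto simp: Z_def intro!: ext sum.cong)
  have sZ: "smooth_on Z UNIV" unfolding Zc by (intro smooth_on_sum finP s\<zeta>) auto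
  have sf: "smooth_on (\<lambda>x. complex_of_real (f x)) V" by (rule smooth_on_of_real[OF V(1) f])
  have sZ': "smooth_on (\<lambda>x. - Z x) V" by (rule smooth_on_minus[OF V(1) smooth_on_subset[OF sZ]]) simp
  \<comment> \<open>The potential minus its Taylor polynomial \<open>Z\<close> of degree exactly
    \<open>N\<close>; operators of order \<open>N\<close> at 0 do not see the rest.\<close>
  define r where "r x = complex_of_real (f x) + - Z x" for x
  have sr: "smooth_on r V" unfolding r_def[abs_def] by (rule smooth_on_add[OF V(1) sf sZ'])
  have "flat N r"
    unfolding flat_def
  proof
    fix X
    have hom: "Z (t *\<^sub>R X) = of_real (t ^ N) * Z X" for t
      unfolding Z_def sum_distrib_left using \<zeta>(1) by (intro sum.cong) (auto simp: P_def Sym_bi_def)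
    have "(ddir X ^^ N) r 0 = (ddir X ^^ N) (\<lambda>x. complex_of_real (f x)) 0 + (ddir X ^^ N) (\<lambda>x. - Z x) 0"
      unfolding r_def[abs_def] by (rule ddir_power_add[OF V(1) sf sZ' V(2)])
    also have "(ddir X ^^ N) (\<lambda>x. complex_of_real (f x)) 0 = of_real ((ddir X ^^ N) f 0)"
      by (rule ddir_power_bounded_linear[OF V(1) f bounded_linear_of_real V(2)])
    also have "(ddir X ^^ N) (\<lambda>x. - Z x) 0 = - (ddir X ^^ N) Z 0"
      by (rule ddir_power_bounded_linear[OF open_UNIV sZ bounded_linear_minus[OF bounded_linear_ident] UNIV_I])
    also have "(ddir X ^^ N) Z 0 = fact N * Z X" by (rule ddir_power_homogeneous[OF sZ hom])
    also have "(ddir X ^^ N) f 0 = fact N * taylor_series f N X" by (rule taylor_series_ddir[OF V f, symmetric])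
    also have "of_real (fact N * taylor_series f N X) = fact N * Z X"
      using \<zeta>(2)[rule_format, of X] N2 by (simp add: Z_def)
    finally show "(ddir X ^^ N) r 0 = 0" by simp
  qed
  then have f3: "flat (Suc (Suc (Suc n))) r" by (simp add: N_def eval_nat_numeral)
  note s1 = smooth_on_pdb[OF V(1) sr, of v]
  note s2 = smooth_on_pd[OF V(1) s1, of u]
  have "mixed n z w u v r 0 = 0"
    by (rule flat_pd_power[OF V smooth_on_pd[OF V(1) s2] flat_pd(1)[OF V s2 flat_pd(1)[OF V s1 flat_pd(2)[OF V sr f3]]]])
  moreover have "mixed n z w u v Z 0 = 0"
    unfolding Zc
  proof (subst mixed_sum[OF finP s\<zeta>])
    show "(\<Sum>i\<in>P. mixed n z w u v (case i of (a, b) \<Rightarrow> \<zeta> a b) 0) = 0"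
    proof (rule sum.neutral, rule)
      fix i assume i: "i \<in> P"
      have "weight (int (fst i) - int (snd i) + 1 - 1 - 1 - int n) (mixed n z w u v (case i of (a, b) \<Rightarrow> \<zeta> a b))"
        by (intro weight_pd_power weight_pd wt i)
      \<comment> \<open>Zero weight would mean a - b = n + 1 together with a + b = n + 3, hence b =
        1.\<close>
      moreover have "int (fst i) - int (snd i) + 1 - 1 - 1 - int n \<noteq> 0"
        using i by (auto simp: P_def N_def)
      ultimately show "mixed n z w u v (case i of (a, b) \<Rightarrow> \<zeta> a b) 0 = 0" by (rule weight_0)
    qed
  qed
  moreover have "mixed n z w u v (\<lambda>x. r x + Z x) 0 = mixed n z w u v r 0 + mixed n z w u v Z 0"
    by (rule mixed_add[OF V(1) sr smooth_on_subset[OF sZ] V(2)]) simp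
  ultimately show ?thesis by (simp add: r_def)
qed

text \<open>On the complex line through \<open>z\<close> the operator d/dl is
  \<open>pd z\<close>.\<close>

lemma hjet_line:
  assumes V: "open V" "0 \<in> V" and F: "smooth_on F V" and jets: "\<And>k. (pd z ^^ k) F 0 = 0"
  shows "hjet ((*) \<i>) n (\<lambda>l. F (cs l z))"
  using F jets
proof (induction n arbitrary: F)
  case (Suc n)
  define U where "U = {l. cs l z \<in> V}"
  have bl: "bounded_linear (\<lambda>l. cs l z)" by (rule bounded_bilinear.bounded_linear_left[OF bounded_bilinear_cs])
  have "continuous_on UNIV (\<lambda>l. cs l z)" using bl by (rule linear_continuous_on)
  from continuous_open_preimage[OF this open_UNIV V(1)] have U: "open U" by (simp add: U_def vimage_def)
  have U0: "0 \<in> U" using V(2) by (simp add: U_def cs_def)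
  have "hjet ((*) \<i>) n (dl ((*) \<i>) (\<lambda>l. F (cs l z)))"
  proof (rule hjet_cong[OF U U0])
    have "(pd z ^^ k) (pd z F) 0 = 0" for k using Suc.prems(2)[of "Suc k"] by (simp add: funpow_swap1[where f = "pd z"])
    then show "hjet ((*) \<i>) n (\<lambda>l. pd z F (cs l z))" by (rule Suc.IH[OF smooth_on_pd[OF V(1) Suc.prems(1)]])
    fix l assume "l \<in> U"
    then have lV: "cs l z \<in> V" by (simp add: U_def)
    have D: "dir_deriv (\<lambda>l. F (cs l z)) l a = dir_deriv F (cs l z) (cs a z)" for a
      by (rule dir_deriv_eq[OF has_derivative_compose[OF bounded_linear_imp_has_derivative[OF bl] smooth_on_has_derivative[OF V(1) Suc.prems(1) lV]]])
    show "pd z F (cs l z) = dl ((*) \<i>) (\<lambda>l. F (cs l z)) l"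
    proof -
      have "cs 1 z = z" "cs \<i> z = I z" by (simp_all add: cs_def)
      then show ?thesis unfolding dl_def D pd_def by (simp add: scaleR_conv_of_real algebra_simps)
    qed
  qed
  moreover have "F (cs 0 z) = 0" using Suc.prems(2)[of 0] by (simp add: cs_def)
  ultimately show ?case by simp
qed simp

end

section \<open>The Levi-Civita connection in Kaehler normal coordinates\<close>

text \<open>Everything takes place in one chart: \<open>\<phi>\<close> is the coordinate expression of the normal coordinates.\<close>

locale normal_chart = metric_pullback S G "ball 0 r0" \<phi> + complex_structure I
  for S :: "'e::euclidean_space set" and G :: "'e \<Rightarrow> 'e \<Rightarrow> 'e \<Rightarrow> real"
    and r0 :: real and \<phi> I :: "'e \<Rightarrow> 'e" +
  fixes J :: "'e \<Rightarrow> 'e \<Rightarrow> 'e" and \<theta> :: "'e \<Rightarrow> real" and B :: "'e \<Rightarrow> real"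
  assumes r0: "0 < r0"
    and linear_J: "x \<in> S \<Longrightarrow> linear (J x)" and smooth_J: "smooth_on (\<lambda>x. J x v) S"
    and J_orthogonal: "x \<in> S \<Longrightarrow> G x (J x u) (J x v) = G x u v"
    and J_parallel: "x \<in> S \<Longrightarrow> dir_deriv (\<lambda>y. J y v) x a + \<Gamma> x a (J x v) = J x (\<Gamma> x a v)"
    and R_parallel: "x \<in> S \<Longrightarrow> dir_deriv (\<lambda>y. curvature G y u v w) x a + \<Gamma> x a (curvature G x u v w)
      = curvature G x (\<Gamma> x a u) v w + curvature G x u (\<Gamma> x a v) w + curvature G x u v (\<Gamma> x a w)"
    and holomorphic: "x \<in> ball 0 r0 \<Longrightarrow> dir_deriv \<phi> x (I v) = J (\<phi> x) (dir_deriv \<phi> x v)"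
    and smooth_\<theta>: "smooth_on \<theta> S"
    and potential: "x \<in> S \<Longrightarrow> of_real (G x (J x u) v) = (\<i> / 2) * del J (delbar J \<theta>) x u v"
    and normal: "(\<lambda>n X. taylor_series (\<theta> \<circ> \<phi>) n X - (if n = 2 then B X else 0)) \<in> Sym_ge22 I"
    and d\<phi>_0: "dir_deriv \<phi> 0 v = v"
begin

abbreviation "V \<equiv> ball 0 r0 :: 'e set"

definition f :: "'e \<Rightarrow> real" where "f x = \<theta> (\<phi> x)"

abbreviation "D2f \<equiv> \<lambda>x u v. dir_deriv (\<lambda>y. dir_deriv f y v) x u"

lemma smooth_f: "smooth_on f V"
  unfolding f_def[abs_def] by (rule smooth_on_pulled[OF smooth_\<theta>])

lemma D2f_sym: "x \<in> V \<Longrightarrow> D2f x u v = D2f x v u"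
  by (rule dir_deriv_commute[OF open_V _ smooth_f])

lemma D2f_neg: "x \<in> V \<Longrightarrow> D2f x u (- v) = - D2f x u v" "x \<in> V \<Longrightarrow> D2f x (- u) v = - D2f x u v"
proof -
  assume x: "x \<in> V"
  show 1: "D2f x (- u) v = - D2f x u v" for u v
    by (rule linear_neg[OF smooth_on_linear_dir_deriv[OF open_V smooth_on_dir_deriv[OF smooth_f] x]])
  show "D2f x u (- v) = - D2f x u v" using D2f_sym[OF x] 1 by metis
qed

text \<open>Holomorphy turns \<open>delbar J\<close> along \<phi> into the operator for the constant
  \<open>I\<close>, and the second derivatives of \<phi> cancel in the exterior derivative. What
  remains is the Hessian of the potential in normal coordinates.\<close>

lemma pull_potential_I: assumes x: "x \<in> V" shows "4 * pull x (I u) v = D2f x (I u) v - D2f x u (I v)"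
proof -
  define \<beta> where "\<beta> = delbar J \<theta>"
  note y = \<phi>_S[OF x]
  note l\<theta> = smooth_on_linear_dir_deriv[OF open_S smooth_\<theta>]
  have lin\<beta>: "linear (\<beta> z)" if z: "z \<in> S" for z
    unfolding \<beta>_def delbar_def
    by (rule linearI) (simp_all add: linear_add[OF l\<theta>[OF z]] linear_scale[OF l\<theta>[OF z]] linear_add[OF linear_J[OF z]]
        linear_scale[OF linear_J[OF z]] scaleR_conv_of_real algebra_simps add_divide_distrib)
  have sm\<beta>: "smooth_on (\<lambda>z. \<beta> z v) S" for v
  proof -
    have "smooth_on (\<lambda>z. dir_deriv \<theta> z (J z v)) S"
      by (rule smooth_on_apply[where L = "dir_deriv \<theta>", OF open_S l\<theta> smooth_on_dir_deriv[OF smooth_\<theta>] smooth_J])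
    then have "smooth_on (\<lambda>z. (1 / 2) * (complex_of_real (dir_deriv \<theta> z v) + \<i> * of_real (dir_deriv \<theta> z (J z v)))) S"
      by (intro smooth_intros open_S smooth_on_dir_deriv smooth_\<theta>)
    then show ?thesis by (simp add: \<beta>_def delbar_def)
  qed
  have \<gamma>: "\<beta> (\<phi> z) (L z v) = (of_real (dir_deriv f z v) + \<i> * of_real (dir_deriv f z (I v))) / 2" if z: "z \<in> V" for z v
    unfolding \<beta>_def delbar_def f_def[abs_def]
    by (simp add: dir_deriv_pulled[OF smooth_\<theta> z] holomorphic[OF z])
  have D\<gamma>: "dir_deriv (\<lambda>z. \<beta> (\<phi> z) (L z v)) x u = (of_real (D2f x u v) + \<i> * of_real (D2f x u (I v))) / 2" for u v
  proof -
    have d: "((\<lambda>z. dir_deriv f z w) has_derivative (\<lambda>u. D2f x u w)) (at x)" for w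
      by (rule smooth_on_has_derivative[OF open_V smooth_on_dir_deriv[OF smooth_f] x])
    have "dir_deriv (\<lambda>z. \<beta> (\<phi> z) (L z v)) x u
        = dir_deriv (\<lambda>z. (of_real (dir_deriv f z v) + \<i> * of_real (dir_deriv f z (I v))) / 2) x u"
      by (rule fun_cong[OF dir_deriv_cong_open[OF open_V x]]) (rule \<gamma>)
    also have "\<dots> = (of_real (D2f x u v) + \<i> * of_real (D2f x u (I v))) / 2"
      by (rule dir_deriv_eq[OF bounded_linear.has_derivative[OF bounded_linear_divide
            has_derivative_add[OF has_derivative_of_real[OF d] has_derivative_mult_right[OF has_derivative_of_real[OF d]]]]])
    finally show ?thesis .
  qed
  have D\<beta>: "dir_deriv (\<lambda>z. \<beta> z (L x v)) (\<phi> x) (L x u) + \<beta> (\<phi> x) (D2 x u v) = dir_deriv (\<lambda>z. \<beta> (\<phi> z) (L z v)) x u" for u v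
    using dir_deriv_apply[where L = "\<lambda>z. \<beta> (\<phi> z)", OF open_V x lin\<beta>[OF \<phi>_S] smooth_on_pulled[OF sm\<beta>] smooth_on_L, where u = u]
    by (simp add: dir_deriv_pulled[OF sm\<beta> x])
  have ext: "ext_deriv \<beta> (\<phi> x) (L x u) (L x v) = (\<i> / 2) * of_real (D2f x u (I v) - D2f x v (I u))" for u v
  proof -
    have e: "dir_deriv (\<lambda>z. \<beta> z (L x v)) (\<phi> x) (L x u)
        = (of_real (D2f x u v) + \<i> * of_real (D2f x u (I v))) / 2 - \<beta> (\<phi> x) (D2 x u v)" for u v
      using D\<beta>[of v u] unfolding D\<gamma> by (simp add: eq_diff_eq)
    show ?thesis
      unfolding ext_deriv_def e using D2_sym[OF x, of u v] D2f_sym[OF x, of u v] by (simp add: field_simps)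
  qed
  have "of_real (pull x (I u) v) = (\<i> / 2) * del J \<beta> (\<phi> x) (L x u) (L x v)"
    unfolding pull_def \<beta>_def holomorphic[OF x] by (rule potential[OF y])
  also have "\<dots> = of_real ((D2f x v (I u) - D2f x u (I v)) / 4)"
    unfolding del_def ext holomorphic[OF x, symmetric]
    using D2f_sym[OF x, of "I u" v] D2f_sym[OF x, of "I v" u] by (simp add: D2f_neg[OF x] field_simps)
  finally have "pull x (I u) v = (D2f x v (I u) - D2f x u (I v)) / 4" by (simp only: of_real_eq_iff)
  then show ?thesis using D2f_sym[OF x, of "I u" v] by simp
qed

lemma pull_potential: "x \<in> V \<Longrightarrow> 4 * pull x u v = D2f x u v + D2f x (I u) (I v)"
  using pull_potential_I[of x "- I u" v] D2f_neg(2)[of x "I v" "I u"] by simp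

lemma pull_I: "x \<in> V \<Longrightarrow> pull x (I u) (I v) = pull x u v"
  unfolding pull_def by (simp add: holomorphic J_orthogonal[OF \<phi>_S])

lemma pull_I2: "x \<in> V \<Longrightarrow> pull x (I u) v = - pull x u (I v)"
  using pull_I[of x u "I v"] linear_neg[OF pull.linear_G(1), of x "I u" v] by simp

text \<open>The Hermitian form of the pulled back metric, complex linear in \<open>u\<close> and
  antilinear in \<open>v\<close>.\<close>

definition H :: "'e \<Rightarrow> 'e \<Rightarrow> 'e \<Rightarrow> complex" where
  "H x u v = of_real (pull x u v) + \<i> * of_real (pull x u (I v))"

lemma linear_H: "x \<in> V \<Longrightarrow> linear (\<lambda>u. H x u v)"
  unfolding H_def
  by (rule linearI) (simp_all add: linear_add[OF pull.linear_G(2)] linear_scale[OF pull.linear_G(2)] scaleR_conv_of_real algebra_simps)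

lemma smooth_on_H: "smooth_on (\<lambda>x. H x u v) V"
  unfolding H_def by (intro smooth_intros open_V pull.smooth_G)

lemma H_I: "x \<in> V \<Longrightarrow> H x (I u) v = \<i> * H x u v"
  using pull_I2[of x u v] pull_I[of x u v] by (simp add: H_def algebra_simps)

lemma H_potential:
  assumes x: "x \<in> V"
  shows "pd u (pdb v (\<lambda>x. of_real (f x))) x = H x u v"
proof -
  have d: "((\<lambda>z. dir_deriv f z w) has_derivative (\<lambda>u. D2f x u w)) (at x)" for w
    by (rule smooth_on_has_derivative[OF open_V smooth_on_dir_deriv[OF smooth_f] x])
  have c: "dir_deriv (\<lambda>x. complex_of_real (f x)) z w = of_real (dir_deriv f z w)" if "z \<in> V" for z w
    by (rule dir_deriv_bounded_linear[OF open_V that smooth_f bounded_linear_of_real])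
  have "pd u (pdb v (\<lambda>x. of_real (f x))) x
      = pd u (\<lambda>z. (1 / 2) * complex_of_real (dir_deriv f z v) + (\<i> / 2) * of_real (dir_deriv f z (I v))) x"
    by (rule pd_cong_open(1)[OF open_V _ x]) (simp add: pdb_def c)
  also have "\<dots> = (1 / 2) * ((1 / 2) * of_real (D2f x u v) + (\<i> / 2) * of_real (D2f x u (I v)))
      + (- \<i> / 2) * ((1 / 2) * of_real (D2f x (I u) v) + (\<i> / 2) * of_real (D2f x (I u) (I v)))"
    unfolding pd_def
    by (simp only: dir_deriv_eq[OF has_derivative_add[OF has_derivative_mult_right[OF has_derivative_of_real[OF d]]
            has_derivative_mult_right[OF has_derivative_of_real[OF d]]]])
  also have "\<dots> = of_real ((D2f x u v + D2f x (I u) (I v)) / 4) + \<i> * of_real ((D2f x u (I v) - D2f x (I u) v) / 4)"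
    by (simp add: field_simps)
  also have "\<dots> = H x u v"
  proof -
    have "(D2f x u v + D2f x (I u) (I v)) / 4 = pull x u v" "(D2f x u (I v) - D2f x (I u) v) / 4 = pull x u (I v)"
      using pull_potential[OF x, of u v] pull_potential[OF x, of u "I v"] by (simp_all add: D2f_neg[OF x])
    then show ?thesis by (simp only: H_def)
  qed
  finally show ?thesis .
qed

lemma christoffel_I: "x \<in> V \<Longrightarrow> pull.\<Gamma> x u (I v) = I (pull.\<Gamma> x u v)"
  by (rule parallel_structure_pullback[OF _ linear_J smooth_J holomorphic J_parallel[OF \<phi>_S]])

text \<open>The product rule also has a term with \<Gamma> applied to \<open>v\<close>; since
  \<open>H\<close> is antilinear in \<open>v\<close>, that term is antilinear in the direction of
  differentiation and \<open>pd\<close> removes it.\<close>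

lemma pd_H:
  assumes x: "x \<in> V"
  shows "pd w (\<lambda>x. H x u v) x = H x (pull.\<Gamma> x w u) v"
proof -
  have d: "((\<lambda>z. pull z a b) has_derivative (\<lambda>w. pull x (pull.\<Gamma> x w a) b + pull x a (pull.\<Gamma> x w b))) (at x)" for a b
    using smooth_on_has_derivative[OF open_V pull.smooth_G x, of a b] by (simp add: pull.metric_compatible[OF x])
  have D: "dir_deriv (\<lambda>x. H x u v) x w = of_real (pull x (pull.\<Gamma> x w u) v + pull x u (pull.\<Gamma> x w v))
      + \<i> * of_real (pull x (pull.\<Gamma> x w u) (I v) + pull x u (pull.\<Gamma> x w (I v)))" for w
    unfolding H_def
    by (rule dir_deriv_eq[OF has_derivative_add[OF has_derivative_of_real[OF d] has_derivative_mult_right[OF has_derivative_of_real[OF d]]]])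
  have GI: "pull.\<Gamma> x (I a) b = I (pull.\<Gamma> x a b)" for a b
    using christoffel_I[OF x, of b a] pull.christoffel_sym[OF x] by metis
  have n: "pull x a (- b) = - pull x a b" for a b by (rule linear_neg[OF pull.linear_G(1)[OF x]])
  show ?thesis
    unfolding pd_def D GI christoffel_I[OF x] pull_I2[OF x]
    by (simp add: H_def n field_simps)
qed

text \<open>For the jet condition: by \<open>H_potential\<close> and \<open>pd_H\<close> the pairing
  of \<Gamma> with \<open>H\<close> is a third derivative of the potential, whose jets along complex
  lines vanish by \<open>potential_jets\<close>; the pairings separate vectors at 0.\<close>

theorem normal_symmetric_germ: "symmetric_germ I pull.\<Gamma> r0"
proof (intro symmetric_germ.intro complex_structure_axioms symmetric_germ_axioms.intro)
  show "0 < r0" by (rule r0)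
  show "linear (pull.\<Gamma> x u)" if "x \<in> V" for x u by (rule pull.linear_christoffel(1)[OF that])
  show "pull.\<Gamma> x u v = pull.\<Gamma> x v u" if "x \<in> V" for x u v by (rule pull.christoffel_sym[OF that])
  show "pull.\<Gamma> x u (I v) = I (pull.\<Gamma> x u v)" if "x \<in> V" for x u v by (rule christoffel_I[OF that])
next
  show "smooth_on (\<lambda>x. pull.\<Gamma> x u v) V" for u v by (rule pull.smooth_on_christoffel)
next
  fix Rm x m u v w
  assume Rm: "\<And>x u v w. x \<in> V \<Longrightarrow> Rm x u v w = dir_deriv (\<lambda>y. pull.\<Gamma> y v w) x u - dir_deriv (\<lambda>y. pull.\<Gamma> y u w) x v
      + pull.\<Gamma> x u (pull.\<Gamma> x v w) - pull.\<Gamma> x v (pull.\<Gamma> x u w)" and x: "x \<in> V"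
  have R: "Rm x u v w = curvature pull x u v w" if "x \<in> V" for x u v w
    using Rm[OF that] pull.curvature_eq[OF that] by simp
  have "dir_deriv (\<lambda>y. Rm y u v w) x m = dir_deriv (\<lambda>y. curvature pull y u v w) x m"
    using dir_deriv_cong_open[OF open_V x R] by simp
  then show "dir_deriv (\<lambda>y. Rm y u v w) x m + pull.\<Gamma> x m (Rm x u v w)
      = Rm x (pull.\<Gamma> x m u) v w + Rm x u (pull.\<Gamma> x m v) w + Rm x u v (pull.\<Gamma> x m w)"
    using parallel_curvature_pullback[OF x R_parallel[OF \<phi>_S[OF x]], of u v w m] by (simp add: R[OF x])
next
  fix n z u w
  define U where "U = {l. cs l z \<in> V}"
  have bl: "bounded_linear (\<lambda>l. cs l z)" by (rule bounded_bilinear.bounded_linear_left[OF bounded_bilinear_cs])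
  have "continuous_on UNIV (\<lambda>l. cs l z)" using bl by (rule linear_continuous_on)
  from continuous_open_preimage[OF this open_UNIV open_V] have U: "open U" by (simp add: U_def vimage_def)
  have V0: "0 \<in> V" using r0 by simp
  have U0: "0 \<in> U" using r0 by (simp add: U_def cs_def)
  have line: "smooth_on (\<lambda>l. F (cs l z)) U" if "smooth_on F V" for F :: "'e \<Rightarrow> 'b::real_normed_vector"
    by (rule smooth_on_compose[OF U open_V that smooth_on_bounded_linear[OF U bl smooth_on_ident[OF U]]])
      (auto simp: U_def)
  show "hjet I n (\<lambda>l. pull.\<Gamma> (cs l z) w u)"
  proof (rule hjet_from_functionals[where \<kappa> = "\<lambda>v l x. H (cs l z) x v", OF complex_structure_I U U0])
    show "linear (\<lambda>x. H (cs l z) x v)" if "l \<in> U" for v l using that by (intro linear_H) (simp add: U_def)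
    show "smooth_on (\<lambda>l. H (cs l z) x v) U" for v x by (rule line[OF smooth_on_H])
    show "H (cs l z) (I x) v = \<i> * H (cs l z) x v" if "l \<in> U" for v l x using that by (intro H_I) (simp add: U_def)
    show "x = 0" if "\<And>v. H (cs 0 z) x v = 0" for x
    proof -
      have "cs 0 z = 0" by (simp add: cs_def)
      then have "pull 0 x x = 0" using that[of x] by (simp add: H_def complex_eq_iff)
      then show ?thesis using pull.G_pos[OF V0, of x] by force
    qed
    show "smooth_on (\<lambda>l. pull.\<Gamma> (cs l z) w u) U" by (rule line[OF pull.smooth_on_christoffel])
    fix v
    define F where "F = pd w (pd u (pdb v (\<lambda>x. of_real (f x))))"
    have sF: "smooth_on F V"
      unfolding F_def by (intro smooth_on_pd smooth_on_pdb open_V smooth_on_of_real smooth_f)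
    have nrm: "(\<lambda>n X. taylor_series f n X - (if n = 2 then B X else 0)) \<in> Sym_ge22 I"
      using normal by (simp add: f_def[abs_def] o_def)
    have jets: "(pd z ^^ k) F 0 = 0" for k
      unfolding F_def by (rule potential_jets[OF open_V V0 smooth_f nrm])
    have FH: "F x = H x (pull.\<Gamma> x w u) v" if "x \<in> V" for x
      unfolding F_def using pd_cong_open(1)[OF open_V H_potential that] pd_H[OF that] by simp
    show "hjet ((*) \<i>) n (\<lambda>l. H (cs l z) (pull.\<Gamma> (cs l z) w u) v)"
    proof (rule hjet_cong[OF U U0])
      show "hjet ((*) \<i>) n (\<lambda>l. F (cs l z))" by (rule hjet_line[OF open_V V0 sF jets])
      show "F (cs l z) = H (cs l z) (pull.\<Gamma> (cs l z) w u) v" if "l \<in> U" for l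
        using that by (intro FH) (simp add: U_def)
    qed
  qed
qed

sublocale germ: symmetric_germ I pull.\<Gamma> r0 by (rule normal_symmetric_germ)

text \<open>At 0 the curvature is the antisymmetrization of \<open>p\<close>. With
  \<open>I X\<close> in two slots, antilinearity of the first slot makes both terms
  positive.\<close>

theorem ad2_model: "ad2 G (\<phi> 0) (I X) A = germ.ad_sq X A"
proof -
  have V0: "0 \<in> V" using r0 by simp
  have "curvature G (\<phi> 0) u v w = curvature pull 0 u v w" for u v w
    using curvature_pullback[OF V0, of u v w] by (simp add: d\<phi>_0)
  also have "curvature pull 0 u v w = germ.p u v w - germ.p v u w" for u v w
    unfolding pull.curvature_eq[OF V0] using germ.D\<Gamma>_0[unfolded germ.D\<Gamma>_def] by (simp add: germ.\<Gamma>_0)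
  finally show ?thesis
    by (simp add: ad2_def germ.ad_sq_def germ.p_simps germ.p_sym[of X A X])
qed

end

section \<open>Uniqueness of geodesics\<close>

lemma smooth_on_Pair:
  fixes a :: "'a::real_normed_vector \<Rightarrow> 'b::real_normed_vector" and b :: "'a \<Rightarrow> 'c::real_normed_vector"
  assumes "open S" "smooth_on a S" "smooth_on b S"
  shows "smooth_on (\<lambda>x. (a x, b x)) S"
proof -
  have bl: "bounded_linear (\<lambda>x::'b. (x, 0::'c))" "bounded_linear (\<lambda>x::'c. (0::'b, x))"
    by (intro bounded_linear_Pair bounded_linear_ident bounded_linear_zero)+
  have "smooth_on (\<lambda>x. (a x, 0) + (0, b x)) S"
    by (rule smooth_on_add[OF assms(1) smooth_on_bounded_linear[OF assms(1) bl(1) assms(2)] smooth_on_bounded_linear[OF assms(1) bl(2) assms(3)]])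
  then show ?thesis by simp
qed

lemma smooth_on_curve_derivative:
  fixes x :: "real \<Rightarrow> 'a::real_normed_vector"
  assumes U: "open U" and x: "smooth_on x U"
  shows "t \<in> U \<Longrightarrow> (x has_vector_derivative vector_derivative x (at t)) (at t)"
    and "smooth_on (\<lambda>t. vector_derivative x (at t)) U"
proof -
  have d: "(x has_vector_derivative dir_deriv x t 1) (at t)" if "t \<in> U" for t
    using smooth_on_line_deriv[OF U x, of 0 t 1] that by simp
  then show "t \<in> U \<Longrightarrow> (x has_vector_derivative vector_derivative x (at t)) (at t)"
    by (metis vector_derivative_at)
  show "smooth_on (\<lambda>t. vector_derivative x (at t)) U"
    by (rule smooth_on_cong[OF U _ smooth_on_dir_deriv[OF x]]) (rule vector_derivative_at[symmetric, OF d])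
qed

text \<open>With a Lipschitz constant \<open>C\<close> on a closed ball containing both solutions
  and \<open>C e <= 1/2\<close>, the maximal distance of the solutions on the interval is at most
  half of itself.\<close>

lemma ode_local_uniqueness:
  fixes y1 y2 :: "real \<Rightarrow> 'a::euclidean_space"
  assumes T: "open T" "t0 \<in> T" and S: "open S" and F: "smooth_on F S" and y0: "y1 t0 \<in> S"
    and y1: "\<And>t. t \<in> T \<Longrightarrow> (y1 has_vector_derivative F (y1 t)) (at t)"
    and y2: "\<And>t. t \<in> T \<Longrightarrow> (y2 has_vector_derivative F (y2 t)) (at t)"
    and eq: "y1 t0 = y2 t0"
  obtains e where "0 < e" "\<And>t. \<bar>t - t0\<bar> < e \<Longrightarrow> y1 t = y2 t"
proof -
  obtain r where r: "0 < r" "cball (y1 t0) r \<subseteq> S" using S y0 open_contains_cball by blast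
  let ?B = "cball (y1 t0) r"
  obtain C where C: "0 \<le> C" "\<And>y v. y \<in> ?B \<Longrightarrow> norm (dir_deriv F y v) \<le> C * norm v"
  proof (rule compact_family_bound[of ?B "\<lambda>y v. dir_deriv F y v"])
    show "linear (dir_deriv F y)" if "y \<in> ?B" for y
      using smooth_on_linear_dir_deriv[OF S F] that r by blast
    show "continuous_on ?B (\<lambda>y. dir_deriv F y v)" for v
      by (rule continuous_on_subset[OF smooth_on_continuous[OF smooth_on_dir_deriv[OF F]] r(2)])
  qed auto
  have lip: "norm (F a - F b) \<le> C * norm (a - b)" if "a \<in> ?B" "b \<in> ?B" for a b
  proof (rule differentiable_bound[OF convex_cball _ _ that])
    show "(F has_derivative dir_deriv F y) (at y within ?B)" if "y \<in> ?B" for y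
      by (rule has_derivative_at_withinI[OF smooth_on_has_derivative[OF S F]]) (use that r in blast)
    show "onorm (dir_deriv F y) \<le> C" if "y \<in> ?B" for y
      by (rule onorm_le) (rule C(2)[OF that])
  qed
  have cont: "isCont y1 t0" "isCont y2 t0"
    using y1[OF T(2)] y2[OF T(2)] has_vector_derivative_continuous by auto
  have "\<forall>\<^sub>F t in nhds t0. t \<in> T" using T by (rule eventually_nhds_in_open)
  moreover have "\<forall>\<^sub>F t in nhds t0. y1 t \<in> ball (y1 t0) r" "\<forall>\<^sub>F t in nhds t0. y2 t \<in> ball (y1 t0) r"
  proof -
    have "(y1 \<longlongrightarrow> y1 t0) (nhds t0)" "(y2 \<longlongrightarrow> y1 t0) (nhds t0)"
      using cont(1)[unfolded isCont_def tendsto_at_iff_tendsto_nhds]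
        cont(2)[unfolded isCont_def tendsto_at_iff_tendsto_nhds, folded eq] by auto
    from this[THEN topological_tendstoD, OF open_ball] r(1)
    show "\<forall>\<^sub>F t in nhds t0. y1 t \<in> ball (y1 t0) r" "\<forall>\<^sub>F t in nhds t0. y2 t \<in> ball (y1 t0) r" by auto
  qed
  ultimately have "\<forall>\<^sub>F t in nhds t0. t \<in> T \<and> y1 t \<in> ?B \<and> y2 t \<in> ?B" by eventually_elim auto
  then obtain d where d: "0 < d" "\<And>t. dist t t0 < d \<Longrightarrow> t \<in> T \<and> y1 t \<in> ?B \<and> y2 t \<in> ?B"
    unfolding eventually_nhds_metric by blast
  \<comment> \<open>\<open>d / 2\<close> keeps the closed interval inside the neighbourhood; the
    summand 1 covers \<open>C = 0\<close>.\<close>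
  define e where "e = min (d / 2) (1 / (2 * (C + 1)))"
  have e: "0 < e" "e < d" using d(1) C(1) by (auto simp: e_def)
  have Ce: "C * e \<le> 1 / 2"
  proof -
    have "C * e \<le> C * (1 / (2 * (C + 1)))" using C(1) by (intro mult_left_mono) (auto simp: e_def)
    also have "\<dots> \<le> 1 / 2" using C(1) by (simp add: field_simps)
    finally show ?thesis .
  qed
  define D where "D t = y1 t - y2 t" for t
  have DD: "(D has_vector_derivative F (y1 t) - F (y2 t)) (at t)" if "t \<in> cball t0 e" for t
    unfolding D_def[abs_def] using d(2)[of t] that e
    by (intro has_vector_derivative_diff y1 y2) (auto simp: dist_commute)
  have "continuous_on (cball t0 e) (\<lambda>t. norm (D t))"
    by (intro continuous_on_norm continuous_at_imp_continuous_on ballI has_vector_derivative_continuous[OF DD])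
  then obtain t1 where t1: "t1 \<in> cball t0 e" "\<And>t. t \<in> cball t0 e \<Longrightarrow> norm (D t) \<le> norm (D t1)"
    using continuous_attains_sup[OF compact_cball, of t0 e "\<lambda>t. norm (D t)"] e by auto
  have "norm (D t1 - D t0) \<le> (C * norm (D t1)) * norm (t1 - t0)"
  proof (rule differentiable_bound[OF convex_cball])
    show "t1 \<in> cball t0 e" "t0 \<in> cball t0 e" using t1 e by auto
    fix t assume t: "t \<in> cball t0 e"
    show "(D has_derivative (\<lambda>h. h *\<^sub>R (F (y1 t) - F (y2 t)))) (at t within cball t0 e)"
      using DD[OF t] unfolding has_vector_derivative_def by (rule has_derivative_at_withinI)
    show "onorm (\<lambda>h. h *\<^sub>R (F (y1 t) - F (y2 t))) \<le> C * norm (D t1)"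
    proof (rule onorm_le)
      fix h :: real
      have "norm (F (y1 t) - F (y2 t)) \<le> C * norm (D t)"
        unfolding D_def using d(2)[of t] t e by (intro lip) (auto simp: dist_commute)
      also have "\<dots> \<le> C * norm (D t1)" using t1(2)[OF t] C(1) by (rule mult_left_mono)
      finally show "norm (h *\<^sub>R (F (y1 t) - F (y2 t))) \<le> C * norm (D t1) * norm h"
        by (simp add: mult.commute mult_left_mono)
    qed
  qed
  also have "\<dots> \<le> (C * norm (D t1)) * e"
    using t1(1) C(1) by (intro mult_left_mono) (auto simp: dist_real_def)
  also have "\<dots> = (C * e) * norm (D t1)" by simp
  also have "\<dots> \<le> (1 / 2) * norm (D t1)" using Ce by (rule mult_right_mono) simp
  finally have "norm (D t1) \<le> (1 / 2) * norm (D t1)" using eq by (simp add: D_def)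
  then have "norm (D t1) \<le> 0" by simp
  then have "D t = 0" if "t \<in> cball t0 e" for t using t1(2)[OF that] by (metis norm_le_zero_iff order_trans)
  then show thesis using that[OF e(1)] by (auto simp: D_def dist_real_def abs_minus_commute)
qed

context riemannian_metric
begin

lemma geodesic_equation_local_uniqueness:
  assumes T: "open T" "t0 \<in> T"
    and x: "\<And>t. t \<in> T \<Longrightarrow> (x has_vector_derivative x' t) (at t)" "\<And>t. t \<in> T \<Longrightarrow> x t \<in> S"
      "\<And>t. t \<in> T \<Longrightarrow> (x' has_vector_derivative - \<Gamma> (x t) (x' t) (x' t)) (at t)"
    and z: "\<And>t. t \<in> T \<Longrightarrow> (z has_vector_derivative z' t) (at t)"
      "\<And>t. t \<in> T \<Longrightarrow> (z' has_vector_derivative - \<Gamma> (z t) (z' t) (z' t)) (at t)"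
    and eq: "x t0 = z t0" "x' t0 = z' t0"
  obtains e where "0 < e" "\<And>t. \<bar>t - t0\<bar> < e \<Longrightarrow> x t = z t"
proof -
  define F where "F q = (snd q, - \<Gamma> (fst q) (snd q) (snd q))" for q :: "'e \<times> 'e"
  let ?S = "S \<times> (UNIV :: 'e set)"
  have oS: "open ?S" by (intro open_Times open_S open_UNIV)
  have f: "smooth_on fst ?S" and s: "smooth_on snd ?S"
    using smooth_on_bounded_linear[OF oS bounded_linear_fst smooth_on_ident[OF oS]]
      smooth_on_bounded_linear[OF oS bounded_linear_snd smooth_on_ident[OF oS]] by simp_all
  have "smooth_on (\<lambda>q. \<Gamma> (fst q) (snd q) (snd q)) ?S"
  proof (rule smooth_on_apply2[where B = "\<lambda>q. \<Gamma> (fst q)", OF oS _ _ s s])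
    show "bilinear (\<Gamma> (fst q))" if "q \<in> ?S" for q using that by (intro bilinear_christoffel) auto
    show "smooth_on (\<lambda>q. \<Gamma> (fst q) v w) ?S" for v w
      by (rule smooth_on_compose[OF oS open_S smooth_on_christoffel f]) auto
  qed
  then have F: "smooth_on F ?S"
    unfolding F_def by (intro smooth_on_Pair oS s smooth_on_minus)
  show thesis
  proof (rule ode_local_uniqueness[OF T oS F, of "\<lambda>t. (x t, x' t)" "\<lambda>t. (z t, z' t)"])
    show "(x t0, x' t0) \<in> ?S" using x(2)[OF T(2)] by simp
    show "((\<lambda>t. (x t, x' t)) has_vector_derivative F (x t, x' t)) (at t)" if "t \<in> T" for t
      using has_vector_derivative_Pair[OF x(1,3)[OF that]] by (simp add: F_def)
    show "((\<lambda>t. (z t, z' t)) has_vector_derivative F (z t, z' t)) (at t)" if "t \<in> T" for t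
      using has_vector_derivative_Pair[OF z(1,2)[OF that]] by (simp add: F_def)
    show "(x t0, x' t0) = (z t0, z' t0)" using eq by simp
    fix e :: real assume e: "0 < e" "\<And>t. \<bar>t - t0\<bar> < e \<Longrightarrow> (x t, x' t) = (z t, z' t)"
    show thesis by (rule that[OF e(1)]) (use e(2) in auto)
  qed
qed

end

context riemannian_manifold
begin

lemma chart_metric: "d \<in> A \<Longrightarrow> riemannian_metric (chart_img d) (g d)"
  by unfold_locales (use open_img metric_bilinear metric_sym metric_pos metric_smooth in auto)

lemma chart_inv_map: "d \<in> A \<Longrightarrow> q \<in> chart_dom d \<Longrightarrow> chart_inv d (chart_map d q) = q"
  by (rule homeomorphism_apply1[OF homeo])

lemma chart_map_inj: "d \<in> A \<Longrightarrow> q \<in> chart_dom d \<Longrightarrow> q' \<in> chart_dom d \<Longrightarrow> chart_map d q = chart_map d q' \<Longrightarrow> q = q'"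
  using chart_inv_map by metis

lemma geodesic_chart:
  assumes geo: "geodesic M A g \<gamma> T" and T: "open T" and d: "d \<in> A"
  defines "U \<equiv> {t \<in> T. \<gamma> t \<in> chart_dom d}" and "x \<equiv> chart_map d \<circ> \<gamma>"
  defines "x' \<equiv> \<lambda>s. vector_derivative x (at s)"
  shows "open U" "continuous_on U x'" "t \<in> U \<Longrightarrow> (x has_vector_derivative x' t) (at t)" "t \<in> U \<Longrightarrow> x t \<in> chart_img d"
    "t \<in> U \<Longrightarrow> (x' has_vector_derivative - christoffel (g d) (x t) (x' t) (x' t)) (at t)"
proof -
  have sm: "smooth_into M A \<gamma> T" using geo by (simp add: geodesic_def)
  have U': "U = T \<inter> \<gamma> -` chart_dom d" by (auto simp: U_def)
  show U: "open U"
    unfolding U' by (rule continuous_open_preimage[OF _ T open_dom[OF d]]) (use sm in \<open>simp add: smooth_into_def\<close>)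
  have x: "smooth_on x U" using sm d by (simp add: smooth_into_def U_def x_def)
  show "(x has_vector_derivative x' t) (at t)" if "t \<in> U"
    unfolding x'_def by (rule smooth_on_curve_derivative(1)[OF U x that])
  have sx': "smooth_on x' U" unfolding x'_def by (rule smooth_on_curve_derivative(2)[OF U x])
  show "continuous_on U x'" by (rule smooth_on_continuous[OF sx'])
  show "x t \<in> chart_img d" if "t \<in> U" using that by (simp add: U_def x_def chart_img_def)
  show "(x' has_vector_derivative - christoffel (g d) (x t) (x' t) (x' t)) (at t)" if t: "t \<in> U"
  proof -
    have "vector_derivative x' (at t) + christoffel (g d) (x t) (x' t) (x' t) = 0"
      using geo d t by (simp add: geodesic_def Let_def U_def x_def x'_def)
    then have "vector_derivative x' (at t) = - christoffel (g d) (x t) (x' t) (x' t)"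
      by (simp add: eq_neg_iff_add_eq_0)
    then show ?thesis using smooth_on_curve_derivative(1)[OF U sx' t] by simp
  qed
qed

lemma geodesic_local_uniqueness:
  assumes geo: "geodesic M A g \<gamma> T" "geodesic M A g \<delta> T" and T: "open T" "t0 \<in> T" and d: "d \<in> A"
    and eq: "\<gamma> t0 = \<delta> t0" "\<gamma> t0 \<in> chart_dom d"
      "vector_derivative (chart_map d \<circ> \<gamma>) (at t0) = vector_derivative (chart_map d \<circ> \<delta>) (at t0)"
  shows "t0 \<in> interior {t \<in> T. \<gamma> t = \<delta> t}"
proof -
  define U where "U = {t \<in> T. \<gamma> t \<in> chart_dom d} \<inter> {t \<in> T. \<delta> t \<in> chart_dom d}"
  note c = geodesic_chart[OF geo(1) T(1) d] geodesic_chart[OF geo(2) T(1) d]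
  have U: "open U" "t0 \<in> U" using c(1) c(6) T eq by (auto simp: U_def)
  interpret riemannian_metric "chart_img d" "g d" by (rule chart_metric[OF d])
  obtain e where e: "0 < e" "\<And>t. \<bar>t - t0\<bar> < e \<Longrightarrow> (chart_map d \<circ> \<gamma>) t = (chart_map d \<circ> \<delta>) t"
    by (rule geodesic_equation_local_uniqueness[OF U c(3) c(4) c(5) c(8) c(10)]) (use eq in \<open>auto simp: U_def\<close>)
  have "t0 \<in> interior (U \<inter> {t. \<bar>t - t0\<bar> < e})"
  proof (rule interiorI[OF _ _ order_refl])
    have "{t. \<bar>t - t0\<bar> < e} = ball t0 e" by (auto simp: dist_real_def abs_minus_commute)
    then show "open (U \<inter> {t. \<bar>t - t0\<bar> < e})" using open_Int[OF U(1) open_ball] by simp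
    show "t0 \<in> U \<inter> {t. \<bar>t - t0\<bar> < e}" using U e by simp
  qed
  moreover have "U \<inter> {t. \<bar>t - t0\<bar> < e} \<subseteq> {t \<in> T. \<gamma> t = \<delta> t}"
    using e(2) chart_map_inj[OF d] by (auto simp: U_def)
  ultimately show ?thesis using interior_mono by blast
qed

lemma geodesic_subset: "geodesic M A g \<gamma> T \<Longrightarrow> T' \<subseteq> T \<Longrightarrow> geodesic M A g \<gamma> T'"
  unfolding geodesic_def smooth_into_def
  by (auto intro: continuous_on_subset smooth_on_subset)

text \<open>The interior \<open>E\<close> of the set of agreement is closed in \<open>T\<close>: at
  a limit point the positions agree, and so do the velocities by continuity in a chart around that
  point, so local uniqueness applies again. Connectedness of \<open>T\<close> finishes the
  argument.\<close>

theorem geodesic_uniqueness: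
  assumes geo: "geodesic M A g \<gamma> T" "geodesic M A g \<delta> T" and T: "open T" "connected T" "t0 \<in> T" and d: "d \<in> A"
    and eq: "\<gamma> t0 = \<delta> t0" "\<gamma> t0 \<in> chart_dom d"
      "vector_derivative (chart_map d \<circ> \<gamma>) (at t0) = vector_derivative (chart_map d \<circ> \<delta>) (at t0)"
    and t: "t \<in> T"
  shows "\<gamma> t = \<delta> t"
proof -
  define E where "E = interior {t \<in> T. \<gamma> t = \<delta> t}"
  have oE: "open E" by (simp add: E_def)
  have E: "\<gamma> t = \<delta> t" "t \<in> T" if "t \<in> E" for t using that interior_subset by (auto simp: E_def)
  have cont: "isCont \<gamma> t" "isCont \<delta> t" if "t \<in> T" for t
    using geo T(1) that by (auto simp: geodesic_def smooth_into_def continuous_on_eq_continuous_at)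
  have "t \<in> E" if t: "t \<in> T" "t \<in> closure E" for t
  proof -
    obtain a where a: "\<And>n. a n \<in> E" "a \<longlonglongrightarrow> t" using t(2) closure_sequential by blast
    have tend: "(\<lambda>n. \<gamma> (a n)) \<longlonglongrightarrow> \<gamma> t" "(\<lambda>n. \<delta> (a n)) \<longlonglongrightarrow> \<delta> t"
      using cont[OF t(1)] isCont_tendsto_compose[OF _ a(2)] by auto
    have eqt: "\<gamma> t = \<delta> t" using LIMSEQ_unique[OF tend(1)] tend(2) E(1)[OF a(1)] by simp
    have "\<gamma> t \<in> M" using geo(1) t(1) by (auto simp: geodesic_def smooth_into_def)
    then obtain d where d: "d \<in> A" "\<gamma> t \<in> chart_dom d" using carrier by auto
    note c = geodesic_chart[OF geo(1) T(1) d(1)] geodesic_chart[OF geo(2) T(1) d(1)]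
    define U where "U = {t \<in> T. \<gamma> t \<in> chart_dom d} \<inter> {t \<in> T. \<delta> t \<in> chart_dom d}"
    have U: "open U" "t \<in> U" using c(1) c(6) t d eqt by (auto simp: U_def)
    let ?v = "\<lambda>\<gamma> s. vector_derivative (chart_map d \<circ> \<gamma>) (at s)"
    have cv: "isCont (?v \<gamma>) t" "isCont (?v \<delta>) t"
      using c(2) c(7) c(1) c(6) U(2) by (auto simp: continuous_on_eq_continuous_at U_def)
    have "?v \<gamma> (a n) = ?v \<delta> (a n)" for n
    proof -
      have "\<forall>\<^sub>F s in nhds (a n). s \<in> E" using oE a(1) by (rule eventually_nhds_in_open)
      then have "\<forall>\<^sub>F s in nhds (a n). (chart_map d \<circ> \<gamma>) s = (chart_map d \<circ> \<delta>) s"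
        by eventually_elim (simp add: E(1))
      then show ?thesis by (intro vector_derivative_cong_eq) (auto elim: eventually_mono)
    qed
    then have "?v \<gamma> t = ?v \<delta> t"
      using LIMSEQ_unique[OF isCont_tendsto_compose[OF cv(1) a(2)]] isCont_tendsto_compose[OF cv(2) a(2)] by simp
    from geodesic_local_uniqueness[OF geo T(1) t(1) d(1) eqt d(2) this] show ?thesis by (simp add: E_def)
  qed
  then have "T \<subseteq> E \<union> - closure E" by auto
  moreover have "E \<inter> - closure E \<inter> T = {}" using closure_subset by auto
  moreover have "t0 \<in> E" unfolding E_def by (rule geodesic_local_uniqueness[OF geo T(1,3) d eq])
  ultimately have "- closure E \<inter> T = {}"
    using connectedD[OF T(2) oE, of "- closure E"] T(3) by auto
  with \<open>T \<subseteq> E \<union> - closure E\<close> t have "t \<in> E" by auto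
  then show ?thesis by (rule E(1))
qed

text \<open>Two candidate geodesics agree on the intersection of their intervals, which makes the
  description in \<open>exp_map\<close> definite.\<close>

lemma exp_map_eq:
  assumes c: "c \<in> A" "p \<in> chart_dom c" and T: "open T" "is_interval T" "{0..1} \<subseteq> T"
    and geo: "geodesic M A g \<gamma> T" "\<gamma> 0 = p" "vector_derivative (chart_map c \<circ> \<gamma>) (at 0) = X"
  shows "exp_map M A g c p X = \<gamma> 1"
  unfolding exp_map_def
proof (rule the_equality)
  show "\<exists>T \<gamma>'. open T \<and> is_interval T \<and> {0..1} \<subseteq> T \<and> geodesic M A g \<gamma>' T \<and> \<gamma>' 0 = p
      \<and> vector_derivative (chart_map c \<circ> \<gamma>') (at 0) = X \<and> \<gamma>' 1 = \<gamma> 1"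
    using T geo by blast
  fix q assume "\<exists>T \<gamma>'. open T \<and> is_interval T \<and> {0..1} \<subseteq> T \<and> geodesic M A g \<gamma>' T \<and> \<gamma>' 0 = p
      \<and> vector_derivative (chart_map c \<circ> \<gamma>') (at 0) = X \<and> \<gamma>' 1 = q"
  then obtain T' \<gamma>' where T': "open T'" "is_interval T'" "{0..1} \<subseteq> T'" and geo': "geodesic M A g \<gamma>' T'"
    "\<gamma>' 0 = p" "vector_derivative (chart_map c \<circ> \<gamma>') (at 0) = X" "\<gamma>' 1 = q" by blast
  have con: "connected (T \<inter> T')"
    using T(2) T'(2) by (simp add: is_interval_connected_1[symmetric] is_interval_Int)
  have "\<gamma>' 1 = \<gamma> 1"
  proof (rule geodesic_uniqueness[where T = "T \<inter> T'" and ?t0.0 = 0 and d = c])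
    show "geodesic M A g \<gamma>' (T \<inter> T')" "geodesic M A g \<gamma> (T \<inter> T')"
      by (rule geodesic_subset[OF geo'(1)] geodesic_subset[OF geo(1)]; simp)+
    show "0 \<in> T \<inter> T'" "1 \<in> T \<inter> T'" using T(3) T'(3) by (simp_all add: subset_iff)
    show "open (T \<inter> T')" using T(1) T'(1) by (rule open_Int)
  qed (simp_all add: con c geo geo')
  then show "q = \<gamma> 1" using geo' by simp
qed

end

section \<open>The exponential map in Kaehler normal coordinates\<close>

lemma christoffel_cong:
  assumes V: "open V" "x \<in> V" and eq: "\<And>y u v. y \<in> V \<Longrightarrow> G y u v = G' y u v"
  shows "christoffel G x = christoffel G' x"
proof -
  have "dir_deriv (\<lambda>y. G y u v) x = dir_deriv (\<lambda>y. G' y u v) x" for u v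
    by (rule dir_deriv_cong_open[OF V]) (rule eq)
  then show ?thesis by (simp add: christoffel_def fun_eq_iff eq[OF V(2)])
qed

lemma taylor_series_cong:
  assumes V: "open V" "0 \<in> V" and eq: "\<And>x. x \<in> V \<Longrightarrow> f x = f' x"
  shows "taylor_series f n X = taylor_series f' n X"
proof -
  define U where "U = {t. t *\<^sub>R X \<in> V}"
  have U: "open U" unfolding U_def
    using continuous_open_preimage[OF _ open_UNIV V(1), of "\<lambda>t. t *\<^sub>R X"]
    by (simp add: vimage_def continuous_on_scaleR continuous_on_id)
  have "(deriv ^^ n) (\<lambda>t. f (t *\<^sub>R X)) t = (deriv ^^ n) (\<lambda>t. f' (t *\<^sub>R X)) t" if "t \<in> U" for t
    using that
  proof (induction n arbitrary: t)
    case (Suc n)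
    have "\<forall>\<^sub>F s in nhds t. s \<in> U" using U Suc.prems by (rule eventually_nhds_in_open)
    then show ?case using Suc.IH by (auto intro!: deriv_cong_ev elim: eventually_mono)
  qed (simp add: U_def eq)
  from this[of 0] show ?thesis using V(2) by (simp add: taylor_series_def U_def)
qed

lemma (in riemannian_metric) metric_subset:
  assumes "open S'" "S' \<subseteq> S"
  shows "riemannian_metric S' G"
  by unfold_locales (use assms bilinear_G G_sym G_pos smooth_on_subset[OF smooth_G] in auto)

lemma (in smooth_manifold) open_chart_image:
  assumes d: "d \<in> A" and W: "open W"
  shows "open (chart_map d ` (chart_dom d \<inter> W))"
proof -
  note h = homeo[OF d]
  have "chart_map d ` (chart_dom d \<inter> W) = chart_img d \<inter> chart_inv d -` W"
    using homeomorphism_apply1[OF h] by (auto simp: chart_img_def)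
  then show ?thesis
    using continuous_open_preimage[OF homeomorphism_cont2[OF h] open_img[OF d] W] by simp
qed

context hermitean_locally_symmetric_space
begin

lemma J_parallel_pointwise:
  assumes "d \<in> A" "x \<in> chart_img d"
  shows "dir_deriv (\<lambda>y. J d y v) x a + christoffel (g d) x a (J d x v) = J d x (christoffel (g d) x a v)"
  using J_parallel[OF assms smooth_on_const[OF open_img[OF assms(1)], of a] smooth_on_const[OF open_img[OF assms(1)], of v]]
  by (simp add: nabla_def)

lemma R_parallel_pointwise:
  assumes "d \<in> A" "x \<in> chart_img d"
  defines "\<Gamma> \<equiv> christoffel (g d)" and "R \<equiv> curvature (g d)"
  shows "dir_deriv (\<lambda>y. R y u v w) x a + \<Gamma> x a (R x u v w) = R x (\<Gamma> x a u) v w + R x u (\<Gamma> x a v) w + R x u v (\<Gamma> x a w)"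
  using curvature_parallel[OF assms(1,2) smooth_on_const[OF open_img[OF assms(1)], of a] smooth_on_const[OF open_img[OF assms(1)], of u]
      smooth_on_const[OF open_img[OF assms(1)], of v] smooth_on_const[OF open_img[OF assms(1)], of w]]
  by (simp add: nabla_def \<Gamma>_def R_def)

end

locale normal_coordinates = hermitean_locally_symmetric_space M A g J
  for M :: "'m::{t2_space, second_countable_topology} set" and A :: "('m, 'e::euclidean_space) chart set"
    and g :: "('m, 'e) chart \<Rightarrow> 'e \<Rightarrow> 'e \<Rightarrow> 'e \<Rightarrow> real" and J :: "('m, 'e) chart \<Rightarrow> 'e \<Rightarrow> 'e \<Rightarrow> 'e" +
  fixes c :: "('m, 'e) chart" and p :: 'm and V :: "'e set" and knc :: "'e \<Rightarrow> 'm"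
  assumes c: "c \<in> A" and p: "p \<in> chart_dom c" and knc: "kaehler_normal_coordinates M A g J c p V knc"
begin

abbreviation "\<phi> \<equiv> chart_map c \<circ> knc"
abbreviation "I \<equiv> J c (chart_map c p)"

lemma anchored: "open V" "0 \<in> V" "open (knc ` V)" "inj_on knc V" "continuous_on V knc" "knc ` V \<subseteq> M" "knc 0 = p"
    "d \<in> A \<Longrightarrow> smooth_on (chart_map d \<circ> knc) {x \<in> V. knc x \<in> chart_dom d}"
    "d \<in> A \<Longrightarrow> smooth_on (inv_into V knc \<circ> chart_inv d) (chart_map d ` (chart_dom d \<inter> knc ` V))"
    "(\<phi> has_derivative (\<lambda>h. h)) (at 0)"
  using knc by (simp_all add: kaehler_normal_coordinates_def anchored_coordinates_def smooth_into_def smooth_from_def)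

lemma open_knc_preimage: "open U \<Longrightarrow> open {x \<in> V. knc x \<in> U}"
  using continuous_open_preimage[OF anchored(5,1), of U] by (simp add: vimage_def Int_def)

lemma p_img: "chart_map c p \<in> chart_img c" using p by (simp add: chart_img_def)

text \<open>Anchored coordinates have a smooth inverse, so the chain rule yields a left inverse of
  the derivative.\<close>

lemma knc_derivative_inj:
  assumes x: "x \<in> V" "knc x \<in> chart_dom c"
  shows "inj (dir_deriv \<phi> x)"
proof -
  let ?U = "{x \<in> V. knc x \<in> chart_dom c}" and ?W = "chart_map c ` (chart_dom c \<inter> knc ` V)"
  have U: "open ?U" by (rule open_knc_preimage[OF open_dom[OF c]])
  have W: "open ?W" by (rule open_chart_image[OF c anchored(3)])
  have "(\<phi> has_derivative dir_deriv \<phi> x) (at x)"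
    by (rule smooth_on_has_derivative[OF U anchored(8)[OF c]]) (use x in simp)
  moreover have "\<phi> x \<in> ?W" using x by auto
  then have "(inv_into V knc \<circ> chart_inv c has_derivative dir_deriv (inv_into V knc \<circ> chart_inv c) (\<phi> x)) (at (\<phi> x))"
    by (rule smooth_on_has_derivative[OF W anchored(9)[OF c]])
  ultimately have "((\<lambda>y. (inv_into V knc \<circ> chart_inv c) (\<phi> y)) has_derivative
      (\<lambda>h. dir_deriv (inv_into V knc \<circ> chart_inv c) (\<phi> x) (dir_deriv \<phi> x h))) (at x)"
    by (rule has_derivative_compose)
  then have "((\<lambda>y. y) has_derivative (\<lambda>h. dir_deriv (inv_into V knc \<circ> chart_inv c) (\<phi> x) (dir_deriv \<phi> x h))) (at x)"
    by (rule has_derivative_transform_within_open[OF _ U]) (use x in \<open>auto simp: chart_inv_map[OF c] anchored(4)\<close>)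
  from has_derivative_unique[OF this has_derivative_ident]
  show ?thesis by (intro injI) metis
qed

text \<open>The image of \<open>c\<close> is cut down to the part \<open>S\<close> on which the
  potential is defined, and \<open>V\<close> to a ball that is mapped into it.\<close>

lemma normal_chart_exists:
  obtains S \<theta> r0 B where "0 < r0" "ball 0 r0 \<subseteq> {x \<in> V. knc x \<in> chart_dom c}" "S \<subseteq> chart_img c"
    "normal_chart S (g c) r0 \<phi> I (J c) \<theta> B"
proof -
  have "\<exists>W \<theta>. p \<in> W \<and> local_potential M A g J W \<theta> \<and>
        (\<lambda>n X. taylor_series (\<theta> \<circ> knc) n X - (if n = 2 then g c (chart_map c p) X X else 0)) \<in> Sym_ge22 I"
    using knc by (simp add: kaehler_normal_coordinates_def)
  then obtain W \<theta> where W: "p \<in> W" "local_potential M A g J W \<theta>"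
    and T: "(\<lambda>n X. taylor_series (\<theta> \<circ> knc) n X - (if n = 2 then g c (chart_map c p) X X else 0)) \<in> Sym_ge22 I"
    by blast
  have W': "open W" using W(2) by (simp add: local_potential_def)
  define S where "S = chart_map c ` (chart_dom c \<inter> W)"
  have S: "open S" "S \<subseteq> chart_img c"
    using open_chart_image[OF c W'] by (auto simp: S_def chart_img_def)
  have "open {x \<in> V. knc x \<in> chart_dom c \<inter> W}" by (intro open_knc_preimage open_Int open_dom c W')
  moreover have "0 \<in> {x \<in> V. knc x \<in> chart_dom c \<inter> W}" using anchored(2,7) p W(1) by simp
  ultimately obtain r0 where r0: "0 < r0" "ball 0 r0 \<subseteq> {x \<in> V. knc x \<in> chart_dom c \<inter> W}"
    using openE by blast
  have metric: "riemannian_metric S (g c)" by (rule riemannian_metric.metric_subset[OF chart_metric[OF c] S])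
  have sm\<phi>: "smooth_on \<phi> (ball 0 r0)"
    by (rule smooth_on_subset[OF anchored(8)[OF c]]) (use r0 in auto)
  have pb: "metric_pullback S (g c) (ball 0 r0) \<phi>"
    using r0(2) by (intro metric_pullback.intro metric metric_pullback_axioms.intro open_ball sm\<phi> knc_derivative_inj)
      (auto simp: S_def)
  have cs: "complex_structure I"
    by (intro complex_structure.intro J_linear[OF c p_img] J_square[OF c p_img])
  have "normal_chart_axioms S (g c) r0 \<phi> I (J c) (\<theta> \<circ> chart_inv c) (\<lambda>X. g c (chart_map c p) X X)"
  proof (rule normal_chart_axioms.intro)
    show "0 < r0" by (rule r0)
    fix x assume x: "x \<in> S"
    then have xi: "x \<in> chart_img c" using S by auto
    show "linear (J c x)" by (rule J_linear[OF c xi])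
    show "g c x (J c x u) (J c x v) = g c x u v" for u v by (rule J_orthogonal[OF c xi])
    show "dir_deriv (\<lambda>y. J c y v) x a + christoffel (g c) x a (J c x v) = J c x (christoffel (g c) x a v)" for v a
      by (rule J_parallel_pointwise[OF c xi])
    show "dir_deriv (\<lambda>y. curvature (g c) y u v w) x a + christoffel (g c) x a (curvature (g c) x u v w)
        = curvature (g c) x (christoffel (g c) x a u) v w + curvature (g c) x u (christoffel (g c) x a v) w
          + curvature (g c) x u v (christoffel (g c) x a w)" for u v w a
      by (rule R_parallel_pointwise[OF c xi])
    show "of_real (g c x (J c x u) v) = (\<i> / 2) * del (J c) (delbar (J c) (\<theta> \<circ> chart_inv c)) x u v" for u v
      using W(2) c x unfolding local_potential_def S_def by blast
  next
    show "smooth_on (\<lambda>x. J c x v) S" for v by (rule smooth_on_subset[OF J_smooth[OF c] S(2)])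
    show "smooth_on (\<theta> \<circ> chart_inv c) S" using W(2) c by (simp add: local_potential_def smooth_from_def S_def)
    show "dir_deriv \<phi> x (I v) = J c (\<phi> x) (dir_deriv \<phi> x v)" if "x \<in> ball 0 r0" for x v
      using knc c r0(2) that by (auto simp: kaehler_normal_coordinates_def holomorphic_coordinates_def)
    have "taylor_series ((\<theta> \<circ> chart_inv c) \<circ> \<phi>) n X = taylor_series (\<theta> \<circ> knc) n X" for n X
      by (rule taylor_series_cong[OF open_ball[of 0 r0]]) (use r0 in \<open>auto simp: chart_inv_map[OF c]\<close>)
    then show "(\<lambda>n X. taylor_series ((\<theta> \<circ> chart_inv c) \<circ> \<phi>) n X - (if n = 2 then g c (chart_map c p) X X else 0)) \<in> Sym_ge22 I"
      using T by simp
    show "dir_deriv \<phi> 0 v = v" for v by (rule dir_deriv_eq[OF anchored(10)])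
  qed
  then have "normal_chart S (g c) r0 \<phi> I (J c) (\<theta> \<circ> chart_inv c) (\<lambda>X. g c (chart_map c p) X X)"
    by (intro normal_chart.intro pb cs)
  then show thesis using r0 S(2) by (intro that[of r0 S]) auto
qed

text \<open>\<open>geodesic\<close> demands the equation in every chart \<open>d\<close>. By
  \<open>metric_transform\<close> the metrics of \<open>c\<close> and \<open>d\<close> pull back to
  the same metric in normal coordinates, so \<open>christoffel_pullback\<close> for \<open>d\<close>
  carries the equation for \<open>k\<close> over to \<open>d\<close>.\<close>

lemma geodesic_from_coordinates:
  assumes pb: "metric_pullback S (g c) B \<phi>" and S: "S \<subseteq> chart_img c" and B: "B \<subseteq> {x \<in> V. knc x \<in> chart_dom c}"
    and T: "open T" and k: "smooth_on k T" "k ` T \<subseteq> B"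
    and k': "\<And>t. t \<in> T \<Longrightarrow> (k has_vector_derivative k' t) (at t)"
      "\<And>t. t \<in> T \<Longrightarrow> (k' has_vector_derivative - christoffel (metric_pullback.pull (g c) \<phi>) (k t) (k' t) (k' t)) (at t)"
  shows "geodesic M A g (knc \<circ> k) T"
proof -
  interpret P: metric_pullback S "g c" B \<phi> by (rule pb)
  have kV: "k t \<in> V" "k t \<in> B" if "t \<in> T" for t using k(2) B that by auto
  have ck: "continuous_on T k" by (rule smooth_on_continuous[OF k(1)])
  have cont: "continuous_on T (knc \<circ> k)"
    by (rule continuous_on_compose[OF ck continuous_on_subset[OF anchored(5)]]) (use kV in auto)
  have charts: "smooth_on (chart_map d \<circ> (knc \<circ> k)) {t \<in> T. (knc \<circ> k) t \<in> chart_dom d} \<and>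
      (\<forall>t\<in>T. (knc \<circ> k) t \<in> chart_dom d \<longrightarrow>
        vector_derivative (\<lambda>s. vector_derivative (chart_map d \<circ> (knc \<circ> k)) (at s)) (at t)
        + christoffel (g d) ((chart_map d \<circ> (knc \<circ> k)) t) (vector_derivative (chart_map d \<circ> (knc \<circ> k)) (at t))
            (vector_derivative (chart_map d \<circ> (knc \<circ> k)) (at t)) = 0)" if d: "d \<in> A" for d
  proof -
    define Vd where "Vd = {x \<in> B. knc x \<in> chart_dom d}"
    define \<psi> where "\<psi> = chart_map d \<circ> knc"
    define Td where "Td = {t \<in> T. (knc \<circ> k) t \<in> chart_dom d}"
    have Vd_sub: "Vd \<subseteq> {x \<in> V. knc x \<in> chart_dom d}" "Vd \<subseteq> B" using B by (auto simp: Vd_def)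
    have oVd: "open Vd"
    proof -
      have "Vd = B \<inter> {x \<in> V. knc x \<in> chart_dom d}" using B by (auto simp: Vd_def)
      then show ?thesis using open_Int[OF P.open_V open_knc_preimage[OF open_dom[OF d]]] by simp
    qed
    have "Td = T \<inter> (knc \<circ> k) -` chart_dom d" by (auto simp: Td_def)
    then have oTd: "open Td" using continuous_open_preimage[OF cont T open_dom[OF d]] by simp
    have sm: "smooth_on \<psi> Vd" unfolding \<psi>_def by (rule smooth_on_subset[OF anchored(8)[OF d] Vd_sub(1)])
    have tr: "\<psi> x = transition c d (\<phi> x)" if "x \<in> Vd" for x
      using that B by (auto simp: \<psi>_def Vd_def transition_def chart_inv_map[OF c])
    let ?W = "chart_map c ` (chart_dom c \<inter> chart_dom d)"
    have W: "open ?W" by (rule open_chart_image[OF c open_dom[OF d]])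
    have \<phi>W: "\<phi> x \<in> ?W" if "x \<in> Vd" for x using that B by (auto simp: Vd_def)
    have Dtr: "dir_deriv \<psi> x v = dir_deriv (transition c d) (\<phi> x) (dir_deriv \<phi> x v)" if x: "x \<in> Vd" for x v
    proof -
      have "dir_deriv \<psi> x v = dir_deriv (\<lambda>x. transition c d (\<phi> x)) x v"
        by (rule fun_cong[OF dir_deriv_cong_open[OF oVd x tr]])
      also have "\<dots> = dir_deriv (transition c d) (\<phi> x) (dir_deriv \<phi> x v)"
        by (rule dir_deriv_compose[OF oVd x smooth_on_subset[OF P.smooth_\<phi> Vd_sub(2)] W \<phi>W[OF x] smooth_transition[OF c d]])
      finally show ?thesis .
    qed
    have iso: "g d (\<psi> x) (dir_deriv \<psi> x u) (dir_deriv \<psi> x v) = P.pull x u v" if x: "x \<in> Vd" for x u v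
      unfolding P.pull_def Dtr[OF x] tr[OF x] by (rule metric_transform[OF c d \<phi>W[OF x]])
    have \<psi>_img: "\<psi> x \<in> chart_img d" if "x \<in> Vd" for x using that by (auto simp: \<psi>_def Vd_def chart_img_def)
    interpret Gd: riemannian_metric "chart_img d" "g d" by (rule chart_metric[OF d])
    interpret Q: metric_pullback "chart_img d" "g d" Vd \<psi>
    proof
      show "open Vd" "smooth_on \<psi> Vd" "\<psi> ` Vd \<subseteq> chart_img d" using oVd sm \<psi>_img by auto
      fix x assume x: "x \<in> Vd"
      have xB: "x \<in> B" using x Vd_sub by auto
      have l: "linear (dir_deriv \<psi> x)" by (rule smooth_on_linear_dir_deriv[OF oVd sm x])
      show "inj (dir_deriv \<psi> x)"
        unfolding linear_injective_0[OF l]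
      proof (intro allI impI)
        fix v assume "dir_deriv \<psi> x v = 0"
        then have "P.pull x v v = 0" using iso[OF x, of v v] linear_0[OF Gd.linear_G(1)[OF \<psi>_img[OF x]]] by simp
        then show "v = 0" using P.pull.G_pos[OF xB, of v] by force
      qed
    qed
    have chr: "dir_deriv \<psi> x (christoffel P.pull x u v)
        = christoffel (g d) (\<psi> x) (dir_deriv \<psi> x u) (dir_deriv \<psi> x v) + dir_deriv (\<lambda>y. dir_deriv \<psi> y v) x u"
      if x: "x \<in> Vd" for x u v
    proof -
      have "christoffel P.pull x = christoffel Q.pull x"
        by (rule christoffel_cong[OF oVd x]) (simp add: Q.pull_def iso)
      then show ?thesis using Q.christoffel_pullback[OF x] by simp
    qed
    have kd: "k t \<in> Vd" if "t \<in> Td" for t using that kV by (auto simp: Vd_def Td_def)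
    have TdT: "t \<in> T" if "t \<in> Td" for t using that by (simp add: Td_def)
    have x: "(chart_map d \<circ> (knc \<circ> k)) = (\<lambda>t. \<psi> (k t))" by (simp add: \<psi>_def o_def)
    have dx: "((\<lambda>t. \<psi> (k t)) has_vector_derivative dir_deriv \<psi> (k t) (k' t)) (at t)" if t: "t \<in> Td" for t
    proof -
      have "((\<lambda>t. \<psi> (k t)) has_derivative (\<lambda>h. dir_deriv \<psi> (k t) (h *\<^sub>R k' t))) (at t)"
        using has_derivative_compose[OF k'(1)[OF TdT[OF t], unfolded has_vector_derivative_def]
            smooth_on_has_derivative[OF oVd sm kd[OF t]]] .
      then show ?thesis
        unfolding has_vector_derivative_def linear_scale[OF Q.linear_L[OF kd[OF t]]] .
    qed
    have d2x: "((\<lambda>t. dir_deriv \<psi> (k t) (k' t)) has_vector_derivative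
        - christoffel (g d) (\<psi> (k t)) (dir_deriv \<psi> (k t) (k' t)) (dir_deriv \<psi> (k t) (k' t))) (at t)" if t: "t \<in> Td" for t
    proof -
      have kt: "k t \<in> Vd" by (rule kd[OF t])
      have l: "linear (dir_deriv \<psi> (k s))" if "s \<in> Td" for s by (rule Q.linear_L[OF kd[OF that]])
      have dk: "(k has_derivative (\<lambda>h. h *\<^sub>R k' t)) (at t)"
        using k'(1)[OF TdT[OF t]] by (simp add: has_vector_derivative_def)
      have L: "((\<lambda>s. dir_deriv \<psi> (k s) v) has_derivative (\<lambda>h. dir_deriv (\<lambda>y. dir_deriv \<psi> y v) (k t) (h *\<^sub>R k' t))) (at t)" for v
        using has_derivative_compose[OF dk smooth_on_has_derivative[OF oVd smooth_on_dir_deriv[OF sm] kt]] .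
      have dk': "(k' has_derivative (\<lambda>h. h *\<^sub>R - christoffel P.pull (k t) (k' t) (k' t))) (at t)"
        using k'(2)[OF TdT[OF t]] by (simp add: has_vector_derivative_def)
      have "((\<lambda>s. dir_deriv \<psi> (k s) (k' s)) has_derivative
          (\<lambda>h. dir_deriv (\<lambda>y. dir_deriv \<psi> y (k' t)) (k t) (h *\<^sub>R k' t)
            + dir_deriv \<psi> (k t) (h *\<^sub>R - christoffel P.pull (k t) (k' t) (k' t)))) (at t)"
        by (rule has_derivative_apply[where L = "\<lambda>s. dir_deriv \<psi> (k s)"
              and L' = "\<lambda>h v. dir_deriv (\<lambda>y. dir_deriv \<psi> y v) (k t) (h *\<^sub>R k' t)", OF oTd t l L dk'])
      moreover have "dir_deriv (\<lambda>y. dir_deriv \<psi> y (k' t)) (k t) (h *\<^sub>R k' t)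
            + dir_deriv \<psi> (k t) (h *\<^sub>R - christoffel P.pull (k t) (k' t) (k' t))
          = h *\<^sub>R - christoffel (g d) (\<psi> (k t)) (dir_deriv \<psi> (k t) (k' t)) (dir_deriv \<psi> (k t) (k' t))" for h
      proof -
        have 1: "dir_deriv (\<lambda>y. dir_deriv \<psi> y (k' t)) (k t) (h *\<^sub>R k' t)
            = h *\<^sub>R dir_deriv (\<lambda>y. dir_deriv \<psi> y (k' t)) (k t) (k' t)"
          by (rule linear_scale[OF smooth_on_linear_dir_deriv[OF oVd Q.smooth_on_L kt]])
        show ?thesis
          unfolding 1 linear_scale[OF l[OF t]] linear_neg[OF l[OF t]] chr[OF kt] by (simp add: algebra_simps)
      qed
      ultimately show ?thesis unfolding has_vector_derivative_def by simp
    qed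
    have smx: "smooth_on (\<lambda>t. \<psi> (k t)) Td"
      by (rule smooth_on_compose[OF oTd oVd sm smooth_on_subset[OF k(1)]]) (use kd TdT in auto)
    have x': "vector_derivative (\<lambda>t. \<psi> (k t)) (at t) = dir_deriv \<psi> (k t) (k' t)" if "t \<in> Td" for t
      by (rule vector_derivative_at[OF dx[OF that]])
    have x'': "vector_derivative (\<lambda>s. vector_derivative (\<lambda>t. \<psi> (k t)) (at s)) (at t)
        = - christoffel (g d) (\<psi> (k t)) (dir_deriv \<psi> (k t) (k' t)) (dir_deriv \<psi> (k t) (k' t))" if t: "t \<in> Td" for t
      by (rule vector_derivative_at[OF has_vector_derivative_transform_within_open[OF d2x[OF t] oTd t x'[symmetric]]])
    show ?thesis unfolding x using smx x' x'' by (simp add: Td_def)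
  qed
  have "(knc \<circ> k) ` T \<subseteq> M" using kV(1) anchored(6) by auto
  then show ?thesis using cont charts by (simp add: geodesic_def smooth_into_def Let_def)
qed

end

section \<open>The exponential map compared with normal coordinates\<close>

context normal_coordinates
begin

abbreviation "ad2I \<equiv> \<lambda>X. ad2 (g c) (chart_map c p) (I X)"
abbreviation "ex \<equiv> exp_map M A g c p"

theorem exp_model:
  obtains r K Ki where "0 < r" "smooth_on K (ball 0 r)" "smooth_on Ki (ball 0 r)" "K 0 = 0" "Ki 0 = 0"
    "(Ki has_derivative (\<lambda>v. v)) (at 0)" "\<And>X. norm X < r \<Longrightarrow> Ki X \<in> V \<and> knc (Ki X) \<in> chart_dom c"
    "\<forall>\<^sub>F X in nhds 0. K X \<in> ball 0 r \<and> Ki (K X) = X" "\<And>X. norm X < r \<Longrightarrow> K (Ki X) = X"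
    "\<And>X. norm X < r \<Longrightarrow> even_series_terms (half_quotient_series artanh) (ad2I X) X sums K X"
    "\<And>X. norm X < r \<Longrightarrow> even_series_terms (half_quotient_series tanh) (ad2I X) X sums Ki X"
    "\<And>X. norm X < r \<Longrightarrow> ex X = knc (Ki X)"
proof -
  obtain S \<theta> r0 B where r0: "0 < r0" "ball 0 r0 \<subseteq> {x \<in> V. knc x \<in> chart_dom c}" and S: "S \<subseteq> chart_img c"
    and nc: "normal_chart S (g c) r0 \<phi> I (J c) \<theta> B"
    by (rule normal_chart_exists)
  interpret C: normal_chart S "g c" r0 \<phi> I "J c" \<theta> B by (rule nc)
  obtain r K Ki where r: "0 < r" and K: "smooth_on K (ball 0 r)" and Ki: "smooth_on Ki (ball 0 r)"
    and K0: "K 0 = 0" "Ki 0 = 0" and dKi: "(Ki has_derivative (\<lambda>v. v)) (at 0)"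
    and KiV: "\<And>X. norm X < r \<Longrightarrow> Ki X \<in> ball 0 r0"
    and ev: "\<forall>\<^sub>F X in nhds 0. K X \<in> ball 0 r \<and> Ki (K X) = X" and KKi: "\<And>X. norm X < r \<Longrightarrow> K (Ki X) = X"
    and sK: "\<And>X. norm X < r \<Longrightarrow> even_series_terms (half_quotient_series artanh) (C.germ.ad_sq X) X sums K X"
    and sKi: "\<And>X. norm X < r \<Longrightarrow> even_series_terms (half_quotient_series tanh) (C.germ.ad_sq X) X sums Ki X"
    and geo: "\<And>X. \<exists>c'. c' 0 = X \<and> (\<forall>t. norm (t *\<^sub>R X) < r \<longrightarrow>
        ((\<lambda>t. Ki (t *\<^sub>R X)) has_vector_derivative c' t) (at t) \<and>
        (c' has_vector_derivative - christoffel C.pull (Ki (t *\<^sub>R X)) (c' t) (c' t)) (at t))"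
    by (rule C.germ.geodesic_model) blast
  have ad: "ad2I X = C.germ.ad_sq X" for X
    using C.ad2_model[of X] anchored(7) by (simp add: fun_eq_iff)
  have ex: "ex X = knc (Ki X)" if X: "norm X < r" for X
  proof -
    \<comment> \<open>All \<open>t\<close> for which \<open>t X\<close> stays in the ball: by
      convexity an open interval, and it contains \<open>{0..1}\<close>.\<close>
    define T where "T = (\<lambda>t. t *\<^sub>R X) -` ball 0 r"
    have bl: "bounded_linear (\<lambda>t. t *\<^sub>R X)" by (rule bounded_linear_scaleR_left)
    have T: "open T" unfolding T_def
      by (rule open_vimage[OF open_ball linear_continuous_on[OF bl]])
    have "convex T" unfolding T_def
      by (rule convex_linear_vimage[OF bounded_linear.linear[OF bl] convex_ball])
    then have iT: "is_interval T" by (simp add: is_interval_convex_1)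
    have 01: "{0..1} \<subseteq> T"
    proof
      fix t :: real assume "t \<in> {0..1}"
      then have "\<bar>t\<bar> * norm X \<le> 1 * norm X" by (intro mult_right_mono) auto
      then show "t \<in> T" using X by (simp add: T_def)
    qed
    obtain k' where k'0: "k' 0 = X" and k': "\<And>t. norm (t *\<^sub>R X) < r \<Longrightarrow>
        ((\<lambda>t. Ki (t *\<^sub>R X)) has_vector_derivative k' t) (at t) \<and>
        (k' has_vector_derivative - christoffel C.pull (Ki (t *\<^sub>R X)) (k' t) (k' t)) (at t)"
      using geo[of X] by blast
    have Tn: "norm (t *\<^sub>R X) < r" if "t \<in> T" for t using that by (simp add: T_def)
    have sm: "smooth_on (\<lambda>t. Ki (t *\<^sub>R X)) T"
      by (rule smooth_on_compose[OF T open_ball Ki smooth_on_bounded_linear[OF T bl smooth_on_ident[OF T]]])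
        (auto simp: T_def)
    have "geodesic M A g (knc \<circ> (\<lambda>t. Ki (t *\<^sub>R X))) T"
    proof (rule geodesic_from_coordinates[OF C.metric_pullback_axioms S r0(2) T sm])
      show "(\<lambda>t. Ki (t *\<^sub>R X)) ` T \<subseteq> ball 0 r0" using KiV Tn by blast
    qed (use k' Tn in auto)
    moreover have "(knc \<circ> (\<lambda>t. Ki (t *\<^sub>R X))) 0 = p" using K0 anchored(7) by simp
    moreover have "vector_derivative (chart_map c \<circ> (knc \<circ> (\<lambda>t. Ki (t *\<^sub>R X)))) (at 0) = X"
    proof -
      have 1: "((\<lambda>t. Ki (t *\<^sub>R X)) has_derivative (\<lambda>h. h *\<^sub>R X)) (at 0)"
        using k'[of 0] r k'0 by (simp add: has_vector_derivative_def)
      have "(\<phi> has_derivative (\<lambda>h. h)) (at (Ki (0 *\<^sub>R X)))" using anchored(10) K0 by simp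
      from has_derivative_compose[OF 1 this]
      have "((\<lambda>t. \<phi> (Ki (t *\<^sub>R X))) has_vector_derivative X) (at 0)" by (simp add: has_vector_derivative_def)
      then show ?thesis by (simp add: o_def vector_derivative_at)
    qed
    ultimately have "exp_map M A g c p X = (knc \<circ> (\<lambda>t. Ki (t *\<^sub>R X))) 1"
      by (rule exp_map_eq[OF c p T iT 01])
    then show ?thesis by simp
  qed
  show thesis
  proof (rule that[OF r K Ki K0 dKi _ ev KKi _ _ ex])
    show "Ki X \<in> V \<and> knc (Ki X) \<in> chart_dom c" if "norm X < r" for X using KiV[OF that] r0(2) by blast
  qed (use sK sKi ad in auto)
qed

text \<open>The inverse of \<open>knc\<close> is continuous when read in the chart \<open>c\<close>,
  and the image under \<open>knc\<close> is a preimage under this inverse.\<close>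

lemma open_knc_image:
  assumes O: "open O'" "O' \<subseteq> {x \<in> V. knc x \<in> chart_dom c}"
  shows "open (knc ` O')"
proof -
  let ?W = "chart_map c ` (chart_dom c \<inter> knc ` V)"
  have W: "open ?W" by (rule open_chart_image[OF c anchored(3)])
  have "continuous_on ?W (inv_into V knc \<circ> chart_inv c)" by (rule smooth_on_continuous[OF anchored(9)[OF c]])
  from continuous_open_preimage[OF this W O(1)]
  have oP: "open (?W \<inter> (inv_into V knc \<circ> chart_inv c) -` O')" .
  have "knc ` O' = chart_dom c \<inter> chart_map c -` (?W \<inter> (inv_into V knc \<circ> chart_inv c) -` O')"
  proof (intro subset_antisym subsetI)
    fix q assume "q \<in> knc ` O'"
    then obtain x where x: "x \<in> O'" "q = knc x" by blast
    then have "x \<in> V" "knc x \<in> chart_dom c" using O(2) by auto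
    then show "q \<in> chart_dom c \<inter> chart_map c -` (?W \<inter> (inv_into V knc \<circ> chart_inv c) -` O')"
      using x by (auto simp: chart_inv_map[OF c] anchored(4))
  next
    fix q assume q: "q \<in> chart_dom c \<inter> chart_map c -` (?W \<inter> (inv_into V knc \<circ> chart_inv c) -` O')"
    then have "inv_into V knc q \<in> O'" using chart_inv_map[OF c, of q] by simp
    moreover obtain q' where q': "q' \<in> chart_dom c" "q' \<in> knc ` V" "chart_map c q = chart_map c q'" using q by auto
    moreover have "q = q'" using chart_map_inj[OF c _ q'(1,3)] q by simp
    ultimately show "q \<in> knc ` O'" using f_inv_into_f[of q knc V] by (metis imageI)
  qed
  then show ?thesis
    using continuous_open_preimage[OF homeomorphism_cont1[OF homeo[OF c]] open_dom[OF c] oP] by simp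
qed

text \<open>For existence, \<open>ex\<close> is \<open>knc\<close> after \<open>Ki\<close>, with
  smooth inverse \<open>K\<close> after the inverse of \<open>knc\<close>. For an arbitrary domain
  \<open>U\<close> the difference element equals \<open>K\<close> wherever \<open>K\<close> takes
  values in \<open>U\<close>, by injectivity of \<open>ex\<close> on \<open>U\<close>, and this
  covers a neighbourhood of 0.\<close>

theorem exp_knc_difference:
  "(\<exists>U. anchored_coordinates M A c p U ex) \<and>
    (\<forall>U. anchored_coordinates M A c p U ex \<longrightarrow>
      (let N = diff_dom U ex V knc; K = diff_element U ex knc
       in (\<forall>\<^sub>F X in nhds 0. X \<in> N \<and>
             even_series_terms (half_quotient_series artanh) (ad2I X) X sums K X) \<and>
          inj_on K N \<and>
          (\<forall>\<^sub>F X in nhds 0. X \<in> K ` N \<and>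
             even_series_terms (half_quotient_series tanh) (ad2I X) X sums inv_into N K X)))"
proof -
  obtain r K Ki where r: "0 < r" and K: "smooth_on K (ball 0 r)" and Ki: "smooth_on Ki (ball 0 r)"
    and K0: "K 0 = 0" "Ki 0 = 0" and dKi: "(Ki has_derivative (\<lambda>v. v)) (at 0)"
    and KiV: "\<And>X. norm X < r \<Longrightarrow> Ki X \<in> V \<and> knc (Ki X) \<in> chart_dom c"
    and ev: "\<forall>\<^sub>F X in nhds 0. K X \<in> ball 0 r \<and> Ki (K X) = X" and KKi: "\<And>X. norm X < r \<Longrightarrow> K (Ki X) = X"
    and sK: "\<And>X. norm X < r \<Longrightarrow> even_series_terms (half_quotient_series artanh) (ad2I X) X sums K X"
    and sKi: "\<And>X. norm X < r \<Longrightarrow> even_series_terms (half_quotient_series tanh) (ad2I X) X sums Ki X"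
    and ex: "\<And>X. norm X < r \<Longrightarrow> ex X = knc (Ki X)"
    by (rule exp_model) blast
  have B0: "0 \<in> ball 0 r" using r by simp
  have tendK: "(K \<longlongrightarrow> 0) (nhds 0)" and tendKi: "(Ki \<longlongrightarrow> 0) (nhds 0)"
  proof -
    have "isCont K 0" "isCont Ki 0"
      using smooth_on_continuous[OF K] smooth_on_continuous[OF Ki] B0
      unfolding continuous_on_eq_continuous_at[OF open_ball] by blast+
    then show "(K \<longlongrightarrow> 0) (nhds 0)" "(Ki \<longlongrightarrow> 0) (nhds 0)"
      unfolding isCont_def tendsto_at_iff_tendsto_nhds by (simp_all only: K0)
  qed
  have evB: "\<forall>\<^sub>F X in nhds 0. X \<in> ball 0 r" using open_ball B0 by (rule eventually_nhds_in_open)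
  have "\<forall>\<^sub>F X in nhds 0. X \<in> {x \<in> V. knc x \<in> chart_dom c}"
    by (rule eventually_nhds_in_open[OF open_knc_preimage[OF open_dom[OF c]]]) (use anchored(2,7) p in simp)
  from eventually_conj[OF evB eventually_conj[OF this ev]]
  \<comment> \<open>A neighbourhood on which \<open>Ki\<close> undoes \<open>K\<close>; the relation
    in the other order holds on the whole ball by \<open>KKi\<close>.\<close>
  obtain O' where O': "open O'" "0 \<in> O'" "\<And>X. X \<in> O' \<Longrightarrow> X \<in> ball 0 r \<and> X \<in> {x \<in> V. knc x \<in> chart_dom c}
      \<and> K X \<in> ball 0 r \<and> Ki (K X) = X"
    unfolding eventually_nhds by blast
  have O'V: "O' \<subseteq> V" "O' \<subseteq> {x \<in> V. knc x \<in> chart_dom c}" "O' \<subseteq> ball 0 r" using O'(3) by auto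
  \<comment> \<open>Chosen so that \<open>Ki\<close> maps \<open>U\<close> onto \<open>O'\<close>
    and \<open>ex\<close> maps it onto the open image of \<open>O'\<close> under
    \<open>knc\<close>.\<close>
  define U where "U = ball 0 r \<inter> Ki -` O'"
  have oU: "open U" unfolding U_def
    by (rule continuous_open_preimage[OF smooth_on_continuous[OF Ki] open_ball O'(1)])
  have Un: "norm X < r" "Ki X \<in> O'" if "X \<in> U" for X using that by (auto simp: U_def)
  have KO: "K Y \<in> U" "ex (K Y) = knc Y" if "Y \<in> O'" for Y
    using O'(3)[OF that] that ex[of "K Y"] by (auto simp: U_def)
  have eU: "ex ` U = knc ` O'"
  proof (intro subset_antisym image_subsetI)
    show "ex X \<in> knc ` O'" if "X \<in> U" for X using Un[OF that] ex by simp
    show "knc Y \<in> ex ` U" if "Y \<in> O'" for Y using KO[OF that] by (metis imageI)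
  qed
  have injU: "inj_on ex U"
  proof (rule inj_onI)
    fix X Y assume XY: "X \<in> U" "Y \<in> U" "ex X = ex Y"
    then have "knc (Ki X) = knc (Ki Y)" using ex Un by simp
    then have "Ki X = Ki Y" using inj_onD[OF anchored(4)] XY(1,2) Un(2) O'V(1) by blast
    then show "X = Y" using KKi Un(1) XY(1,2) by metis
  qed
  have oW: "open (knc ` O')" by (rule open_knc_image[OF O'(1) O'V(2)])
  have smKi: "smooth_on Ki U" by (rule smooth_on_subset[OF Ki]) (auto simp: U_def)
  have "anchored_coordinates M A c p U ex"
    unfolding anchored_coordinates_def
  proof (intro conjI)
    show "open U" by (rule oU)
    show "0 \<in> U" using r O'(2) K0 by (simp add: U_def)
    show "open (ex ` U)" unfolding eU by (rule oW)
    show "inj_on ex U" by (rule injU)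
    show "ex 0 = p" using ex[of 0] r K0 anchored(7) by simp
    show "smooth_into M A ex U"
      unfolding smooth_into_def
    proof (intro conjI ballI)
      have "continuous_on U (knc \<circ> Ki)"
        by (rule continuous_on_compose[OF smooth_on_continuous[OF smKi] continuous_on_subset[OF anchored(5)]])
          (use Un O'V in auto)
      then show cont: "continuous_on U ex" by (rule continuous_on_eq) (simp add: ex Un)
      show "ex ` U \<subseteq> M" unfolding eU using anchored(6) O'V by auto
      fix d assume d: "d \<in> A"
      let ?U = "{X \<in> U. ex X \<in> chart_dom d}"
      have "?U = U \<inter> ex -` chart_dom d" by auto
      then have oU': "open ?U" using continuous_open_preimage[OF cont oU open_dom[OF d]] by simp
      have "smooth_on (\<lambda>X. (chart_map d \<circ> knc) (Ki X)) ?U"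
        by (rule smooth_on_compose[OF oU' open_knc_preimage[OF open_dom[OF d]] anchored(8)[OF d] smooth_on_subset[OF smKi]])
          (use Un ex O'V in auto)
      then show "smooth_on (chart_map d \<circ> ex) ?U"
        by (rule smooth_on_cong[OF oU', rotated]) (simp add: ex Un)
    qed
    show "smooth_from A (inv_into U ex) (ex ` U)"
      unfolding smooth_from_def
    proof
      fix d assume d: "d \<in> A"
      let ?W = "chart_map d ` (chart_dom d \<inter> ex ` U)"
      have W: "open ?W" unfolding eU by (rule open_chart_image[OF d oW])
      have inv: "inv_into V knc (knc x) = x" if "x \<in> O'" for x using that O'V(1) by (intro inv_into_f_f[OF anchored(4)]) auto
      have "smooth_on (\<lambda>y. K ((inv_into V knc \<circ> chart_inv d) y)) ?W"
        by (rule smooth_on_compose[OF W open_ball K smooth_on_subset[OF anchored(9)[OF d]]])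
          (use O'V in \<open>auto simp: eU chart_inv_map[OF d] inv\<close>)
      then show "smooth_on (inv_into U ex \<circ> chart_inv d) ?W"
      proof (rule smooth_on_cong[OF W, rotated])
        fix y assume "y \<in> ?W"
        then obtain x where x: "x \<in> O'" "knc x \<in> chart_dom d" "y = chart_map d (knc x)" unfolding eU by auto
        have "inv_into U ex (ex (K x)) = K x" by (rule inv_into_f_f[OF injU KO(1)[OF x(1)]])
        then show "K ((inv_into V knc \<circ> chart_inv d) y) = (inv_into U ex \<circ> chart_inv d) y"
          using x by (simp add: chart_inv_map[OF d] inv KO(2))
      qed
    qed
    have "(\<phi> has_derivative (\<lambda>h. h)) (at (Ki 0))" using anchored(10) K0 by simp
    from has_derivative_compose[OF dKi this]
    have "((\<lambda>X. \<phi> (Ki X)) has_derivative (\<lambda>h. h)) (at 0)" .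
    then show "(chart_map c \<circ> ex has_derivative (\<lambda>h. h)) (at 0)"
      by (rule has_derivative_transform_within_open[OF _ open_ball B0]) (simp add: ex)
  qed
  moreover have "let N = diff_dom U ex V knc; K = diff_element U ex knc
       in (\<forall>\<^sub>F X in nhds 0. X \<in> N \<and>
             even_series_terms (half_quotient_series artanh) (ad2I X) X sums K X) \<and>
          inj_on K N \<and>
          (\<forall>\<^sub>F X in nhds 0. X \<in> K ` N \<and>
             even_series_terms (half_quotient_series tanh) (ad2I X) X sums inv_into N K X)"
    if U: "anchored_coordinates M A c p U ex" for U
  proof -
    define N where "N = diff_dom U ex V knc"
    define D where "D = diff_element U ex knc"
    have U': "open U" "0 \<in> U" "inj_on ex U" using U by (simp_all add: anchored_coordinates_def)
    \<comment> \<open>\<open>ex\<close> after \<open>D\<close> is \<open>knc\<close>, which is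
      injective on all of \<open>V\<close>.\<close>
    have inj: "inj_on D N"
    proof (rule inj_onI)
      fix X Y assume XY: "X \<in> N" "Y \<in> N" "D X = D Y"
      have e: "ex (D X) = knc X" if "X \<in> N" for X
        using that by (simp add: N_def D_def diff_dom_def diff_element_def f_inv_into_f)
      have "knc X = knc Y" using e[OF XY(1)] e[OF XY(2)] XY(3) by simp
      then show "X = Y" using inj_onD[OF anchored(4)] XY(1,2) by (simp add: N_def diff_dom_def)
    qed
    have DK: "X \<in> N" "D X = K X" if "X \<in> O'" "K X \<in> U" for X
    proof -
      have e: "ex (K X) = knc X" by (rule KO(2)[OF that(1)])
      show "X \<in> N" using that O'V(1) e by (force simp: N_def diff_dom_def)
      show "D X = K X" unfolding D_def diff_element_def o_def e[symmetric] by (rule inv_into_f_f[OF U'(3) that(2)])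
    qed
    have "\<forall>\<^sub>F X in nhds 0. X \<in> O'" using O'(1,2) by (rule eventually_nhds_in_open)
    moreover have "\<forall>\<^sub>F X in nhds 0. K X \<in> U" by (rule topological_tendstoD[OF tendK U'(1,2)])
    ultimately have 1: "\<forall>\<^sub>F X in nhds 0. X \<in> N \<and> even_series_terms (half_quotient_series artanh) (ad2I X) X sums D X"
    proof eventually_elim
      case (elim X)
      have "norm X < r" using elim(1) O'V(3) by auto
      then show ?case using DK[OF elim] sK by simp
    qed
    have "\<forall>\<^sub>F X in nhds 0. X \<in> U" using U'(1,2) by (rule eventually_nhds_in_open)
    moreover have "\<forall>\<^sub>F X in nhds 0. Ki X \<in> O'" by (rule topological_tendstoD[OF tendKi O'(1,2)])
    ultimately have 2: "\<forall>\<^sub>F X in nhds 0. X \<in> D ` N \<and> even_series_terms (half_quotient_series tanh) (ad2I X) X sums inv_into N D X"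
      using evB
    proof eventually_elim
      case (elim X)
      have n: "norm X < r" using elim(3) by simp
      have KX: "K (Ki X) = X" by (rule KKi[OF n])
      then have "K (Ki X) \<in> U" using elim(1) by simp
      note m = DK[OF elim(2) this]
      have DX: "D (Ki X) = X" using m(2) KX by simp
      then have "X \<in> D ` N" using m(1) by (metis imageI)
      moreover have "inv_into N D X = Ki X" using inv_into_f_f[OF inj m(1)] DX by simp
      ultimately show ?case using sKi[OF n] by simp
    qed
    show ?thesis unfolding Let_def N_def[symmetric] D_def[symmetric] using 1 2 inj by blast
  qed
  ultimately show ?thesis by blast
qed

end

theorem theorem5p3:
  fixes M :: "'m::{t2_space, second_countable_topology} set"
    and A :: "('m, 'e::euclidean_space) chart set"
    and g :: "('m, 'e) chart \<Rightarrow> 'e \<Rightarrow> 'e \<Rightarrow> 'e \<Rightarrow> real"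
    and J :: "('m, 'e) chart \<Rightarrow> 'e \<Rightarrow> 'e \<Rightarrow> 'e"
    and c :: "('m, 'e) chart" and p :: 'm
    and V :: "'e set" and knc :: "'e \<Rightarrow> 'm"
  assumes "hermitean_locally_symmetric_space M A g J"
    and "c \<in> A" and "p \<in> chart_dom c"
    and "kaehler_normal_coordinates M A g J c p V knc"
  shows "(\<exists>U. anchored_coordinates M A c p U (exp_map M A g c p)) \<and>
    (\<forall>U. anchored_coordinates M A c p U (exp_map M A g c p) \<longrightarrow>
      (let N = diff_dom U (exp_map M A g c p) V knc;
           K = diff_element U (exp_map M A g c p) knc;
           ad2I = (\<lambda>X. ad2 (g c) (chart_map c p) (J c (chart_map c p) X))
       in (\<forall>\<^sub>F X in nhds 0. X \<in> N \<and>
             even_series_terms (half_quotient_series artanh) (ad2I X) X sums K X) \<and>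
          inj_on K N \<and>
          (\<forall>\<^sub>F X in nhds 0. X \<in> K ` N \<and>
             even_series_terms (half_quotient_series tanh) (ad2I X) X sums inv_into N K X)))"
proof -
  interpret normal_coordinates M A g J c p V knc
    by (rule normal_coordinates.intro[OF assms(1) normal_coordinates_axioms.intro[OF assms(2-4)]])
  show ?thesis using exp_knc_difference unfolding Let_def .
qed

end
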